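(* Let $M:[0,\infty)\to[0,\infty)$ be continuous, put $\mathscr M(t)=\int_0^t M(\tau)\,d\tau$, and assume: (i) there exists $\theta\in[1,p^*/q)$ such that $tM(t)\le\theta\mathscr M(t)$ for any $t\in[0,\infty)$; (ii) for any $\tau>0$ there exists $\kappa=\kappa(\tau)>0$ such that $M(t)\ge\kappa$ for any $t\ge\tau$. Let $f:\Omega\times\mathbb R\to\mathbb R$ be a Carathéodory function, put $F(x,t)=\int_0^t f(x,\tau)\,d\tau$, and assume (with the $\theta$ of (i)): (iii) there exists an exponent $r\in(q\theta,p^* )$ such that for any $\varepsilon>0$ there exists $\delta_\varepsilon=\delta(\varepsilon)>0$ such that $|f(x,t)|\le q\theta\varepsilon|t|^{q\theta-1}+r\delta_\varepsilon|t|^{r-1}$ for a.e. $x\in\Omega$ and any $t\in\mathbb R$; (iv) there exist $\sigma\in(q\theta,p^* )$, $c>0$ and $t_0\ge0$ such that $c\le\sigma F(x,t)\le tf(x,t)$ for a.e. $x\in\Omega$ and any $|t|\ge t_0$. Then the problem $$-M\left(\int_\Omega|\nabla u|^p\,dx\right)\Delta_p u-M\left(\int_\Omega a(x)|\nabla u|^q\,dx\right)\mathrm{div}\left(a(x)|\nabla u|^{q-2}\nabla u\right)=f(x,u)\ \text{in }\Omega,\qquad u=0\ \text{on }\partial\Omega,$$ admits a non-trivial weak solution $u\in W^{1,\mathcal H}_0(\Omega)$.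
   Context: Standing assumptions: $\Omega\subset\mathbb R^N$ is an open, bounded set with Lipschitz boundary, $N\ge2$, $1<p<q<N$, $\frac qp<1+\frac1N$, and $a:\overline\Omega\to[0,\infty)$ is Lipschitz continuous. $p^*=Np/(N-p)$, and $\Delta_p u=\mathrm{div}(|\nabla u|^{p-2}\nabla u)$. Function spaces: $\mathcal H(x,t)=t^p+a(x)t^q$ for $x\in\Omega$, $t\ge0$; $\varrho_{\mathcal H}(u)=\int_\Omega(|u|^p+a(x)|u|^q)\,dx$; $L^{\mathcal H}(\Omega)$ is the space of measurable $u:\Omega\to\mathbb R$ with $\varrho_{\mathcal H}(u)<\infty$, with the Luxemburg norm $\|u\|_{\mathcal H}=\inf\{\lambda>0:\varrho_{\mathcal H}(u/\lambda)\le1\}$. $W^{1,\mathcal H}(\Omega)=\{u\in L^{\mathcal H}(\Omega):|\nabla u|\in L^{\mathcal H}(\Omega)\}$ with norm $\|u\|_{\mathcal H}+\|\,|\nabla u|\,\|_{\mathcal H}$, and $W^{1,\mathcal H}_0(\Omega)$ is the completion (closure) of $C_0^\infty(\Omega)$ in $W^{1,\mathcal H}(\Omega)$, endowed with the equivalent norm $\|u\|=\|\,|\nabla u|\,\|_{\mathcal H}$. Weak solution: writing $\|\nabla u\|_p^p=\int_\Omega|\nabla u|^p\,dx$ and $\|\nabla u\|_{q,a}^q=\int_\Omega a(x)|\nabla u|^q\,dx$, a function $u\in W^{1,\mathcal H}_0(\Omega)$ is a weak solution of the problem if, for any $\varphi\in W^{1,\mathcal H}_0(\Omega)$, $$M(\|\nabla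 u\|_p^p)\int_\Omega|\nabla u|^{p-2}\nabla u\cdot\nabla\varphi\,dx+M(\|\nabla u\|_{q,a}^q)\int_\Omega a(x)|\nabla u|^{q-2}\nabla u\cdot\nabla\varphi\,dx=\int_\Omega f(x,u)\varphi\,dx.$$ *)

theory Defs
  imports "HOL-Analysis.Analysis"
begin

text \<open>
  Functions on a set \<open>\<Omega>\<close> are total functions whose values outside \<open>\<Omega>\<close> are ignored, and
  measurability and integrals on \<open>\<Omega>\<close> refer to \<open>lebesgue_on \<Omega>\<close>. Elements of the function spaces
  below are functions, not almost-everywhere classes; all spaces are closed under a.e. equality.
  Recall that \<open>0 powr s = 0\<close> for every \<open>s\<close>, so terms of the form
  \<open>norm v powr (p - 2) * (v \<bullet> w)\<close> vanish at \<open>v = 0\<close>, also when \<open>p < 2\<close>.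
\<close>

definition lipschitz_boundary :: "'a::euclidean_space set \<Rightarrow> bool" where
  \<comment> \<open>near each boundary point, \<open>\<Omega>\<close> is the strict epigraph, in some direction \<open>e\<close>, of a
     Lipschitz function on the hyperplane orthogonal to \<open>e\<close>\<close>
  "lipschitz_boundary \<Omega> \<longleftrightarrow>
    (\<forall>z\<in>frontier \<Omega>. \<exists>e \<rho> L (\<gamma> :: 'a \<Rightarrow> real).
        norm e = 1 \<and> \<rho> > 0 \<and> L-lipschitz_on {y. y \<bullet> e = 0} \<gamma> \<and>
        \<Omega> \<inter> ball z \<rho> = {y \<in> ball z \<rho>. \<gamma> (y - (y \<bullet> e) *\<^sub>R e) < y \<bullet> e})"

primrec C_k :: "nat \<Rightarrow> ('a::euclidean_space \<Rightarrow> real) \<Rightarrow> bool" where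
  "C_k 0 f \<longleftrightarrow> continuous_on UNIV f"
| "C_k (Suc k) f \<longleftrightarrow>
     (\<forall>x. f differentiable (at x)) \<and> (\<forall>v. C_k k (\<lambda>x. frechet_derivative f (at x) v))"

definition test_functions :: "'a::euclidean_space set \<Rightarrow> ('a \<Rightarrow> real) set" where
  "test_functions \<Omega> =
    {\<phi>. (\<forall>k. C_k k \<phi>) \<and> compact (closure {x. \<phi> x \<noteq> 0}) \<and> closure {x. \<phi> x \<noteq> 0} \<subseteq> \<Omega>}"

definition locally_integrable_on ::
    "'a::euclidean_space set \<Rightarrow> ('a \<Rightarrow> 'b::euclidean_space) \<Rightarrow> bool" where
  "locally_integrable_on \<Omega> g \<longleftrightarrow> (\<forall>K. compact K \<and> K \<subseteq> \<Omega> \<longrightarrow> g absolutely_integrable_on K)"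

definition has_weak_gradient ::
    "'a::euclidean_space set \<Rightarrow> ('a \<Rightarrow> real) \<Rightarrow> ('a \<Rightarrow> 'a) \<Rightarrow> bool" where
  "has_weak_gradient \<Omega> u g \<longleftrightarrow>
     locally_integrable_on \<Omega> u \<and> locally_integrable_on \<Omega> g \<and>
     (\<forall>\<phi>\<in>test_functions \<Omega>. \<forall>i\<in>Basis.
        (\<integral>x. u x * frechet_derivative \<phi> (at x) i \<partial>lebesgue_on \<Omega>)
          = - (\<integral>x. (g x \<bullet> i) * \<phi> x \<partial>lebesgue_on \<Omega>))"

definition weak_grad :: "'a::euclidean_space set \<Rightarrow> ('a \<Rightarrow> real) \<Rightarrow> 'a \<Rightarrow> 'a" where
  \<comment> \<open>an arbitrary representative: weak gradients are unique up to null sets\<close>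
  "weak_grad \<Omega> u = (SOME g. has_weak_gradient \<Omega> u g)"

definition double_phase :: "real \<Rightarrow> real \<Rightarrow> ('a \<Rightarrow> real) \<Rightarrow> 'a \<Rightarrow> real \<Rightarrow> real" where
  "double_phase p q a x t = t powr p + a x * t powr q"

definition modular ::
    "real \<Rightarrow> real \<Rightarrow> ('a::euclidean_space \<Rightarrow> real) \<Rightarrow> 'a set \<Rightarrow> ('a \<Rightarrow> real) \<Rightarrow> ennreal" where
  "modular p q a \<Omega> u = (\<integral>\<^sup>+x. ennreal (double_phase p q a x \<bar>u x\<bar>) \<partial>lebesgue_on \<Omega>)"

definition L_H ::
    "real \<Rightarrow> real \<Rightarrow> ('a::euclidean_space \<Rightarrow> real) \<Rightarrow> 'a set \<Rightarrow> ('a \<Rightarrow> real) set" where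
  "L_H p q a \<Omega> = {u \<in> borel_measurable (lebesgue_on \<Omega>). modular p q a \<Omega> u < \<infinity>}"

definition luxemburg_norm ::
    "real \<Rightarrow> real \<Rightarrow> ('a::euclidean_space \<Rightarrow> real) \<Rightarrow> 'a set \<Rightarrow> ('a \<Rightarrow> real) \<Rightarrow> real" where
  "luxemburg_norm p q a \<Omega> u = Inf {l. l > 0 \<and> modular p q a \<Omega> (\<lambda>x. u x / l) \<le> 1}"

definition W1_H ::
    "real \<Rightarrow> real \<Rightarrow> ('a::euclidean_space \<Rightarrow> real) \<Rightarrow> 'a set \<Rightarrow> ('a \<Rightarrow> real) set" where
  "W1_H p q a \<Omega> =
    {u \<in> L_H p q a \<Omega>. (\<exists>g. has_weak_gradient \<Omega> u g) \<and>
                        (\<lambda>x. norm (weak_grad \<Omega> u x)) \<in> L_H p q a \<Omega>}"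

definition W1_H_norm ::
    "real \<Rightarrow> real \<Rightarrow> ('a::euclidean_space \<Rightarrow> real) \<Rightarrow> 'a set \<Rightarrow> ('a \<Rightarrow> real) \<Rightarrow> real" where
  "W1_H_norm p q a \<Omega> u =
     luxemburg_norm p q a \<Omega> u + luxemburg_norm p q a \<Omega> (\<lambda>x. norm (weak_grad \<Omega> u x))"

definition W10_H ::
    "real \<Rightarrow> real \<Rightarrow> ('a::euclidean_space \<Rightarrow> real) \<Rightarrow> 'a set \<Rightarrow> ('a \<Rightarrow> real) set" where
  "W10_H p q a \<Omega> =
    {u \<in> W1_H p q a \<Omega>.
       \<forall>\<epsilon>>0. \<exists>\<phi>\<in>test_functions \<Omega>. W1_H_norm p q a \<Omega> (\<lambda>x. u x - \<phi> x) < \<epsilon>}"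

definition caratheodory_on :: "'a::euclidean_space set \<Rightarrow> ('a \<Rightarrow> real \<Rightarrow> real) \<Rightarrow> bool" where
  "caratheodory_on \<Omega> f \<longleftrightarrow>
     (\<forall>t. (\<lambda>x. f x t) \<in> borel_measurable (lebesgue_on \<Omega>)) \<and>
     (AE x in lebesgue_on \<Omega>. continuous_on UNIV (f x))"

definition primitive :: "(real \<Rightarrow> real) \<Rightarrow> real \<Rightarrow> real" where
  \<comment> \<open>oriented integral: for \<open>t < 0\<close> this is minus the integral over \<open>(t, 0)\<close>\<close>
  "primitive h t = (LBINT \<tau>=ereal 0..ereal t. h \<tau>)"

definition sobolev_exponent :: "real \<Rightarrow> real \<Rightarrow> real" where
  "sobolev_exponent N p = N * p / (N - p)"

definition weak_solution ::
    "real \<Rightarrow> real \<Rightarrow> ('a::euclidean_space \<Rightarrow> real) \<Rightarrow> 'a set \<Rightarrow> (real \<Rightarrow> real) \<Rightarrow>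
     ('a \<Rightarrow> real \<Rightarrow> real) \<Rightarrow> ('a \<Rightarrow> real) \<Rightarrow> bool" where
  \<comment> \<open>The integrability clauses say that the three integrals exist; the Bochner integral of a
     non-integrable function is \<open>0\<close> by convention. The integrals in the arguments of \<open>M\<close>
     are finite because \<open>u \<in> W10_H p q a \<Omega>\<close>.\<close>
  "weak_solution p q a \<Omega> M f u \<longleftrightarrow>
     u \<in> W10_H p q a \<Omega> \<and>
     (\<forall>\<phi>\<in>W10_H p q a \<Omega>.
        let Du = weak_grad \<Omega> u; D\<phi> = weak_grad \<Omega> \<phi> in
          integrable (lebesgue_on \<Omega>) (\<lambda>x. norm (Du x) powr (p - 2) * (Du x \<bullet> D\<phi> x)) \<and>
          integrable (lebesgue_on \<Omega>) (\<lambda>x. a x * norm (Du x) powr (q - 2) * (Du x \<bullet> D\<phi> x)) \<and>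
          integrable (lebesgue_on \<Omega>) (\<lambda>x. f x (u x) * \<phi> x) \<and>
          M (\<integral>x. norm (Du x) powr p \<partial>lebesgue_on \<Omega>) *
            (\<integral>x. norm (Du x) powr (p - 2) * (Du x \<bullet> D\<phi> x) \<partial>lebesgue_on \<Omega>) +
          M (\<integral>x. a x * norm (Du x) powr q \<partial>lebesgue_on \<Omega>) *
            (\<integral>x. a x * norm (Du x) powr (q - 2) * (Du x \<bullet> D\<phi> x) \<partial>lebesgue_on \<Omega>)
          = (\<integral>x. f x (u x) * \<phi> x \<partial>lebesgue_on \<Omega>))"

end

theory Submission
  imports Defs "HOL-Computational_Algebra.Polynomial" "HOL-Complex_Analysis.Great_Picard"
begin

text \<open>The energy is minimaxed on the test functions alone, although they are not complete: if no
  test function with energy in the right range had a small derivative, finitely many uniform descent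
  steps would push a fine chain across the barrier below the mountain-pass level. The resulting
  Palais--Smale sequence \<open>z n\<close> is bounded because \<open>q * \<theta> < \<sigma>\<close>, and the
  compact subcritical embedding, proved by averaging over dyadic cubes, makes \<open>z n\<close> and the
  terms containing \<open>f\<close> converge. Testing the equations for \<open>z n\<close> and \<open>z m\<close> against \<open>z n - z m\<close> leaves two
  asymptotically nonnegative terms, one for each exponent, whose sum tends to \<open>0\<close>; strong monotonicity of
  \<open>v \<mapsto> \<bar>v\<bar>\<^sup>s\<^sup>-\<^sup>2 v\<close> then makes the gradients Cauchy in norm, so neither reflexivity nor weak limits enter.
  The limit is a weak solution, and it is non-trivial since its energy is positive.\<close>

section \<open>Almost critical points of mountain-pass type\<close>

text \<open>Test functions are bounded with bounded gradients, so the functional is differentiated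
  along them under the integral with constant majorants, and weak gradients are needed only to place
  the limit in \<open>W10_H\<close>. The obstacle in the compactness step is that \<open>M\<close>
  may vanish at 0, so a small form does not control the gradients by itself. Hence the integrals
  inside \<open>M\<close> are first made to converge: a phase whose integral tends to 0 is
  convergent outright, and in the other case the coefficient stays away from 0. Multiplying
  gradients by \<open>a x powr (1 / q)\<close> turns the weighted phase into an unweighted one, so
  one abstract treatment serves both exponents. For the geometry,
  \<open>t * M t \<le> \<theta> * primitive M t\<close> says that
  \<open>primitive M t / t powr \<theta>\<close> does not increase: for a small gradient norm
  \<open>y\<close> the first phase is at least of order \<open>y powr (p * \<theta>)\<close>,
  against terms in \<open>f\<close> of order \<open>y powr (q * \<theta>)\<close> and higher, and
  along a ray both phases grow at most like the power
  \<open>q * \<theta> < \<sigma>\<close>.\<close>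

lemma segment_chain:
  fixes V :: "'v::real_vector set" and N :: "'v \<Rightarrow> real"
  assumes V: "subspace V"
    and N_scale: "\<And>c v. v \<in> V \<Longrightarrow> N (c *\<^sub>R v) = \<bar>c\<bar> * N v"
    and pq: "x \<in> V" "y \<in> V" and eta: "\<eta> > 0"
    and seg: "\<And>t. 0 \<le> t \<Longrightarrow> t \<le> 1 \<Longrightarrow> P (x + t *\<^sub>R (y - x))"
  shows "(x, y) \<in> {(u, v). u \<in> V \<and> v \<in> V \<and> P u \<and> P v \<and> N (u - v) \<le> \<eta>}\<^sup>*" (is "_ \<in> ?R\<^sup>*")
proof -
  obtain K :: nat where K: "real K > N (y - x) / \<eta>" "K > 0"
    by (metis gr0I less_trans of_nat_0_less_iff reals_Archimedean2 of_nat_less_iff zero_less_Suc not_less_iff_gr_or_eq lessI)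
  have step: "(x, x + (real k / real K) *\<^sub>R (y - x)) \<in> ?R\<^sup>*" if "k \<le> K" for k using that
  proof (induction k)
    case (Suc k)
    have a: "x + (real k / real K) *\<^sub>R (y - x) \<in> V" "x + (real (Suc k) / real K) *\<^sub>R (y - x) \<in> V"
      using V pq by (auto intro!: subspace_add subspace_scale subspace_diff)
    have b: "x + (real k / real K) *\<^sub>R (y - x) - (x + (real (Suc k) / real K) *\<^sub>R (y - x)) = (- 1 / K) *\<^sub>R (y - x)"
      by (simp add: add_divide_distrib scaleR_left.add algebra_simps diff_divide_distrib)
    have c: "N ((- 1 / K) *\<^sub>R (y - x)) \<le> \<eta>"
      using K eta subspace_diff[OF V pq(2,1)] by (subst N_scale) (auto simp: field_simps)
    have "(x + (real k / real K) *\<^sub>R (y - x), x + (real (Suc k) / real K) *\<^sub>R (y - x)) \<in> ?R"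
      using a b c Suc(2) K(2) by (auto intro!: seg)
    then show ?case using Suc by (meson Suc_leD rtrancl.rtrancl_into_rtrancl)
  qed simp
  from step[of K] K(2) show ?thesis by simp
qed

text \<open>A chain with links of length at most \<eta> takes the place of a path, and a descent
  direction \<open>d x\<close> chosen at each point without any continuity takes the place of a
  pseudo-gradient field. Uniform continuity of \<open>D\<close> makes the directions at both ends of
  a link descend along the whole segment that refills the gap between their images, so a moved chain
  can be refined again. One round lowers the level by s \<delta> / 4, down to 3 \<alpha> / 4, and
  enlarges the seminorm bound by s.\<close>

theorem mountain_pass_almost_critical:
  fixes V :: "'v::real_vector set" and N I G :: "'v \<Rightarrow> real" and D :: "'v \<Rightarrow> 'v \<Rightarrow> real"
  assumes V: "subspace V"
    and N_scale: "\<And>c v. v \<in> V \<Longrightarrow> N (c *\<^sub>R v) = \<bar>c\<bar> * N v"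
    and N_tri: "\<And>u v. u \<in> V \<Longrightarrow> v \<in> V \<Longrightarrow> N (u + v) \<le> N u + N v"
    and D_add: "\<And>u v w. u \<in> V \<Longrightarrow> v \<in> V \<Longrightarrow> w \<in> V \<Longrightarrow> D u (v + w) = D u v + D u w"
    and D_scale: "\<And>u v c. u \<in> V \<Longrightarrow> v \<in> V \<Longrightarrow> D u (c *\<^sub>R v) = c * D u v"
    and deriv: "\<And>u v t. u \<in> V \<Longrightarrow> v \<in> V \<Longrightarrow>
        ((\<lambda>t. I (u + t *\<^sub>R v)) has_real_derivative D (u + t *\<^sub>R v) v) (at t)"
    and D_bdd: "\<And>R. \<exists>C. \<forall>u\<in>V. \<forall>v\<in>V. N u \<le> R \<longrightarrow> \<bar>D u v\<bar> \<le> C * N v"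
    and D_cont: "\<And>R \<epsilon>. \<epsilon> > 0 \<Longrightarrow> \<exists>\<eta>>0. \<forall>u\<in>V. \<forall>w\<in>V. N u \<le> R \<longrightarrow> N w \<le> R \<longrightarrow> N (u - w) \<le> \<eta> \<longrightarrow>
        (\<forall>v\<in>V. \<bar>D u v - D w v\<bar> \<le> \<epsilon> * N v)"
    and G: "\<And>u v. u \<in> V \<Longrightarrow> v \<in> V \<Longrightarrow> \<bar>G u - G v\<bar> \<le> N (u - v)"
    and e: "e \<in> V" and rho: "G 0 < \<rho>\<^sub>1" "\<rho>\<^sub>1 < \<rho>\<^sub>2" "\<rho>\<^sub>2 < G e"
    and barrier: "\<And>u. u \<in> V \<Longrightarrow> \<rho>\<^sub>1 \<le> G u \<Longrightarrow> G u \<le> \<rho>\<^sub>2 \<Longrightarrow> \<alpha> \<le> I u"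
    and low: "0 < \<alpha>" "I 0 \<le> 0" "I e \<le> 0"
  shows "\<exists>B. \<forall>\<delta>>0. \<exists>u\<in>V. \<alpha> / 2 \<le> I u \<and> I u \<le> B \<and> (\<forall>v\<in>V. \<bar>D u v\<bar> \<le> \<delta> * N v)"
proof -
  have zV: "0 \<in> V" using V by (rule subspace_0)
  note sub = subspace_add[OF V] subspace_scale[OF V] subspace_diff[OF V] zV
  have N0: "N 0 = 0" using N_scale[OF zV, of 0] by simp
  have N_minus: "N (- v) = N v" if "v \<in> V" for v using N_scale[OF that, of "-1"] by simp
  have N_diff: "N (u - v) \<le> N u + N v" if "u \<in> V" "v \<in> V" for u v
    using N_tri[of u "-v"] that N_minus subspace_neg[OF V] by simp
  have N_nonneg: "N v \<ge> 0" if "v \<in> V" for v using N_diff[OF that that] N0 by simp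
  have mvt: "\<exists>t. 0 < t \<and> t < 1 \<and> I (u + v) - I u = D (u + t *\<^sub>R v) v" if "u \<in> V" "v \<in> V" for u v
  proof -
    from MVT2[of 0 1 "\<lambda>t. I (u + t *\<^sub>R v)", OF _ deriv[OF that]]
    show ?thesis by auto
  qed
  define r0 where "r0 = N e"
  obtain C0 where C0: "\<And>u v. u \<in> V \<Longrightarrow> v \<in> V \<Longrightarrow> N u \<le> r0 \<Longrightarrow> \<bar>D u v\<bar> \<le> C0 * N v" using D_bdd[of r0] by blast
  \<comment> \<open>The mean value theorem on the segment from 0 to \<open>e\<close>, where
    \<open>N\<close> is at most \<open>r0\<close>, together with \<open>I 0 \<le> 0\<close>: this is
    the level of the initial chain.\<close>
  define B where "B = \<bar>C0\<bar> * r0"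
  have seg_bound: "I (t *\<^sub>R e) \<le> B \<and> N (t *\<^sub>R e) \<le> r0" if t: "0 \<le> t" "t \<le> 1" for t
  proof -
    have teV: "t *\<^sub>R e \<in> V" using sub e by auto
    have Nt: "N (s *\<^sub>R e) \<le> r0" if "0 \<le> s" "s \<le> 1" for s
      using N_scale[OF e, of s] that N_nonneg[OF e] mult_right_mono[of s 1 "N e"] unfolding r0_def by auto
    obtain s where s: "0 < s" "s < 1" "I (0 + t *\<^sub>R e) - I 0 = D (0 + s *\<^sub>R (t *\<^sub>R e)) (t *\<^sub>R e)"
      using mvt[OF zV teV] by blast
    have "s * t \<le> 1" using s t by (simp add: mult_le_one)
    then have "N (s *\<^sub>R (t *\<^sub>R e)) \<le> r0" using Nt[of "s * t"] s t by simp
    then have "\<bar>D (s *\<^sub>R (t *\<^sub>R e)) (t *\<^sub>R e)\<bar> \<le> C0 * N (t *\<^sub>R e)" using C0 teV sub e by blast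
    also have "\<dots> \<le> \<bar>C0\<bar> * r0" using Nt[of t] t N_nonneg[OF teV] by (intro mult_mono) auto
    finally show ?thesis using s low Nt t unfolding B_def by auto
  qed
  have B0: "B \<ge> 0" unfolding B_def r0_def using N_nonneg[OF e] by simp
  have "\<exists>u\<in>V. \<alpha> / 2 \<le> I u \<and> I u \<le> B \<and> (\<forall>v\<in>V. \<bar>D u v\<bar> \<le> \<delta> * N v)" if \<delta>: "\<delta> > 0" for \<delta>
  proof (rule ccontr)
    assume neg: "\<not> ?thesis"
    \<comment> \<open>The direction is 0 below \<alpha> / 2, which keeps 0 and \<open>e\<close>
      fixed; above \<open>B\<close> nothing is asked, since no chain point gets there.\<close>
    have "\<exists>v\<in>V. N v \<le> 1 \<and> (I u < \<alpha> / 2 \<longrightarrow> v = 0) \<and> (\<alpha> / 2 \<le> I u \<and> I u \<le> B \<longrightarrow> D u v \<le> - \<delta>)" if "u \<in> V" for u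
    proof (cases "\<alpha> / 2 \<le> I u \<and> I u \<le> B")
      case True
      with neg that obtain v where v: "v \<in> V" "\<bar>D u v\<bar> > \<delta> * N v" by (auto simp: not_le)
      from D_bdd[of "N u"] obtain C where "\<forall>u'\<in>V. \<forall>v\<in>V. N u' \<le> N u \<longrightarrow> \<bar>D u' v\<bar> \<le> C * N v" ..
      then have C: "\<bar>D u w\<bar> \<le> C * N w" if "w \<in> V" for w using that \<open>u \<in> V\<close> by auto
      \<comment> \<open>\<open>N\<close> is only a seminorm; the bound by \<open>C * N v\<close>
        excludes \<open>N v = 0\<close> here.\<close>
      have "N v \<noteq> 0" using C[OF v(1)] v(2) by auto
      then have Nv: "N v > 0" using N_nonneg[OF v(1)] by simp
      define w where "w = (- sgn (D u v) / N v) *\<^sub>R v"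
      have "D u w = - \<bar>D u v\<bar> / N v" unfolding w_def D_scale[OF that v(1)] by (simp add: abs_sgn mult.commute)
      also have "\<dots> \<le> - \<delta>" using v(2) Nv by (simp add: field_simps)
      finally have "D u w \<le> - \<delta>" .
      moreover have "N w \<le> 1" unfolding w_def N_scale[OF v(1)] using Nv by (simp add: abs_mult abs_sgn_eq)
      moreover have "w \<in> V" unfolding w_def using v sub by blast
      ultimately show ?thesis using True by auto
    next
      case False
      then show ?thesis using zV N0 by (intro bexI[of _ 0]) auto
    qed
    then obtain d where d: "\<And>u. u \<in> V \<Longrightarrow> d u \<in> V" "\<And>u. u \<in> V \<Longrightarrow> N (d u) \<le> 1"
      "\<And>u. u \<in> V \<Longrightarrow> I u < \<alpha> / 2 \<Longrightarrow> d u = 0"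
      "\<And>u. u \<in> V \<Longrightarrow> \<alpha> / 2 \<le> I u \<Longrightarrow> I u \<le> B \<Longrightarrow> D u (d u) \<le> - \<delta>" by metis
    \<comment> \<open>About 4 B / (s \<delta>) rounds, each adding s \<le> 1 to the seminorm bound,
      stay within r0 + 4 B / \<delta> + 1.\<close>
    define R where "R = r0 + 4 * B / \<delta> + 2"
    obtain C1 where C1: "\<And>u v. u \<in> V \<Longrightarrow> v \<in> V \<Longrightarrow> N u \<le> R \<Longrightarrow> \<bar>D u v\<bar> \<le> C1 * N v" using D_bdd[of R] by blast
    define C where "C = max C1 1"
    have C: "\<bar>D u v\<bar> \<le> C * N v" if "u \<in> V" "v \<in> V" "N u \<le> R" for u v
      using C1[OF that] mult_right_mono[of C1 C "N v"] N_nonneg[OF that(2)] unfolding C_def by simp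
    have C1': "C \<ge> 1" unfolding C_def by simp
    obtain \<eta>0 where eta0: "\<eta>0 > 0" "\<And>u w v. u \<in> V \<Longrightarrow> w \<in> V \<Longrightarrow> N u \<le> R \<Longrightarrow> N w \<le> R \<Longrightarrow> N (u - w) \<le> \<eta>0 \<Longrightarrow>
        v \<in> V \<Longrightarrow> \<bar>D u v - D w v\<bar> \<le> \<delta> / 4 * N v"
      using D_cont[of "\<delta>/4" R] \<delta> by (metis zero_less_divide_iff zero_less_numeral)
    \<comment> \<open>\<eta>0 / 4: the intermediate points of the mean value theorem lie within 3 s
      of both ends of their link. \<alpha> / (16 C): a point that starts below \<alpha> / 2 + C
      \<eta> rises by at most C (\<eta> + s), and both errors together are at most 4 C s \<le>
      \<alpha> / 4.\<close>
    define s where "s = Min {1, \<eta>0 / 4, \<alpha> / (16 * C)}"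
    have s: "s > 0" "s \<le> 1" "4 * s \<le> \<eta>0" "16 * C * s \<le> \<alpha>"
    proof -
      have "s \<le> \<eta>0 / 4" "s \<le> \<alpha> / (16 * C)" unfolding s_def by auto
      then show "4 * s \<le> \<eta>0" "16 * C * s \<le> \<alpha>" using C1' by (auto simp: field_simps)
    qed (use eta0 low C1' in \<open>auto simp: s_def\<close>)
    \<comment> \<open>Links are no longer than s, so short that moving along one costs at most s
      \<delta> / 8, and no longer than the width of the shell, so that none can jump over
      it.\<close>
    define \<eta> where "\<eta> = Min {s, s * \<delta> / (8 * C), \<rho>\<^sub>2 - \<rho>\<^sub>1}"
    have eta: "\<eta> > 0" "\<eta> \<le> s" "C * \<eta> \<le> s * \<delta> / 8" "\<eta> \<le> \<rho>\<^sub>2 - \<rho>\<^sub>1"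
    proof -
      have "\<eta> \<le> s * \<delta> / (8 * C)" unfolding \<eta>_def by auto
      then show "C * \<eta> \<le> s * \<delta> / 8" using C1' by (auto simp: field_simps)
    qed (use s \<delta> rho C1' in \<open>auto simp: \<eta>_def\<close>)
    define Rel where "Rel b r = {(x, y). x \<in> V \<and> y \<in> V \<and> (I x \<le> b \<and> N x \<le> r) \<and> (I y \<le> b \<and> N y \<le> r) \<and> N (x - y) \<le> \<eta>}"
      for b r
    have chain: "(x, y) \<in> (Rel b r)\<^sup>*"
      if "x \<in> V" "y \<in> V" "\<And>t. 0 \<le> t \<Longrightarrow> t \<le> 1 \<Longrightarrow> I (x + t *\<^sub>R (y - x)) \<le> b \<and> N (x + t *\<^sub>R (y - x)) \<le> r" for x y b r
      using segment_chain[where P = "\<lambda>x. I x \<le> b \<and> N x \<le> r" and V = V and N = N, OF V N_scale that(1,2) eta(1) that(3)]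
      unfolding Rel_def by auto
    define w where "w x = x + s *\<^sub>R d x" for x
    have w0: "w 0 = 0" "w e = e" unfolding w_def using d(3)[OF zV] d(3)[OF e] low by auto
    have step: "(w x, w y) \<in> (Rel (max (b - s * \<delta> / 4) (3 * \<alpha> / 4)) (r + s))\<^sup>*"
      if xy: "(x, y) \<in> Rel b r" and b: "b \<le> B" and r: "r + s \<le> R" for x y b r
    proof (rule chain)
      have x: "x \<in> V" "I x \<le> b" "N x \<le> r" and y: "y \<in> V" "I y \<le> b" "N y \<le> r" and xy': "N (x - y) \<le> \<eta>"
        using xy unfolding Rel_def by auto
      note dx = d(1,2)[OF x(1)] and dy = d(1,2)[OF y(1)]
      show wx: "w x \<in> V" and wy: "w y \<in> V" unfolding w_def using x y dx dy sub by auto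
      have Nw: "N (w x) \<le> r + s" "N (w y) \<le> r + s"
        using N_tri[OF x(1) sub(2)[OF dx(1)], of s] N_tri[OF y(1) sub(2)[OF dy(1)], of s] x(3) y(3) s(1)
          N_scale[OF dx(1), of s] N_scale[OF dy(1), of s] mult_left_mono[OF dx(2), of s] mult_left_mono[OF dy(2), of s]
        unfolding w_def by linarith+
      fix l :: real assume l: "0 \<le> l" "l \<le> 1"
      \<comment> \<open>Displacement from \<open>x\<close> to the point with parameter
        \<open>l\<close> on the segment from \<open>w x\<close> to \<open>w y\<close>: a part of the
        old link plus a mixture of the two descent steps.\<close>
      define h where "h = l *\<^sub>R (y - x) + ((1 - l) * s) *\<^sub>R d x + (l * s) *\<^sub>R d y"
      have z: "w x + l *\<^sub>R (w y - w x) = x + h" unfolding w_def h_def by (simp add: algebra_simps)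
      have z': "x + h = (1 - l) *\<^sub>R w x + l *\<^sub>R w y" unfolding z[symmetric] by (simp add: algebra_simps)
      have hV: "h \<in> V" unfolding h_def using x y dx dy by (intro sub)
      have yxV: "y - x \<in> V" using x y by (intro sub)
      have Nyx: "N (y - x) \<le> \<eta>" using N_minus[of "x - y"] xy' sub(3)[OF x(1) y(1)] by simp
      have convex: "N ((1 - t) *\<^sub>R u + t *\<^sub>R v) \<le> c" if "u \<in> V" "v \<in> V" "N u \<le> c" "N v \<le> c" "0 \<le> t" "t \<le> 1" for u v c t
      proof -
        have "N ((1 - t) *\<^sub>R u + t *\<^sub>R v) \<le> (1 - t) * N u + t * N v"
          using N_tri[of "(1 - t) *\<^sub>R u" "t *\<^sub>R v"] N_scale that sub by auto
        also have "\<dots> \<le> (1 - t) * c + t * c" using that by (intro add_mono mult_left_mono) auto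
        finally show ?thesis by (simp add: algebra_simps)
      qed
      have Nz: "N (x + h) \<le> r + s" unfolding z' by (rule convex[OF wx wy Nw l])
      have "N h \<le> N (l *\<^sub>R (y - x)) + N (((1 - l) * s) *\<^sub>R d x) + N ((l * s) *\<^sub>R d y)"
        unfolding h_def using N_tri[of "l *\<^sub>R (y - x) + ((1 - l) * s) *\<^sub>R d x" "(l * s) *\<^sub>R d y"]
          N_tri[of "l *\<^sub>R (y - x)" "((1 - l) * s) *\<^sub>R d x"] sub(1)[OF sub(2)[OF yxV, of l] sub(2)[OF dx(1), of "(1 - l) * s"]]
          sub(2)[OF yxV, of l] sub(2)[OF dx(1), of "(1 - l) * s"] sub(2)[OF dy(1), of "l * s"] by simp
      also have "\<dots> = l * N (y - x) + ((1 - l) * s) * N (d x) + (l * s) * N (d y)"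
        using N_scale[OF yxV] N_scale[OF dx(1)] N_scale[OF dy(1)] l s by (simp add: abs_mult)
      also have "\<dots> \<le> 1 * \<eta> + ((1 - l) * s) * 1 + (l * s) * 1"
        using l s dx dy Nyx N_nonneg[OF yxV] N_nonneg[OF dx(1)] N_nonneg[OF dy(1)] by (intro add_mono mult_mono) auto
      finally have Nh: "N h \<le> \<eta> + s" by (simp add: algebra_simps)
      obtain t where t: "0 < t" "t < 1" "I (x + h) - I x = D (x + t *\<^sub>R h) h" using mvt[OF x(1) hV] by blast
      define m where "m = x + t *\<^sub>R h"
      have mV: "m \<in> V" unfolding m_def using x hV sub by blast
      have m': "m = (1 - t) *\<^sub>R x + t *\<^sub>R (x + h)" unfolding m_def by (simp add: algebra_simps)
      have Nm: "N m \<le> r + s" unfolding m' using convex[OF x(1) sub(1)[OF x(1) hV], of "r + s" t] x(3) Nz t s by auto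
      have Nmx: "N (m - x) \<le> 2 * s"
      proof -
        have "N (m - x) = t * N h" unfolding m_def using N_scale[OF hV] t by simp
        also have "\<dots> \<le> 1 * (\<eta> + s)" using t Nh N_nonneg[OF hV] by (intro mult_mono) auto
        finally show ?thesis using eta by simp
      qed
      have Nmy: "N (m - y) \<le> 3 * s" using N_tri[of "m - x" "x - y"] Nmx xy' eta(2) x y mV sub by auto
      have Dh: "D m h = l * D m (y - x) + ((1 - l) * s) * D m (d x) + (l * s) * D m (d y)"
        unfolding h_def using mV x y dx dy yxV sub by (simp add: D_add D_scale)
      \<comment> \<open>Either both ends lie in the critical range, and the gain s \<delta> / 2 of
        the mixed step outweighs the cost s \<delta> / 8 of the link; or one end is below \<alpha> /
        2, whence \<open>I x < \<alpha> / 2 + C * \<eta>\<close> and the point stays below 3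
        \<alpha> / 4.\<close>
      have "I (x + h) \<le> max (b - s * \<delta> / 4) (3 * \<alpha> / 4)"
      proof (cases "\<alpha> / 2 \<le> I x \<and> \<alpha> / 2 \<le> I y")
        case True
        have "D x (d x) \<le> - \<delta>" "D y (d y) \<le> - \<delta>" using d(4) x y b True by auto
        moreover have "\<bar>D m (d x) - D x (d x)\<bar> \<le> \<delta> / 4 * N (d x)"
          using eta0(2)[OF mV x(1)] Nm x(3) r s Nmx dx by auto
        moreover have "\<bar>D m (d y) - D y (d y)\<bar> \<le> \<delta> / 4 * N (d y)"
          using eta0(2)[OF mV y(1)] Nm y(3) r s Nmy dy by auto
        moreover have "\<delta> / 4 * N (d x) \<le> \<delta> / 4" "\<delta> / 4 * N (d y) \<le> \<delta> / 4" using \<delta> dx dy by auto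
        ultimately have le: "D m (d x) \<le> - \<delta> / 2" "D m (d y) \<le> - \<delta> / 2" using \<delta> by linarith+
        have "D m (y - x) \<le> C * \<eta>" using C[OF mV yxV] Nm r mult_left_mono[OF Nyx, of C] C1' by linarith
        then have "D m (y - x) \<le> s * \<delta> / 8" using eta by linarith
        then have "l * D m (y - x) \<le> l * (s * \<delta> / 8)" using l by (intro mult_left_mono)
        also have "\<dots> \<le> 1 * (s * \<delta> / 8)" using l s \<delta> by (intro mult_right_mono) auto
        finally have "l * D m (y - x) \<le> 1 * (s * \<delta> / 8)" .
        moreover have "((1 - l) * s) * D m (d x) + (l * s) * D m (d y) \<le> ((1 - l) * s) * (- \<delta> / 2) + (l * s) * (- \<delta> / 2)"
          using le l s by (intro add_mono mult_left_mono) auto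
        ultimately have "D m h \<le> s * \<delta> / 8 + ((1 - l) * s) * (- \<delta> / 2) + (l * s) * (- \<delta> / 2)" unfolding Dh by linarith
        also have "\<dots> = s * \<delta> / 8 - s * \<delta> / 2" by (simp add: field_simps)
        also have "\<dots> \<le> - (s * \<delta> / 4)" using s \<delta> by simp
        finally show ?thesis using t(3) x(2) unfolding m_def by auto
      next
        case False
        have "D m h \<le> C * (\<eta> + s)" using C[OF mV hV] Nm r mult_left_mono[OF Nh, of C] C1' by linarith
        moreover have "I x < \<alpha> / 2 + C * \<eta>"
        proof (cases "I x < \<alpha> / 2")
          case True
          then show ?thesis using C1' eta by (smt (verit) mult_pos_pos)
        next
          case F: False
          obtain t' where t': "0 < t'" "t' < 1" "I (y + (x - y)) - I y = D (y + t' *\<^sub>R (x - y)) (x - y)"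
            using mvt[OF y(1), of "x - y"] x y sub by blast
          have yv: "y + t' *\<^sub>R (x - y) \<in> V" using x y sub by blast
          have "y + t' *\<^sub>R (x - y) = (1 - t') *\<^sub>R y + t' *\<^sub>R x" by (simp add: algebra_simps)
          then have "N (y + t' *\<^sub>R (x - y)) \<le> r" using convex[OF y(1) x(1) y(3) x(3), of t'] t' by simp
          then have "D (y + t' *\<^sub>R (x - y)) (x - y) \<le> C * \<eta>"
            using C[OF yv sub(3)[OF x(1) y(1)]] r s mult_left_mono[OF xy', of C] C1' by linarith
          then show ?thesis using F False t' by auto
        qed
        moreover have "C * (\<eta> + s) + C * \<eta> \<le> 4 * C * s"
          using eta mult_left_mono[of \<eta> s C] C1' mult_nonneg_nonneg[of C s] s by (simp add: algebra_simps)
        ultimately have "I (x + h) \<le> 3 * \<alpha> / 4" using t(3) s unfolding m_def by linarith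
        then show ?thesis by simp
      qed
      then show "I (w x + l *\<^sub>R (w y - w x)) \<le> max (b - s * \<delta> / 4) (3 * \<alpha> / 4) \<and> N (w x + l *\<^sub>R (w y - w x)) \<le> r + s"
        using z Nz by simp
    qed
    have steps: "(0, e) \<in> (Rel (max (B - real k * (s * \<delta> / 4)) (3 * \<alpha> / 4)) (r0 + real k * s))\<^sup>*"
      if "r0 + real k * s \<le> R" "B \<ge> 3 * \<alpha> / 4" for k using that(1)
    proof (induction k)
      case 0
      have "max (B - real 0 * (s * \<delta> / 4)) (3 * \<alpha> / 4) = B" using that(2) by simp
      then show ?case using seg_bound e zV by (intro chain) auto
    next
      case (Suc k)
      define b r where "b = max (B - real k * (s * \<delta> / 4)) (3 * \<alpha> / 4)" and "r = r0 + real k * s"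
      have r: "r + s \<le> R" using Suc(2) unfolding r_def by (simp add: algebra_simps)
      have b: "b \<le> B" unfolding b_def using that(2) s \<delta> by auto
      have "(0, e) \<in> (Rel b r)\<^sup>*" using Suc(1) r s unfolding b_def r_def by auto
      then have "(w 0, w e) \<in> (Rel (max (b - s * \<delta> / 4) (3 * \<alpha> / 4)) (r + s))\<^sup>*"
        by (induction rule: rtrancl_induct) (use step[OF _ b r] in \<open>auto intro: rtrancl_trans\<close>)
      moreover have "Rel (max (b - s * \<delta> / 4) (3 * \<alpha> / 4)) (r + s)
        = Rel (max (B - real (Suc k) * (s * \<delta> / 4)) (3 * \<alpha> / 4)) (r0 + real (Suc k) * s)"
      proof -
        have "max (b - s * \<delta> / 4) (3 * \<alpha> / 4) = max (B - real (Suc k) * (s * \<delta> / 4)) (3 * \<alpha> / 4)"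
        proof -
          have "B - real (Suc k) * (s * \<delta> / 4) = (B - real k * (s * \<delta> / 4)) - s * \<delta> / 4"
            by (simp add: algebra_simps add_divide_distrib)
          moreover have "s * \<delta> / 4 > 0" using s \<delta> by simp
          ultimately show ?thesis unfolding b_def by (simp add: max_def)
        qed
        then show ?thesis unfolding r_def by (simp add: algebra_simps)
      qed
      ultimately show ?case using w0 by simp
    qed
    \<comment> \<open>\<open>G\<close> changes by at most \<eta> \<le>
      \<open>\<rho>\<^sub>2 - \<rho>\<^sub>1\<close> along a link, and values in the shell are
      excluded at levels below \<alpha>; so \<open>G\<close> stays below
      \<open>\<rho>\<^sub>1\<close> along the chain, while \<open>e\<close> lies beyond
      \<open>\<rho>\<^sub>2\<close>.\<close>
    have barr: False if "(0, e) \<in> (Rel b r)\<^sup>*" "b < \<alpha>" for b r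
    proof -
      have "G y < \<rho>\<^sub>1" if "(0, y) \<in> (Rel b r)\<^sup>*" for y using that
      proof (induction rule: rtrancl_induct)
        case base then show ?case using rho by simp
      next
        case (step y z)
        then have yz: "y \<in> V" "z \<in> V" "I z \<le> b" "N (y - z) \<le> \<eta>" unfolding Rel_def by auto
        have "\<bar>G y - G z\<bar> \<le> N (y - z)" using G[OF yz(1,2)] .
        then have "G z < \<rho>\<^sub>2" using step(3) yz(4) eta(4) by linarith
        then show ?case using barrier[OF yz(2)] yz(3) \<open>b < \<alpha>\<close> by linarith
      qed
      from this[OF that(1)] rho show False by simp
    qed
    have B34: "B \<ge> 3 * \<alpha> / 4"
    proof (rule ccontr)
      assume "\<not> ?thesis"
      moreover have "(0, e) \<in> (Rel B r0)\<^sup>*" using seg_bound e zV by (intro chain) auto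
      ultimately show False using barr[of B r0] low by auto
    qed
    \<comment> \<open>Enough rounds to bring B - k s \<delta> / 4 down to 0; the level is then 3
      \<alpha> / 4 < \<alpha>.\<close>
    define k where "k = nat \<lceil>4 * B / (s * \<delta>)\<rceil>"
    have k1: "real k \<ge> 4 * B / (s * \<delta>)" unfolding k_def by (rule real_nat_ceiling_ge)
    have "real k \<le> 4 * B / (s * \<delta>) + 1" unfolding k_def using B0 s \<delta> by (simp add: of_nat_nat)
    then have "real k * s \<le> (4 * B / (s * \<delta>) + 1) * s" using s by (intro mult_right_mono) auto
    also have "\<dots> = 4 * B / \<delta> + s" using s by (simp add: field_simps)
    finally have "r0 + real k * s \<le> R" unfolding R_def using s by simp
    from steps[OF this B34] have "(0, e) \<in> (Rel (max (B - real k * (s * \<delta> / 4)) (3 * \<alpha> / 4)) (r0 + real k * s))\<^sup>*" .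
    moreover have "B - real k * (s * \<delta> / 4) \<le> 0" using k1 s \<delta> by (simp add: field_simps)
    moreover have "max (B - real k * (s * \<delta> / 4)) (3 * \<alpha> / 4) < \<alpha>" using calculation(2) low by simp
    ultimately show False using barr by blast
  qed
  then show ?thesis by blast
qed

section \<open>Test functions\<close>

lemma C_k_const: "C_k k (\<lambda>x. c)" by (induction k arbitrary: c) auto

lemma C_k_Suc_imp: "C_k (Suc k) f \<Longrightarrow> C_k k f"
proof (induction k arbitrary: f)
  case 0
  then show ?case
    by (auto intro!: differentiable_imp_continuous_on simp: differentiable_on_def differentiable_at_withinI)
next
  case (Suc k)
  then show ?case by (subst C_k.simps) (auto simp del: C_k.simps(1) intro: Suc.IH)
qed

lemma C_k_differentiable: "C_k (Suc k) f \<Longrightarrow> (f has_derivative frechet_derivative f (at x)) (at x)"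
  by (auto simp: frechet_derivative_works)

lemma C_k_SucI:
  assumes "\<And>x. (f has_derivative f' x) (at x)" "\<And>v. C_k k (\<lambda>x. f' x v)"
  shows "C_k (Suc k) f" using assms frechet_derivative_at[OF assms(1)] by (auto simp: differentiable_def)

lemma C_k_add: "C_k k f \<Longrightarrow> C_k k g \<Longrightarrow> C_k k (\<lambda>x. f x + g x)"
proof (induction k arbitrary: f g)
  case (Suc k)
  show ?case
    by (rule C_k_SucI[OF has_derivative_add[OF C_k_differentiable[OF Suc(2)] C_k_differentiable[OF Suc(3)]]])
      (rule Suc.IH; use Suc(2,3) in simp)
qed (auto intro: continuous_intros)

lemma C_k_mult: "C_k k f \<Longrightarrow> C_k k g \<Longrightarrow> C_k k (\<lambda>x. f x * g x)"
proof (induction k arbitrary: f g)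
  case (Suc k)
  have *: "C_k k (\<lambda>x. f x * frechet_derivative g (at x) v + frechet_derivative f (at x) v * g x)" for v
    using Suc(2,3) by (intro C_k_add Suc.IH C_k_Suc_imp[OF Suc(2)] C_k_Suc_imp[OF Suc(3)]) simp_all
  show ?case
    by (rule C_k_SucI[OF has_derivative_mult[OF C_k_differentiable[OF Suc(2)] C_k_differentiable[OF Suc(3)]]]) (rule *)
qed (auto intro: continuous_intros)

lemma C_k_prod: "finite A \<Longrightarrow> (\<And>i. i \<in> A \<Longrightarrow> C_k k (f i)) \<Longrightarrow> C_k k (\<lambda>x. \<Prod>i\<in>A. f i x)"
  by (induction A rule: finite_induct) (auto intro: C_k_const C_k_mult)

text \<open>The derivatives of \<open>exp (- 1 / t)\<close> keep this shape, the polynomial being evaluated at \<open>1 / t\<close>.\<close>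

definition flat :: "real poly \<Rightarrow> real \<Rightarrow> real" where
  "flat P t = (if t > 0 then poly P (1 / t) * exp (- 1 / t) else 0)"

lemma poly_exp_tendsto_0: "((\<lambda>y::real. poly P y * exp (- y)) \<longlongrightarrow> 0) at_top"
proof (induction P)
  case (pCons a P)
  have "((\<lambda>y::real. y ^ k * exp (- y)) \<longlongrightarrow> 0) at_top" for k
    using tendsto_power_div_exp_0[of k] by (simp add: exp_minus field_simps)
  then have *: "((\<lambda>y. \<Sum>i\<le>degree (pCons a P). coeff (pCons a P) i * (y ^ i * exp (- y))) \<longlongrightarrow> (\<Sum>i\<le>degree (pCons a P). coeff (pCons a P) i * 0)) at_top"
    by (intro tendsto_sum tendsto_mult tendsto_const)
  then show ?case by (simp add: poly_altdef sum_distrib_right mult.assoc del: degree_pCons_eq_if)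
qed simp

text \<open>With y = 1 / t, the derivative of P(y) exp(-y) in t is y^2 (P(y) - P'(y)) exp(-y), which
  explains the new polynomial. At 0 the difference quotient from the right is y P(y) exp(-y) with y
  tending to infinity.\<close>

lemma flat_has_derivative:
  "(flat P has_real_derivative flat ([:0, 0, 1:] * (P - pderiv P)) t) (at t)"
proof -
  let ?Q = "[:0, 0, 1:] * (P - pderiv P)"
  consider "t > 0" | "t < 0" | "t = 0" by linarith
  then show ?thesis
  proof cases
    case 1
    have "((\<lambda>t. poly P (1 / t) * exp (- 1 / t)) has_real_derivative flat ?Q t) (at t)"
      using 1 by (auto intro!: derivative_eq_intros simp: flat_def field_simps power2_eq_square)
    then show ?thesis
      by (rule has_field_derivative_transform_within_open[of _ _ _ "{0<..}"]) (use 1 in \<open>auto simp: flat_def\<close>)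
  next
    case 2
    have "((\<lambda>t. 0) has_real_derivative flat ?Q t) (at t)" using 2 by (simp add: flat_def)
    then show ?thesis
      by (rule has_field_derivative_transform_within_open[of _ _ _ "{..<0}"]) (use 2 in \<open>auto simp: flat_def\<close>)
  next
    case 3
    have "((\<lambda>h. poly (pCons 0 P) (inverse h) * exp (- inverse h)) \<longlongrightarrow> 0) (at_right 0)"
      by (rule filterlim_compose[OF poly_exp_tendsto_0 filterlim_inverse_at_top_right])
    then have "((\<lambda>h. flat P h / h) \<longlongrightarrow> 0) (at_right 0)" by (rule Lim_transform_eventually)
        (auto simp: flat_def field_simps eventually_at_filter)
    moreover have "((\<lambda>h. flat P h / h) \<longlongrightarrow> 0) (at_left 0)"
      by (rule Lim_transform_eventually[OF tendsto_const]) (auto simp: flat_def eventually_at_filter)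
    ultimately have "((\<lambda>h. flat P h / h) \<longlongrightarrow> 0) (at 0)" by (simp add: filterlim_split_at)
    then show ?thesis using 3 by (simp add: DERIV_def flat_def)
  qed
qed

text \<open>The directional derivative is a constant times a function of the same shape with another
  polynomial, so the induction runs over all \<open>P\<close> at once.\<close>

lemma C_k_flat: "C_k k (\<lambda>x. flat P (x \<bullet> e + c))"
proof (induction k arbitrary: P)
  case 0
  have "continuous_on UNIV (flat P)"
    using flat_has_derivative by (blast intro: DERIV_continuous_on has_field_derivative_at_within)
  then show ?case by (auto intro!: continuous_on_compose2[of UNIV "flat P"] continuous_intros)
next
  case (Suc k)
  have "((\<lambda>x. flat P (x \<bullet> e + c)) has_derivative (\<lambda>v. (v \<bullet> e) * flat ([:0, 0, 1:] * (P - pderiv P)) (x \<bullet> e + c))) (at x)" for x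
  proof -
    have "((\<lambda>x. x \<bullet> e + c) has_derivative (\<lambda>v. v \<bullet> e)) (at x)" by (auto intro!: derivative_eq_intros)
    from has_derivative_compose[OF this flat_has_derivative[of P "x \<bullet> e + c", unfolded has_field_derivative_def]]
    show ?thesis by (simp only: mult.commute)
  qed
  then show ?case by (rule C_k_SucI) (intro C_k_mult C_k_const Suc)
qed

text \<open>For \<open>k > 0\<close> a smooth function that is positive exactly on the open box.
  Larger \<open>k\<close> makes it steeper, so the sequence tends to the indicator of the box while
  staying between 0 and 1.\<close>

definition bump :: "nat \<Rightarrow> 'a::euclidean_space \<Rightarrow> 'a \<Rightarrow> 'a \<Rightarrow> real" where
  "bump k a b x = (\<Prod>i\<in>Basis. flat 1 (real k * (x \<bullet> i - a \<bullet> i)) * flat 1 (real k * (b \<bullet> i - x \<bullet> i)))"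

lemma flat_1: "0 \<le> flat 1 t" "flat 1 t \<le> 1" by (auto simp: flat_def)

lemma bump_bounds: "0 \<le> bump k a b x" "bump k a b x \<le> 1"
  unfolding bump_def by (auto intro!: prod_nonneg prod_le_1 mult_le_one simp: flat_1)

lemma bump_eq_0: "x \<notin> box a b \<Longrightarrow> bump k a b x = 0"
  unfolding bump_def by (force simp: mem_box flat_def not_less mult_nonneg_nonpos zero_less_mult_iff)

lemma C_k_bump: "C_k m (bump k a b)"
proof -
  have "bump k a b = (\<lambda>x. \<Prod>i\<in>Basis. flat 1 (x \<bullet> (real k *\<^sub>R i) + (- real k * (a \<bullet> i))) *
      flat 1 (x \<bullet> ((- real k) *\<^sub>R i) + real k * (b \<bullet> i)))"
    unfolding bump_def by (auto simp: fun_eq_iff algebra_simps)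
  then show ?thesis by (simp only:) (intro C_k_prod C_k_mult C_k_flat finite_Basis)
qed

lemma bump_test_function:
  assumes "cbox a b \<subseteq> U"
  shows "bump k a b \<in> test_functions U"
proof -
  have "closure {x. bump k a b x \<noteq> 0} \<subseteq> cbox a b"
  proof (rule closure_minimal)
    show "{x. bump k a b x \<noteq> 0} \<subseteq> cbox a b" using bump_eq_0[of _ a b k] box_subset_cbox[of a b] by blast
  qed (rule closed_cbox)
  moreover from this have "compact (closure {x. bump k a b x \<noteq> 0})"
    by (metis bounded_cbox bounded_subset closed_closure compact_eq_bounded_closed)
  ultimately show ?thesis using assms C_k_bump unfolding test_functions_def by blast
qed

lemma bump_tendsto: "(\<lambda>k. bump k a b x) \<longlonglongrightarrow> indicat_real (box a b) x"
proof (cases "x \<in> box a b")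
  case True
  have lim: "(\<lambda>k. flat 1 (real k * t)) \<longlonglongrightarrow> 1" if "t > 0" for t
  proof -
    have "(\<lambda>k. - inverse t * inverse (real k)) \<longlonglongrightarrow> - inverse t * 0" by (intro tendsto_intros lim_inverse_n)
    then have "(\<lambda>k. exp (- inverse t * inverse (real k))) \<longlonglongrightarrow> exp 0" by (intro tendsto_exp) simp
    then have "(\<lambda>k. exp (- inverse t * inverse (real k))) \<longlonglongrightarrow> 1" by simp
    moreover have "\<forall>\<^sub>F k in sequentially. exp (- inverse t * inverse (real k)) = flat 1 (real k * t)"
    proof (rule eventually_sequentiallyI[of 1])
      fix k :: nat assume "1 \<le> k"
      then have "real k * t > 0" using that by simp
      then show "exp (- inverse t * inverse (real k)) = flat 1 (real k * t)"
        by (simp add: flat_def divide_inverse mult.commute)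
    qed
    ultimately show ?thesis by (rule Lim_transform_eventually)
  qed
  have "(\<lambda>k. bump k a b x) \<longlonglongrightarrow> (\<Prod>i\<in>(Basis::'a set). 1 * 1)"
    unfolding bump_def by (intro tendsto_prod tendsto_mult lim) (use True in \<open>auto simp: mem_box\<close>)
  then show ?thesis using True by simp
qed (simp add: bump_eq_0)

section \<open>Gradients of test functions, and the algebra of test functions\<close>

definition grad :: "('a::euclidean_space \<Rightarrow> real) \<Rightarrow> 'a \<Rightarrow> 'a" where
  "grad \<phi> x = (\<Sum>i\<in>Basis. frechet_derivative \<phi> (at x) i *\<^sub>R i)"

lemma test_functionsD:
  assumes "\<phi> \<in> test_functions U"
  shows "C_k k \<phi>" "compact (closure {x. \<phi> x \<noteq> 0})" "closure {x. \<phi> x \<noteq> 0} \<subseteq> U"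
  using assms by (auto simp: test_functions_def)

lemma grad_eqI:
  assumes "(\<phi> has_derivative (\<lambda>v. g \<bullet> v)) (at x)"
  shows "grad \<phi> x = g"
  unfolding grad_def frechet_derivative_at[OF assms, symmetric] by (rule euclidean_representation)

context
  fixes \<Omega> :: "'a::euclidean_space set" and \<phi> :: "'a \<Rightarrow> real"
  assumes phi: "\<phi> \<in> test_functions \<Omega>"
begin

lemma test_has_derivative: "(\<phi> has_derivative (\<lambda>v. grad \<phi> x \<bullet> v)) (at x)"
proof -
  have d: "(\<phi> has_derivative frechet_derivative \<phi> (at x)) (at x)"
    using C_k_differentiable[OF test_functionsD(1)[OF phi]] .
  interpret bounded_linear "frechet_derivative \<phi> (at x)" using d by (rule has_derivative_bounded_linear)
  have "frechet_derivative \<phi> (at x) v = grad \<phi> x \<bullet> v" for v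
  proof -
    have "frechet_derivative \<phi> (at x) v = frechet_derivative \<phi> (at x) (\<Sum>i\<in>Basis. (v \<bullet> i) *\<^sub>R i)"
      by (simp add: euclidean_representation)
    also have "\<dots> = (\<Sum>i\<in>Basis. (v \<bullet> i) * frechet_derivative \<phi> (at x) i)" by (simp add: sum scaleR)
    finally show ?thesis unfolding grad_def by (simp add: inner_sum_left inner_commute[of v] mult.commute)
  qed
  with d show ?thesis by (metis (no_types, lifting) ext)
qed

lemma test_frechet: "frechet_derivative \<phi> (at x) v = grad \<phi> x \<bullet> v"
  using frechet_derivative_at[OF test_has_derivative] by metis

lemma test_continuous: "continuous_on A \<phi>" using test_functionsD(1)[OF phi, of 0] continuous_on_subset by auto

lemma grad_continuous: "continuous_on A (grad \<phi>)"
proof -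
  have "continuous_on UNIV (\<lambda>x. frechet_derivative \<phi> (at x) v)" for v
    using test_functionsD(1)[OF phi, of 1] by simp
  then have "continuous_on UNIV (grad \<phi>)" unfolding grad_def[abs_def] by (intro continuous_intros)
  then show ?thesis by (rule continuous_on_subset) simp
qed

lemma test_zero: "x \<notin> closure {x. \<phi> x \<noteq> 0} \<Longrightarrow> \<phi> x = 0" using closure_subset[of "{x. \<phi> x \<noteq> 0}"] by blast

lemma grad_zero:
  assumes "x \<notin> closure {x. \<phi> x \<noteq> 0}"
  shows "grad \<phi> x = 0"
proof (rule grad_eqI)
  have "((\<lambda>x. 0) has_derivative (\<lambda>v. 0 \<bullet> v)) (at x)" by simp
  then show "(\<phi> has_derivative (\<lambda>v. 0 \<bullet> v)) (at x)"
  proof (rule has_derivative_transform_within_open)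
    show "open (- closure {x. \<phi> x \<noteq> 0})" by (rule open_Compl[OF closed_closure])
    show "x \<in> - closure {x. \<phi> x \<noteq> 0}" using assms by simp
    show "0 = \<phi> y" if "y \<in> - closure {x. \<phi> x \<noteq> 0}" for y using test_zero[of y] that by simp
  qed
qed

lemma test_bounded: obtains B where "B > 0" "\<And>x. \<bar>\<phi> x\<bar> \<le> B" "\<And>x. norm (grad \<phi> x) \<le> B"
proof -
  let ?K = "closure {x. \<phi> x \<noteq> 0}"
  have K: "compact ?K" using phi by (rule test_functionsD)
  have "compact (\<phi> ` ?K)" "compact (grad \<phi> ` ?K)"
    using K test_continuous grad_continuous by (auto intro: compact_continuous_image)
  then have "bounded (\<phi> ` ?K)" "bounded (grad \<phi> ` ?K)" by (auto intro: compact_imp_bounded)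
  then obtain B1 B2 where B: "\<forall>x\<in>?K. \<bar>\<phi> x\<bar> \<le> B1" "\<forall>x\<in>?K. norm (grad \<phi> x) \<le> B2"
    unfolding bounded_iff by (metis imageI real_norm_def)
  show ?thesis
  proof (rule that[of "max 1 (max B1 B2)"])
    show "\<bar>\<phi> x\<bar> \<le> max 1 (max B1 B2)" "norm (grad \<phi> x) \<le> max 1 (max B1 B2)" for x
      using B test_zero[of x] grad_zero[of x] by (cases "x \<in> ?K"; force)+
  qed simp
qed

end

lemma test_functions_zero: "(\<lambda>x. 0) \<in> test_functions U" by (auto simp: test_functions_def C_k_const)

lemma test_functionsI:
  assumes "\<And>k. C_k k \<zeta>" "compact K" "K \<subseteq> U" "\<And>x. x \<notin> K \<Longrightarrow> \<zeta> x = 0"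
  shows "\<zeta> \<in> test_functions U"
proof -
  have c: "closure {x. \<zeta> x \<noteq> 0} \<subseteq> K"
  proof (rule closure_minimal)
    show "{x. \<zeta> x \<noteq> 0} \<subseteq> K" using assms(4) by blast
  qed (rule compact_imp_closed[OF assms(2)])
  have "compact (K \<inter> closure {x. \<zeta> x \<noteq> 0})" using assms(2) by (rule compact_Int_closed) simp
  with c have "compact (closure {x. \<zeta> x \<noteq> 0})" by (simp add: Int_absorb1)
  with c assms(1,3) show ?thesis by (simp add: test_functions_def)
qed

lemma test_functions_add:
  assumes "\<phi> \<in> test_functions U" "\<psi> \<in> test_functions U"
  shows "(\<lambda>x. \<phi> x + \<psi> x) \<in> test_functions U"
proof (rule test_functionsI)
  note A = test_functionsD[OF assms(1)] and B = test_functionsD[OF assms(2)]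
  show "C_k k (\<lambda>x. \<phi> x + \<psi> x)" for k using A(1) B(1) by (rule C_k_add)
  show "compact (closure {x. \<phi> x \<noteq> 0} \<union> closure {x. \<psi> x \<noteq> 0})" using A(2) B(2) by (rule compact_Un)
  show "closure {x. \<phi> x \<noteq> 0} \<union> closure {x. \<psi> x \<noteq> 0} \<subseteq> U" using A(3) B(3) by (rule Un_least)
  show "\<phi> x + \<psi> x = 0" if "x \<notin> closure {x. \<phi> x \<noteq> 0} \<union> closure {x. \<psi> x \<noteq> 0}" for x
    using that test_zero[OF assms(1), of x] test_zero[OF assms(2), of x] by simp
qed

lemma test_functions_mult:
  assumes "\<phi> \<in> test_functions U" "\<psi> \<in> test_functions U"
  shows "(\<lambda>x. \<phi> x * \<psi> x) \<in> test_functions U"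
proof (rule test_functionsI)
  note A = test_functionsD[OF assms(1)] and B = test_functionsD[OF assms(2)]
  show "C_k k (\<lambda>x. \<phi> x * \<psi> x)" for k using A(1) B(1) by (rule C_k_mult)
  show "compact (closure {x. \<phi> x \<noteq> 0} \<union> closure {x. \<psi> x \<noteq> 0})" using A(2) B(2) by (rule compact_Un)
  show "closure {x. \<phi> x \<noteq> 0} \<union> closure {x. \<psi> x \<noteq> 0} \<subseteq> U" using A(3) B(3) by (rule Un_least)
  show "\<phi> x * \<psi> x = 0" if "x \<notin> closure {x. \<phi> x \<noteq> 0} \<union> closure {x. \<psi> x \<noteq> 0}" for x
    using that test_zero[OF assms(1), of x] test_zero[OF assms(2), of x] by simp
qed

lemma test_functions_cmult:
  assumes "\<phi> \<in> test_functions U"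
  shows "(\<lambda>x. c * \<phi> x) \<in> test_functions U"
proof (rule test_functionsI)
  show "C_k k (\<lambda>x. c * \<phi> x)" for k using C_k_const test_functionsD(1)[OF assms] by (rule C_k_mult)
  show "c * \<phi> x = 0" if "x \<notin> closure {x. \<phi> x \<noteq> 0}" for x using test_zero[OF assms that] by simp
qed (rule test_functionsD[OF assms])+

lemma test_functions_diff:
  assumes "\<phi> \<in> test_functions U" "\<psi> \<in> test_functions U"
  shows "(\<lambda>x. \<phi> x - \<psi> x) \<in> test_functions U"
  using test_functions_add[OF assms(1) test_functions_cmult[OF assms(2), of "-1"]] by simp

lemma grad_add:
  assumes "\<phi> \<in> test_functions U" "\<psi> \<in> test_functions U"
  shows "grad (\<lambda>x. \<phi> x + \<psi> x) x = grad \<phi> x + grad \<psi> x"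
  by (rule grad_eqI) (auto intro!: derivative_eq_intros test_has_derivative assms simp: inner_add_left)

lemma grad_diff:
  assumes "\<phi> \<in> test_functions U" "\<psi> \<in> test_functions U"
  shows "grad (\<lambda>x. \<phi> x - \<psi> x) x = grad \<phi> x - grad \<psi> x"
  by (rule grad_eqI) (auto intro!: derivative_eq_intros test_has_derivative assms simp: inner_diff_left)

lemma grad_cmult:
  assumes "\<phi> \<in> test_functions U"
  shows "grad (\<lambda>x. c * \<phi> x) x = c *\<^sub>R grad \<phi> x"
  by (rule grad_eqI) (auto intro!: derivative_eq_intros test_has_derivative assms)

lemma grad_mult:
  assumes "\<phi> \<in> test_functions U" "\<psi> \<in> test_functions U"
  shows "grad (\<lambda>x. \<phi> x * \<psi> x) x = \<phi> x *\<^sub>R grad \<psi> x + \<psi> x *\<^sub>R grad \<phi> x"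
  by (rule grad_eqI) (auto intro!: derivative_eq_intros test_has_derivative assms simp: inner_add_left)

section \<open>Integration by parts for test functions\<close>

lemma integrable_compact_support:
  fixes g :: "'a::euclidean_space \<Rightarrow> 'b::{banach, second_countable_topology}"
  assumes "continuous_on K g" "compact K" "\<And>x. x \<notin> K \<Longrightarrow> g x = 0"
  shows "integrable lborel g"
proof -
  have "(\<lambda>x. indicator K x *\<^sub>R g x) = g" using assms(3) by (auto simp: fun_eq_iff indicator_def)
  then show ?thesis using borel_integrable_compact[OF assms(2,1)] by simp
qed

lemma lebesgue_on_supported:
  fixes g :: "'a::euclidean_space \<Rightarrow> 'b::{banach, second_countable_topology}"
  assumes "U \<in> sets lebesgue" "g \<in> borel_measurable borel" "\<And>x. x \<notin> U \<Longrightarrow> g x = 0"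
  shows "integral\<^sup>L (lebesgue_on U) g = integral\<^sup>L lborel g"
    and "integrable (lebesgue_on U) g \<longleftrightarrow> integrable lborel g"
proof -
  have *: "(\<lambda>x. indicator U x *\<^sub>R g x) = g" using assms(3) by (auto simp: fun_eq_iff indicator_def)
  show "integral\<^sup>L (lebesgue_on U) g = integral\<^sup>L lborel g"
    using assms by (subst integral_restrict_space) (auto simp: * integral_completion)
  show "integrable (lebesgue_on U) g \<longleftrightarrow> integrable lborel g"
    using assms by (subst integrable_restrict_space) (auto simp: * integrable_completion)
qed

lemma integral_translate:
  fixes f :: "'a::euclidean_space \<Rightarrow> 'b::{banach, second_countable_topology}"
  assumes "f \<in> borel_measurable borel"
  shows "(LINT x|lborel. f (x + z)) = (LINT x|lborel. f x)"
proof -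
  have "(LINT x|lborel. f x) = (LINT x|distr lborel borel ((+) z). f x)" by (simp add: lborel_distr_plus)
  also have "\<dots> = (LINT x|lborel. f (z + x))" using assms by (subst integral_distr) auto
  finally show ?thesis by (simp add: add.commute)
qed

lemma test_borel_measurable:
  assumes "\<phi> \<in> test_functions U"
  shows "\<phi> \<in> borel_measurable borel" "grad \<phi> \<in> borel_measurable borel"
  using test_continuous[OF assms] grad_continuous[OF assms] by (auto intro: borel_measurable_continuous_onI)

lemma test_lipschitz:
  assumes "\<phi> \<in> test_functions U" "\<And>x. norm (grad \<phi> x) \<le> B"
  shows "\<bar>\<phi> y - \<phi> x\<bar> \<le> B * norm (y - x)"
proof -
  have "norm (\<phi> y - \<phi> x) \<le> B * norm (y - x)"
  proof (rule differentiable_bound[of UNIV \<phi> "\<lambda>x v. grad \<phi> x \<bullet> v"])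
    show "(\<phi> has_derivative (\<lambda>v. grad \<phi> x \<bullet> v)) (at x within UNIV)" for x
      using test_has_derivative[OF assms(1)] by simp
    show "onorm (\<lambda>v. grad \<phi> x \<bullet> v) \<le> B" for x
      using assms(2)[of x] by (intro onorm_le) (metis Cauchy_Schwarz_ineq2 mult_right_mono norm_ge_zero order_trans real_norm_def)
  qed auto
  then show ?thesis by simp
qed

lemma test_tendsto_derivative:
  assumes "\<phi> \<in> test_functions U"
  shows "(\<lambda>n. real (Suc n) * (\<phi> (x + (1 / real (Suc n)) *\<^sub>R v) - \<phi> x)) \<longlonglongrightarrow> grad \<phi> x \<bullet> v"
proof -
  have "((\<lambda>t. x + t *\<^sub>R v) has_derivative (\<lambda>t. t *\<^sub>R v)) (at 0)" by (auto intro!: derivative_eq_intros)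
  moreover have "(\<phi> has_derivative (\<lambda>v. grad \<phi> x \<bullet> v)) (at (x + 0 *\<^sub>R v))"
    using test_has_derivative[OF assms] by simp
  ultimately have "((\<lambda>t. \<phi> (x + t *\<^sub>R v)) has_derivative (\<lambda>t. grad \<phi> x \<bullet> (t *\<^sub>R v))) (at 0)"
    using has_derivative_compose by blast
  then have "((\<lambda>t. \<phi> (x + t *\<^sub>R v)) has_real_derivative (grad \<phi> x \<bullet> v)) (at 0)"
    by (simp add: has_field_derivative_def mult_commute_abs)
  then have "((\<lambda>h. (\<phi> (x + h *\<^sub>R v) - \<phi> x) / h) \<longlongrightarrow> grad \<phi> x \<bullet> v) (at 0)" by (simp add: DERIV_def)
  moreover have "filterlim (\<lambda>n. 1 / real (Suc n)) (at 0) sequentially"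
    unfolding filterlim_at using LIMSEQ_inverse_real_of_nat by (simp add: inverse_eq_divide del: of_nat_Suc)
  ultimately have "((\<lambda>n. (\<phi> (x + (1 / real (Suc n)) *\<^sub>R v) - \<phi> x) / (1 / real (Suc n))) \<longlongrightarrow> grad \<phi> x \<bullet> v) sequentially"
    by (rule filterlim_compose)
  then show ?thesis by (simp add: mult.commute)
qed

text \<open>The difference quotients in direction \<open>v\<close> have integral 0 by translation
  invariance, and the Lipschitz bound dominates them by a constant on one fixed ball.\<close>

lemma integral_grad_zero:
  assumes phi: "\<phi> \<in> test_functions U"
  shows "(LINT x|lborel. grad \<phi> x \<bullet> v) = 0"
proof -
  note [measurable] = test_borel_measurable[OF phi]
  let ?K = "closure {x. \<phi> x \<noteq> 0}"
  obtain B where B: "B > 0" "\<And>x. \<bar>\<phi> x\<bar> \<le> B" "\<And>x. norm (grad \<phi> x) \<le> B" using test_bounded[OF phi] by blast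
  have K: "compact ?K" using phi by (rule test_functionsD)
  obtain R where R: "\<And>x. x \<in> ?K \<Longrightarrow> norm x \<le> R" using compact_imp_bounded[OF K] by (auto simp: bounded_iff)
  \<comment> \<open>A ball that contains the supports of \<phi> and of all its shifts by at most
    \<open>norm v\<close>.\<close>
  define K' where "K' = cball (0::'a) (R + norm v)"
  have K': "compact K'" by (simp add: K'_def)
  define D where "D n x = real (Suc n) * (\<phi> (x + (1 / real (Suc n)) *\<^sub>R v) - \<phi> x)" for n x
  have int: "integrable lborel \<phi>"
    using integrable_compact_support[OF test_continuous[OF phi] K test_zero[OF phi]] .
  have int': "integrable lborel (\<lambda>x. \<phi> (x + z))" for z
  proof (rule integrable_compact_support)
    show "continuous_on ((\<lambda>x. - z + x) ` ?K) (\<lambda>x. \<phi> (x + z))"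
      using test_continuous[OF phi, of UNIV] by (auto intro!: continuous_on_compose2[of UNIV \<phi>] continuous_intros)
    show "compact ((\<lambda>x. - z + x) ` ?K)" using K by (rule compact_translation)
    show "\<phi> (x + z) = 0" if "x \<notin> (\<lambda>x. - z + x) ` ?K" for x
      using that by (intro test_zero[OF phi]) (force simp: image_iff)
  qed
  have "(\<lambda>n. LINT x|lborel. D n x) \<longlonglongrightarrow> (LINT x|lborel. grad \<phi> x \<bullet> v)"
  proof (rule integral_dominated_convergence)
    show "integrable lborel (\<lambda>x. indicator K' x *\<^sub>R (B * norm v))" by (rule borel_integrable_compact[OF K']) simp
    show "AE x in lborel. (\<lambda>n. D n x) \<longlonglongrightarrow> grad \<phi> x \<bullet> v"
      unfolding D_def by (intro AE_I2 test_tendsto_derivative[OF phi])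
    show "AE x in lborel. norm (D n x) \<le> indicator K' x *\<^sub>R (B * norm v)" for n
    proof (rule AE_I2)
      fix x
      have le: "\<bar>D n x\<bar> \<le> B * norm v"
      proof -
        have "\<bar>D n x\<bar> = real (Suc n) * \<bar>\<phi> (x + (1 / real (Suc n)) *\<^sub>R v) - \<phi> x\<bar>" unfolding D_def abs_mult by simp
        also have "\<dots> \<le> real (Suc n) * (B * norm ((x + (1 / real (Suc n)) *\<^sub>R v) - x))"
          using test_lipschitz[OF phi B(3)] by (rule mult_left_mono) simp
        also have "\<dots> = B * norm v" by simp
        finally show ?thesis .
      qed
      show "norm (D n x) \<le> indicator K' x *\<^sub>R (B * norm v)"
      proof (cases "x \<in> K'")
        case False
        have "norm ((1 / real (Suc n)) *\<^sub>R v) \<le> norm v"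
          using mult_left_mono[of 1 "real (Suc n)" "norm v"] by (simp add: divide_le_eq mult.commute)
        then have "norm x \<le> norm (x + (1 / real (Suc n)) *\<^sub>R v) + norm v"
          using norm_triangle_ineq4[of "x + (1 / real (Suc n)) *\<^sub>R v" "(1 / real (Suc n)) *\<^sub>R v"] by simp
        then have "x \<notin> ?K" "x + (1 / real (Suc n)) *\<^sub>R v \<notin> ?K"
          using False R[of x] R[of "x + (1 / real (Suc n)) *\<^sub>R v"] norm_ge_zero[of v] by (auto simp: K'_def simp del: norm_ge_zero)
        then have "\<phi> x = 0" "\<phi> (x + (1 / real (Suc n)) *\<^sub>R v) = 0" using test_zero[OF phi] by blast+
        then show ?thesis using False unfolding D_def by simp
      qed (use le in simp)
    qed
  qed (auto simp: D_def)
  moreover have "(LINT x|lborel. D n x) = 0" for n unfolding D_def using int int' by (simp add: integral_translate)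
  ultimately show ?thesis by (simp add: LIMSEQ_const_iff)
qed

lemma test_integrable_lborel:
  assumes "\<phi> \<in> test_functions U" "continuous_on UNIV g"
  shows "integrable lborel (\<lambda>x. g x * \<phi> x)" "integrable lborel (\<lambda>x. g x * (grad \<phi> x \<bullet> v))"
proof -
  let ?K = "closure {x. \<phi> x \<noteq> 0}"
  note cont = continuous_on_subset[OF assms(2) subset_UNIV, of ?K]
    test_continuous[OF assms(1), of ?K] grad_continuous[OF assms(1), of ?K]
  show "integrable lborel (\<lambda>x. g x * \<phi> x)"
  proof (rule integrable_compact_support)
    show "continuous_on ?K (\<lambda>x. g x * \<phi> x)" using cont by (intro continuous_intros)
    show "g x * \<phi> x = 0" if "x \<notin> ?K" for x using test_zero[OF assms(1) that] by simp
  qed (rule test_functionsD[OF assms(1)])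
  show "integrable lborel (\<lambda>x. g x * (grad \<phi> x \<bullet> v))"
  proof (rule integrable_compact_support)
    show "continuous_on ?K (\<lambda>x. g x * (grad \<phi> x \<bullet> v))" using cont by (intro continuous_intros)
    show "g x * (grad \<phi> x \<bullet> v) = 0" if "x \<notin> ?K" for x using grad_zero[OF assms(1) that] by simp
  qed (rule test_functionsD[OF assms(1)])
qed

text \<open>The gradient of the product of two test functions integrates to 0.\<close>

lemma integration_by_parts:
  assumes "\<phi> \<in> test_functions U" "\<psi> \<in> test_functions U"
  shows "(LINT x|lborel. \<phi> x * (grad \<psi> x \<bullet> v)) = - (LINT x|lborel. (grad \<phi> x \<bullet> v) * \<psi> x)"
proof -
  have int: "integrable lborel (\<lambda>x. \<phi> x * (grad \<psi> x \<bullet> v))" "integrable lborel (\<lambda>x. \<psi> x * (grad \<phi> x \<bullet> v))"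
    using assms test_continuous by (auto intro: test_integrable_lborel)
  have "0 = (LINT x|lborel. \<phi> x * (grad \<psi> x \<bullet> v) + \<psi> x * (grad \<phi> x \<bullet> v))"
    using integral_grad_zero[OF test_functions_mult[OF assms], of v] grad_mult[OF assms]
    by (simp add: inner_add_left)
  also have "\<dots> = (LINT x|lborel. \<phi> x * (grad \<psi> x \<bullet> v)) + (LINT x|lborel. \<psi> x * (grad \<phi> x \<bullet> v))"
    using int by (rule Bochner_Integration.integral_add)
  finally show ?thesis by (simp add: mult.commute)
qed

lemma continuous_locally_integrable:
  assumes "continuous_on UNIV g"
  shows "locally_integrable_on U g" unfolding locally_integrable_on_def
proof safe
  fix K :: "'a set" assume K: "compact K"
  have "integrable lborel (\<lambda>x. indicator K x *\<^sub>R g x)"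
    using continuous_on_subset[OF assms] by (intro borel_integrable_compact[OF K]) auto
  then show "g absolutely_integrable_on K" unfolding set_integrable_def by (subst integrable_completion) auto
qed

lemma has_weak_gradient_test:
  assumes phi: "\<phi> \<in> test_functions U" and U: "U \<in> sets lebesgue"
  shows "has_weak_gradient U \<phi> (grad \<phi>)" unfolding has_weak_gradient_def
proof (intro conjI ballI)
  show "locally_integrable_on U \<phi>" "locally_integrable_on U (grad \<phi>)"
    using phi by (auto intro: continuous_locally_integrable test_continuous grad_continuous)
  fix \<psi> and i :: 'a assume psi: "\<psi> \<in> test_functions U" and i: "i \<in> Basis"
  note [measurable] = test_borel_measurable[OF phi] test_borel_measurable[OF psi]
  have out: "\<phi> x = 0" "\<psi> x = 0" if "x \<notin> U" for x
    using test_zero[OF phi, of x] test_zero[OF psi, of x] test_functionsD(3)[OF phi] test_functionsD(3)[OF psi] that by auto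
  show "(LINT x|lebesgue_on U. \<phi> x * frechet_derivative \<psi> (at x) i) = - (LINT x|lebesgue_on U. grad \<phi> x \<bullet> i * \<psi> x)"
    using integration_by_parts[OF phi psi, of i] out
    by (simp add: test_frechet[OF psi] lebesgue_on_supported(1)[OF U])
qed

section \<open>Weak gradients\<close>

lemma indicator_box_measurable: "indicat_real (box a b) \<in> borel_measurable lebesgue"
  by (intro borel_measurable_indicator fmeasurableD lmeasurable_box)

text \<open>The functions \<open>bump k a b\<close> are admissible and tend boundedly to the
  indicator of the box.\<close>

lemma integral_box_zero:
  fixes g :: "'a::euclidean_space \<Rightarrow> real"
  assumes U: "U \<in> sets lebesgue" and g: "g absolutely_integrable_on (cbox a b)" and ab: "cbox a b \<subseteq> U"
    and zero: "\<And>\<phi>. \<phi> \<in> test_functions U \<Longrightarrow> (LINT x|lebesgue_on U. g x * \<phi> x) = 0"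
  shows "(LINT x|lebesgue. indicator (box a b) x * g x) = 0"
proof -
  let ?g = "\<lambda>x. indicator (cbox a b) x * g x"
  have int: "integrable lebesgue ?g" using g by (simp add: set_integrable_def)
  have [measurable]: "?g \<in> borel_measurable lebesgue" using int by auto
  have bm: "bump k a b \<in> borel_measurable lebesgue" for k
    using test_borel_measurable(1)[OF bump_test_function[OF ab]] by (simp add: measurable_completion)
  have eq: "?g x * bump k a b x = g x * bump k a b x" for x k
    using bump_eq_0[of x a b k] box_subset_cbox[of a b] by (auto simp: indicator_def)
  have "(\<lambda>k. LINT x|lebesgue. ?g x * bump k a b x) \<longlonglongrightarrow> (LINT x|lebesgue. ?g x * indicator (box a b) x)"
  proof (rule integral_dominated_convergence[where w = "\<lambda>x. norm (?g x)"])
    show "AE x in lebesgue. (\<lambda>k. ?g x * bump k a b x) \<longlonglongrightarrow> ?g x * indicator (box a b) x"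
      by (intro AE_I2 tendsto_mult tendsto_const bump_tendsto)
    show "AE x in lebesgue. norm (?g x * bump k a b x) \<le> norm (?g x)" for k
      by (intro AE_I2) (simp add: abs_mult bump_bounds mult_left_le mult_left_le[where c = "bump k a b x" for x])
    show "(\<lambda>x. ?g x * indicator (box a b) x) \<in> borel_measurable lebesgue"
      by (rule borel_measurable_times[OF borel_measurable_integrable[OF int] indicator_box_measurable])
    show "(\<lambda>x. ?g x * bump k a b x) \<in> borel_measurable lebesgue" for k
      by (rule borel_measurable_times[OF borel_measurable_integrable[OF int] bm])
  qed (use int in auto)
  moreover have "(LINT x|lebesgue. ?g x * bump k a b x) = 0" for k
  proof -
    have *: "(\<lambda>x. indicator U x *\<^sub>R (g x * bump k a b x)) = (\<lambda>x. g x * bump k a b x)"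
      using ab bump_eq_0[of _ a b k] box_subset_cbox[of a b] by (auto simp: indicator_def fun_eq_iff)
    show ?thesis unfolding eq using zero[OF bump_test_function[OF ab, of k]] U
      by (subst (asm) integral_restrict_space) (auto simp: * simp del: real_scaleR_def)
  qed
  ultimately have "(LINT x|lebesgue. ?g x * indicator (box a b) x) = 0" by (simp add: LIMSEQ_const_iff)
  moreover have "?g x * indicator (box a b) x = indicator (box a b) x * g x" for x
    using box_subset_cbox[of a b] by (auto simp: indicator_def)
  ultimately show ?thesis by simp
qed

text \<open>Open boxes form an intersection-stable generator of the Borel sets, so vanishing
  integrals spread from boxes to all Borel sets. The whole space is not a box; \<open>tot\<close>
  supplies it for the step to complements.\<close>

lemma AE_zero_if_box_integrals_zero:
  fixes h :: "'a::euclidean_space \<Rightarrow> real"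
  assumes int: "integrable lborel h" and zero: "\<And>a b. (LINT x|lborel. indicator (box a b) x * h x) = 0"
    and tot: "(LINT x|lborel. h x) = 0"
  shows "AE x in lborel. h x = 0"
proof -
  have h[measurable]: "h \<in> borel_measurable borel" using int by auto
  have si: "set_integrable lborel A h" if "A \<in> sets borel" for A
    using int that unfolding set_integrable_def by (intro integrable_mult_indicator) auto
  have "(\<integral>x\<in>A. h x \<partial>lborel) = 0" if "A \<in> sets borel" for A
  proof -
    let ?G = "range (\<lambda>(a, b). box a b :: 'a set)"
    have "Int_stable ?G"
    proof (rule Int_stableI)
      fix A B assume "A \<in> ?G" "B \<in> ?G"
      then obtain a b c d where "A = box a b" "B = box c d" by auto
      then show "A \<inter> B \<in> ?G" by (simp only: box_Int_box) auto
    qed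
    moreover have "?G \<subseteq> Pow UNIV" by simp
    moreover have "A \<in> sigma_sets UNIV ?G" using that by (simp add: borel_eq_box)
    ultimately show ?thesis
    proof (induction rule: sigma_sets_induct_disjoint)
      case (basic A)
      then show ?case using zero by (auto simp: set_lebesgue_integral_def)
    next
      case (compl A)
      then have A: "A \<in> sets borel" by (simp add: borel_eq_box)
      have "(\<integral>x\<in>UNIV. h x \<partial>lborel) = (\<integral>x\<in>A \<union> (UNIV - A). h x \<partial>lborel)" by simp
      also have "\<dots> = (\<integral>x\<in>A. h x \<partial>lborel) + (\<integral>x\<in>UNIV - A. h x \<partial>lborel)" using A by (intro set_integral_Un si) auto
      finally show ?case using compl tot by (simp add: set_lebesgue_integral_def)
    next
      case (union A)
      then have A: "\<And>i. A i \<in> sets borel" by (auto simp: borel_eq_box)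
      have "(\<integral>x\<in>(\<Union>i. A i). h x \<partial>lborel) = (\<Sum>i. (\<integral>x\<in>(A i). h x \<partial>lborel))"
        using union(1) A by (intro lebesgue_integral_countable_add si) (auto simp: disjoint_family_on_def)
      then show ?case using union by simp
    qed (simp add: set_lebesgue_integral_def)
  qed
  then show ?thesis
    using sigma_finite_measure.density_unique_banach[OF sigma_finite_lborel int, of "\<lambda>x. 0"] by (simp add: set_lebesgue_integral_def)
qed

lemma AE_zero_on_cbox:
  fixes g :: "'a::euclidean_space \<Rightarrow> real"
  assumes U: "U \<in> sets lebesgue" and g: "g absolutely_integrable_on (cbox c d)" and cd: "cbox c d \<subseteq> U"
    and zero: "\<And>\<phi>. \<phi> \<in> test_functions U \<Longrightarrow> (LINT x|lebesgue_on U. g x * \<phi> x) = 0"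
  shows "AE x in lebesgue. x \<in> cbox c d \<longrightarrow> g x = 0"
proof -
  let ?g = "\<lambda>x. indicator (box c d) x * g x"
  have "set_integrable lebesgue (box c d) g" by (rule set_integrable_subset[OF g]) (auto simp: box_subset_cbox)
  then have int: "integrable lebesgue ?g" by (simp add: set_integrable_def)
  \<comment> \<open>\<open>g\<close> is only Lebesgue measurable; uniqueness of densities is applied
    to a Borel representative of its restriction to the box.\<close>
  obtain h where h: "h \<in> borel_measurable lborel" "AE x in lborel. ?g x = h x"
    using completion_ex_borel_measurable_real[OF borel_measurable_integrable[OF int]] by blast
  have h' [measurable]: "h \<in> borel_measurable lebesgue" using h(1) by (rule measurable_completion)
  have ae: "AE x in lebesgue. ?g x = h x" using h(2) by (simp add: AE_completion_iff)
  have "integrable lebesgue h" using integrable_cong_AE_imp[OF int h'] ae by (simp add: eq_commute)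
  then have inth: "integrable lborel h" using h(1) by (simp add: integrable_completion)
  have box0: "(LINT x|lebesgue. indicator (box a b) x * ?g x) = 0" for a b
  proof -
    obtain a' b' where ab: "box a b \<inter> box c d = box a' b'" using that[OF box_Int_box] .
    show ?thesis
    proof (cases "box a' b' = {}")
      case True
      then have "(\<lambda>x. indicator (box a b) x * ?g x) = (\<lambda>x. 0)" using ab by (auto simp: fun_eq_iff split: split_indicator)
      then show ?thesis by (simp only: Bochner_Integration.integral_zero)
    next
      case False
      then have sub: "cbox a' b' \<subseteq> cbox c d"
      proof -
        have "closure (box a' b') \<subseteq> cbox c d"
          unfolding ab[symmetric] using box_subset_cbox[of c d] by (intro closure_minimal) auto
        then show ?thesis using closure_box[OF False] by simp
      qed
      have z: "(LINT x|lebesgue. indicator (box a' b') x * g x) = 0"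
        using sub cd by (intro integral_box_zero[OF U _ _ zero] set_integrable_subset[OF g]) auto
      have "(\<lambda>x. indicator (box a' b') x * g x) = (\<lambda>x. indicator (box a b) x * ?g x)"
        unfolding ab[symmetric] by (simp add: indicator_inter_arith fun_eq_iff)
      from z[unfolded this] show ?thesis .
    qed
  qed
  have "(LINT x|lborel. indicator (box a b) x * h x) = 0" for a b
  proof -
    have "(LINT x|lborel. indicator (box a b) x * h x) = (LINT x|lebesgue. indicator (box a b) x * h x)"
      using h(1) by (subst integral_completion) auto
    also have "\<dots> = (LINT x|lebesgue. indicator (box a b) x * ?g x)"
    proof (rule integral_cong_AE)
      show "(\<lambda>x. indicator (box a b) x * ?g x) \<in> borel_measurable lebesgue"
        by (rule borel_measurable_times[OF indicator_box_measurable borel_measurable_integrable[OF int]])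
      show "AE x in lebesgue. indicator (box a b) x * h x = indicator (box a b) x * ?g x"
        using ae by eventually_elim simp
    qed (rule borel_measurable_times[OF indicator_box_measurable h'])
    finally show ?thesis using box0 by simp
  qed
  moreover have "(LINT x|lborel. h x) = 0"
  proof -
    have "(LINT x|lborel. h x) = (LINT x|lebesgue. h x)" using h(1) by (subst integral_completion) auto
    also have "\<dots> = (LINT x|lebesgue. indicator (box c d) x * ?g x)"
    proof (rule integral_cong_AE)
      show "(\<lambda>x. indicator (box c d) x * ?g x) \<in> borel_measurable lebesgue"
        by (rule borel_measurable_times[OF indicator_box_measurable borel_measurable_integrable[OF int]])
      show "AE x in lebesgue. h x = indicator (box c d) x * ?g x"
        using ae by eventually_elim (auto simp: indicator_def split: if_splits)
    qed (rule h')
    finally show ?thesis using box0 by simp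
  qed
  ultimately have "AE x in lborel. h x = 0" using AE_zero_if_box_integrals_zero[OF inth] by blast
  with h(2) have "AE x in lborel. x \<in> box c d \<longrightarrow> g x = 0" by eventually_elim (auto simp: indicator_def)
  then have "AE x in lebesgue. x \<in> box c d \<longrightarrow> g x = 0" by (simp add: AE_completion_iff)
  moreover have "AE x in lebesgue. x \<notin> cbox c d - box c d"
    by (rule AE_not_in) (metis negligible_frontier_interval negligible_iff_null_sets)
  ultimately show ?thesis by eventually_elim auto
qed

text \<open>The fundamental lemma of the calculus of variations: an open set is a countable union of
  closed boxes, and on each of them the function vanishes almost everywhere.\<close>

lemma locally_integrable_AE_zero:
  fixes g :: "'a::euclidean_space \<Rightarrow> real"
  assumes U: "open U" and g: "locally_integrable_on U g"
    and zero: "\<And>\<phi>. \<phi> \<in> test_functions U \<Longrightarrow> (LINT x|lebesgue_on U. g x * \<phi> x) = 0"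
  shows "AE x in lebesgue_on U. g x = 0"
proof -
  have \<Omega>': "U \<in> sets lebesgue" using U by (simp add: lborelD)
  obtain D where D: "countable D" "D \<subseteq> Pow U" "\<And>X. X \<in> D \<Longrightarrow> \<exists>a b. X = cbox a b" "\<Union>D = U"
    using open_countable_Union_open_cbox[OF U] by blast
  have "AE x in lebesgue. x \<in> X \<longrightarrow> g x = 0" if "X \<in> D" for X
  proof -
    obtain a b where X: "X = cbox a b" using D(3)[OF \<open>X \<in> D\<close>] by blast
    show ?thesis unfolding X
      using g D(2) \<open>X \<in> D\<close> X by (intro AE_zero_on_cbox[OF \<Omega>' _ _ zero]) (auto simp: locally_integrable_on_def)
  qed
  then have "AE x in lebesgue. \<forall>X\<in>D. x \<in> X \<longrightarrow> g x = 0" by (subst AE_ball_countable[OF D(1)]) blast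
  then show ?thesis using \<Omega>' D(4) by (auto simp: AE_restrict_space_iff elim!: eventually_mono)
qed

lemma locally_integrable_measurable:
  fixes g :: "'a::euclidean_space \<Rightarrow> 'b::euclidean_space"
  assumes U: "open U" and g: "locally_integrable_on U g"
  shows "g \<in> borel_measurable (lebesgue_on U)"
proof -
  obtain D where D: "countable D" "D \<subseteq> Pow U" "\<And>X. X \<in> D \<Longrightarrow> \<exists>a b. X = cbox a b" "\<Union>D = U"
    using open_countable_Union_open_cbox[OF U] by blast
  show ?thesis
  proof (rule measurable_piecewise_restrict[OF D(1)])
    fix X assume X: "X \<in> D"
    then obtain a b where ab: "X = cbox a b" using D by blast
    then have "g absolutely_integrable_on X" using g D(2) X by (auto simp: locally_integrable_on_def)
    then have "g \<in> borel_measurable (lebesgue_on X)"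
      unfolding set_integrable_def using ab by (auto simp: borel_measurable_restrict_space_iff)
    then show "g \<in> borel_measurable (restrict_space (lebesgue_on U) X)"
    proof -
      have "U \<inter> X = X" using D(2) X by auto
      then show ?thesis using \<open>g \<in> borel_measurable (lebesgue_on X)\<close> ab
        by (simp add: restrict_restrict_space U lborelD)
    qed
    show "X \<inter> space (lebesgue_on U) \<in> sets (lebesgue_on U)"
      using D(2) X U ab by (auto simp: sets_restrict_space_iff lborelD Int_absorb2)
  qed (use D(4) in simp)
qed

lemma weak_gradient_integrable:
  assumes U: "open U" and g: "locally_integrable_on U g" and phi: "\<phi> \<in> test_functions U"
  shows "integrable (lebesgue_on U) (\<lambda>x. (g x \<bullet> i) * \<phi> x)"
proof -
  let ?K = "closure {x. \<phi> x \<noteq> 0}"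
  have \<Omega>': "U \<in> sets lebesgue" using U by (simp add: lborelD)
  note K = test_functionsD[OF phi]
  obtain B where "B > 0" and B: "\<And>x. \<bar>\<phi> x\<bar> \<le> B" and "\<And>x. norm (grad \<phi> x) \<le> B" using test_bounded[OF phi] by blast
  have "g absolutely_integrable_on ?K" using g K by (auto simp: locally_integrable_on_def)
  then have int: "integrable lebesgue (\<lambda>x. (indicator ?K x *\<^sub>R g x) \<bullet> i)"
    unfolding set_integrable_def by (rule integrable_inner_left)
  have [measurable]: "\<phi> \<in> borel_measurable lebesgue"
    using test_borel_measurable(1)[OF phi] by (simp add: measurable_completion)
  have "integrable lebesgue (\<lambda>x. ((indicator ?K x *\<^sub>R g x) \<bullet> i) * \<phi> x)"
  proof (rule Bochner_Integration.integrable_bound)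
    show "integrable lebesgue (\<lambda>x. B * ((indicator ?K x *\<^sub>R g x) \<bullet> i))" using int by simp
    show "AE x in lebesgue. norm (((indicator ?K x *\<^sub>R g x) \<bullet> i) * \<phi> x) \<le> norm (B * ((indicator ?K x *\<^sub>R g x) \<bullet> i))"
    proof (rule AE_I2)
      fix x
      have "\<bar>\<phi> x\<bar> \<le> \<bar>B\<bar>" using B[of x] by linarith
      from mult_right_mono[OF this abs_ge_zero, of "(indicator ?K x *\<^sub>R g x) \<bullet> i"]
      show "norm (((indicator ?K x *\<^sub>R g x) \<bullet> i) * \<phi> x) \<le> norm (B * ((indicator ?K x *\<^sub>R g x) \<bullet> i))"
        by (simp only: real_norm_def abs_mult mult.commute)
    qed
  qed (use int in measurable)
  moreover have "(\<lambda>x. ((indicator ?K x *\<^sub>R g x) \<bullet> i) * \<phi> x) = (\<lambda>x. indicator U x *\<^sub>R ((g x \<bullet> i) * \<phi> x))"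
  proof
    fix x show "((indicator ?K x *\<^sub>R g x) \<bullet> i) * \<phi> x = indicator U x *\<^sub>R ((g x \<bullet> i) * \<phi> x)"
      using K(3) test_zero[OF phi, of x] by (cases "x \<in> ?K") auto
  qed
  ultimately have "integrable lebesgue (\<lambda>x. indicator U x *\<^sub>R ((g x \<bullet> i) * \<phi> x))" by (simp only:)
  then show ?thesis using \<Omega>' by (subst integrable_restrict_space) auto
qed

text \<open>The fundamental lemma, applied to each component of g - h. The two functions may differ
  on a null set because elements of the spaces are functions, not classes.\<close>

lemma weak_gradient_unique:
  assumes U: "open U" and g: "has_weak_gradient U u g" and h: "has_weak_gradient U v h"
    and uv: "AE x in lebesgue_on U. u x = v x"
  shows "AE x in lebesgue_on U. g x = h x"
proof -
  have \<Omega>': "U \<in> sets lebesgue" using U by (simp add: lborelD)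
  have lg: "locally_integrable_on U g" and lh: "locally_integrable_on U h"
    and lu: "locally_integrable_on U u" and lv: "locally_integrable_on U v"
    using g h by (auto simp: has_weak_gradient_def)
  have "AE x in lebesgue_on U. g x \<bullet> i - h x \<bullet> i = 0" if i: "i \<in> Basis" for i
  proof (rule locally_integrable_AE_zero[OF U])
    show "locally_integrable_on U (\<lambda>x. g x \<bullet> i - h x \<bullet> i)" unfolding locally_integrable_on_def
    proof safe
      fix K assume K: "compact K" "K \<subseteq> U"
      have comp: "(\<lambda>x. k x \<bullet> i) absolutely_integrable_on K" if "locally_integrable_on U k" for k
      proof -
        have "integrable lebesgue (\<lambda>x. (indicator K x *\<^sub>R k x) \<bullet> i)"
          using that K by (intro integrable_inner_left) (auto simp: locally_integrable_on_def set_integrable_def)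
        then show ?thesis by (simp add: set_integrable_def)
      qed
      show "(\<lambda>x. g x \<bullet> i - h x \<bullet> i) absolutely_integrable_on K"
        using comp[OF lg] comp[OF lh] by (rule set_integral_diff(1))
    qed
    fix \<phi> assume phi: "\<phi> \<in> test_functions U"
    note [measurable] = locally_integrable_measurable[OF U lu] locally_integrable_measurable[OF U lv]
    have [measurable]: "grad \<phi> \<in> borel_measurable (lebesgue_on U)"
      using test_borel_measurable(2)[OF phi] by (simp add: measurable_completion measurable_restrict_space1)
    have "(LINT x|lebesgue_on U. (g x \<bullet> i - h x \<bullet> i) * \<phi> x)
        = (LINT x|lebesgue_on U. (g x \<bullet> i) * \<phi> x) - (LINT x|lebesgue_on U. (h x \<bullet> i) * \<phi> x)"
      using weak_gradient_integrable[OF U lg phi] weak_gradient_integrable[OF U lh phi]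
      by (simp add: left_diff_distrib)
    also have "\<dots> = (LINT x|lebesgue_on U. v x * frechet_derivative \<phi> (at x) i) - (LINT x|lebesgue_on U. u x * frechet_derivative \<phi> (at x) i)"
      using g h phi i by (auto simp: has_weak_gradient_def)
    also have "(LINT x|lebesgue_on U. v x * frechet_derivative \<phi> (at x) i) = (LINT x|lebesgue_on U. u x * frechet_derivative \<phi> (at x) i)"
    proof (rule integral_cong_AE)
      show "AE x in lebesgue_on U. v x * frechet_derivative \<phi> (at x) i = u x * frechet_derivative \<phi> (at x) i"
        using uv by eventually_elim simp
    qed (auto simp: test_frechet[OF phi])
    finally show "(LINT x|lebesgue_on U. (g x \<bullet> i - h x \<bullet> i) * \<phi> x) = 0" by simp
  qed
  then have "AE x in lebesgue_on U. \<forall>i\<in>Basis. g x \<bullet> i - h x \<bullet> i = 0" by (rule AE_finite_allI[OF finite_Basis])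
  then show ?thesis
  proof eventually_elim
    fix x assume "\<forall>i\<in>Basis. g x \<bullet> i - h x \<bullet> i = 0"
    then show "g x = h x" by - (rule euclidean_eqI, simp)
  qed
qed

lemma has_weak_gradient_weak_grad: "has_weak_gradient U u g \<Longrightarrow> has_weak_gradient U u (weak_grad U u)"
  unfolding weak_grad_def by (rule someI[of "has_weak_gradient U u"])

text \<open>This neutralises the arbitrary choice in \<open>weak_grad\<close>: any weak gradient
  that is known explicitly may stand for it.\<close>

lemma weak_grad_AE:
  assumes "open U" "has_weak_gradient U u g"
  shows "AE x in lebesgue_on U. weak_grad U u x = g x"
  using weak_gradient_unique[OF assms(1) has_weak_gradient_weak_grad[OF assms(2)] assms(2)] by simp

section \<open>Lebesgue spaces\<close>

lemma powr_convex_comb: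
  fixes x y l s :: real
  assumes "s \<ge> 1" "x \<ge> 0" "y \<ge> 0" "0 \<le> l" "l \<le> 1"
  shows "((1 - l) * x + l * y) powr s \<le> (1 - l) * x powr s + l * y powr s"
proof -
  have scale: "(m * z) powr s \<le> m * z powr s" if "0 \<le> m" "m \<le> 1" for m z :: real
  proof -
    have "m powr s \<le> m powr 1" using that assms(1) by (intro powr_mono') auto
    then show ?thesis using that by (simp add: powr_mult mult_right_mono)
  qed
  consider "x = 0" | "y = 0" | "x > 0" "y > 0" using assms by linarith
  then show ?thesis
  proof cases
    case 3
    with convex_onD[OF powr_convex[OF assms(1)], of l x y] assms show ?thesis by simp
  qed (use scale[of l y] scale[of "1 - l" x] assms in auto)
qed

lemma powr_add_le:
  fixes x y s :: real
  assumes "s > 0" "x \<ge> 0" "y \<ge> 0"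
  shows "(x + y) powr s \<le> 2 powr s * (x powr s + y powr s)"
proof -
  have "(x + y) powr s \<le> (2 * max x y) powr s" using assms by (intro powr_mono2) auto
  also have "\<dots> = 2 powr s * (max x y) powr s" by (simp add: powr_mult)
  also have "\<dots> \<le> 2 powr s * (x powr s + y powr s)" by (intro mult_left_mono) (auto simp: max_def)
  finally show ?thesis .
qed

text \<open>Vector values are allowed so that functions and gradient fields share one set of
  lemmas.\<close>

definition Lp :: "real \<Rightarrow> 'a measure \<Rightarrow> ('a \<Rightarrow> 'b::euclidean_space) set" where
  "Lp s M = {V \<in> borel_measurable M. integrable M (\<lambda>x. norm (V x) powr s)}"

abbreviation Lp_int :: "real \<Rightarrow> 'a measure \<Rightarrow> ('a \<Rightarrow> 'b::euclidean_space) \<Rightarrow> real" where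
  "Lp_int s M V \<equiv> LINT x|M. norm (V x) powr s"

definition Lp_norm :: "real \<Rightarrow> 'a measure \<Rightarrow> ('a \<Rightarrow> 'b::euclidean_space) \<Rightarrow> real" where
  "Lp_norm s M V = Lp_int s M V powr (1 / s)"

abbreviation Lp_lim :: "real \<Rightarrow> 'a measure \<Rightarrow> (nat \<Rightarrow> 'a \<Rightarrow> 'b::euclidean_space) \<Rightarrow> ('a \<Rightarrow> 'b) \<Rightarrow> bool" where
  "Lp_lim s M V W \<equiv> (\<lambda>n. Lp_norm s M (\<lambda>x. V n x - W x)) \<longlonglongrightarrow> 0"

lemma LpD: "V \<in> Lp s M \<Longrightarrow> V \<in> borel_measurable M" "V \<in> Lp s M \<Longrightarrow> integrable M (\<lambda>x. norm (V x) powr s)"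
  by (auto simp: Lp_def)

lemma Lp_bound:
  assumes W: "W \<in> Lp s M" and V: "V \<in> borel_measurable M" and s: "s > 0"
    and le: "AE x in M. norm (V x) \<le> norm (W x)"
  shows "V \<in> Lp s M" "Lp_int s M V \<le> Lp_int s M W"
proof -
  note [measurable] = V
  have le': "AE x in M. norm (V x) powr s \<le> norm (W x) powr s"
    using le by eventually_elim (use s in \<open>auto intro: powr_mono2\<close>)
  have int: "integrable M (\<lambda>x. norm (V x) powr s)"
    by (rule Bochner_Integration.integrable_bound[OF LpD(2)[OF W]]) (use le' in auto)
  then show "V \<in> Lp s M" using V by (simp add: Lp_def)
  show "Lp_int s M V \<le> Lp_int s M W" by (rule integral_mono_AE[OF int LpD(2)[OF W] le'])
qed

lemma Lp_scale: "V \<in> Lp s M \<Longrightarrow> (\<lambda>x. c *\<^sub>R V x) \<in> Lp s M" by (auto simp: Lp_def powr_mult)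

lemma Lp_add:
  assumes "V \<in> Lp s M" "W \<in> Lp s M" "s > 0"
  shows "(\<lambda>x. V x + W x) \<in> Lp s M"
proof -
  note [measurable] = LpD(1)[OF assms(1)] LpD(1)[OF assms(2)]
  have "integrable M (\<lambda>x. norm (V x + W x) powr s)"
  proof (rule Bochner_Integration.integrable_bound)
    show "integrable M (\<lambda>x. 2 powr s * (norm (V x) powr s + norm (W x) powr s))"
      using LpD(2)[OF assms(1)] LpD(2)[OF assms(2)] by simp
    show "AE x in M. norm (norm (V x + W x) powr s) \<le> norm (2 powr s * (norm (V x) powr s + norm (W x) powr s))"
    proof (rule AE_I2)
      fix x
      have "norm (V x + W x) powr s \<le> (norm (V x) + norm (W x)) powr s"
        using assms(3) by (intro powr_mono2) (auto simp: norm_triangle_ineq)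
      also have "\<dots> \<le> 2 powr s * (norm (V x) powr s + norm (W x) powr s)" using assms(3) by (intro powr_add_le) auto
      finally show "norm (norm (V x + W x) powr s) \<le> norm (2 powr s * (norm (V x) powr s + norm (W x) powr s))"
        by simp
    qed
  qed simp
  then show ?thesis by (auto simp: Lp_def)
qed

lemma Lp_diff:
  assumes "V \<in> Lp s M" "W \<in> Lp s M" "s > 0"
  shows "(\<lambda>x. V x - W x) \<in> Lp s M" using Lp_add[OF assms(1) Lp_scale[OF assms(2), of "-1"] assms(3)] by simp

lemma Lp_norm_nonneg [simp]: "Lp_norm s M V \<ge> 0" by (simp add: Lp_norm_def)

lemma Lp_norm_powr: "s > 0 \<Longrightarrow> Lp_norm s M V powr s = Lp_int s M V" by (simp add: Lp_norm_def powr_powr)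

lemma Lp_norm_scale: "s > 0 \<Longrightarrow> Lp_norm s M (\<lambda>x. c *\<^sub>R V x) = \<bar>c\<bar> * Lp_norm s M V"
  by (simp add: Lp_norm_def powr_mult powr_powr)

lemma Lp_norm_minus: "Lp_norm s M (\<lambda>x. - V x) = Lp_norm s M V" by (simp add: Lp_norm_def)

lemma Lp_norm_diff_commute: "Lp_norm s M (\<lambda>x. V x - W x) = Lp_norm s M (\<lambda>x. W x - V x)"
  by (simp add: Lp_norm_def norm_minus_commute)

lemma Lp_norm_le_iff:
  assumes "s > 0" "A \<ge> 0"
  shows "Lp_norm s M V \<le> A \<longleftrightarrow> (Lp_int s M V) \<le> A powr s"
proof -
  have "Lp_norm s M V \<le> A \<longleftrightarrow> Lp_norm s M V powr s \<le> A powr s"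
    using assms by (simp add: powr_mono2 powr_less_mono2 not_le[symmetric] linorder_not_less)
      (metis Lp_norm_nonneg linorder_not_less powr_less_mono2 powr_mono2 less_imp_le)
  then show ?thesis using assms by (simp add: Lp_norm_powr)
qed

text \<open>Minkowski's inequality from convexity: V + W is A + B times a convex combination of V /
  A and W / B, where A and B slightly exceed the two norms.\<close>

lemma Lp_norm_triangle:
  assumes V: "V \<in> Lp s M" and W: "W \<in> Lp s M" and s: "s \<ge> 1"
  shows "Lp_norm s M (\<lambda>x. V x + W x) \<le> Lp_norm s M V + Lp_norm s M W"
proof (rule field_le_epsilon)
  fix e :: real assume e: "e > 0"
  \<comment> \<open>The summand e / 2 keeps both divisors positive when a norm is 0.\<close>
  define A B where "A = Lp_norm s M V + e / 2" and "B = Lp_norm s M W + e / 2"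
  have AB: "A > 0" "B > 0" using e by (auto simp: A_def B_def add_nonneg_pos)
  have leA: "Lp_int s M V \<le> A powr s" and leB: "Lp_int s M W \<le> B powr s"
    using e s by (subst Lp_norm_le_iff[symmetric]; simp add: A_def B_def)+
  define l where "l = B / (A + B)"
  have l: "0 \<le> l" "l \<le> 1" "1 - l = A / (A + B)" using AB by (auto simp: l_def field_simps)
  have pt: "norm (V x + W x) powr s \<le> (A + B) powr s * ((1 - l) * (norm (V x) powr s / A powr s) + l * (norm (W x) powr s / B powr s))" for x
  proof -
    have "norm (V x + W x) powr s \<le> (norm (V x) + norm (W x)) powr s"
      using s by (intro powr_mono2) (auto simp: norm_triangle_ineq)
    also have "norm (V x) + norm (W x) = (A + B) * ((1 - l) * (norm (V x) / A) + l * (norm (W x) / B))"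
    proof -
      have "(1 - l) * (norm (V x) / A) = norm (V x) / (A + B)" using AB by (simp add: l(3))
      moreover have "l * (norm (W x) / B) = norm (W x) / (A + B)" using AB by (simp add: l_def)
      ultimately show ?thesis using AB by (simp add: add_divide_distrib[symmetric])
    qed
    also have "\<dots> powr s = (A + B) powr s * ((1 - l) * (norm (V x) / A) + l * (norm (W x) / B)) powr s"
      by (simp add: powr_mult)
    also have "\<dots> \<le> (A + B) powr s * ((1 - l) * (norm (V x) / A) powr s + l * (norm (W x) / B) powr s)"
      using AB l s by (intro mult_left_mono powr_convex_comb) auto
    finally show ?thesis by (simp add: powr_divide)
  qed
  have "Lp_int s M (\<lambda>x. V x + W x) \<le> (LINT x|M. (A + B) powr s * ((1 - l) * (norm (V x) powr s / A powr s) + l * (norm (W x) powr s / B powr s)))"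
    using LpD(2)[OF Lp_add[OF V W]] LpD(2)[OF V] LpD(2)[OF W] pt s by (intro integral_mono) auto
  also have "\<dots> = (A + B) powr s * ((1 - l) * (Lp_int s M V / A powr s) + l * (Lp_int s M W / B powr s))"
    using LpD(2)[OF V] LpD(2)[OF W] by simp
  also have "\<dots> \<le> (A + B) powr s * ((1 - l) * 1 + l * 1)"
    using leA leB AB l by (intro mult_left_mono add_mono) (auto simp: divide_le_eq)
  finally have "Lp_norm s M (\<lambda>x. V x + W x) \<le> A + B" using AB s by (subst Lp_norm_le_iff) auto
  then show "Lp_norm s M (\<lambda>x. V x + W x) \<le> Lp_norm s M V + Lp_norm s M W + e" by (simp add: A_def B_def)
qed

lemma Lp_norm_triangle_diff:
  assumes V: "V \<in> Lp s M" and W: "W \<in> Lp s M" and s: "s \<ge> 1"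
  shows "\<bar>Lp_norm s M V - Lp_norm s M W\<bar> \<le> Lp_norm s M (\<lambda>x. V x - W x)"
  using Lp_norm_triangle[OF Lp_diff[OF V W] W s] Lp_norm_triangle[OF Lp_diff[OF W V] V s] s
  by (simp add: Lp_norm_diff_commute[of s M V W])

text \<open>Young's inequality for V / A and W / B, with A and B above the two norms, integrates to
  the bound A B; letting A and B decrease to the norms also covers norms equal to 0.\<close>

lemma Holder:
  assumes V: "V \<in> Lp s M" and W: "W \<in> Lp (s / (s - 1)) M" and s: "s > 1"
  shows "integrable M (\<lambda>x. norm (V x) * norm (W x))"
    and "(LINT x|M. norm (V x) * norm (W x)) \<le> Lp_norm s M V * Lp_norm (s / (s - 1)) M W"
proof -
  note [measurable] = LpD(1)[OF V] LpD(1)[OF W]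
  let ?t = "s / (s - 1)"
  have t: "?t > 1" "1 / s + 1 / ?t = 1" using s by (auto simp: field_simps)
  have young: "norm (V x) * norm (W x) \<le> norm (V x) powr s / s + norm (W x) powr ?t / ?t" for x
    using Youngs_inequality[OF s t] by simp
  show int: "integrable M (\<lambda>x. norm (V x) * norm (W x))"
  proof (rule Bochner_Integration.integrable_bound)
    show "integrable M (\<lambda>x. norm (V x) powr s / s + norm (W x) powr ?t / ?t)"
      using LpD(2)[OF V] LpD(2)[OF W] by (intro Bochner_Integration.integrable_add integrable_divide)
    show "AE x in M. norm (norm (V x) * norm (W x)) \<le> norm (norm (V x) powr s / s + norm (W x) powr ?t / ?t)"
      using young abs_ge_self order_trans by (intro AE_I2) (simp add: abs_mult, blast)
  qed simp
  have le: "(LINT x|M. norm (V x) * norm (W x)) \<le> A * B"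
    if A: "A > Lp_norm s M V" and B: "B > Lp_norm ?t M W" for A B
  proof -
    have AB: "A > 0" "B > 0" using A B Lp_norm_nonneg le_less_trans by blast+
    have leA: "Lp_int s M V \<le> A powr s" and leB: "(LINT x|M. norm (W x) powr ?t) \<le> B powr ?t"
      using A B AB s t by (subst Lp_norm_le_iff[symmetric]; simp)+
    have "norm (V x) * norm (W x) \<le> A * B * ((norm (V x) powr s / A powr s) / s + (norm (W x) powr ?t / B powr ?t) / ?t)" for x
    proof -
      have "(norm (V x) / A) * (norm (W x) / B) \<le> (norm (V x) / A) powr s / s + (norm (W x) / B) powr ?t / ?t"
        using AB by (intro Youngs_inequality[OF s t]) auto
      then have "A * B * ((norm (V x) / A) * (norm (W x) / B)) \<le> A * B * ((norm (V x) / A) powr s / s + (norm (W x) / B) powr ?t / ?t)"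
        using AB by (intro mult_left_mono) auto
      then show ?thesis using AB by (simp add: powr_divide)
    qed
    then have "(LINT x|M. norm (V x) * norm (W x)) \<le> (LINT x|M. A * B * ((norm (V x) powr s / A powr s) / s + (norm (W x) powr ?t / B powr ?t) / ?t))"
      using int LpD(2)[OF V] LpD(2)[OF W]
      by (intro integral_mono integrable_mult_right Bochner_Integration.integrable_add integrable_divide) auto
    also have "\<dots> = A * B * ((Lp_int s M V / A powr s) / s + ((LINT x|M. norm (W x) powr ?t) / B powr ?t) / ?t)"
      using LpD(2)[OF V] LpD(2)[OF W] by (simp add: integrable_divide del: divide_divide_eq_right divide_divide_eq_left times_divide_eq_left)
    also have "\<dots> \<le> A * B * (1 / s + 1 / ?t)"
      using leA leB AB s t by (intro mult_left_mono add_mono divide_right_mono) (auto simp: divide_le_eq)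
    finally show ?thesis using t by simp
  qed
  show "(LINT x|M. norm (V x) * norm (W x)) \<le> Lp_norm s M V * Lp_norm ?t M W"
  proof (rule tendsto_lowerbound[where F = "at_right (0::real)"])
    show "((\<lambda>e. (Lp_norm s M V + e) * (Lp_norm ?t M W + e)) \<longlongrightarrow> Lp_norm s M V * Lp_norm ?t M W) (at_right 0)"
      by (rule tendsto_eq_intros refl | simp)+
    show "\<forall>\<^sub>F e in at_right 0. (LINT x|M. norm (V x) * norm (W x)) \<le> (Lp_norm s M V + e) * (Lp_norm ?t M W + e)"
      by (rule eventually_mono[OF eventually_at_right_less]) (intro le, auto)
  qed simp
qed

lemma Holder_inner:
  assumes V: "V \<in> Lp s M" and W: "W \<in> Lp (s / (s - 1)) M" and s: "s > 1"
  shows "integrable M (\<lambda>x. W x \<bullet> V x)"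
    and "\<bar>LINT x|M. W x \<bullet> V x\<bar> \<le> Lp_norm (s / (s - 1)) M W * Lp_norm s M V"
proof -
  note [measurable] = LpD(1)[OF V] LpD(1)[OF W]
  show int: "integrable M (\<lambda>x. W x \<bullet> V x)" by (rule Bochner_Integration.integrable_bound[OF Holder(1)[OF assms]])
      (auto simp: Cauchy_Schwarz_ineq2 mult.commute[of "norm (V _)"])
  have "\<bar>LINT x|M. W x \<bullet> V x\<bar> \<le> (LINT x|M. \<bar>W x \<bullet> V x\<bar>)" by (rule integral_abs_bound)
  also have "\<dots> \<le> (LINT x|M. norm (V x) * norm (W x))"
    using int Holder(1)[OF assms] by (intro integral_mono) (auto simp: Cauchy_Schwarz_ineq2 mult.commute[of "norm (V _)"])
  finally show "\<bar>LINT x|M. W x \<bullet> V x\<bar> \<le> Lp_norm (s / (s - 1)) M W * Lp_norm s M V"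
    using Holder(2)[OF assms] by (simp add: mult.commute)
qed

lemma Lp_Fatou:
  fixes V :: "'a \<Rightarrow> 'b::euclidean_space"
  assumes Vn: "\<And>n. Vn n \<in> Lp s M" and V: "V \<in> borel_measurable M" and s: "s > 0"
    and lim: "AE x in M. (\<lambda>n. Vn n x) \<longlonglongrightarrow> V x" and bd: "\<And>n. n \<ge> n0 \<Longrightarrow> Lp_norm s M (Vn n) \<le> C"
  shows "V \<in> Lp s M" "Lp_norm s M V \<le> C"
proof -
  note [measurable] = LpD(1)[OF Vn] V
  have C: "C \<ge> 0" using bd[of n0] Lp_norm_nonneg order_trans by blast
  have "(\<integral>\<^sup>+x. ennreal (norm (V x) powr s) \<partial>M) = (\<integral>\<^sup>+x. liminf (\<lambda>n. ennreal (norm (Vn n x) powr s)) \<partial>M)"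
  proof (rule nn_integral_cong_AE)
    show "AE x in M. ennreal (norm (V x) powr s) = liminf (\<lambda>n. ennreal (norm (Vn n x) powr s))" using lim
    proof eventually_elim
      fix x assume "(\<lambda>n. Vn n x) \<longlonglongrightarrow> V x"
      then have "(\<lambda>n. ennreal (norm (Vn n x) powr s)) \<longlonglongrightarrow> ennreal (norm (V x) powr s)"
        using s by (intro tendsto_ennrealI tendsto_powr' tendsto_norm tendsto_const) auto
      then show "ennreal (norm (V x) powr s) = liminf (\<lambda>n. ennreal (norm (Vn n x) powr s))"
        by (rule lim_imp_Liminf[OF sequentially_bot, symmetric])
    qed
  qed
  also have "\<dots> \<le> liminf (\<lambda>n. \<integral>\<^sup>+x. ennreal (norm (Vn n x) powr s) \<partial>M)" by (rule nn_integral_liminf) simp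
  also have "\<dots> \<le> ennreal (C powr s)"
  proof (rule Liminf_le)
    show "\<forall>\<^sub>F n in sequentially. (\<integral>\<^sup>+x. ennreal (norm (Vn n x) powr s) \<partial>M) \<le> ennreal (C powr s)"
    proof (rule eventually_sequentiallyI[of n0])
      fix n assume "n0 \<le> n"
      then have "Lp_int s M (Vn n) \<le> C powr s" using bd[of n] C s by (simp add: Lp_norm_le_iff)
      then show "(\<integral>\<^sup>+x. ennreal (norm (Vn n x) powr s) \<partial>M) \<le> ennreal (C powr s)"
        by (subst nn_integral_eq_integral[OF LpD(2)[OF Vn]]) (auto intro: ennreal_leI)
    qed
  qed simp
  finally have le: "(\<integral>\<^sup>+x. ennreal (norm (V x) powr s) \<partial>M) \<le> ennreal (C powr s)" .
  then have int: "integrable M (\<lambda>x. norm (V x) powr s)" by (intro integrableI_nonneg) (auto simp: le_less_trans)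
  then show "V \<in> Lp s M" using V by (simp add: Lp_def)
  have "Lp_int s M V \<le> C powr s" using le by (subst (asm) nn_integral_eq_integral[OF int]) auto
  then show "Lp_norm s M V \<le> C" using C s by (simp add: Lp_norm_le_iff)
qed

lemma Lp_norm_tendsto_zero_iff:
  assumes "s > 0"
  shows "(\<lambda>n. Lp_norm s M (V n)) \<longlonglongrightarrow> 0 \<longleftrightarrow> (\<lambda>n. Lp_int s M (V n)) \<longlonglongrightarrow> 0"
proof
  assume "(\<lambda>n. Lp_norm s M (V n)) \<longlonglongrightarrow> 0"
  then have "(\<lambda>n. Lp_norm s M (V n) powr s) \<longlonglongrightarrow> 0 powr s" using assms by (intro tendsto_powr') auto
  then show "(\<lambda>n. Lp_int s M (V n)) \<longlonglongrightarrow> 0" using assms by (simp add: Lp_norm_powr)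
next
  assume "(\<lambda>n. Lp_int s M (V n)) \<longlonglongrightarrow> 0"
  then have "(\<lambda>n. (Lp_int s M (V n)) powr (1 / s)) \<longlonglongrightarrow> 0 powr (1 / s)" using assms by (intro tendsto_powr') auto
  then show "(\<lambda>n. Lp_norm s M (V n)) \<longlonglongrightarrow> 0" by (simp add: Lp_norm_def)
qed

lemma Lp_convergent_AE_subseq:
  fixes V :: "'a \<Rightarrow> 'b::euclidean_space"
  assumes Vn: "\<And>n. Vn n \<in> Lp s M" and V: "V \<in> Lp s M" and s: "s > 0"
    and lim: "Lp_lim s M Vn V"
  obtains r :: "nat \<Rightarrow> nat" where "strict_mono r" "AE x in M. (\<lambda>n. Vn (r n) x) \<longlonglongrightarrow> V x"
proof -
  have "\<exists>r::nat\<Rightarrow>nat. strict_mono r \<and> (AE x in M. (\<lambda>n. norm (Vn (r n) x - V x) powr s) \<longlonglongrightarrow> 0)"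
  proof (rule tendsto_L1_AE_subseq)
    show "integrable M (\<lambda>x. norm (Vn n x - V x) powr s)" for n using LpD(2)[OF Lp_diff[OF Vn V s]] .
    show "(\<lambda>n. LINT x|M. norm (norm (Vn n x - V x) powr s)) \<longlonglongrightarrow> 0" using lim s by (simp add: Lp_norm_tendsto_zero_iff)
  qed
  then obtain r :: "nat \<Rightarrow> nat" where r: "strict_mono r" "AE x in M. (\<lambda>n. norm (Vn (r n) x - V x) powr s) \<longlonglongrightarrow> 0" by blast
  have "AE x in M. (\<lambda>n. Vn (r n) x) \<longlonglongrightarrow> V x" using r(2)
  proof eventually_elim
    fix x assume "(\<lambda>n. norm (Vn (r n) x - V x) powr s) \<longlonglongrightarrow> 0"
    then have "(\<lambda>n. (norm (Vn (r n) x - V x) powr s) powr (1 / s)) \<longlonglongrightarrow> 0 powr (1 / s)"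
      using s by (intro tendsto_powr') auto
    then have "(\<lambda>n. norm (Vn (r n) x - V x)) \<longlonglongrightarrow> 0" using s by (simp add: powr_powr)
    then show "(\<lambda>n. Vn (r n) x) \<longlonglongrightarrow> V x" by (simp add: tendsto_norm_zero_iff LIM_zero_iff)
  qed
  with r(1) show ?thesis by (rule that)
qed

text \<open>Along a subsequence with increments of norm at most 4^(-k), the integrals of (2^k
  |d_k|)^s are summable; so almost everywhere |d_k| \<le> 2^(-k) eventually, and the subsequence
  converges. Fatou's lemma, applied to a fixed member minus the subsequence, turns this into norm
  convergence of the whole sequence.\<close>

lemma Lp_complete:
  fixes Vn :: "nat \<Rightarrow> 'a \<Rightarrow> 'b::euclidean_space"
  assumes Vn: "\<And>n. Vn n \<in> Lp s M" and s: "s \<ge> 1"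
    and cauchy: "\<And>e. e > 0 \<Longrightarrow> \<exists>n0. \<forall>m\<ge>n0. \<forall>n\<ge>n0. Lp_norm s M (\<lambda>x. Vn m x - Vn n x) \<le> e"
  obtains V where "V \<in> Lp s M" "Lp_lim s M Vn V"
proof -
  note [measurable] = LpD(1)[OF Vn]
  have s0: "s > 0" using s by simp
  have "\<forall>k. \<exists>n0. \<forall>m\<ge>n0. \<forall>n\<ge>n0. Lp_norm s M (\<lambda>x. Vn m x - Vn n x) \<le> (1/4) ^ k" using cauchy by simp
  then obtain r0 where r0: "\<And>k m n. m \<ge> r0 k \<Longrightarrow> n \<ge> r0 k \<Longrightarrow> Lp_norm s M (\<lambda>x. Vn m x - Vn n x) \<le> (1/4) ^ k" by metis
  \<comment> \<open>The partial sums are strictly increasing and dominate \<open>r0\<close>.\<close>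
  define r where "r k = (\<Sum>i\<le>k. Suc (r0 i))" for k
  have r: "r0 k \<le> r k" for k unfolding r_def using member_le_sum[of k "{..k}" "\<lambda>i. Suc (r0 i)"] by simp
  have rmono: "strict_mono r" by (rule strict_mono_Suc_iff[THEN iffD2]) (simp add: r_def)
  define d where "d k x = Vn (r (Suc k)) x - Vn (r k) x" for k x
  have dLp: "d k \<in> Lp s M" for k unfolding d_def by (rule Lp_diff[OF Vn Vn s0])
  note [measurable] = LpD(1)[OF dLp]
  have dk: "Lp_norm s M (d k) \<le> (1/4) ^ k" for k
    unfolding d_def using r[of k] strict_mono_less_eq[OF rmono, of k "Suc k"] by (intro r0) auto
  have sub: "(\<integral>\<^sup>+x. ennreal ((2 ^ k * norm (d k x)) powr s) \<partial>M) \<le> ennreal ((1/2) ^ k)" for k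
  proof -
    have "integrable M (\<lambda>x. (2 ^ k * norm (d k x)) powr s)" using LpD(2)[OF dLp] by (simp add: powr_mult)
    then have "(\<integral>\<^sup>+x. ennreal ((2 ^ k * norm (d k x)) powr s) \<partial>M) = ennreal (LINT x|M. (2 ^ k * norm (d k x)) powr s)"
      by (rule nn_integral_eq_integral) simp
    also have "(LINT x|M. (2 ^ k * norm (d k x)) powr s) = (2 ^ k * Lp_norm s M (d k)) powr s"
      using s0 by (simp add: powr_mult Lp_norm_powr)
    also have "ennreal \<dots> \<le> ennreal (((1/2) ^ k) powr 1)"
    proof (rule ennreal_leI)
      have "2 ^ k * Lp_norm s M (d k) \<le> 2 ^ k * (1/4) ^ k" using dk by (intro mult_left_mono) auto
      also have "\<dots> = (1/2) ^ k" by (simp add: power_mult_distrib[symmetric])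
      finally have "(2 ^ k * Lp_norm s M (d k)) powr s \<le> ((1/2) ^ k) powr s" using s0 by (intro powr_mono2) auto
      also have "\<dots> \<le> ((1/2) ^ k) powr 1" using s by (intro powr_mono') (auto simp: power_le_one)
      finally show "(2 ^ k * Lp_norm s M (d k)) powr s \<le> ((1/2) ^ k) powr 1" .
    qed
    finally show ?thesis by simp
  qed
  have "(\<integral>\<^sup>+x. (\<Sum>k. ennreal ((2 ^ k * norm (d k x)) powr s)) \<partial>M) = (\<Sum>k. \<integral>\<^sup>+x. ennreal ((2 ^ k * norm (d k x)) powr s) \<partial>M)"
    by (rule nn_integral_suminf) simp
  also have "\<dots> \<le> (\<Sum>k. ennreal ((1/2) ^ k))" by (intro suminf_le sub) auto
  also have "\<dots> < \<infinity>" by (subst suminf_ennreal2) (auto simp: summable_geometric)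
  finally have "(\<integral>\<^sup>+x. (\<Sum>k. ennreal ((2 ^ k * norm (d k x)) powr s)) \<partial>M) \<noteq> \<infinity>" by simp
  then have fin: "AE x in M. (\<Sum>k. ennreal ((2 ^ k * norm (d k x)) powr s)) \<noteq> \<infinity>"
    by (intro nn_integral_noteq_infinite) auto
  have conv: "AE x in M. convergent (\<lambda>k. Vn (r k) x)" using fin
  proof eventually_elim
    fix x assume a: "(\<Sum>k. ennreal ((2 ^ k * norm (d k x)) powr s)) \<noteq> \<infinity>"
    then have sm: "summable (\<lambda>k. (2 ^ k * norm (d k x)) powr s)" by (intro summable_suminf_not_top) auto
    then have "(\<lambda>k. (2 ^ k * norm (d k x)) powr s) \<longlonglongrightarrow> 0" by (rule summable_LIMSEQ_zero)
    then have "\<forall>\<^sub>F k in sequentially. (2 ^ k * norm (d k x)) powr s < 1" by (rule order_tendstoD) simp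
    then have "\<forall>\<^sub>F k in sequentially. norm (d k x) \<le> (1/2) ^ k"
    proof eventually_elim
      fix k assume "(2 ^ k * norm (d k x)) powr s < 1"
      moreover have "1 \<le> (2 ^ k * norm (d k x)) powr s" if "1 < 2 ^ k * norm (d k x)"
        using that s0 by (intro ge_one_powr_ge_zero) auto
      ultimately have "2 ^ k * norm (d k x) \<le> 1" by linarith
      then show "norm (d k x) \<le> (1/2) ^ k" by (simp add: field_simps)
    qed
    then have "summable (\<lambda>k. d k x)" by (rule summable_comparison_test_ev) (rule summable_geometric, simp)
    then have "convergent (\<lambda>n. \<Sum>k<n. d k x)" by (simp add: summable_iff_convergent)
    then have "convergent (\<lambda>n. Vn (r 0) x + (\<Sum>k<n. d k x))" by (intro convergent_add convergent_const)
    moreover have "Vn (r 0) x + (\<Sum>k<n. d k x) = Vn (r n) x" for n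
      unfolding d_def using sum_lessThan_telescope[of "\<lambda>k. Vn (r k) x" n] by simp
    ultimately show "convergent (\<lambda>k. Vn (r k) x)" by simp
  qed
  define V where "V x = lim (\<lambda>k. Vn (r k) x)" for x
  have Vm[measurable]: "V \<in> borel_measurable M" unfolding V_def by measurable
  have lim: "AE x in M. (\<lambda>k. Vn (r k) x) \<longlonglongrightarrow> V x"
    using conv by eventually_elim (simp add: V_def convergent_LIMSEQ_iff)
  have main: "(\<lambda>x. Vn n x - V x) \<in> Lp s M \<and> Lp_norm s M (\<lambda>x. Vn n x - V x) \<le> e"
    if n: "n \<ge> n0" and n0: "\<forall>m\<ge>n0. \<forall>n\<ge>n0. Lp_norm s M (\<lambda>x. Vn m x - Vn n x) \<le> e" for n n0 e
  proof -
    have 1: "(\<lambda>x. Vn n x - Vn (r k) x) \<in> Lp s M" for k by (rule Lp_diff[OF Vn Vn s0])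
    have 2: "(\<lambda>x. Vn n x - V x) \<in> borel_measurable M" by measurable
    have 3: "AE x in M. (\<lambda>k. Vn n x - Vn (r k) x) \<longlonglongrightarrow> Vn n x - V x"
      using lim by eventually_elim (intro tendsto_intros)
    have 4: "Lp_norm s M (\<lambda>x. Vn n x - Vn (r k) x) \<le> e" if "k \<ge> n0" for k
      using n n0 that seq_suble[OF rmono, of k] by auto
    show ?thesis using Lp_Fatou[OF 1 2 s0 3 4] by blast
  qed
  have VLp: "V \<in> Lp s M"
  proof -
    obtain n0 where "\<forall>m\<ge>n0. \<forall>n\<ge>n0. Lp_norm s M (\<lambda>x. Vn m x - Vn n x) \<le> 1" using cauchy[of 1] by auto
    from main[OF order_refl this] have "(\<lambda>x. Vn n0 x - V x) \<in> Lp s M" by blast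
    from Lp_diff[OF Vn[of n0] this s0] show ?thesis by simp
  qed
  have "Lp_lim s M Vn V"
  proof (rule LIMSEQ_I)
    fix e :: real assume "e > 0"
    then obtain n0 where "\<forall>m\<ge>n0. \<forall>n\<ge>n0. Lp_norm s M (\<lambda>x. Vn m x - Vn n x) \<le> e / 2" using cauchy[of "e / 2"] by auto
    from main[OF _ this] \<open>e > 0\<close>
    show "\<exists>n0. \<forall>n\<ge>n0. norm (Lp_norm s M (\<lambda>x. Vn n x - V x) - 0) < e" by (intro exI[of _ n0]) fastforce
  qed
  with VLp show ?thesis by (rule that)
qed

section \<open>The monotone power map\<close>

text \<open>The flux |v|^(s-2) v, that is, the gradient of |v|^s / s. It is 0 at the origin for
  every s.\<close>

definition pw :: "real \<Rightarrow> 'b::euclidean_space \<Rightarrow> 'b" where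
  "pw s v = norm v powr (s - 2) *\<^sub>R v"

lemma pw_zero [simp]: "pw s 0 = 0" by (simp add: pw_def)

lemma norm_pw: "norm (pw s v) = norm v powr (s - 1)"
proof (cases "v = 0")
  case False
  have "norm v powr (s - 2) * norm v powr 1 = norm v powr (s - 1)" by (simp only: powr_add[symmetric]) simp
  then show ?thesis using False by (simp add: pw_def)
qed (simp add: pw_def)

lemma pw_inner_self: "pw s v \<bullet> v = norm v powr s"
proof (cases "v = 0")
  case False
  have "norm v powr (s - 2) * norm v powr 2 = norm v powr s" by (simp only: powr_add[symmetric]) simp
  then show ?thesis using False by (simp add: pw_def dot_square_norm)
qed (simp add: pw_def)

lemma pw_scaleR: "c \<ge> 0 \<Longrightarrow> pw s (c *\<^sub>R v) = c powr (s - 1) *\<^sub>R pw s v"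
proof (cases "c = 0")
  case False
  assume "c \<ge> 0"
  have "c powr (s - 2) * c powr 1 = c powr (s - 1)" by (simp only: powr_add[symmetric]) simp
  then show ?thesis using False \<open>c \<ge> 0\<close> by (simp add: pw_def powr_mult)
qed (simp add: pw_def)

lemma continuous_on_pw:
  assumes "s > 1"
  shows "continuous_on A (pw s)"
proof -
  have "isCont (pw s) v" for v
  proof (cases "v = 0")
    case True
    have "((\<lambda>v. norm (pw s v)) \<longlongrightarrow> 0) (at 0)"
      unfolding norm_pw by (rule tendsto_eq_intros refl | use assms in force)+
    then show ?thesis unfolding True isCont_def by (simp add: tendsto_norm_zero_iff)
  next
    case False
    then show ?thesis unfolding pw_def by (auto intro!: continuous_intros)
  qed
  then show ?thesis by (intro continuous_at_imp_continuous_on ballI)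
qed

text \<open>The pairing is the sum of (|v|^(s-1) - |w|^(s-1)) (|v| - |w|) and two Cauchy-Schwarz
  defects, all of them nonnegative. If it is 0, the norms agree and the vectors point in the same
  direction.\<close>

lemma pw_monotone:
  assumes "s > 1"
  shows "(pw s v - pw s w) \<bullet> (v - w) \<ge> 0"
    and "(pw s v - pw s w) \<bullet> (v - w) = 0 \<Longrightarrow> v = w"
proof -
  let ?a = "norm v powr (s - 1)" and ?b = "norm w powr (s - 1)"
  have cs1: "pw s v \<bullet> w \<le> ?a * norm w" and cs2: "pw s w \<bullet> v \<le> ?b * norm v"
    using norm_cauchy_schwarz[of "pw s v" w] norm_cauchy_schwarz[of "pw s w" v] by (simp_all add: norm_pw)
  have self: "pw s v \<bullet> v = ?a * norm v" "pw s w \<bullet> w = ?b * norm w" by (simp_all add: pw_inner_self powr_diff)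
  have expand: "(pw s v - pw s w) \<bullet> (v - w) = (?a - ?b) * (norm v - norm w) + (?a * norm w - pw s v \<bullet> w) + (?b * norm v - pw s w \<bullet> v)"
    using self by (simp add: inner_diff_left inner_diff_right algebra_simps)
  have sgn: "(?a - ?b) * (norm v - norm w) \<ge> 0"
  proof (cases "norm v \<le> norm w")
    case True
    then have "?a \<le> ?b" using assms by (intro powr_mono2) auto
    with True show ?thesis by (simp add: mult_nonpos_nonpos)
  next
    case False
    then have "?b \<le> ?a" using assms by (intro powr_mono2) auto
    with False show ?thesis by simp
  qed
  show "(pw s v - pw s w) \<bullet> (v - w) \<ge> 0" using expand sgn cs1 cs2 by linarith
  assume "(pw s v - pw s w) \<bullet> (v - w) = 0"
  then have z: "(?a - ?b) * (norm v - norm w) = 0" and e: "pw s v \<bullet> w = ?a * norm w"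
    using expand sgn cs1 cs2 by linarith+
  have nvw: "norm v = norm w"
  proof (rule ccontr)
    assume n: "norm v \<noteq> norm w"
    then consider "norm v < norm w" | "norm w < norm v" by linarith
    then have "?a \<noteq> ?b"
      by cases (use powr_less_mono2[of "s - 1" "norm v" "norm w"] powr_less_mono2[of "s - 1" "norm w" "norm v"] assms in auto)
    with z n show False by simp
  qed
  show "v = w"
  proof (cases "v = 0")
    case True
    then show ?thesis using nvw by simp
  next
    case False
    have "pw s v \<bullet> w = norm v powr (s - 2) * (v \<bullet> w)" by (simp add: pw_def)
    moreover have "?a * norm w = norm v powr (s - 2) * (norm v * norm w)"
      using False by (simp add: powr_diff power2_eq_square)
    ultimately have "v \<bullet> w = norm v * norm w" using e False by simp
    then have "norm v *\<^sub>R w = norm w *\<^sub>R v" by (simp add: norm_cauchy_schwarz_eq)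
    then show ?thesis using nvw False by auto
  qed
qed

lemma powr_max_le: "s > 0 \<Longrightarrow> (max (norm v) (norm w)) powr s \<le> norm v powr s + norm w powr s" by (simp add: max_def)

text \<open>Both sides are homogeneous of degree s, so the unit ball suffices. There uniform
  continuity yields the term with \<open>e\<close> when v and w are close; otherwise |v - w| is
  bounded below and a large C covers the left side. The argument is the same for s < 2 and s \<ge>
  2.\<close>

lemma pw_difference_bound:
  assumes s: "s > 1" and e: "e > 0"
  obtains C where "C \<ge> 0"
    "\<And>v w :: 'b::euclidean_space. norm (pw s v - pw s w) powr (s / (s - 1)) \<le> e * (norm v powr s + norm w powr s) + C * norm (v - w) powr s"
proof -
  let ?t = "s / (s - 1)"
  have t: "?t > 0" using s by simp
  have "uniformly_continuous_on (cball (0::'b) 1) (pw s)"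
    using s by (intro compact_uniformly_continuous continuous_on_pw) auto
  moreover have "e powr (1 / ?t) > 0" using e by simp
  ultimately obtain \<eta> where eta: "\<eta> > 0" "\<And>v w. v \<in> cball (0::'b) 1 \<Longrightarrow> w \<in> cball 0 1 \<Longrightarrow> dist w v < \<eta> \<Longrightarrow> dist (pw s w) (pw s v) < e powr (1 / ?t)"
    unfolding uniformly_continuous_on_def by meson
  \<comment> \<open>In the unit ball the left side is at most 2 powr (s / (s - 1)), which equals C
    \<eta> powr s, the smallest value of the last term at distance at least \<eta>.\<close>
  define C where "C = 2 powr ?t / \<eta> powr s"
  have C: "C \<ge> 0" by (simp add: C_def)
  have unit: "norm (pw s v - pw s w) powr ?t \<le> e + C * norm (v - w) powr s" if "norm v \<le> 1" "norm w \<le> 1" for v w :: 'b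
  proof (cases "norm (v - w) < \<eta>")
    case True
    then have "norm (pw s v - pw s w) \<le> e powr (1 / ?t)" using eta(2)[of w v] that by (simp add: dist_norm)
    then have "norm (pw s v - pw s w) powr ?t \<le> (e powr (1 / ?t)) powr ?t" using t by (intro powr_mono2) auto
    also have "\<dots> = e" unfolding powr_powr using e s by simp
    finally show ?thesis using C by (simp add: add_increasing2)
  next
    case False
    have "norm (pw s v) \<le> 1" "norm (pw s w) \<le> 1" unfolding norm_pw
      using that s powr_le1[of "s - 1" "norm v"] powr_le1[of "s - 1" "norm w"] by auto
    then have "norm (pw s v - pw s w) \<le> 2" using norm_triangle_ineq4[of "pw s v" "pw s w"] by linarith
    then have "norm (pw s v - pw s w) powr ?t \<le> 2 powr ?t" using t by (intro powr_mono2) auto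
    also have "\<dots> = C * \<eta> powr s" using eta by (simp add: C_def)
    also have "\<dots> \<le> C * norm (v - w) powr s" using False C eta s by (intro mult_left_mono powr_mono2) auto
    finally show ?thesis using e by simp
  qed
  have "norm (pw s v - pw s w) powr ?t \<le> e * (norm v powr s + norm w powr s) + C * norm (v - w) powr s" for v w :: 'b
  proof (cases "v = 0 \<and> w = 0")
    case False
    define m where "m = max (norm v) (norm w)"
    have m: "m > 0" using False unfolding m_def by (auto simp: less_max_iff_disj)
    define v' w' where "v' = (1 / m) *\<^sub>R v" and "w' = (1 / m) *\<^sub>R w"
    have vw: "v = m *\<^sub>R v'" "w = m *\<^sub>R w'" using m by (auto simp: v'_def w'_def)
    have le: "norm v' \<le> 1" "norm w' \<le> 1" using m by (auto simp: v'_def w'_def m_def)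
    have "norm (pw s v - pw s w) powr ?t = (m powr (s - 1) * norm (pw s v' - pw s w')) powr ?t"
      using m unfolding vw by (simp add: pw_scaleR scaleR_diff_right[symmetric])
    also have "\<dots> = m powr s * norm (pw s v' - pw s w') powr ?t" using s by (simp add: powr_mult powr_powr)
    also have "\<dots> \<le> m powr s * (e + C * norm (v' - w') powr s)" using unit[OF le] by (intro mult_left_mono) auto
    also have "\<dots> = e * m powr s + C * norm (v - w) powr s"
    proof -
      have "norm (v - w) powr s = m powr s * norm (v' - w') powr s"
        using m unfolding vw by (simp add: scaleR_diff_right[symmetric] powr_mult)
      then show ?thesis by (simp add: distrib_left mult.left_commute mult.commute)
    qed
    also have "\<dots> \<le> e * (norm v powr s + norm w powr s) + C * norm (v - w) powr s"
      unfolding m_def using powr_max_le[of s v w] s e by (intro add_right_mono mult_left_mono) auto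
    finally show ?thesis .
  qed simp
  with C show ?thesis by (rule that)
qed

text \<open>Again by homogeneity of degree s. On the compact set of pairs in the unit ball at
  distance at least \<delta>, strict monotonicity gives the pairing a positive minimum; closer pairs
  are covered by \<delta> powr s = e. Compactness treats singular and degenerate exponents
  alike.\<close>

lemma pw_monotone_bound:
  assumes s: "s > 1" and e: "e > 0"
  obtains C where "C \<ge> 0"
    "\<And>v w :: 'b::euclidean_space. norm (v - w) powr s \<le> e * (norm v powr s + norm w powr s) + C * ((pw s v - pw s w) \<bullet> (v - w))"
proof -
  define \<delta> where "\<delta> = e powr (1 / s)"
  have \<delta>: "\<delta> > 0" "\<delta> powr s = e" using e s by (auto simp: \<delta>_def powr_powr)
  define K where "K = {z :: 'b \<times> 'b. norm (fst z) \<le> 1 \<and> norm (snd z) \<le> 1 \<and> \<delta> \<le> norm (fst z - snd z)}"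
  have "K = (cball 0 1 \<times> cball 0 1) \<inter> {z. \<delta> \<le> norm (fst z - snd z)}" unfolding K_def by auto
  moreover have "closed {z :: 'b \<times> 'b. \<delta> \<le> norm (fst z - snd z)}" by (intro closed_Collect_le continuous_intros)
  ultimately have K: "compact K" by (simp add: compact_Int_closed compact_Times)
  let ?f = "\<lambda>z. (pw s (fst z) - pw s (snd z)) \<bullet> (fst z - snd z)"
  have pos: "?f z > 0" if "z \<in> K" for z
  proof -
    have "fst z \<noteq> snd z" using that \<delta> by (auto simp: K_def)
    then show ?thesis using pw_monotone[OF s, of "fst z" "snd z"] by linarith
  qed
  have "continuous_on K ?f"
    by (intro continuous_intros continuous_on_compose2[OF continuous_on_pw[OF s, of UNIV]]) auto
  then obtain m where m: "m > 0" "\<And>z. z \<in> K \<Longrightarrow> m \<le> ?f z"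
    using continuous_attains_inf[OF K, of ?f] pos by (cases "K = {}") (auto intro: zero_less_one)
  define C where "C = 2 powr s / m"
  have C: "C \<ge> 0" using m by (simp add: C_def)
  have unit: "norm (v - w) powr s \<le> e + C * ((pw s v - pw s w) \<bullet> (v - w))" if "norm v \<le> 1" "norm w \<le> 1" for v w :: 'b
  proof (cases "\<delta> \<le> norm (v - w)")
    case True
    then have "m \<le> (pw s v - pw s w) \<bullet> (v - w)" using m(2)[of "(v, w)"] that by (auto simp: K_def)
    then have "C * m \<le> C * ((pw s v - pw s w) \<bullet> (v - w))" using C by (rule mult_left_mono)
    moreover have "norm (v - w) powr s \<le> 2 powr s"
      using norm_triangle_ineq4[of v w] that s by (intro powr_mono2) auto
    ultimately show ?thesis using m e by (simp add: C_def)
  next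
    case False
    then have "norm (v - w) powr s \<le> \<delta> powr s" using s by (intro powr_mono2) auto
    then show ?thesis using \<delta> C pw_monotone(1)[OF s, of v w] by (simp add: add_increasing2)
  qed
  have "norm (v - w) powr s \<le> e * (norm v powr s + norm w powr s) + C * ((pw s v - pw s w) \<bullet> (v - w))" for v w :: 'b
  proof (cases "v = 0 \<and> w = 0")
    case False
    define m where "m = max (norm v) (norm w)"
    have m: "m > 0" using False unfolding m_def by (auto simp: less_max_iff_disj)
    define v' w' where "v' = (1 / m) *\<^sub>R v" and "w' = (1 / m) *\<^sub>R w"
    have vw: "v = m *\<^sub>R v'" "w = m *\<^sub>R w'" using m by (auto simp: v'_def w'_def)
    have le: "norm v' \<le> 1" "norm w' \<le> 1" using m by (auto simp: v'_def w'_def m_def)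
    have ms: "m powr (s - 1) * m = m powr s" using m powr_mult_base[of m "s - 1"] by (simp add: mult.commute)
    have "norm (v - w) powr s = m powr s * norm (v' - w') powr s"
      using m unfolding vw by (simp add: scaleR_diff_right[symmetric] powr_mult)
    also have "\<dots> \<le> m powr s * (e + C * ((pw s v' - pw s w') \<bullet> (v' - w')))"
      using unit[OF le] by (intro mult_left_mono) auto
    also have "\<dots> = e * m powr s + C * ((m powr (s - 1) * m) * ((pw s v' - pw s w') \<bullet> (v' - w')))"
      unfolding ms by (simp add: algebra_simps)
    also have "(m powr (s - 1) * m) * ((pw s v' - pw s w') \<bullet> (v' - w')) = (pw s v - pw s w) \<bullet> (v - w)"
      using m unfolding vw by (simp add: pw_scaleR scaleR_diff_right[symmetric])
    also have "e * m powr s + C * ((pw s v - pw s w) \<bullet> (v - w)) \<le> e * (norm v powr s + norm w powr s) + C * ((pw s v - pw s w) \<bullet> (v - w))"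
      unfolding m_def using powr_max_le[of s v w] s e by (intro add_right_mono mult_left_mono) auto
    finally show ?thesis .
  qed simp
  with C show ?thesis by (rule that)
qed

lemma pw_measurable [measurable]: "V \<in> borel_measurable M \<Longrightarrow> (\<lambda>x. pw s (V x)) \<in> borel_measurable M"
  unfolding pw_def by measurable

lemma pw_Lp:
  assumes "V \<in> Lp s M" "s > 1"
  shows "(\<lambda>x. pw s (V x)) \<in> Lp (s / (s - 1)) M" using assms by (auto simp: Lp_def norm_pw powr_powr)

lemma Lp_norm_pw:
  assumes "s > 1"
  shows "Lp_norm (s / (s - 1)) M (\<lambda>x. pw s (V x)) = Lp_norm s M V powr (s - 1)"
  using assms by (simp add: Lp_norm_def norm_pw powr_powr)

text \<open>The integrated form of \<open>pw_difference_bound\<close>. The constants are chosen so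
  that each of its two terms contributes at most half of e powr (s / (s - 1)), uniformly on the ball
  of radius R.\<close>

lemma pw_uniformly_continuous:
  fixes M :: "'a measure"
  assumes s: "s > 1" and e: "e > 0"
  obtains \<eta> where "\<eta> > 0"
    "\<And>V W :: 'a \<Rightarrow> 'b::euclidean_space. V \<in> Lp s M \<Longrightarrow> W \<in> Lp s M \<Longrightarrow> Lp_norm s M V \<le> R \<Longrightarrow> Lp_norm s M W \<le> R \<Longrightarrow>
       Lp_norm s M (\<lambda>x. V x - W x) \<le> \<eta> \<Longrightarrow> Lp_norm (s / (s - 1)) M (\<lambda>x. pw s (V x) - pw s (W x)) \<le> e"
proof -
  let ?t = "s / (s - 1)"
  have t: "?t > 0" using s by simp
  \<comment> \<open>Writing |R| + 1 for R keeps the denominator positive; the factor 4 shares one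
    half among the two norms.\<close>
  define \<epsilon>' where "\<epsilon>' = e powr ?t / (4 * (\<bar>R\<bar> + 1) powr s)"
  have R: "(\<bar>R\<bar> + 1) powr s > 0" by simp
  have e': "\<epsilon>' > 0" using e R by (simp add: \<epsilon>'_def)
  obtain C where C: "C \<ge> 0" "\<And>v w :: 'b. norm (pw s v - pw s w) powr ?t \<le> \<epsilon>' * (norm v powr s + norm w powr s) + C * norm (v - w) powr s"
    using pw_difference_bound[OF s e', where 'b = 'b] by blast
  define \<eta> where "\<eta> = (e powr ?t / (2 * (C + 1))) powr (1 / s)"
  have eta: "\<eta> > 0" "\<eta> powr s = e powr ?t / (2 * (C + 1))" using e C s by (auto simp: \<eta>_def powr_powr)
  show ?thesis
  proof (rule that[OF eta(1)])
    fix V W :: "'a \<Rightarrow> 'b"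
    assume V: "V \<in> Lp s M" and W: "W \<in> Lp s M" and VR: "Lp_norm s M V \<le> R" and WR: "Lp_norm s M W \<le> R"
      and VW: "Lp_norm s M (\<lambda>x. V x - W x) \<le> \<eta>"
    have s0: "s > 0" using s by simp
    have R0: "R \<ge> 0" using VR Lp_norm_nonneg order_trans by blast
    note int = LpD(2)[OF V] LpD(2)[OF W] LpD(2)[OF Lp_diff[OF V W s0]]
    have "(LINT x|M. norm (pw s (V x) - pw s (W x)) powr ?t) \<le> (LINT x|M. \<epsilon>' * (norm (V x) powr s + norm (W x) powr s) + C * norm (V x - W x) powr s)"
      using LpD(2)[OF Lp_diff[OF pw_Lp[OF V s] pw_Lp[OF W s] t]] int C(2) by (intro integral_mono) auto
    also have "\<dots> = \<epsilon>' * (Lp_int s M V + Lp_int s M W) + C * Lp_int s M (\<lambda>x. V x - W x)" using int by simp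
    also have "\<dots> \<le> \<epsilon>' * ((\<bar>R\<bar> + 1) powr s + (\<bar>R\<bar> + 1) powr s) + C * \<eta> powr s"
    proof -
      have "Lp_int s M V \<le> R powr s" "Lp_int s M W \<le> R powr s" using VR WR R0 s0 by (simp_all add: Lp_norm_le_iff)
      moreover have "R powr s \<le> (\<bar>R\<bar> + 1) powr s" using R0 s0 by (intro powr_mono2) auto
      moreover have "Lp_int s M (\<lambda>x. V x - W x) \<le> \<eta> powr s" using VW eta s0 by (simp add: Lp_norm_le_iff)
      ultimately show ?thesis using e' C by (intro add_mono mult_left_mono) auto
    qed
    also have "\<dots> \<le> e powr ?t"
    proof -
      have "\<epsilon>' * ((\<bar>R\<bar> + 1) powr s + (\<bar>R\<bar> + 1) powr s) = e powr ?t / 2"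
        using R unfolding \<epsilon>'_def by (simp add: field_simps)
      moreover have "C * \<eta> powr s \<le> e powr ?t / 2"
      proof -
        have "C * \<eta> powr s = (C / (C + 1)) * (e powr ?t / 2)" unfolding eta(2) by simp
        also have "\<dots> \<le> 1 * (e powr ?t / 2)" using C by (intro mult_right_mono) auto
        finally show ?thesis by simp
      qed
      ultimately show ?thesis by simp
    qed
    finally show "Lp_norm ?t M (\<lambda>x. pw s (V x) - pw s (W x)) \<le> e" using t e by (subst Lp_norm_le_iff) auto
  qed
qed

lemma pw_monotone_Lp:
  assumes s: "s > 1" and V: "V \<in> Lp s M" and W: "W \<in> Lp s M"
  shows "integrable M (\<lambda>x. (pw s (V x) - pw s (W x)) \<bullet> (V x - W x))"
    and "(LINT x|M. (pw s (V x) - pw s (W x)) \<bullet> (V x - W x)) \<ge> 0"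
proof -
  have "s > 0" "s / (s - 1) > 0" using s by auto
  then show "integrable M (\<lambda>x. (pw s (V x) - pw s (W x)) \<bullet> (V x - W x))"
    using s V W by (intro Holder_inner(1)[where s = s] Lp_diff pw_Lp)
  show "(LINT x|M. (pw s (V x) - pw s (W x)) \<bullet> (V x - W x)) \<ge> 0"
    by (intro integral_nonneg_AE AE_I2 pw_monotone(1)[OF s])
qed

text \<open>The integrated form of \<open>pw_monotone_bound\<close>. A small monotone pairing forces
  a small distance, uniformly on norm balls; this is what yields the Cauchy property of
  gradients.\<close>

lemma pw_strongly_monotone:
  fixes M :: "'a measure"
  assumes s: "s > 1" and e: "e > 0"
  obtains \<eta> where "\<eta> > 0"
    "\<And>V W :: 'a \<Rightarrow> 'b::euclidean_space. V \<in> Lp s M \<Longrightarrow> W \<in> Lp s M \<Longrightarrow> Lp_norm s M V \<le> R \<Longrightarrow> Lp_norm s M W \<le> R \<Longrightarrow>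
       (LINT x|M. (pw s (V x) - pw s (W x)) \<bullet> (V x - W x)) \<le> \<eta> \<Longrightarrow> Lp_norm s M (\<lambda>x. V x - W x) \<le> e"
proof -
  have s0: "s > 0" using s by simp
  define \<epsilon>' where "\<epsilon>' = e powr s / (4 * (\<bar>R\<bar> + 1) powr s)"
  have R: "(\<bar>R\<bar> + 1) powr s > 0" by simp
  have e': "\<epsilon>' > 0" using e R by (simp add: \<epsilon>'_def)
  obtain C where C: "C \<ge> 0" "\<And>v w :: 'b. norm (v - w) powr s \<le> \<epsilon>' * (norm v powr s + norm w powr s) + C * ((pw s v - pw s w) \<bullet> (v - w))"
    using pw_monotone_bound[OF s e', where 'b = 'b] by blast
  define \<eta> where "\<eta> = e powr s / (2 * (C + 1))"
  have eta: "\<eta> > 0" using e C by (auto simp: \<eta>_def)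
  show ?thesis
  proof (rule that[OF eta])
    fix V W :: "'a \<Rightarrow> 'b"
    assume V: "V \<in> Lp s M" and W: "W \<in> Lp s M" and VR: "Lp_norm s M V \<le> R" and WR: "Lp_norm s M W \<le> R"
      and VW: "(LINT x|M. (pw s (V x) - pw s (W x)) \<bullet> (V x - W x)) \<le> \<eta>"
    have R0: "R \<ge> 0" using VR Lp_norm_nonneg order_trans by blast
    note int = LpD(2)[OF V] LpD(2)[OF W] pw_monotone_Lp(1)[OF s V W]
    have "Lp_int s M (\<lambda>x. V x - W x) \<le> (LINT x|M. \<epsilon>' * (norm (V x) powr s + norm (W x) powr s) + C * ((pw s (V x) - pw s (W x)) \<bullet> (V x - W x)))"
      using LpD(2)[OF Lp_diff[OF V W s0]] int C(2) by (intro integral_mono) auto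
    also have "\<dots> = \<epsilon>' * (Lp_int s M V + Lp_int s M W) + C * (LINT x|M. (pw s (V x) - pw s (W x)) \<bullet> (V x - W x))"
      using int by simp
    also have "\<dots> \<le> \<epsilon>' * ((\<bar>R\<bar> + 1) powr s + (\<bar>R\<bar> + 1) powr s) + C * \<eta>"
    proof -
      have "Lp_int s M V \<le> R powr s" "Lp_int s M W \<le> R powr s" using VR WR R0 s0 by (simp_all add: Lp_norm_le_iff)
      moreover have "R powr s \<le> (\<bar>R\<bar> + 1) powr s" using R0 s0 by (intro powr_mono2) auto
      ultimately show ?thesis using e' C VW by (intro add_mono mult_left_mono) auto
    qed
    also have "\<dots> \<le> e powr s"
    proof -
      have "\<epsilon>' * ((\<bar>R\<bar> + 1) powr s + (\<bar>R\<bar> + 1) powr s) = e powr s / 2"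
        using R unfolding \<epsilon>'_def by (simp add: field_simps)
      moreover have "C * \<eta> \<le> e powr s / 2"
      proof -
        have "C * \<eta> = (C / (C + 1)) * (e powr s / 2)" unfolding \<eta>_def by simp
        also have "\<dots> \<le> 1 * (e powr s / 2)" using C by (intro mult_right_mono) auto
        finally show ?thesis by simp
      qed
      ultimately show ?thesis by simp
    qed
    finally show "Lp_norm s M (\<lambda>x. V x - W x) \<le> e" using s0 e by (subst Lp_norm_le_iff) auto
  qed
qed

section \<open>Sobolev and Rellich by dyadic averages\<close>

text \<open>Hoelder's inequality against the indicator of \<open>A\<close>. Stated in ennreal it
  holds also when the right side is infinite, so the later estimates carry no integrability
  conditions on p-th powers.\<close>

lemma power_mean:
  fixes f :: "'a \<Rightarrow> real"
  assumes p: "p > 1" and A[measurable]: "A \<in> sets M" and c: "emeasure M A = ennreal c" "c > 0"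
    and f: "integrable M (\<lambda>x. indicator A x * f x)"
  shows "ennreal (\<bar>LINT x|M. indicator A x * f x\<bar> powr p)
    \<le> ennreal (c powr (p - 1)) * (\<integral>\<^sup>+x. indicator A x * ennreal (\<bar>f x\<bar> powr p) \<partial>M)"
proof -
  let ?V = "\<lambda>x. indicator A x * f x" and ?t = "p / (p - 1)"
  have t: "?t > 0" and p0: "p > 0" using p by auto
  have [measurable]: "?V \<in> borel_measurable M" using f by auto
  have nn: "(\<integral>\<^sup>+x. indicator A x * ennreal (\<bar>f x\<bar> powr p) \<partial>M) = (\<integral>\<^sup>+x. ennreal (norm (?V x) powr p) \<partial>M)"
    by (intro nn_integral_cong) (auto split: split_indicator)
  show ?thesis
  proof (cases "(\<integral>\<^sup>+x. ennreal (norm (?V x) powr p) \<partial>M) < \<infinity>")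
    case False
    then have "(\<integral>\<^sup>+x. ennreal (norm (?V x) powr p) \<partial>M) = \<infinity>" by (simp add: less_top[symmetric])
    then show ?thesis unfolding nn using c by (simp add: ennreal_mult_top)
  next
    case True
    then have int: "integrable M (\<lambda>x. norm (?V x) powr p)" by (intro integrableI_nonneg) auto
    then have V: "?V \<in> Lp p M" by (simp add: Lp_def)
    have ind: "(\<lambda>x. norm (indicat_real A x) powr ?t) = indicat_real A" using t by (auto split: split_indicator)
    have W: "indicat_real A \<in> Lp ?t M"
      unfolding Lp_def mem_Collect_eq ind using c by (auto intro!: integrable_real_indicator)
    have mA: "measure M A = c" using c by (simp add: measure_def)
    have "\<bar>LINT x|M. ?V x\<bar> \<le> (LINT x|M. \<bar>?V x\<bar>)" by (rule integral_abs_bound)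
    also have "\<dots> = (LINT x|M. norm (?V x) * norm (indicat_real A x))"
      by (intro Bochner_Integration.integral_cong) (auto split: split_indicator)
    also have "\<dots> \<le> Lp_norm p M ?V * Lp_norm ?t M (indicat_real A)" by (rule Holder(2)[OF V W p])
    also have "Lp_norm ?t M (indicat_real A) = c powr (1 - 1 / p)"
      unfolding Lp_norm_def ind using p by (simp add: mA diff_divide_distrib)
    finally have "\<bar>LINT x|M. ?V x\<bar> powr p \<le> (Lp_norm p M ?V * c powr (1 - 1 / p)) powr p"
      using p0 by (intro powr_mono2) auto
    also have "\<dots> = Lp_int p M (\<lambda>x. ?V x) * c powr ((1 - 1 / p) * p)"
      using p0 by (simp add: powr_mult powr_powr Lp_norm_powr)
    also have "(1 - 1 / p) * p = p - 1" using p by (simp add: algebra_simps)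
    finally have "ennreal (\<bar>LINT x|M. ?V x\<bar> powr p) \<le> ennreal (c powr (p - 1) * Lp_int p M (\<lambda>x. ?V x))"
      by (intro ennreal_leI) (simp add: mult.commute)
    also have "\<dots> = ennreal (c powr (p - 1)) * (\<integral>\<^sup>+x. ennreal (norm (?V x) powr p) \<partial>M)"
      by (subst nn_integral_eq_integral[OF int]) (auto simp: ennreal_mult integral_nonneg_AE)
    finally show ?thesis unfolding nn .
  qed
qed

section \<open>Translations, dyadic cubes and averages\<close>

lemma nn_integral_translate:
  fixes f :: "'a::euclidean_space \<Rightarrow> ennreal"
  assumes "f \<in> borel_measurable borel"
  shows "(\<integral>\<^sup>+x. f (z + x) \<partial>lborel) = (\<integral>\<^sup>+x. f x \<partial>lborel)"
proof -
  have "(\<integral>\<^sup>+x. f x \<partial>lborel) = (\<integral>\<^sup>+x. f x \<partial>distr lborel borel ((+) z))" by (simp add: lborel_distr_plus)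
  also have "\<dots> = (\<integral>\<^sup>+x. f (z + x) \<partial>lborel)" using assms by (subst nn_integral_distr) auto
  finally show ?thesis by simp
qed

abbreviation mass :: "real \<Rightarrow> ('a::euclidean_space \<Rightarrow> real) \<Rightarrow> ennreal" where
  "mass p u \<equiv> \<integral>\<^sup>+x. ennreal (\<bar>u x\<bar> powr p) \<partial>lborel"

text \<open>The Dirichlet p-integral over the whole space, extended-real valued. The functional of
  the variational problem is \<open>energy_fun\<close>.\<close>

definition energy :: "real \<Rightarrow> ('a::euclidean_space \<Rightarrow> real) \<Rightarrow> ennreal" where
  "energy p u = (\<integral>\<^sup>+x. ennreal (norm (grad u x) powr p) \<partial>lborel)"

text \<open>u(x + z) - u(x) is the integral over [0, 1] of the inner product of grad u(x + t z) with
  z; the power mean on a set of measure 1 and Cauchy-Schwarz give the bound.\<close>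

lemma translation_pointwise:
  fixes u :: "'a::euclidean_space \<Rightarrow> real"
  assumes u: "u \<in> test_functions U" and p: "p > 1"
  shows "ennreal (\<bar>u (z + x) - u x\<bar> powr p)
    \<le> ennreal (norm z powr p) * (\<integral>\<^sup>+t. indicator {0..1} t * ennreal (norm (grad u (t *\<^sub>R z + x)) powr p) \<partial>lborel)"
proof -
  note [measurable] = test_borel_measurable[OF u]
  let ?f = "\<lambda>t. grad u (t *\<^sub>R z + x) \<bullet> z"
  have cont: "continuous_on UNIV ?f"
    by (intro continuous_intros continuous_on_compose2[OF grad_continuous[OF u, of UNIV]]) auto
  have der: "((\<lambda>t. u (t *\<^sub>R z + x)) has_real_derivative ?f t) (at t)" for t
  proof -
    have "((\<lambda>t. t *\<^sub>R z + x) has_derivative (\<lambda>h. h *\<^sub>R z)) (at t)" by (auto intro!: derivative_eq_intros)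
    from has_derivative_compose[OF this test_has_derivative[OF u]]
    show ?thesis by (simp add: has_field_derivative_def mult_commute_abs)
  qed
  have "u (z + x) - u x = (LINT t|lborel. ?f t * indicator {0..1} t)"
    using integral_FTC_Icc_real[of 0 1 "\<lambda>t. u (t *\<^sub>R z + x)" ?f] der cont
    by (simp add: continuous_on_eq_continuous_at)
  then have eq: "u (z + x) - u x = (LINT t|lborel. indicator {0..1} t * ?f t)" by (simp add: mult.commute)
  have "ennreal (\<bar>u (z + x) - u x\<bar> powr p) \<le> ennreal (1 powr (p - 1)) * (\<integral>\<^sup>+t. indicator {0..1} t * ennreal (\<bar>?f t\<bar> powr p) \<partial>lborel)"
    unfolding eq
  proof (rule power_mean[OF p])
    show "integrable lborel (\<lambda>t. indicator {0..1} t * ?f t)"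
      using borel_integrable_compact[of "{0..1}" ?f] continuous_on_subset[OF cont] by auto
  qed auto
  also have "\<dots> \<le> (\<integral>\<^sup>+t. ennreal (norm z powr p) * (indicator {0..1} t * ennreal (norm (grad u (t *\<^sub>R z + x)) powr p)) \<partial>lborel)"
  proof -
    have "ennreal (\<bar>?f t\<bar> powr p) \<le> ennreal (norm z powr p) * ennreal (norm (grad u (t *\<^sub>R z + x)) powr p)" for t
      unfolding ennreal_mult[symmetric, OF powr_ge_zero powr_ge_zero] powr_mult[symmetric]
      using p Cauchy_Schwarz_ineq2[of "grad u (t *\<^sub>R z + x)" z]
      by (intro ennreal_leI powr_mono2) (auto simp: mult.commute)
    then show ?thesis by (auto intro!: nn_integral_mono split: split_indicator)
  qed
  also have "\<dots> = ennreal (norm z powr p) * (\<integral>\<^sup>+t. indicator {0..1} t * ennreal (norm (grad u (t *\<^sub>R z + x)) powr p) \<partial>lborel)"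
    by (rule nn_integral_cmult) measurable
  finally show ?thesis .
qed

text \<open>By Fubini the integral in x is taken first, and for each t the shift by t z leaves the
  Dirichlet integral unchanged.\<close>

lemma translation_estimate:
  fixes u :: "'a::euclidean_space \<Rightarrow> real"
  assumes u: "u \<in> test_functions U" and p: "p > 1"
  shows "mass p (\<lambda>x. u (z + x) - u x) \<le> ennreal (norm z powr p) * energy p u"
proof -
  note [measurable] = test_borel_measurable[OF u]
  have "mass p (\<lambda>x. u (z + x) - u x)
     \<le> (\<integral>\<^sup>+x. ennreal (norm z powr p) * (\<integral>\<^sup>+t. indicator {0..1} t * ennreal (norm (grad u (t *\<^sub>R z + x)) powr p) \<partial>lborel) \<partial>lborel)"
    by (intro nn_integral_mono translation_pointwise[OF u p])
  also have "\<dots> = ennreal (norm z powr p) * (\<integral>\<^sup>+x. (\<integral>\<^sup>+t. indicator {0..1} t * ennreal (norm (grad u (t *\<^sub>R z + x)) powr p) \<partial>lborel) \<partial>lborel)"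
    by (rule nn_integral_cmult) measurable
  also have "(\<integral>\<^sup>+x. (\<integral>\<^sup>+t. indicator {0..1} t * ennreal (norm (grad u (t *\<^sub>R z + x)) powr p) \<partial>lborel) \<partial>lborel)
    = (\<integral>\<^sup>+t. (\<integral>\<^sup>+x. indicator {0..1} t * ennreal (norm (grad u (t *\<^sub>R z + x)) powr p) \<partial>lborel) \<partial>lborel)"
    by (rule lborel_pair.Fubini'[symmetric]) measurable
  also have "\<dots> = (\<integral>\<^sup>+t. indicator {0..1::real} t * energy p u \<partial>lborel)"
  proof (intro nn_integral_cong)
    fix t :: real
    have "(\<integral>\<^sup>+x. indicator {0..1} t * ennreal (norm (grad u (t *\<^sub>R z + x)) powr p) \<partial>lborel)
      = indicator {0..1} t * (\<integral>\<^sup>+x. ennreal (norm (grad u (t *\<^sub>R z + x)) powr p) \<partial>lborel)"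
      by (rule nn_integral_cmult) measurable
    also have "(\<integral>\<^sup>+x. ennreal (norm (grad u (t *\<^sub>R z + x)) powr p) \<partial>lborel) = energy p u"
      unfolding energy_def by (rule nn_integral_translate[of "\<lambda>x. ennreal (norm (grad u x) powr p)"]) measurable
    finally show "(\<integral>\<^sup>+x. indicator {0..1} t * ennreal (norm (grad u (t *\<^sub>R z + x)) powr p) \<partial>lborel) = indicator {0..1} t * energy p u" .
  qed
  also have "\<dots> = energy p u" by (simp add: nn_integral_multc)
  finally show ?thesis .
qed

lemma energy_finite:
  assumes u: "u \<in> test_functions U" and p: "p > 0"
  shows "energy p u = ennreal (Lp_int p lborel (grad u))" "integrable lborel (\<lambda>x. norm (grad u x) powr p)"
proof -
  show int: "integrable lborel (\<lambda>x. norm (grad u x) powr p)"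
  proof (rule integrable_compact_support)
    show "continuous_on (closure {x. u x \<noteq> 0}) (\<lambda>x. norm (grad u x) powr p)"
      using p by (intro continuous_on_powr' continuous_on_norm grad_continuous[OF u] continuous_on_const) auto
    show "norm (grad u x) powr p = 0" if "x \<notin> closure {x. u x \<noteq> 0}" for x using grad_zero[OF u that] by simp
  qed (rule test_functionsD[OF u])
  show "energy p u = ennreal (Lp_int p lborel (grad u))"
    unfolding energy_def by (rule nn_integral_eq_integral[OF int]) simp
qed

text \<open>The half-open dyadic cube of side 2^(-k) around \<open>x\<close>, encoded as a class of
  points with equal floors, so that partition and nesting become statements about floors.\<close>

definition cube :: "nat \<Rightarrow> 'a::euclidean_space \<Rightarrow> 'a set" where
  "cube k x = {y. \<forall>i\<in>Basis. \<lfloor>2 ^ k * (y \<bullet> i)\<rfloor> = \<lfloor>2 ^ k * (x \<bullet> i)\<rfloor>}"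

text \<open>The prefactor is the reciprocal of the volume of the cube.\<close>

definition average :: "nat \<Rightarrow> ('a::euclidean_space \<Rightarrow> real) \<Rightarrow> 'a \<Rightarrow> real" where
  "average k u x = (2 ^ k) ^ DIM('a) * (LINT y|lborel. indicator (cube k x) y * u y)"

lemma cube_refl [simp]: "x \<in> cube k x" by (simp add: cube_def)

lemma cube_eq: "y \<in> cube k x \<Longrightarrow> cube k y = cube k x" by (auto simp: cube_def)

lemma cube_Suc: "cube (Suc k) x \<subseteq> cube k x"
proof
  fix y assume y: "y \<in> cube (Suc k) x"
  have half: "\<lfloor>2 ^ k * t\<rfloor> = \<lfloor>2 ^ Suc k * t\<rfloor> div 2" for t :: real
    using floor_divide_real_eq_div[of 2 "2 ^ Suc k * t"] by simp
  show "y \<in> cube k x" using y unfolding cube_def half by simp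
qed

lemma cube_measurable [measurable]: "Measurable.pred (borel \<Otimes>\<^sub>M borel) (\<lambda>z. snd z \<in> cube k (fst z))"
  unfolding cube_def mem_Collect_eq by measurable

lemma cube_borel [measurable]: "cube k x \<in> sets borel"
proof -
  have "{y \<in> space borel. \<forall>i\<in>Basis. \<lfloor>2 ^ k * (y \<bullet> i)\<rfloor> = \<lfloor>2 ^ k * (x \<bullet> i)\<rfloor>} \<in> sets borel" by measurable
  then show ?thesis by (simp add: cube_def)
qed

text \<open>The open and the closed box have the same volume, which is therefore the volume of the
  cube between them.\<close>

lemma cube_between:
  fixes x :: "'a::euclidean_space" and k :: nat
  defines "l \<equiv> (\<Sum>i\<in>Basis. (of_int \<lfloor>2 ^ k * (x \<bullet> i)\<rfloor> / 2 ^ k) *\<^sub>R i)"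
  defines "h \<equiv> (\<Sum>i\<in>Basis. (1 / 2 ^ k) *\<^sub>R i)"
  shows "box l (l + h) \<subseteq> cube k x" "cube k x \<subseteq> cbox l (l + h)"
proof -
  have li: "l \<bullet> i = of_int \<lfloor>2 ^ k * (x \<bullet> i)\<rfloor> / 2 ^ k" "(l + h) \<bullet> i = (of_int \<lfloor>2 ^ k * (x \<bullet> i)\<rfloor> + 1) / 2 ^ k" if "i \<in> Basis" for i
    using that by (simp_all add: l_def h_def inner_add_left add_divide_distrib)
  show "box l (l + h) \<subseteq> cube k x"
  proof
    fix y assume "y \<in> box l (l + h)"
    then have "of_int \<lfloor>2 ^ k * (x \<bullet> i)\<rfloor> \<le> 2 ^ k * (y \<bullet> i)" "2 ^ k * (y \<bullet> i) < of_int \<lfloor>2 ^ k * (x \<bullet> i)\<rfloor> + 1" if "i \<in> Basis" for i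
      using that li[OF that] by (auto simp: mem_box divide_less_eq less_divide_eq mult.commute)
    then show "y \<in> cube k x" unfolding cube_def by (auto intro!: floor_unique)
  qed
  show "cube k x \<subseteq> cbox l (l + h)"
  proof
    fix y assume y: "y \<in> cube k x"
    have "l \<bullet> i \<le> y \<bullet> i \<and> y \<bullet> i \<le> (l + h) \<bullet> i" if "i \<in> Basis" for i
    proof -
      have "\<lfloor>2 ^ k * (y \<bullet> i)\<rfloor> = \<lfloor>2 ^ k * (x \<bullet> i)\<rfloor>" using y that by (auto simp: cube_def)
      then have "of_int \<lfloor>2 ^ k * (x \<bullet> i)\<rfloor> \<le> 2 ^ k * (y \<bullet> i)" "2 ^ k * (y \<bullet> i) < of_int \<lfloor>2 ^ k * (x \<bullet> i)\<rfloor> + 1"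
        by linarith+
      then show ?thesis using li[OF that] by (simp add: divide_le_eq le_divide_eq mult.commute less_imp_le)
    qed
    then show "y \<in> cbox l (l + h)" by (simp add: mem_box)
  qed
qed

lemma emeasure_cube: "emeasure lborel (cube k (x :: 'a::euclidean_space)) = ennreal (1 / (2 ^ k) ^ DIM('a))"
proof -
  define l h :: 'a where "l = (\<Sum>i\<in>Basis. (of_int \<lfloor>2 ^ k * (x \<bullet> i)\<rfloor> / 2 ^ k) *\<^sub>R i)"
    and "h = (\<Sum>i\<in>Basis. (1 / 2 ^ k) *\<^sub>R i)"
  note sub = cube_between[where x = x and k = k, folded l_def h_def]
  have li: "l \<bullet> i \<le> (l + h) \<bullet> i" "((l + h) - l) \<bullet> i = 1 / 2 ^ k" if "i \<in> Basis" for i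
    using that by (simp_all add: h_def inner_add_left)
  have "emeasure lborel (box l (l + h)) = ennreal (1 / (2 ^ k) ^ DIM('a))"
    using li by (subst emeasure_lborel_box) (auto simp: prod_constant power_one_over)
  moreover have "emeasure lborel (cbox l (l + h)) = ennreal (1 / (2 ^ k) ^ DIM('a))"
    using li by (subst emeasure_lborel_cbox) (auto simp: prod_constant power_one_over)
  moreover have "emeasure lborel (box l (l + h)) \<le> emeasure lborel (cube k x)"
    "emeasure lborel (cube k x) \<le> emeasure lborel (cbox l (l + h))" using sub by (auto intro!: emeasure_mono)
  ultimately show ?thesis by (metis antisym)
qed

lemma cube_diff_norm:
  fixes x :: "'a::euclidean_space"
  assumes "y \<in> cube k x"
  shows "y - x \<in> cbox (- (\<Sum>i\<in>Basis. (1 / 2 ^ k) *\<^sub>R i)) (\<Sum>i\<in>Basis. (1 / 2 ^ k) *\<^sub>R i)"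
proof -
  have "\<bar>(y - x) \<bullet> i\<bar> \<le> 1 / 2 ^ k" if "i \<in> Basis" for i
  proof -
    have "\<lfloor>2 ^ k * (y \<bullet> i)\<rfloor> = \<lfloor>2 ^ k * (x \<bullet> i)\<rfloor>" using assms that by (auto simp: cube_def)
    then have "\<bar>2 ^ k * (y \<bullet> i) - 2 ^ k * (x \<bullet> i)\<bar> \<le> 1" by linarith
    then have "2 ^ k * \<bar>(y - x) \<bullet> i\<bar> \<le> 1" by (simp add: inner_diff_left right_diff_distrib[symmetric] abs_mult)
    then show ?thesis by (simp add: le_divide_eq mult.commute)
  qed
  then show ?thesis by (force simp: mem_box abs_le_iff)
qed

lemma integrable_cube:
  assumes "u \<in> test_functions U"
  shows "integrable lborel (\<lambda>y. indicator (cube k x) y * u y)" "integrable lborel u"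
proof -
  show int: "integrable lborel u"
    using integrable_compact_support[OF test_continuous[OF assms] test_functionsD(2)[OF assms] test_zero[OF assms]] .
  show "integrable lborel (\<lambda>y. indicator (cube k x) y * u y)"
    using integrable_mult_indicator[OF _ int, of "cube k x"] by simp
qed

lemma average_diff:
  fixes u :: "'a::euclidean_space \<Rightarrow> real"
  assumes u: "u \<in> test_functions U"
  shows "average k u x - c = (2 ^ k) ^ DIM('a) * (LINT y|lborel. indicator (cube k x) y * (u y - c))"
    and "integrable lborel (\<lambda>y. indicator (cube k x) y * (u y - c))"
proof -
  have m: "measure lborel (cube k x) = 1 / (2 ^ k) ^ DIM('a)" by (simp add: measure_def emeasure_cube)
  have int: "integrable lborel (\<lambda>y. indicator (cube k x) y * c)"
    by (intro integrable_mult_left integrable_real_indicator) (auto simp: emeasure_cube)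
  show "average k u x - c = (2 ^ k) ^ DIM('a) * (LINT y|lborel. indicator (cube k x) y * (u y - c))"
    using integrable_cube[OF u] int unfolding average_def right_diff_distrib
    by (subst Bochner_Integration.integral_diff) (auto simp: m right_diff_distrib)
  show "integrable lborel (\<lambda>y. indicator (cube k x) y * (u y - c))"
    unfolding right_diff_distrib using integrable_cube(1)[OF u] int by (rule Bochner_Integration.integrable_diff)
qed

text \<open>The constant is arbitrary because three choices occur: c = u(x), c the average over the
  coarser cube, and c = 0.\<close>

lemma average_jensen:
  fixes u :: "'a::euclidean_space \<Rightarrow> real"
  assumes u: "u \<in> test_functions U" and p: "p > 1"
  shows "ennreal (\<bar>average k u x - c\<bar> powr p)
    \<le> ennreal ((2 ^ k) ^ DIM('a)) * (\<integral>\<^sup>+y. indicator (cube k x) y * ennreal (\<bar>u y - c\<bar> powr p) \<partial>lborel)"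
proof -
  let ?H = "(2 ^ k) ^ DIM('a) :: real"
  have H: "?H > 0" by simp
  have "ennreal (\<bar>average k u x - c\<bar> powr p) = ennreal (?H powr p) * ennreal (\<bar>LINT y|lborel. indicator (cube k x) y * (u y - c)\<bar> powr p)"
    unfolding average_diff(1)[OF u] abs_mult powr_mult by (simp add: ennreal_mult)
  also have "\<dots> \<le> ennreal (?H powr p) * (ennreal ((1 / ?H) powr (p - 1)) * (\<integral>\<^sup>+y. indicator (cube k x) y * ennreal (\<bar>u y - c\<bar> powr p) \<partial>lborel))"
    using H by (intro mult_left_mono power_mean[OF p _ emeasure_cube] average_diff(2)[OF u]) auto
  also have "\<dots> = ennreal (?H powr p * (1 / ?H) powr (p - 1)) * (\<integral>\<^sup>+y. indicator (cube k x) y * ennreal (\<bar>u y - c\<bar> powr p) \<partial>lborel)"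
    by (simp add: ennreal_mult mult.assoc)
  also have "?H powr p * (1 / ?H) powr (p - 1) = ?H" by (simp add: powr_divide powr_diff)
  finally show ?thesis .
qed

lemma average_measurable [measurable]:
  assumes "u \<in> test_functions U"
  shows "average k u \<in> borel_measurable borel"
proof -
  note [measurable] = test_borel_measurable[OF assms]
  have "(\<lambda>z. if snd z \<in> cube k (fst z) then u (snd z) else 0) \<in> borel_measurable (borel \<Otimes>\<^sub>M borel)" by measurable
  also have "(\<lambda>z. if snd z \<in> cube k (fst z) then u (snd z) else 0) = (\<lambda>(x, y). indicator (cube k x) y * u y)"
    by (auto simp: fun_eq_iff)
  also have "borel_measurable (borel \<Otimes>\<^sub>M borel) = borel_measurable (borel \<Otimes>\<^sub>M (lborel :: 'a measure))"
    by (intro measurable_cong_sets sets_pair_measure_cong) auto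
  finally show ?thesis unfolding average_def[abs_def]
    by (intro borel_measurable_times borel_measurable_const lborel.borel_measurable_lebesgue_integral)
qed

text \<open>For y in the cube of x, the difference y - x lies in the fixed box Q of side 2 / 2^k.
  Replacing the cube by x + Q makes the inner domain independent of x, so Fubini reduces the claim
  to translations by z in Q, of norm at most N / 2^k. The volumes leave the factor 2^N.\<close>

lemma average_estimate:
  fixes u :: "'a::euclidean_space \<Rightarrow> real"
  assumes u: "u \<in> test_functions U" and p: "p > 1"
  shows "mass p (\<lambda>x. u x - average k u x)
    \<le> ennreal (2 ^ DIM('a) * (real DIM('a) / 2 ^ k) powr p) * energy p u"
proof -
  note [measurable] = test_borel_measurable[OF u]
  define H where "H = ((2 ^ k) ^ DIM('a) :: real)"
  define o1 :: 'a where "o1 = (\<Sum>i\<in>Basis. (1 / 2 ^ k) *\<^sub>R i)"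
  define Q where "Q = cbox (- o1) o1"
  have H: "H > 0" by (simp add: H_def)
  have [measurable]: "Q \<in> sets borel" by (simp add: Q_def)
  have pt: "ennreal (\<bar>u x - average k u x\<bar> powr p)
      \<le> ennreal H * (\<integral>\<^sup>+z. indicator Q z * ennreal (\<bar>u (z + x) - u x\<bar> powr p) \<partial>lborel)" for x
  proof -
    have "ennreal (\<bar>u x - average k u x\<bar> powr p)
        \<le> ennreal H * (\<integral>\<^sup>+y. indicator (cube k x) y * ennreal (\<bar>u y - u x\<bar> powr p) \<partial>lborel)"
      using average_jensen[OF u p, of k x "u x"] by (simp add: abs_minus_commute H_def)
    also have "\<dots> \<le> ennreal H * (\<integral>\<^sup>+y. indicator Q (- x + y) * ennreal (\<bar>u (- x + y + x) - u x\<bar> powr p) \<partial>lborel)"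
      using cube_diff_norm[of _ k x]
      by (intro mult_left_mono nn_integral_mono) (auto simp: Q_def o1_def split: split_indicator)
    also have "(\<integral>\<^sup>+y. indicator Q (- x + y) * ennreal (\<bar>u (- x + y + x) - u x\<bar> powr p) \<partial>lborel)
        = (\<integral>\<^sup>+z. indicator Q z * ennreal (\<bar>u (z + x) - u x\<bar> powr p) \<partial>lborel)"
      by (rule nn_integral_translate[of "\<lambda>z. indicator Q z * ennreal (\<bar>u (z + x) - u x\<bar> powr p)" "- x"]) measurable
    finally show ?thesis .
  qed
  have Qn: "norm z \<le> real DIM('a) / 2 ^ k" if "z \<in> Q" for z
  proof -
    have "norm z \<le> (\<Sum>i\<in>Basis. \<bar>z \<bullet> i\<bar>)" by (rule norm_le_l1)
    also have "\<dots> \<le> (\<Sum>i\<in>(Basis::'a set). 1 / 2 ^ k)"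
      using that by (intro sum_mono) (auto simp: Q_def o1_def mem_box abs_le_iff minus_le_iff)
    finally show ?thesis by simp
  qed
  have "mass p (\<lambda>x. u x - average k u x)
      \<le> (\<integral>\<^sup>+x. ennreal H * (\<integral>\<^sup>+z. indicator Q z * ennreal (\<bar>u (z + x) - u x\<bar> powr p) \<partial>lborel) \<partial>lborel)"
    by (intro nn_integral_mono pt)
  also have "\<dots> = ennreal H * (\<integral>\<^sup>+x. (\<integral>\<^sup>+z. indicator Q z * ennreal (\<bar>u (z + x) - u x\<bar> powr p) \<partial>lborel) \<partial>lborel)"
    by (rule nn_integral_cmult) measurable
  also have "\<dots> \<le> ennreal H * (ennreal ((2 / 2 ^ k) ^ DIM('a)) * (ennreal ((real DIM('a) / 2 ^ k) powr p) * energy p u))"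
  proof (rule mult_left_mono)
    have "(\<integral>\<^sup>+x. (\<integral>\<^sup>+z. indicator Q z * ennreal (\<bar>u (z + x) - u x\<bar> powr p) \<partial>lborel) \<partial>lborel)
       = (\<integral>\<^sup>+z. (\<integral>\<^sup>+x. indicator Q z * ennreal (\<bar>u (z + x) - u x\<bar> powr p) \<partial>lborel) \<partial>lborel)"
      by (rule lborel_pair.Fubini'[symmetric]) measurable
    also have "\<dots> = (\<integral>\<^sup>+z. indicator Q z * mass p (\<lambda>x. u (z + x) - u x) \<partial>lborel)"
      by (intro nn_integral_cong nn_integral_cmult) measurable
    also have "\<dots> \<le> (\<integral>\<^sup>+z. indicator Q z * (ennreal ((real DIM('a) / 2 ^ k) powr p) * energy p u) \<partial>lborel)"
    proof (intro nn_integral_mono)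
      fix z :: 'a
      show "indicator Q z * mass p (\<lambda>x. u (z + x) - u x) \<le> indicator Q z * (ennreal ((real DIM('a) / 2 ^ k) powr p) * energy p u)"
      proof (cases "z \<in> Q")
        case True
        have "mass p (\<lambda>x. u (z + x) - u x) \<le> ennreal (norm z powr p) * energy p u"
          by (rule translation_estimate[OF u p])
        also have "\<dots> \<le> ennreal ((real DIM('a) / 2 ^ k) powr p) * energy p u"
          using Qn[OF True] p by (intro mult_right_mono ennreal_leI powr_mono2) auto
        finally show ?thesis using True by simp
      qed simp
    qed
    also have "\<dots> = emeasure lborel Q * (ennreal ((real DIM('a) / 2 ^ k) powr p) * energy p u)"
      by (subst nn_integral_multc) auto
    also have "emeasure lborel Q = ennreal ((2 / 2 ^ k) ^ DIM('a))"
    proof -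
      have o1: "o1 \<bullet> i = 1 / 2 ^ k" if "i \<in> Basis" for i using that by (simp add: o1_def)
      have "emeasure lborel Q = ennreal (\<Prod>i\<in>Basis. (o1 - - o1) \<bullet> i)"
        unfolding Q_def using o1 by (intro emeasure_lborel_cbox) (auto intro: order_trans[of _ 0])
      also have "(\<Prod>i\<in>Basis. (o1 - - o1) \<bullet> i) = (\<Prod>i\<in>(Basis::'a set). 2 / 2 ^ k)"
        using o1 by (intro prod.cong) (auto simp: inner_add_left)
      finally show ?thesis by simp
    qed
    finally show "(\<integral>\<^sup>+x. (\<integral>\<^sup>+z. indicator Q z * ennreal (\<bar>u (z + x) - u x\<bar> powr p) \<partial>lborel) \<partial>lborel)
        \<le> ennreal ((2 / 2 ^ k) ^ DIM('a)) * (ennreal ((real DIM('a) / 2 ^ k) powr p) * energy p u)" .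
  qed simp
  also have "ennreal H * (ennreal ((2 / 2 ^ k) ^ DIM('a)) * (ennreal ((real DIM('a) / 2 ^ k) powr p) * energy p u))
    = ennreal (H * (2 / 2 ^ k) ^ DIM('a) * (real DIM('a) / 2 ^ k) powr p) * energy p u"
    using H by (simp add: ennreal_mult mult.assoc)
  also have "H * (2 / 2 ^ k) ^ DIM('a) = 2 ^ DIM('a)" unfolding H_def power_mult_distrib[symmetric] by simp
  finally show ?thesis .
qed

text \<open>The coarse average is constant on the fine cube, so Jensen with that constant bounds the
  increment by the total error of the coarse averages, at the price of the inverse volume of the
  fine cube.\<close>

lemma average_Suc_estimate:
  fixes u :: "'a::euclidean_space \<Rightarrow> real"
  assumes u: "u \<in> test_functions U" and p: "p > 1"
  shows "ennreal (\<bar>average (Suc k) u x - average k u x\<bar> powr p)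
    \<le> ennreal ((2 ^ Suc k) ^ DIM('a) * (2 ^ DIM('a) * (real DIM('a) / 2 ^ k) powr p)) * energy p u"
proof -
  note [measurable] = test_borel_measurable[OF u]
  have "ennreal (\<bar>average (Suc k) u x - average k u x\<bar> powr p)
    \<le> ennreal ((2 ^ Suc k) ^ DIM('a)) * (\<integral>\<^sup>+y. indicator (cube (Suc k) x) y * ennreal (\<bar>u y - average k u x\<bar> powr p) \<partial>lborel)"
    by (rule average_jensen[OF u p])
  also have "\<dots> \<le> ennreal ((2 ^ Suc k) ^ DIM('a)) * (\<integral>\<^sup>+y. ennreal (\<bar>u y - average k u y\<bar> powr p) \<partial>lborel)"
  proof (intro mult_left_mono nn_integral_mono)
    fix y
    show "indicator (cube (Suc k) x) y * ennreal (\<bar>u y - average k u x\<bar> powr p) \<le> ennreal (\<bar>u y - average k u y\<bar> powr p)"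
    proof (cases "y \<in> cube (Suc k) x")
      case True
      then have "cube k y = cube k x" using cube_Suc cube_eq by blast
      then show ?thesis using True by (simp add: average_def)
    qed simp
  qed simp
  also have "\<dots> \<le> ennreal ((2 ^ Suc k) ^ DIM('a)) * (ennreal (2 ^ DIM('a) * (real DIM('a) / 2 ^ k) powr p) * energy p u)"
    by (intro mult_left_mono average_estimate[OF u p]) simp
  finally show ?thesis by (simp add: ennreal_mult mult.assoc)
qed

text \<open>A translation by 3 R moves a set of radius R off itself, so on that set the difference
  between the translate and u is -u.\<close>

lemma poincare:
  fixes u :: "'a::euclidean_space \<Rightarrow> real"
  assumes u: "u \<in> test_functions U" and p: "p > 1" and U: "\<And>x. x \<in> U \<Longrightarrow> norm x \<le> R" "R > 0"
  shows "mass p u \<le> ennreal ((3 * R) powr p) * energy p u"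
proof -
  obtain b :: 'a where b: "b \<in> Basis" using nonempty_Basis by blast
  define z where "z = (3 * R) *\<^sub>R b"
  have z: "norm z = 3 * R" using b U by (simp add: z_def)
  have "mass p u \<le> mass p (\<lambda>x. u (z + x) - u x)"
  proof (intro nn_integral_mono)
    fix x
    have out: "u y = 0" if "y \<notin> U" for y using test_zero[OF u, of y] test_functionsD(3)[OF u] that by blast
    show "ennreal (\<bar>u x\<bar> powr p) \<le> ennreal (\<bar>u (z + x) - u x\<bar> powr p)"
    proof (cases "x \<in> U")
      case True
      have "z + x \<notin> U"
      proof
        assume "z + x \<in> U"
        then have "norm (z + x) \<le> R" "norm x \<le> R" using U(1) True by auto
        then show False using z U(2) norm_triangle_ineq4[of "z + x" x] by simp
      qed
      then show ?thesis using out by simp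
    qed (simp add: out)
  qed
  also have "\<dots> \<le> ennreal ((3 * R) powr p) * energy p u" using translation_estimate[OF u p, of z] z by simp
  finally show ?thesis .
qed

section \<open>Growth of the averages and the Sobolev inequality\<close>

lemma powr_le_cancel:
  fixes x y p :: real
  assumes "x powr p \<le> y powr p" "p > 0" "y \<ge> 0"
  shows "x \<le> y" using powr_less_mono2[of p y x] assms by linarith

text \<open>The p-th root of the factor in \<open>average_Suc_estimate\<close> is C 2^(\<gamma> k)
  with \<gamma> = N / p - 1 > 0, so the increments sum geometrically to a bound of the same
  order.\<close>

lemma average_bound:
  fixes U :: "'a::euclidean_space set"
  assumes p: "p > 1" "p < real DIM('a)" and U: "\<And>x. x \<in> U \<Longrightarrow> norm x \<le> R" "R > 0"
  obtains K where "K > 0"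
    "\<And>u k x. u \<in> test_functions U \<Longrightarrow> energy p u \<le> 1 \<Longrightarrow> \<bar>average k u x\<bar> \<le> K * 2 powr ((real DIM('a) / p - 1) * real k)"
proof -
  let ?N = "real DIM('a)"
  define \<gamma> where "\<gamma> = ?N / p - 1"
  have \<gamma>: "\<gamma> > 0" using p by (simp add: \<gamma>_def)
  have g1: "2 powr \<gamma> > 1" using powr_less_mono[of 0 \<gamma> 2] \<gamma> by simp
  define C where "C = (2 powr (2 * ?N) * ?N powr p) powr (1 / p)"
  have C: "C > 0" by (simp add: C_def)
  have coeff: "(2 ^ Suc k) ^ DIM('a) * (2 ^ DIM('a) * (?N / 2 ^ k) powr p) = (C * 2 powr (\<gamma> * real k)) powr p" for k
  proof -
    have "(C * 2 powr (\<gamma> * real k)) powr p = 2 powr (2 * ?N) * ?N powr p * 2 powr (real k * ?N - real k * p)"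
      using p by (simp add: C_def powr_mult powr_powr \<gamma>_def algebra_simps)
    also have "\<dots> = 2 powr (2 * ?N) * ?N powr p * (2 powr (real k * ?N) / 2 powr (real k * p))"
      by (simp only: powr_diff)
    also have "2 powr (2 * ?N) = 2 powr ?N * 2 powr ?N" by (simp only: powr_add[symmetric]) simp
    also have "2 powr ?N * 2 powr ?N * ?N powr p * (2 powr (real k * ?N) / 2 powr (real k * p))
        = (2 powr real k * 2) powr ?N * (2 powr ?N * (?N / 2 powr real k) powr p)"
      by (simp add: powr_mult powr_divide powr_powr)
    finally show ?thesis by (simp add: powr_realpow mult.commute)
  qed
  \<comment> \<open>3 R comes from the Poincare inequality on cubes of volume 1 and starts the
    induction; C / (2^\<gamma> - 1) closes it, since then K + C \<le> K 2^\<gamma>.\<close>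
  define K where "K = 3 * R + C / (2 powr \<gamma> - 1)"
  have K: "K > 0" "3 * R \<le> K" using U(2) C g1 by (auto simp: K_def intro!: add_pos_pos)
  have KC: "C \<le> K * (2 powr \<gamma> - 1)"
  proof -
    have "K * (2 powr \<gamma> - 1) = 3 * R * (2 powr \<gamma> - 1) + C" using \<gamma> by (simp add: K_def distrib_right)
    moreover have "3 * R * (2 powr \<gamma> - 1) \<ge> 0" using g1 U(2) by (intro mult_nonneg_nonneg) auto
    ultimately show ?thesis by linarith
  qed
  have "\<bar>average k u x\<bar> \<le> K * 2 powr (\<gamma> * real k)" if u: "u \<in> test_functions U" and e: "energy p u \<le> 1" for u k x
  proof (induction k)
    case 0
    have "ennreal (\<bar>average 0 u x - 0\<bar> powr p) \<le> ennreal ((2 ^ 0) ^ DIM('a)) * (\<integral>\<^sup>+y. indicator (cube 0 x) y * ennreal (\<bar>u y - 0\<bar> powr p) \<partial>lborel)"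
      by (rule average_jensen[OF u p(1), of 0 x 0])
    also have "\<dots> = (\<integral>\<^sup>+y. indicator (cube 0 x) y * ennreal (\<bar>u y\<bar> powr p) \<partial>lborel)" by simp
    also have "\<dots> \<le> (\<integral>\<^sup>+y. ennreal (\<bar>u y\<bar> powr p) \<partial>lborel)"
      by (intro nn_integral_mono) (simp split: split_indicator)
    also have "\<dots> \<le> ennreal ((3 * R) powr p) * energy p u" by (rule poincare[OF u p(1) U])
    also have "\<dots> \<le> ennreal ((3 * R) powr p) * 1" using e by (intro mult_left_mono) auto
    finally have "ennreal (\<bar>average 0 u x\<bar> powr p) \<le> ennreal ((3 * R) powr p)" by simp
    then have "\<bar>average 0 u x\<bar> powr p \<le> (3 * R) powr p" by (subst (asm) ennreal_le_iff) auto
    moreover have "0 < p" "0 \<le> 3 * R" using p U(2) by auto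
    ultimately have "\<bar>average 0 u x\<bar> \<le> 3 * R" by (rule powr_le_cancel)
    then show ?case using K by simp
  next
    case (Suc k)
    have "ennreal (\<bar>average (Suc k) u x - average k u x\<bar> powr p) \<le> ennreal ((C * 2 powr (\<gamma> * real k)) powr p) * energy p u"
      using average_Suc_estimate[OF u p(1), of k x] unfolding coeff .
    also have "\<dots> \<le> ennreal ((C * 2 powr (\<gamma> * real k)) powr p) * 1" using e by (intro mult_left_mono) auto
    finally have "ennreal (\<bar>average (Suc k) u x - average k u x\<bar> powr p) \<le> ennreal ((C * 2 powr (\<gamma> * real k)) powr p)" by simp
    then have "\<bar>average (Suc k) u x - average k u x\<bar> powr p \<le> (C * 2 powr (\<gamma> * real k)) powr p" by (subst (asm) ennreal_le_iff) auto
    moreover have "0 < p" "0 \<le> C * 2 powr (\<gamma> * real k)" using p C by auto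
    ultimately have "\<bar>average (Suc k) u x - average k u x\<bar> \<le> C * 2 powr (\<gamma> * real k)" by (rule powr_le_cancel)
    also have "\<dots> \<le> K * (2 powr \<gamma> - 1) * 2 powr (\<gamma> * real k)" using KC by (intro mult_right_mono) auto
    finally have "\<bar>average (Suc k) u x\<bar> \<le> K * (2 powr \<gamma> - 1) * 2 powr (\<gamma> * real k) + K * 2 powr (\<gamma> * real k)"
      using Suc by linarith
    also have "\<dots> = K * (2 powr \<gamma> * 2 powr (\<gamma> * real k))" by (simp add: algebra_simps)
    also have "2 powr \<gamma> * 2 powr (\<gamma> * real k) = 2 powr (\<gamma> * real (Suc k))"
      by (simp only: powr_add[symmetric]) (simp add: algebra_simps)
    finally show ?case .
  qed
  with K(1) show ?thesis unfolding \<gamma>_def by (rule that)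
qed

text \<open>Where \<open>\<bar>u\<bar>\<close> exceeds twice the bound \<open>K * 2 powr (\<gamma> * k)\<close> on its averages over cubes of side \<open>1 / 2 ^ k\<close>,
  it is at most twice its distance to the average. Summing over \<open>k\<close> the dyadic layers of \<open>\<bar>u\<bar>\<close> gives a
  geometric series, convergent exactly for subcritical \<open>r\<close>.\<close>

lemma sobolev_normalized:
  fixes \<Omega> :: "'a::euclidean_space set"
  assumes p: "p > 1" "p < real DIM('a)" and \<Omega>: "\<And>x. x \<in> \<Omega> \<Longrightarrow> norm x \<le> R" "R > 0"
    and r: "p \<le> r" "r < sobolev_exponent (real DIM('a)) p"
  obtains C where "C > 0"
    "\<And>u. u \<in> test_functions \<Omega> \<Longrightarrow> energy p u \<le> 1 \<Longrightarrow> mass r u \<le> ennreal C"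
proof -
  let ?N = "real DIM('a)"
  define \<gamma> where "\<gamma> = ?N / p - 1"
  have \<gamma>: "\<gamma> > 0" using p by (simp add: \<gamma>_def)
  \<comment> \<open>Multiplied out, this is r (N - p) < N p, the subcriticality of r.\<close>
  have \<gamma>r: "\<gamma> * (r - p) < p"
  proof -
    have "r * (?N - p) < ?N * p" using r p by (simp add: sobolev_exponent_def less_divide_eq)
    then have "(?N - p) * (r - p) < p * p" by (simp add: algebra_simps)
    then have "(?N - p) * (r - p) / p < p" using p by (simp add: divide_less_eq)
    moreover have "\<gamma> * (r - p) = (?N - p) * (r - p) / p" using p by (simp add: \<gamma>_def diff_divide_distrib left_diff_distrib)
    ultimately show ?thesis by simp
  qed
  obtain K where K: "K > 0"
    "\<And>u k x. u \<in> test_functions \<Omega> \<Longrightarrow> energy p u \<le> 1 \<Longrightarrow> \<bar>average k u x\<bar> \<le> K * 2 powr (\<gamma> * real k)"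
    using average_bound[OF p \<Omega>] unfolding \<gamma>_def by blast
  \<comment> \<open>Weight of layer k: there |u|^(r - p) is at most (2 K 2^(\<gamma> (k + 1)))^(r -
    p), and 2^p stems from |u| being at most twice its distance to the average.\<close>
  define c where "c k = 2 powr p * (2 * K * 2 powr (\<gamma> * real (Suc k))) powr (r - p)" for k
  have c: "c k \<ge> 0" for k by (simp add: c_def)
  \<comment> \<open>The ratio of the geometric series: from one scale to the next the weight grows
    by 2^(\<gamma> (r - p)), and the averaging error shrinks by 2^(-p).\<close>
  define q where "q = 2 powr (\<gamma> * (r - p) - p)"
  have q: "0 < q" "q < 1" using powr_less_mono[of "\<gamma> * (r - p) - p" 0 2] \<gamma>r by (auto simp: q_def)
  define A where "A = 2 powr p * (2 * K * 2 powr \<gamma>) powr (r - p) * (2 ^ DIM('a) * ?N powr p)"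
  have A: "A > 0" using K(1) by (simp add: A_def)
  have cA: "c k * (2 ^ DIM('a) * (?N / 2 ^ k) powr p) = A * q ^ k" for k
  proof -
    have "2 powr (\<gamma> * real (Suc k)) = 2 powr \<gamma> * 2 powr (\<gamma> * real k)"
      by (simp only: powr_add[symmetric]) (simp add: algebra_simps)
    then have "c k = 2 powr p * (2 * K * 2 powr \<gamma>) powr (r - p) * 2 powr (\<gamma> * real k * (r - p))"
      by (simp add: c_def powr_mult powr_powr)
    moreover have "(?N / 2 ^ k) powr p = ?N powr p / 2 powr (real k * p)"
      by (simp add: powr_divide powr_powr flip: powr_realpow)
    moreover have "q ^ k = 2 powr (\<gamma> * real k * (r - p)) / 2 powr (real k * p)"
    proof -
      have "q ^ k = q powr real k" using q by (simp add: powr_realpow)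
      also have "\<dots> = 2 powr ((\<gamma> * real k * (r - p)) - real k * p)" unfolding q_def powr_powr by (simp add: algebra_simps)
      finally show ?thesis by (simp only: powr_diff)
    qed
    ultimately show ?thesis by (simp add: A_def)
  qed
  \<comment> \<open>The first summand is the Poincare bound on the set where |u| < 2 K, the second
    the sum of all layers.\<close>
  define C where "C = (2 * K) powr (r - p) * (3 * R) powr p + A * (1 / (1 - q))"
  have C: "C > 0" using K(1) q A by (auto simp: C_def intro!: add_nonneg_pos)
  have "mass r u \<le> ennreal C" if u: "u \<in> test_functions \<Omega>" and e: "energy p u \<le> 1" for u
  proof -
    note [measurable] = test_borel_measurable[OF u] average_measurable[OF u]
    have pt: "ennreal (\<bar>u x\<bar> powr r) \<le> ennreal ((2 * K) powr (r - p)) * ennreal (\<bar>u x\<bar> powr p)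
        + (\<Sum>k. ennreal (c k) * ennreal (\<bar>u x - average k u x\<bar> powr p))" for x
    proof -
      have split: "\<bar>u x\<bar> powr r = \<bar>u x\<bar> powr (r - p) * \<bar>u x\<bar> powr p" by (simp add: powr_add[symmetric])
      show ?thesis
      proof (cases "\<bar>u x\<bar> < 2 * K")
        case True
        then have "\<bar>u x\<bar> powr (r - p) \<le> (2 * K) powr (r - p)" using r by (intro powr_mono2) auto
        then have "\<bar>u x\<bar> powr r \<le> (2 * K) powr (r - p) * \<bar>u x\<bar> powr p" unfolding split by (intro mult_right_mono) auto
        then have "ennreal (\<bar>u x\<bar> powr r) \<le> ennreal ((2 * K) powr (r - p)) * ennreal (\<bar>u x\<bar> powr p)"
          by (simp add: ennreal_mult[symmetric] ennreal_leI)
        then show ?thesis by (simp add: add_increasing2)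
      next
        case False
        let ?P = "\<lambda>k. \<bar>u x\<bar> < 2 * K * 2 powr (\<gamma> * real k)"
        have "\<exists>k. ?P k"
        proof -
          have g1: "2 powr \<gamma> > 1" using powr_less_mono[of 0 \<gamma> 2] \<gamma> by simp
          obtain k where "\<bar>u x\<bar> / (2 * K) < (2 powr \<gamma>) ^ k" using real_arch_pow[OF g1] by blast
          also have "(2 powr \<gamma>) ^ k = 2 powr (\<gamma> * real k)" by (simp add: powr_powr flip: powr_realpow)
          finally show ?thesis using K(1) by (auto simp: divide_less_eq mult.commute)
        qed
        then obtain n where n: "?P n" by blast
        have "\<not> ?P 0" using False by simp
        from ex_least_nat_less[of ?P, OF n this] obtain k where k: "\<not> ?P k" "?P (Suc k)" by blast
        have half: "U \<le> 2 * d" if "a \<le> X" "2 * X \<le> U" "U \<le> d + a" for a d U X :: real using that by linarith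
        have "\<bar>u x\<bar> \<le> 2 * \<bar>u x - average k u x\<bar>"
        proof (rule half)
          show "\<bar>average k u x\<bar> \<le> K * 2 powr (\<gamma> * real k)" by (rule K(2)[OF u e])
          show "2 * (K * 2 powr (\<gamma> * real k)) \<le> \<bar>u x\<bar>" using k(1) by (simp add: not_less mult.assoc)
          show "\<bar>u x\<bar> \<le> \<bar>u x - average k u x\<bar> + \<bar>average k u x\<bar>" by linarith
        qed
        then have "\<bar>u x\<bar> powr p \<le> (2 * \<bar>u x - average k u x\<bar>) powr p" using p by (intro powr_mono2) auto
        moreover have "\<bar>u x\<bar> powr (r - p) \<le> (2 * K * 2 powr (\<gamma> * real (Suc k))) powr (r - p)"
          using k(2) r by (intro powr_mono2) auto
        ultimately have "\<bar>u x\<bar> powr r \<le> (2 * K * 2 powr (\<gamma> * real (Suc k))) powr (r - p) * (2 * \<bar>u x - average k u x\<bar>) powr p"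
          unfolding split by (intro mult_mono) auto
        also have "\<dots> = c k * \<bar>u x - average k u x\<bar> powr p" by (simp add: c_def powr_mult)
        finally have "ennreal (\<bar>u x\<bar> powr r) \<le> ennreal (c k) * ennreal (\<bar>u x - average k u x\<bar> powr p)"
          by (simp add: ennreal_mult[symmetric] ennreal_leI c)
        also have "\<dots> = (\<Sum>k\<in>{k}. ennreal (c k) * ennreal (\<bar>u x - average k u x\<bar> powr p))" by simp
        also have "\<dots> \<le> (\<Sum>k. ennreal (c k) * ennreal (\<bar>u x - average k u x\<bar> powr p))" by (intro sum_le_suminf) auto
        finally show ?thesis by (simp add: add_increasing)
      qed
    qed
    have "mass r u \<le> (\<integral>\<^sup>+x. ennreal ((2 * K) powr (r - p)) * ennreal (\<bar>u x\<bar> powr p)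
        + (\<Sum>k. ennreal (c k) * ennreal (\<bar>u x - average k u x\<bar> powr p)) \<partial>lborel)" by (intro nn_integral_mono pt)
    also have "\<dots> = ennreal ((2 * K) powr (r - p)) * mass p u
        + (\<Sum>k. ennreal (c k) * mass p (\<lambda>x. u x - average k u x))"
      by (subst nn_integral_add) (auto simp: nn_integral_cmult nn_integral_suminf)
    also have "\<dots> \<le> ennreal ((2 * K) powr (r - p)) * ennreal ((3 * R) powr p) + (\<Sum>k. ennreal (A * q ^ k))"
    proof (intro add_mono mult_left_mono suminf_le)
      have "mass p u \<le> ennreal ((3 * R) powr p) * energy p u" by (rule poincare[OF u p(1) \<Omega>])
      also have "\<dots> \<le> ennreal ((3 * R) powr p) * 1" using e by (intro mult_left_mono) auto
      finally show "mass p u \<le> ennreal ((3 * R) powr p)" by simp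
      fix k
      have "mass p (\<lambda>x. u x - average k u x) \<le> ennreal (2 ^ DIM('a) * (?N / 2 ^ k) powr p) * energy p u"
        by (rule average_estimate[OF u p(1)])
      also have "\<dots> \<le> ennreal (2 ^ DIM('a) * (?N / 2 ^ k) powr p) * 1" using e by (intro mult_left_mono) auto
      finally have "ennreal (c k) * mass p (\<lambda>x. u x - average k u x)
          \<le> ennreal (c k) * ennreal (2 ^ DIM('a) * (?N / 2 ^ k) powr p)" by (intro mult_left_mono) auto
      also have "\<dots> = ennreal (A * q ^ k)" unfolding cA[symmetric] using c by (simp add: ennreal_mult)
      finally show "ennreal (c k) * mass p (\<lambda>x. u x - average k u x) \<le> ennreal (A * q ^ k)" .
    qed auto
    also have "(\<Sum>k. ennreal (A * q ^ k)) = ennreal (A * (1 / (1 - q)))"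
      using q A by (subst suminf_ennreal2) (auto intro!: summable_mult simp: suminf_mult suminf_geometric summable_geometric)
    also have "ennreal ((2 * K) powr (r - p)) * ennreal ((3 * R) powr p) + ennreal (A * (1 / (1 - q))) = ennreal C"
      using q A by (simp add: C_def ennreal_mult[symmetric] ennreal_plus[symmetric] del: ennreal_plus)
    finally show ?thesis .
  qed
  with C show ?thesis by (rule that)
qed

lemma test_Lp:
  assumes u: "u \<in> test_functions U" and U: "U \<in> sets lebesgue" and s: "s > 0"
  shows "u \<in> Lp s lborel" "grad u \<in> Lp s lborel" "u \<in> Lp s (lebesgue_on U)" "grad u \<in> Lp s (lebesgue_on U)"
    and "Lp_norm s (lebesgue_on U) u = Lp_norm s lborel u" "Lp_norm s (lebesgue_on U) (grad u) = Lp_norm s lborel (grad u)"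
proof -
  note [measurable] = test_borel_measurable[OF u]
  let ?K = "closure {x. u x \<noteq> 0}"
  have 1: "integrable lborel (\<lambda>x. norm (u x) powr s)"
  proof (rule integrable_compact_support)
    show "continuous_on ?K (\<lambda>x. norm (u x) powr s)"
      using s by (intro continuous_on_powr' continuous_on_norm test_continuous[OF u] continuous_on_const) auto
    show "norm (u x) powr s = 0" if "x \<notin> ?K" for x using test_zero[OF u that] by simp
  qed (rule test_functionsD[OF u])
  note 2 = energy_finite(2)[OF u s]
  have out: "u x = 0" "grad u x = 0" if "x \<notin> U" for x
    using test_zero[OF u, of x] grad_zero[OF u, of x] test_functionsD(3)[OF u] that by blast+
  have 3: "integral\<^sup>L (lebesgue_on U) (\<lambda>x. norm (u x) powr s) = integral\<^sup>L lborel (\<lambda>x. norm (u x) powr s)"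
    "integrable (lebesgue_on U) (\<lambda>x. norm (u x) powr s)"
    using lebesgue_on_supported[OF U, of "\<lambda>x. norm (u x) powr s"] 1 out by auto
  have 4: "integral\<^sup>L (lebesgue_on U) (\<lambda>x. norm (grad u x) powr s) = integral\<^sup>L lborel (\<lambda>x. norm (grad u x) powr s)"
    "integrable (lebesgue_on U) (\<lambda>x. norm (grad u x) powr s)"
    using lebesgue_on_supported[OF U, of "\<lambda>x. norm (grad u x) powr s"] 2 out by auto
  have m: "u \<in> borel_measurable (lebesgue_on U)" "grad u \<in> borel_measurable (lebesgue_on U)"
    using test_borel_measurable[OF u] by (auto intro!: measurable_restrict_space1 simp: measurable_completion)
  show "u \<in> Lp s lborel" "grad u \<in> Lp s lborel" using 1 2 by (auto simp: Lp_def)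
  show "u \<in> Lp s (lebesgue_on U)" "grad u \<in> Lp s (lebesgue_on U)" using 3 4 m by (auto simp: Lp_def)
  show "Lp_norm s (lebesgue_on U) u = Lp_norm s lborel u" "Lp_norm s (lebesgue_on U) (grad u) = Lp_norm s lborel (grad u)"
    using 3 4 by (auto simp: Lp_norm_def)
qed

lemma energy_eq_Lp_norm:
  assumes "u \<in> test_functions U" "p > 0"
  shows "energy p u = ennreal (Lp_norm p lborel (grad u) powr p)"
  using energy_finite(1)[OF assms] assms(2) by (simp add: Lp_norm_powr)

lemma Lp_norm_grad_cmult:
  assumes "u \<in> test_functions U" "p > 0"
  shows "Lp_norm p M (grad (\<lambda>x. c * u x)) = \<bar>c\<bar> * Lp_norm p M (grad u)"
proof -
  have "grad (\<lambda>x. c * u x) = (\<lambda>x. c *\<^sub>R grad u x)" using grad_cmult[OF assms(1)] by (rule ext)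
  then show ?thesis using Lp_norm_scale[OF assms(2)] by (simp only:)
qed

theorem sobolev_inequality:
  fixes U :: "'a::euclidean_space set"
  assumes p: "p > 1" "p < real DIM('a)" and U: "bounded U" "U \<in> sets lebesgue"
    and r: "p \<le> r" "r < sobolev_exponent (real DIM('a)) p"
  obtains C where "C > 0"
    "\<And>u. u \<in> test_functions U \<Longrightarrow> Lp_norm r (lebesgue_on U) u \<le> C * Lp_norm p (lebesgue_on U) (grad u)"
proof -
  obtain R where R: "R > 0" "\<And>x. x \<in> U \<Longrightarrow> norm x \<le> R" using U by (auto simp: bounded_pos)
  have r0: "r > 0" and p0: "p > 0" using r p by auto
  obtain C0 where C0: "C0 > 0" "\<And>u. u \<in> test_functions U \<Longrightarrow> energy p u \<le> 1 \<Longrightarrow> mass r u \<le> ennreal C0"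
    using sobolev_normalized[OF p R(2,1) r] by blast
  define C where "C = C0 powr (1 / r)"
  have C: "C > 0" using C0(1) by (simp add: C_def)
  have norm1: "Lp_norm r lborel u \<le> C" if u: "u \<in> test_functions U" "Lp_norm p lborel (grad u) \<le> 1" for u
  proof -
    have "Lp_norm p lborel (grad u) powr p \<le> 1" using powr_le1[of p "Lp_norm p lborel (grad u)"] p0 u(2) by simp
    then have "energy p u \<le> 1" using energy_eq_Lp_norm[OF u(1) p0] by simp
    then have "(\<integral>\<^sup>+x. ennreal (norm (u x) powr r) \<partial>lborel) \<le> ennreal C0" using C0(2)[OF u(1)] by simp
    then have "Lp_int r lborel u \<le> C0"
      using C0(1) by (subst (asm) nn_integral_eq_integral[OF LpD(2)[OF test_Lp(1)[OF u(1) U(2) r0]]]) auto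
    also have "C0 = C powr r" using C0(1) r0 by (simp add: C_def powr_powr)
    finally show ?thesis using C r0 by (simp add: Lp_norm_le_iff)
  qed
  have "Lp_norm r lborel u \<le> C * Lp_norm p lborel (grad u)" if u: "u \<in> test_functions U" for u
  proof (rule field_le_epsilon)
    fix e :: real assume e: "e > 0"
    \<comment> \<open>e / C keeps the divisor positive when the gradient norm is 0, and it adds
      exactly e to the final bound.\<close>
    define g where "g = Lp_norm p lborel (grad u) + e / C"
    have g: "g > 0" "Lp_norm p lborel (grad u) \<le> g" using e C by (auto simp: g_def add_nonneg_pos)
    have v: "(\<lambda>x. (1 / g) * u x) \<in> test_functions U" using u by (rule test_functions_cmult)
    have "Lp_norm p lborel (grad (\<lambda>x. (1 / g) * u x)) \<le> 1"
      unfolding Lp_norm_grad_cmult[OF u p0] using g by (simp add: divide_le_eq)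
    from norm1[OF v this] have "\<bar>1 / g\<bar> * Lp_norm r lborel u \<le> C"
      using Lp_norm_scale[OF r0, of lborel "1 / g" u] by simp
    then have "Lp_norm r lborel u \<le> C * g" using g by (simp add: divide_le_eq)
    also have "\<dots> = C * Lp_norm p lborel (grad u) + e" using C by (simp add: g_def distrib_left)
    finally show "Lp_norm r lborel u \<le> C * Lp_norm p lborel (grad u) + e" .
  qed
  then have "Lp_norm r (lebesgue_on U) u \<le> C * Lp_norm p (lebesgue_on U) (grad u)" if "u \<in> test_functions U" for u
    using that test_Lp(5)[OF that U(2) r0] test_Lp(6)[OF that U(2) p0] by simp
  with C show ?thesis by (rule that)
qed

section \<open>Compactness of the embedding\<close>

lemma cube_contains_dense:
  fixes x :: "'a::euclidean_space"
  assumes D: "\<And>X :: 'a set. open X \<Longrightarrow> X \<noteq> {} \<Longrightarrow> \<exists>d\<in>D. d \<in> X"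
  shows "\<exists>d\<in>D. cube k d = cube k x"
proof -
  define l h :: 'a where "l = (\<Sum>i\<in>Basis. (of_int \<lfloor>2 ^ k * (x \<bullet> i)\<rfloor> / 2 ^ k) *\<^sub>R i)"
    and "h = (\<Sum>i\<in>Basis. (1 / 2 ^ k) *\<^sub>R i)"
  have sub: "box l (l + h) \<subseteq> cube k x" unfolding l_def h_def by (rule cube_between)
  have "box l (l + h) \<noteq> {}" by (auto simp: box_ne_empty h_def inner_add_left)
  then obtain d where "d \<in> D" "d \<in> box l (l + h)" using D[of "box l (l + h)"] open_box by blast
  then show ?thesis using sub cube_eq by blast
qed

lemma average_cong: "cube k x = cube k y \<Longrightarrow> average k u x = average k u y" by (simp add: average_def)

lemma average_scale: "average k (\<lambda>x. c * u x) x = c * average k u x"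
proof -
  have "(LINT y|lborel. indicator (cube k x) y * (c * u y)) = (LINT y|lborel. c * (indicator (cube k x) y * u y))"
    by (intro Bochner_Integration.integral_cong) auto
  then show ?thesis by (simp add: average_def)
qed

lemma average_bound_Lp:
  fixes U :: "'a::euclidean_space set"
  assumes p: "p > 1" "p < real DIM('a)" and U: "\<And>x. x \<in> U \<Longrightarrow> norm x \<le> R" "R > 0" and G: "G > 0"
  obtains K where "K > 0"
    "\<And>u k x. u \<in> test_functions U \<Longrightarrow> Lp_norm p lborel (grad u) \<le> G \<Longrightarrow> \<bar>average k u x\<bar> \<le> K * 2 powr ((real DIM('a) / p - 1) * real k)"
proof -
  obtain K where K: "K > 0"
    "\<And>u k x. u \<in> test_functions U \<Longrightarrow> energy p u \<le> 1 \<Longrightarrow> \<bar>average k u x\<bar> \<le> K * 2 powr ((real DIM('a) / p - 1) * real k)"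
    using average_bound[OF p U] by blast
  have p0: "p > 0" using p by simp
  have "\<bar>average k u x\<bar> \<le> (G * K) * 2 powr ((real DIM('a) / p - 1) * real k)"
    if u: "u \<in> test_functions U" "Lp_norm p lborel (grad u) \<le> G" for u k x
  proof -
    have v: "(\<lambda>x. (1 / G) * u x) \<in> test_functions U" using u(1) by (rule test_functions_cmult)
    have "Lp_norm p lborel (grad (\<lambda>x. (1 / G) * u x)) \<le> 1"
      unfolding Lp_norm_grad_cmult[OF u(1) p0] using G u(2) by (simp add: divide_le_eq)
    then have "Lp_norm p lborel (grad (\<lambda>x. (1 / G) * u x)) powr p \<le> 1"
      using powr_le1[of p "Lp_norm p lborel (grad (\<lambda>x. (1 / G) * u x))"] p0 by simp
    then have "energy p (\<lambda>x. (1 / G) * u x) \<le> 1" unfolding energy_eq_Lp_norm[OF v p0] by simp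
    from K(2)[OF v this, of k x] have "\<bar>(1 / G) * average k u x\<bar> \<le> K * 2 powr ((real DIM('a) / p - 1) * real k)"
      unfolding average_scale .
    then show ?thesis using G by (simp add: abs_mult divide_le_eq mult.commute mult.left_commute)
  qed
  then show ?thesis using that[of "G * K"] G K(1) by simp
qed

text \<open>At each scale the average depends on the cube only, and every cube meets a countable
  dense set; so countably many bounded sequences decide convergence everywhere, and a diagonal
  argument applies.\<close>

lemma average_convergent_subseq:
  fixes U :: "'a::euclidean_space set"
  assumes p: "p > 1" "p < real DIM('a)" and U: "\<And>x. x \<in> U \<Longrightarrow> norm x \<le> R" "R > 0" and G: "G > 0"
    and u: "\<And>n. u n \<in> test_functions U" "\<And>n. Lp_norm p lborel (grad (u n)) \<le> G"
  obtains s :: "nat \<Rightarrow> nat" and w :: "nat \<Rightarrow> 'a \<Rightarrow> real" and B :: "nat \<Rightarrow> real" where "strict_mono s"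
    "\<And>k x. (\<lambda>n. average k (u (s n)) x) \<longlonglongrightarrow> w k x" "\<And>k n x. \<bar>average k (u n) x\<bar> \<le> B k"
proof -
  obtain K where K: "K > 0"
    "\<And>u k x. u \<in> test_functions U \<Longrightarrow> Lp_norm p lborel (grad u) \<le> G \<Longrightarrow> \<bar>average k u x\<bar> \<le> K * 2 powr ((real DIM('a) / p - 1) * real k)"
    using average_bound_Lp[OF p U G] by blast
  define b where "b k = 2 powr ((real DIM('a) / p - 1) * real k)" for k :: nat
  have b: "b k > 0" for k by (simp add: b_def)
  have bound: "\<bar>average k (u n) x\<bar> \<le> K * b k" for k n x using K(2)[OF u] by (simp add: b_def)
  obtain D :: "'a set" where D: "countable D" "\<And>X :: 'a set. open X \<Longrightarrow> X \<noteq> {} \<Longrightarrow> \<exists>d\<in>D. d \<in> X"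
    using countable_dense_exists by blast
  define S where "S = (UNIV :: nat set) \<times> D"
  have "countable S" unfolding S_def using D(1) by (intro countable_SIGMA) auto
  \<comment> \<open>Division by \<open>b k\<close> provides one bound for all scales at once, as the
    diagonal argument requires.\<close>
  moreover have "norm (average (fst z) (u n) (snd z) / b (fst z)) \<le> K" for n z
    using bound[of "fst z" n "snd z"] b[of "fst z"] by (simp add: divide_le_eq)
  ultimately obtain s :: "nat \<Rightarrow> nat" where s: "strict_mono s"
    "\<And>z. z \<in> S \<Longrightarrow> \<exists>l. (\<lambda>n. average (fst z) (u (s n)) (snd z) / b (fst z)) \<longlonglongrightarrow> l"
    using function_convergent_subsequence[of S "\<lambda>n z. average (fst z) (u n) (snd z) / b (fst z)" K] by metis
  have "\<exists>l. (\<lambda>n. average k (u (s n)) x) \<longlonglongrightarrow> l" for k x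
  proof -
    obtain d where d: "d \<in> D" "cube k d = cube k x" using cube_contains_dense[OF D(2), of k x] by blast
    then obtain l where "(\<lambda>n. average k (u (s n)) d / b k) \<longlonglongrightarrow> l" using s(2)[of "(k, d)"] by (auto simp: S_def)
    then have "(\<lambda>n. b k * (average k (u (s n)) d / b k)) \<longlonglongrightarrow> b k * l" by (intro tendsto_intros)
    then have "(\<lambda>n. average k (u (s n)) x) \<longlonglongrightarrow> b k * l" using b[of k] average_cong[OF d(2)] by simp
    then show ?thesis by blast
  qed
  then obtain w where "\<And>k x. (\<lambda>n. average k (u (s n)) x) \<longlonglongrightarrow> w k x" by metis
  with s(1) bound show ?thesis by (intro that[of s w "\<lambda>k. K * b k"])
qed

lemma Lp_bounded_convergence:
  fixes Vn :: "nat \<Rightarrow> 'a \<Rightarrow> 'b::euclidean_space"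
  assumes M: "finite_measure M" and V: "\<And>n. Vn n \<in> borel_measurable M" and s: "s > 0"
    and lim: "\<And>x. (\<lambda>n. Vn n x) \<longlonglongrightarrow> V x" and bd: "\<And>n x. norm (Vn n x) \<le> B"
  shows "Vn n \<in> Lp s M" "V \<in> Lp s M" "Lp_lim s M Vn V"
proof -
  interpret finite_measure M by (rule M)
  have B: "B \<ge> 0" using bd[of 0 undefined] norm_ge_zero order_trans by blast
  have [measurable]: "V \<in> borel_measurable M" using lim V by (rule borel_measurable_LIMSEQ_metric[rotated])
  note [measurable] = V
  have Vb: "norm (V x) \<le> B" for x
    using tendsto_norm[OF lim[of x]] bd by (intro LIMSEQ_le_const2[of "\<lambda>n. norm (Vn n x)"]) auto
  have const: "(\<lambda>x. B) \<in> Lp s M" by (simp add: Lp_def)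
  show "Vn n \<in> Lp s M" for n by (rule Lp_bound(1)[OF const V s]) (use bd B in auto)
  show "V \<in> Lp s M" by (rule Lp_bound(1)[OF const _ s]) (use Vb B in auto)
  show "Lp_lim s M Vn V" unfolding Lp_norm_tendsto_zero_iff[OF s]
  proof -
    have "(\<lambda>n. Lp_int s M (\<lambda>x. Vn n x - V x)) \<longlonglongrightarrow> (LINT x|M. 0)"
    proof (rule integral_dominated_convergence)
      show "integrable M (\<lambda>x. (2 * B) powr s)" by simp
      show "AE x in M. (\<lambda>n. norm (Vn n x - V x) powr s) \<longlonglongrightarrow> 0"
      proof (rule AE_I2)
        fix x
        have "(\<lambda>n. norm (Vn n x - V x) powr s) \<longlonglongrightarrow> 0 powr s"
          using lim[of x] s by (intro tendsto_powr' tendsto_norm_zero tendsto_const) (auto simp: LIM_zero)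
        then show "(\<lambda>n. norm (Vn n x - V x) powr s) \<longlonglongrightarrow> 0" by simp
      qed
      show "AE x in M. norm (norm (Vn n x - V x) powr s) \<le> (2 * B) powr s" for n
      proof (rule AE_I2)
        fix x
        have "norm (Vn n x - V x) \<le> 2 * B" using norm_triangle_ineq4[of "Vn n x" "V x"] bd[of n x] Vb[of x] by linarith
        then show "norm (norm (Vn n x - V x) powr s) \<le> (2 * B) powr s" using s by (simp add: powr_mono2)
      qed
    qed auto
    then show "(\<lambda>n. Lp_int s M (\<lambda>x. Vn n x - V x)) \<longlonglongrightarrow> 0" by simp
  qed
qed

text \<open>If 1 \<le> e t^(r' - r), the first term dominates. Otherwise t is at most (1 / e)^(1 /
  (r' - r)), which bounds the factor t^(r - p).\<close>

lemma powr_interpolation: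
  fixes t p r r' e :: real
  assumes "p \<le> r" "r < r'" "0 \<le> t" "e > 0"
  shows "t powr r \<le> e * t powr r' + (1 / e) powr ((r - p) / (r' - r)) * t powr p"
proof (cases "t = 0")
  case False
  then have t: "t > 0" using assms by simp
  show ?thesis
  proof (cases "1 \<le> e * t powr (r' - r)")
    case True
    have "t powr r * 1 \<le> t powr r * (e * t powr (r' - r))" using True by (intro mult_left_mono) auto
    also have "\<dots> = e * t powr r'" using t by (simp add: powr_diff)
    finally show ?thesis by (simp add: add_increasing2)
  next
    case f: False
    then have "t powr (r' - r) \<le> 1 / e" using assms by (simp add: field_simps)
    then have "(t powr (r' - r)) powr ((r - p) / (r' - r)) \<le> (1 / e) powr ((r - p) / (r' - r))"
      using assms by (intro powr_mono2) auto
    then have "t powr (r - p) \<le> (1 / e) powr ((r - p) / (r' - r))" using assms by (simp add: powr_powr)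
    then have "t powr (r - p) * t powr p \<le> (1 / e) powr ((r - p) / (r' - r)) * t powr p" by (intro mult_right_mono) auto
    then have "t powr r \<le> (1 / e) powr ((r - p) / (r' - r)) * t powr p" using t by (simp add: powr_diff)
    then show ?thesis using assms by (simp add: add_increasing)
  qed
qed simp

lemma finite_measure_lebesgue_on: "bounded U \<Longrightarrow> U \<in> sets lebesgue \<Longrightarrow> finite_measure (lebesgue_on U)"
proof (intro finite_measureI)
  assume U: "bounded U" "U \<in> sets lebesgue"
  have "emeasure (lebesgue_on U) (space (lebesgue_on U)) = emeasure lebesgue U"
    using U by (subst emeasure_restrict_space) auto
  also have "\<dots> \<noteq> \<infinity>" unfolding infinity_ennreal_def by (rule fmeasurableD2[OF bounded_set_imp_lmeasurable[OF U]])
  finally show "emeasure (lebesgue_on U) (space (lebesgue_on U)) \<noteq> \<infinity>" .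
qed

lemma average_Lp_estimate:
  fixes U :: "'a::euclidean_space set"
  assumes u: "u \<in> test_functions U" and p: "p > 1" and U: "U \<in> sets lebesgue"
  shows "(\<lambda>x. u x - average k u x) \<in> Lp p (lebesgue_on U)"
    "Lp_norm p (lebesgue_on U) (\<lambda>x. u x - average k u x)
      \<le> 2 powr (real DIM('a) / p) * (real DIM('a) / 2 ^ k) * Lp_norm p (lebesgue_on U) (grad u)"
proof -
  have p0: "p > 0" using p by simp
  note m[measurable] = test_borel_measurable(1)[OF u] average_measurable[OF u, of k]
  let ?d = "\<lambda>x. u x - average k u x" and ?g = "Lp_norm p lborel (grad u)"
  let ?C = "2 powr (real DIM('a) / p) * (real DIM('a) / 2 ^ k) * ?g"
  have C: "?C powr p = 2 ^ DIM('a) * (real DIM('a) / 2 ^ k) powr p * ?g powr p"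
    using p0 by (simp add: powr_mult powr_divide powr_powr powr_realpow)
  have md: "?d \<in> borel_measurable (lebesgue_on U)"
    using m by (intro measurable_restrict_space1 measurable_completion) simp
  have "(\<integral>\<^sup>+x. ennreal (norm (?d x) powr p) \<partial>lebesgue_on U) = (\<integral>\<^sup>+x. ennreal (norm (?d x) powr p) * indicator U x \<partial>lebesgue)"
    using U by (intro nn_integral_restrict_space) simp
  also have "\<dots> \<le> (\<integral>\<^sup>+x. ennreal (norm (?d x) powr p) \<partial>lebesgue)"
    by (intro nn_integral_mono) (simp split: split_indicator)
  also have "\<dots> = (\<integral>\<^sup>+x. ennreal (norm (?d x) powr p) \<partial>lborel)" by (rule nn_integral_completion)
  also have "\<dots> \<le> ennreal (2 ^ DIM('a) * (real DIM('a) / 2 ^ k) powr p) * energy p u"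
    using average_estimate[OF u p, of k] by simp
  also have "\<dots> = ennreal (?C powr p)" unfolding C energy_eq_Lp_norm[OF u p0] by (simp add: ennreal_mult)
  finally have le: "(\<integral>\<^sup>+x. ennreal (norm (?d x) powr p) \<partial>lebesgue_on U) \<le> ennreal (?C powr p)" .
  have int: "integrable (lebesgue_on U) (\<lambda>x. norm (?d x) powr p)"
    using le md by (intro integrableI_nonneg) (auto simp: le_less_trans)
  show "?d \<in> Lp p (lebesgue_on U)" using md int by (simp add: Lp_def)
  have "Lp_int p (lebesgue_on U) (\<lambda>x. ?d x) \<le> ?C powr p"
    using le by (subst (asm) nn_integral_eq_integral[OF int]) auto
  then show "Lp_norm p (lebesgue_on U) ?d \<le> 2 powr (real DIM('a) / p) * (real DIM('a) / 2 ^ k) * Lp_norm p (lebesgue_on U) (grad u)"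
    unfolding test_Lp(6)[OF u U p0] using p0 by (subst Lp_norm_le_iff) auto
qed

lemma test_grad_diff_norm:
  assumes u: "u \<in> test_functions U" "v \<in> test_functions U" and U: "U \<in> sets lebesgue" and p: "p \<ge> 1"
  shows "Lp_norm p (lebesgue_on U) (grad (\<lambda>x. u x - v x))
    \<le> Lp_norm p (lebesgue_on U) (grad u) + Lp_norm p (lebesgue_on U) (grad v)"
proof -
  have p0: "p > 0" using p by simp
  have "grad (\<lambda>x. u x - v x) = (\<lambda>x. grad u x + (- grad v x))" using grad_diff[OF u] by auto
  moreover have "(\<lambda>x. - grad v x) \<in> Lp p (lebesgue_on U)" using Lp_scale[OF test_Lp(4)[OF u(2) U p0], of "-1"] by simp
  ultimately show ?thesis
    using Lp_norm_triangle[OF test_Lp(4)[OF u(1) U p0], of "\<lambda>x. - grad v x"] p by (simp add: Lp_norm_minus)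
qed

text \<open>At a fixed scale the averages converge boundedly, hence in L^p, and they approximate the
  functions at the rate 2^(-k) uniformly in n. Interpolation with an exponent r' between r and the
  critical one upgrades L^p to L^r, and the subsequence is chosen before r.\<close>

theorem rellich:
  fixes U :: "'a::euclidean_space set"
  assumes p: "p > 1" "p < real DIM('a)" and U: "bounded U" "U \<in> sets lebesgue"
    and u: "\<And>n. u n \<in> test_functions U" "\<And>n. Lp_norm p (lebesgue_on U) (grad (u n)) \<le> G"
  obtains s :: "nat \<Rightarrow> nat" where "strict_mono s"
    "\<And>r e. p \<le> r \<Longrightarrow> r < sobolev_exponent (real DIM('a)) p \<Longrightarrow> e > 0 \<Longrightarrow>
      \<exists>n0. \<forall>m\<ge>n0. \<forall>n\<ge>n0. Lp_norm r (lebesgue_on U) (\<lambda>x. u (s m) x - u (s n) x) \<le> e"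
proof -
  let ?\<mu> = "lebesgue_on U"
  have p0: "p > 0" using p by simp
  obtain R where R: "R > 0" "\<And>x. x \<in> U \<Longrightarrow> norm x \<le> R" using U by (auto simp: bounded_pos)
  define H where "H = \<bar>G\<bar> + 1"
  have H: "H > 0" "\<And>n. Lp_norm p ?\<mu> (grad (u n)) \<le> H" using u(2) by (auto simp: H_def intro: order_trans[OF u(2)])
  have uH: "Lp_norm p lborel (grad (u n)) \<le> H" for n using H(2)[of n] test_Lp(6)[OF u(1) U(2) p0] by simp
  obtain s :: "nat \<Rightarrow> nat" and w B where s: "strict_mono s"
    "\<And>k x. (\<lambda>n. average k (u (s n)) x) \<longlonglongrightarrow> w k x" "\<And>k n x. \<bar>average k (u n) x\<bar> \<le> B k"
  proof (rule average_convergent_subseq[OF p R(2,1) H(1) u(1) uH])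
    fix s :: "nat \<Rightarrow> nat" and w :: "nat \<Rightarrow> 'a \<Rightarrow> real" and B :: "nat \<Rightarrow> real"
    assume "strict_mono s" "\<And>k x. (\<lambda>n. average k (u (s n)) x) \<longlonglongrightarrow> w k x" "\<And>k n x. \<bar>average k (u n) x\<bar> \<le> B k"
    then show thesis by (rule that)
  qed
  have fin: "finite_measure ?\<mu>" using U by (rule finite_measure_lebesgue_on)
  have am: "average k (u n) \<in> borel_measurable ?\<mu>" for k n
    using average_measurable[OF u(1)] by (intro measurable_restrict_space1 measurable_completion) simp
  have cauchy_p: "\<exists>n0. \<forall>m\<ge>n0. \<forall>n\<ge>n0. Lp_norm p ?\<mu> (\<lambda>x. u (s m) x - u (s n) x) \<le> e" if e: "e > 0" for e
  proof -
    define C where "C = 2 powr (real DIM('a) / p) * real DIM('a) * H"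
    have C: "C > 0" using H(1) by (simp add: C_def)
    \<comment> \<open>A scale at which the averaging error is at most e / 4 for every member of the
      sequence.\<close>
    obtain k where k: "4 * C / e < 2 ^ k" using real_arch_pow[of 2 "4 * C / e"] by auto
    have "4 * C < 2 ^ k * e" using k e unfolding divide_less_eq by simp
    then have Ck: "C / 2 ^ k \<le> e / 4" by (simp add: divide_le_eq mult.commute)
    have near: "(\<lambda>x. u n x - average k (u n) x) \<in> Lp p ?\<mu>" "Lp_norm p ?\<mu> (\<lambda>x. u n x - average k (u n) x) \<le> e / 4" for n
    proof -
      show "(\<lambda>x. u n x - average k (u n) x) \<in> Lp p ?\<mu>" by (rule average_Lp_estimate(1)[OF u(1) p(1) U(2)])
      have "Lp_norm p ?\<mu> (\<lambda>x. u n x - average k (u n) x)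
        \<le> 2 powr (real DIM('a) / p) * (real DIM('a) / 2 ^ k) * Lp_norm p ?\<mu> (grad (u n))"
        by (rule average_Lp_estimate(2)[OF u(1) p(1) U(2)])
      also have "\<dots> \<le> 2 powr (real DIM('a) / p) * (real DIM('a) / 2 ^ k) * H"
        using H(2) by (intro mult_left_mono) auto
      also have "\<dots> = C / 2 ^ k" by (simp add: C_def)
      also note Ck
      finally show "Lp_norm p ?\<mu> (\<lambda>x. u n x - average k (u n) x) \<le> e / 4" .
    qed
    let ?A = "\<lambda>n. average k (u (s n))"
    have bd: "norm (?A n x) \<le> B k" for n x using s(3) by simp
    note conv = Lp_bounded_convergence[OF fin am p0 s(2)[of k] bd]
    have "\<forall>\<^sub>F n in sequentially. Lp_norm p ?\<mu> (\<lambda>x. ?A n x - w k x) < e / 4"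
      using conv(3) e by (intro order_tendstoD(2)[where y = 0]) auto
    then obtain n0 where n0: "\<And>n. n \<ge> n0 \<Longrightarrow> Lp_norm p ?\<mu> (\<lambda>x. ?A n x - w k x) < e / 4"
      by (auto simp: eventually_sequentially)
    have half: "(\<lambda>x. u (s n) x - w k x) \<in> Lp p ?\<mu> \<and> Lp_norm p ?\<mu> (\<lambda>x. u (s n) x - w k x) \<le> e / 2" if "n \<ge> n0" for n
    proof -
      have d: "(\<lambda>x. ?A n x - w k x) \<in> Lp p ?\<mu>" by (rule Lp_diff[OF conv(1,2) p0])
      have eq: "(\<lambda>x. u (s n) x - w k x) = (\<lambda>x. (u (s n) x - ?A n x) + (?A n x - w k x))" by auto
      show ?thesis unfolding eq
        using Lp_add[OF near(1)[of "s n"] d p0] Lp_norm_triangle[OF near(1)[of "s n"] d] near(2)[of "s n"] n0[OF that] p(1) by auto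
    qed
    have "Lp_norm p ?\<mu> (\<lambda>x. u (s m) x - u (s n) x) \<le> e" if "m \<ge> n0" "n \<ge> n0" for m n
    proof -
      have d: "(\<lambda>x. w k x - u (s n) x) \<in> Lp p ?\<mu>" "Lp_norm p ?\<mu> (\<lambda>x. w k x - u (s n) x) \<le> e / 2"
        using Lp_scale[of "\<lambda>x. u (s n) x - w k x" p ?\<mu> "-1"] half[OF that(2)] by (auto simp: Lp_norm_diff_commute)
      have eq: "(\<lambda>x. u (s m) x - u (s n) x) = (\<lambda>x. (u (s m) x - w k x) + (w k x - u (s n) x))" by auto
      have hm: "(\<lambda>x. u (s m) x - w k x) \<in> Lp p ?\<mu>" "Lp_norm p ?\<mu> (\<lambda>x. u (s m) x - w k x) \<le> e / 2"
        using half[OF that(1)] by auto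
      show ?thesis unfolding eq using Lp_norm_triangle[OF hm(1) d(1)] hm(2) d(2) p(1) by linarith
    qed
    then show ?thesis by blast
  qed
  have "\<exists>n0. \<forall>m\<ge>n0. \<forall>n\<ge>n0. Lp_norm r ?\<mu> (\<lambda>x. u (s m) x - u (s n) x) \<le> e"
    if r: "p \<le> r" "r < sobolev_exponent (real DIM('a)) p" and e: "e > 0" for r e
  proof -
    define r' where "r' = (r + sobolev_exponent (real DIM('a)) p) / 2"
    have r': "p \<le> r'" "r < r'" "r' < sobolev_exponent (real DIM('a)) p" using r by (auto simp: r'_def)
    have r0: "r > 0" "r' > 0" using r r' p0 by auto
    obtain C where C: "C > 0"
      "\<And>v. v \<in> test_functions U \<Longrightarrow> Lp_norm r' ?\<mu> v \<le> C * Lp_norm p ?\<mu> (grad v)"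
      using sobolev_inequality[OF p U r'(1,3)] by blast
    \<comment> \<open>By the Sobolev bound C (2 H) for differences, this makes the r'-part of the
      interpolation at most e^r / 2; e' does the same for the p-part.\<close>
    define \<epsilon> where "\<epsilon> = e powr r / (2 * (C * (2 * H)) powr r')"
    have eps: "\<epsilon> > 0" "\<epsilon> * (C * (2 * H)) powr r' = e powr r / 2" using e C(1) H(1) by (auto simp: \<epsilon>_def)
    define L where "L = (1 / \<epsilon>) powr ((r - p) / (r' - r)) + 1"
    have L: "L > 0" by (simp add: L_def add_nonneg_pos)
    define e' where "e' = (e powr r / (2 * L)) powr (1 / p)"
    have e': "e' > 0" "e' powr p = e powr r / (2 * L)" using e L p0 by (auto simp: e'_def powr_powr)
    obtain n0 where n0: "\<forall>m\<ge>n0. \<forall>n\<ge>n0. Lp_norm p ?\<mu> (\<lambda>x. u (s m) x - u (s n) x) \<le> e'"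
      using cauchy_p[OF e'(1)] by blast
    have "Lp_norm r ?\<mu> (\<lambda>x. u (s m) x - u (s n) x) \<le> e" if mn: "m \<ge> n0" "n \<ge> n0" for m n
    proof -
      let ?v = "\<lambda>x. u (s m) x - u (s n) x"
      have v: "?v \<in> test_functions U" by (rule test_functions_diff[OF u(1) u(1)])
      have "Lp_norm p ?\<mu> (grad ?v) \<le> 2 * H"
        using test_grad_diff_norm[OF u(1)[of "s m"] u(1)[of "s n"] U(2), of p] p(1) H(2)[of "s m"] H(2)[of "s n"] by linarith
      then have "Lp_norm r' ?\<mu> ?v \<le> C * (2 * H)"
        using C(2)[OF v] mult_left_mono[of _ "2 * H" C] C(1) by (meson less_imp_le order_trans)
      then have vr': "(LINT x|?\<mu>. norm (?v x) powr r') \<le> (C * (2 * H)) powr r'"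
        using C(1) H(1) r0 by (subst Lp_norm_le_iff[symmetric]) auto
      have "Lp_norm p ?\<mu> ?v \<le> e'" using n0 mn by blast
      then have vp: "(LINT x|?\<mu>. norm (?v x) powr p) \<le> e' powr p"
        using e'(1) p0 by (subst Lp_norm_le_iff[symmetric]) auto
      note int = LpD(2)[OF test_Lp(3)[OF v U(2)]]
      have "(LINT x|?\<mu>. norm (?v x) powr r) \<le> (LINT x|?\<mu>. \<epsilon> * norm (?v x) powr r' + L * norm (?v x) powr p)"
      proof (rule integral_mono)
        show "integrable ?\<mu> (\<lambda>x. norm (?v x) powr r)" by (rule int[OF r0(1)])
        show "integrable ?\<mu> (\<lambda>x. \<epsilon> * norm (?v x) powr r' + L * norm (?v x) powr p)"
          by (intro Bochner_Integration.integrable_add integrable_mult_right int r0 p0)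
        fix x
        have "norm (?v x) powr r \<le> \<epsilon> * norm (?v x) powr r' + (1 / \<epsilon>) powr ((r - p) / (r' - r)) * norm (?v x) powr p"
          using powr_interpolation[OF r(1) r'(2) norm_ge_zero eps(1)] .
        also have "\<dots> \<le> \<epsilon> * norm (?v x) powr r' + L * norm (?v x) powr p"
          unfolding L_def by (intro add_left_mono mult_right_mono) auto
        finally show "norm (?v x) powr r \<le> \<epsilon> * norm (?v x) powr r' + L * norm (?v x) powr p" .
      qed
      also have "\<dots> = \<epsilon> * (LINT x|?\<mu>. norm (?v x) powr r') + L * (LINT x|?\<mu>. norm (?v x) powr p)"
        using int[OF r0(2)] int[OF p0] by simp
      also have "\<dots> \<le> \<epsilon> * (C * (2 * H)) powr r' + L * e' powr p"
        using vr' vp eps(1) L by (intro add_mono mult_left_mono) auto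
      also have "\<dots> = e powr r" unfolding eps(2) e'(2) using L by simp
      finally show ?thesis using e r0 by (subst Lp_norm_le_iff) auto
    qed
    then show ?thesis by blast
  qed
  with s(1) show ?thesis by (rule that)
qed

section \<open>Caratheodory nonlinearities\<close>

lemma primitive_zero [simp]: "primitive h 0 = 0" by (simp add: primitive_def)

lemma primitive_has_derivative:
  assumes "continuous_on UNIV h"
  shows "(primitive h has_real_derivative h t) (at t)"
proof -
  define b where "b = \<bar>t\<bar> + 1"
  have b: "- b < t" "t < b" "- b \<le> 0" "0 \<le> b" by (auto simp: b_def)
  have "((\<lambda>u. LBINT y=ereal 0..ereal u. h y) has_vector_derivative h t) (at t within {-b..b})"
    using b continuous_on_subset[OF assms subset_UNIV] by (intro interval_integral_FTC2) auto
  then have "((\<lambda>u. primitive h u) has_vector_derivative h t) (at t)"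
    using b by (simp add: primitive_def at_within_Icc_at)
  then show ?thesis by (simp add: has_real_derivative_iff_has_vector_derivative)
qed

lemma primitive_continuous: "continuous_on UNIV h \<Longrightarrow> continuous_on A (primitive h)"
  using primitive_has_derivative by (intro DERIV_continuous_on) (blast intro: has_field_derivative_at_within)

lemma primitive_bound:
  assumes h: "continuous_on UNIV h" and bd: "\<And>\<tau>. \<bar>\<tau>\<bar> \<le> \<bar>t\<bar> \<Longrightarrow> \<bar>h \<tau>\<bar> \<le> B"
  shows "\<bar>primitive h t\<bar> \<le> B * \<bar>t\<bar>"
proof -
  have "norm (primitive h t - primitive h 0) \<le> B * norm (t - 0)"
  proof (rule differentiable_bound[of "closed_segment 0 t" "primitive h" "\<lambda>x d. h x * d"])
    show "(primitive h has_derivative (\<lambda>d. h x * d)) (at x within closed_segment 0 t)" for x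
      using primitive_has_derivative[OF h, of x] by (auto simp: has_field_derivative_def intro: has_derivative_at_withinI)
    show "onorm (\<lambda>d. h x * d) \<le> B" if "x \<in> closed_segment 0 t" for x
    proof (rule onorm_le)
      fix d :: real
      have "\<bar>x\<bar> \<le> \<bar>t\<bar>" using that by (auto simp: closed_segment_eq_real_ivl split: if_splits)
      then show "norm (h x * d) \<le> B * norm d" using bd by (simp add: abs_mult mult_right_mono)
    qed
  qed auto
  then show ?thesis by simp
qed

lemma primitive_cong_nonneg:
  assumes "t \<ge> 0" "\<And>\<tau>. \<tau> \<ge> 0 \<Longrightarrow> h \<tau> = g \<tau>"
  shows "primitive h t = primitive g t"
  unfolding primitive_def by (rule interval_integral_cong) (use assms in auto)

text \<open>Rounding u down to multiples of 1 / (n + 1) leaves countably many values, where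
  measurability for fixed t suffices; continuity in t gives the limit.\<close>

lemma caratheodory_comp:
  fixes f :: "'a \<Rightarrow> real \<Rightarrow> real"
  assumes meas: "\<And>t. (\<lambda>x. f x t) \<in> borel_measurable M"
    and cont: "\<And>x. x \<in> space M \<Longrightarrow> continuous_on UNIV (f x)"
    and u[measurable]: "u \<in> borel_measurable M"
  shows "(\<lambda>x. f x (u x)) \<in> borel_measurable M"
proof (rule borel_measurable_LIMSEQ_real)
  fix n :: nat
  show "(\<lambda>x. f x (of_int \<lfloor>real (Suc n) * u x\<rfloor> / real (Suc n))) \<in> borel_measurable M"
    by (rule measurable_compose_countable[where f = "\<lambda>i x. f x (of_int i / real (Suc n))"])
      (use meas in auto)
next
  fix x assume x: "x \<in> space M"
  have "(\<lambda>n. of_int \<lfloor>real (Suc n) * u x\<rfloor> / real (Suc n)) \<longlonglongrightarrow> u x"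
  proof (rule LIMSEQ_I)
    fix e :: real assume "e > 0"
    then obtain n0 where n0: "1 / real (Suc n0) < e" using nat_approx_posE by blast
    have "\<bar>of_int \<lfloor>real (Suc n) * u x\<rfloor> / real (Suc n) - u x\<bar> < e" if "n \<ge> n0" for n
    proof -
      have "\<bar>of_int \<lfloor>real (Suc n) * u x\<rfloor> / real (Suc n) - u x\<bar> = \<bar>of_int \<lfloor>real (Suc n) * u x\<rfloor> - real (Suc n) * u x\<bar> / real (Suc n)"
        by (simp add: field_simps abs_divide del: of_nat_Suc)
      also have "\<dots> \<le> 1 / real (Suc n)" by (intro divide_right_mono) linarith+
      also have "\<dots> \<le> 1 / real (Suc n0)" using that by (simp add: frac_le)
      finally show ?thesis using n0 by linarith
    qed
    then show "\<exists>n0. \<forall>n\<ge>n0. norm (of_int \<lfloor>real (Suc n) * u x\<rfloor> / real (Suc n) - u x) < e" by auto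
  qed
  moreover have "isCont (f x) (u x)" using cont[OF x] by (simp add: continuous_on_eq_continuous_at)
  ultimately show "(\<lambda>n. f x (of_int \<lfloor>real (Suc n) * u x\<rfloor> / real (Suc n))) \<longlonglongrightarrow> f x (u x)"
    using isCont_tendsto_compose by blast
qed

text \<open>\<open>caratheodory_comp\<close> on the product space, with the second coordinate in the
  role of u, yields joint measurability; integrating out that coordinate preserves
  measurability.\<close>

lemma primitive_measurable:
  fixes f :: "'a \<Rightarrow> real \<Rightarrow> real"
  assumes meas: "\<And>t. (\<lambda>x. f x t) \<in> borel_measurable M"
    and cont: "\<And>x. x \<in> space M \<Longrightarrow> continuous_on UNIV (f x)"
  shows "(\<lambda>x. primitive (f x) t) \<in> borel_measurable M"
proof -
  have joint: "(\<lambda>z. f (fst z) (snd z)) \<in> borel_measurable (M \<Otimes>\<^sub>M lborel)"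
  proof (rule caratheodory_comp[where f = "\<lambda>z. f (fst z)" and u = snd])
    show "(\<lambda>z. f (fst z) t) \<in> borel_measurable (M \<Otimes>\<^sub>M lborel)" for t
      by (rule measurable_compose[OF measurable_fst meas])
    show "continuous_on UNIV (f (fst z))" if "z \<in> space (M \<Otimes>\<^sub>M lborel)" for z
      using that cont by (auto simp: space_pair_measure)
    show "snd \<in> borel_measurable (M \<Otimes>\<^sub>M lborel)" using measurable_snd[of M lborel] by simp
  qed
  have int: "(\<lambda>x. \<integral>\<tau>. indicator A \<tau> * f x \<tau> \<partial>lborel) \<in> borel_measurable M" if A: "A \<in> sets borel" for A
  proof (rule lborel.borel_measurable_lebesgue_integral)
    have "(\<lambda>z. indicator A (snd z) * f (fst z) (snd z)) \<in> borel_measurable (M \<Otimes>\<^sub>M lborel)"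
    proof (intro borel_measurable_times joint)
      have "indicat_real A \<in> borel_measurable lborel" using A by simp
      from measurable_compose[OF measurable_snd this]
      show "(\<lambda>z. indicat_real A (snd z)) \<in> borel_measurable (M \<Otimes>\<^sub>M lborel)" .
    qed
    then show "(\<lambda>(x, \<tau>). indicator A \<tau> * f x \<tau>) \<in> borel_measurable (M \<Otimes>\<^sub>M lborel)" by (simp add: case_prod_beta')
  qed
  show ?thesis using int[of "{0<..<t}"] int[of "{t<..<0}"]
    by (cases "0 \<le> t") (auto simp: primitive_def interval_lebesgue_integral_def set_lebesgue_integral_def zero_ereal_def)
qed

text \<open>Dominated convergence with a moving majorant: hn \<le> min hn A + Bn, where the first
  part has the fixed majorant A and the second tends to 0 in mean.\<close>

lemma integral_tendsto_0_dominated: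
  fixes h A :: "_ \<Rightarrow> real"
  assumes h[measurable]: "\<And>n. hn n \<in> borel_measurable M" and h0: "\<And>n x. hn n x \<ge> 0"
    and lim: "AE x in M. (\<lambda>n. hn n x) \<longlonglongrightarrow> 0"
    and A: "integrable M A" "\<And>x. A x \<ge> 0" and B: "\<And>n. integrable M (Bn n)" "\<And>n x. Bn n x \<ge> 0"
    and le: "\<And>n. AE x in M. hn n x \<le> A x + Bn n x" and B0: "(\<lambda>n. LINT x|M. Bn n x) \<longlonglongrightarrow> 0"
  shows "(\<lambda>n. LINT x|M. hn n x) \<longlonglongrightarrow> 0"
proof -
  have [measurable]: "A \<in> borel_measurable M" using A by auto
  have int: "integrable M (hn n)" for n
  proof (rule Bochner_Integration.integrable_bound)
    show "integrable M (\<lambda>x. A x + Bn n x)" using A B by simp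
    show "AE x in M. norm (hn n x) \<le> norm (A x + Bn n x)"
      using le[of n] by eventually_elim (use h0 A(2) B(2) in \<open>simp add: abs_of_nonneg\<close>)
  qed simp
  have mint: "integrable M (\<lambda>x. min (hn n x) (A x))" for n
    by (rule Bochner_Integration.integrable_bound[OF A(1)]) (use h0 A(2) in \<open>auto simp: abs_of_nonneg\<close>)
  have "(\<lambda>n. LINT x|M. min (hn n x) (A x)) \<longlonglongrightarrow> (LINT x|M. 0)"
  proof (rule integral_dominated_convergence[where w = A])
    show "AE x in M. (\<lambda>n. min (hn n x) (A x)) \<longlonglongrightarrow> 0" using lim
    proof eventually_elim
      fix x assume "(\<lambda>n. hn n x) \<longlonglongrightarrow> 0"
      then have "(\<lambda>n. min (hn n x) (A x)) \<longlonglongrightarrow> min 0 (A x)" by (intro tendsto_min tendsto_const)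
      then show "(\<lambda>n. min (hn n x) (A x)) \<longlonglongrightarrow> 0" using A(2)[of x] by simp
    qed
    show "AE x in M. norm (min (hn n x) (A x)) \<le> A x" for n
      using h0 A(2) by (intro AE_I2) (simp add: abs_of_nonneg)
  qed (use A in auto)
  then have m0: "(\<lambda>n. (LINT x|M. min (hn n x) (A x)) + (LINT x|M. Bn n x)) \<longlonglongrightarrow> 0 + 0" using B0 by (intro tendsto_add) auto
  show ?thesis
  proof (rule tendsto_sandwich[OF _ _ tendsto_const])
    show "\<forall>\<^sub>F n in sequentially. 0 \<le> (LINT x|M. hn n x)" using h0 by (auto intro!: always_eventually integral_nonneg_AE)
    show "\<forall>\<^sub>F n in sequentially. (LINT x|M. hn n x) \<le> (LINT x|M. min (hn n x) (A x)) + (LINT x|M. Bn n x)"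
    proof (intro always_eventually allI)
      fix n
      have "(LINT x|M. hn n x) \<le> (LINT x|M. min (hn n x) (A x) + Bn n x)"
      proof (rule integral_mono_AE)
        show "integrable M (\<lambda>x. min (hn n x) (A x) + Bn n x)" using mint B by simp
        show "AE x in M. hn n x \<le> min (hn n x) (A x) + Bn n x"
          using le[of n] by eventually_elim (use B(2) in \<open>auto simp: min_def\<close>)
      qed (rule int)
      also have "\<dots> = (LINT x|M. min (hn n x) (A x)) + (LINT x|M. Bn n x)" using mint B by simp
      finally show "(LINT x|M. hn n x) \<le> (LINT x|M. min (hn n x) (A x)) + (LINT x|M. Bn n x)" .
    qed
  qed (use m0 in simp)
qed

text \<open>Growth of order r - 1 sends L^r into its dual, so f(u) can be paired with L^r functions.
  The conditions hold at every point; \<open>theorem1p3\<close> arranges this by changing f on a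
  null set.\<close>

locale caratheodory_growth = finite_measure M for M :: "'a measure" +
  fixes f :: "'a \<Rightarrow> real \<Rightarrow> real" and c r :: real
  assumes f_meas: "\<And>t. (\<lambda>x. f x t) \<in> borel_measurable M"
    and f_cont: "\<And>x. x \<in> space M \<Longrightarrow> continuous_on UNIV (f x)"
    and r: "r > 1" and c: "c \<ge> 0"
    and growth: "\<And>x t. x \<in> space M \<Longrightarrow> \<bar>f x t\<bar> \<le> c * (1 + \<bar>t\<bar> powr (r - 1))"
begin

abbreviation "r' \<equiv> r / (r - 1)"

lemma r': "r' > 1" "r' > 0" "r' > 0" "(r - 1) * r' = r" using r by (auto simp: field_simps)

lemma f_comp [measurable]: "u \<in> borel_measurable M \<Longrightarrow> (\<lambda>x. f x (u x)) \<in> borel_measurable M"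
  by (rule caratheodory_comp[OF f_meas f_cont])

lemma F_comp [measurable]: "u \<in> borel_measurable M \<Longrightarrow> (\<lambda>x. primitive (f x) (u x)) \<in> borel_measurable M"
  by (rule caratheodory_comp[OF primitive_measurable[OF f_meas f_cont] primitive_continuous[OF f_cont]])

lemma F_growth:
  assumes "x \<in> space M"
  shows "\<bar>primitive (f x) t\<bar> \<le> 2 * c * (1 + \<bar>t\<bar> powr r)"
proof -
  have "\<bar>primitive (f x) t\<bar> \<le> c * (1 + \<bar>t\<bar> powr (r - 1)) * \<bar>t\<bar>"
  proof (rule primitive_bound[OF f_cont[OF assms]])
    fix \<tau> :: real assume "\<bar>\<tau>\<bar> \<le> \<bar>t\<bar>"
    then have "\<bar>\<tau>\<bar> powr (r - 1) \<le> \<bar>t\<bar> powr (r - 1)" using r by (intro powr_mono2) auto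
    then show "\<bar>f x \<tau>\<bar> \<le> c * (1 + \<bar>t\<bar> powr (r - 1))"
      using growth[OF assms, of \<tau>] c by (meson add_left_mono mult_left_mono order_trans)
  qed
  also have "\<dots> = c * (\<bar>t\<bar> + \<bar>t\<bar> powr r)" using powr_mult_base[of "\<bar>t\<bar>" "r - 1"] by (simp add: algebra_simps)
  also have "\<dots> \<le> c * (2 * (1 + \<bar>t\<bar> powr r))"
  proof (intro mult_left_mono c)
    have "\<bar>t\<bar> \<le> 1 + \<bar>t\<bar> powr r"
    proof (cases "\<bar>t\<bar> \<le> 1")
      case False
      then have "\<bar>t\<bar> powr 1 \<le> \<bar>t\<bar> powr r" using r by (intro powr_mono) auto
      then show ?thesis by simp
    qed (simp add: add_increasing2)
    moreover have "a + b \<le> 2 * (1 + b)" if "a \<le> 1 + b" "0 \<le> b" for a b :: real using that by simp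
    ultimately show "\<bar>t\<bar> + \<bar>t\<bar> powr r \<le> 2 * (1 + \<bar>t\<bar> powr r)" using powr_ge_zero by blast
  qed
  finally show ?thesis by (simp add: algebra_simps)
qed

lemma growth_powr:
  assumes "x \<in> space M"
  shows "\<bar>f x t\<bar> powr r' \<le> (2 * c) powr r' * (1 + \<bar>t\<bar> powr r)"
proof -
  have "\<bar>f x t\<bar> powr r' \<le> (c * (1 + \<bar>t\<bar> powr (r - 1))) powr r'"
    using growth[OF assms] r' by (intro powr_mono2) auto
  also have "\<dots> = c powr r' * (1 + \<bar>t\<bar> powr (r - 1)) powr r'" by (simp add: powr_mult)
  also have "\<dots> \<le> c powr r' * (2 powr r' * (1 powr r' + (\<bar>t\<bar> powr (r - 1)) powr r'))"
    using r' by (intro mult_left_mono powr_add_le) auto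
  also have "\<dots> = (2 * c) powr r' * (1 + \<bar>t\<bar> powr r)" using r' by (simp add: powr_mult powr_powr)
  finally show ?thesis .
qed

lemma f_Lp:
  assumes u: "u \<in> Lp r M"
  shows "(\<lambda>x. f x (u x)) \<in> Lp r' M"
proof -
  note [measurable] = LpD(1)[OF u]
  have "integrable M (\<lambda>x. norm (f x (u x)) powr r')"
  proof (rule Bochner_Integration.integrable_bound)
    show "integrable M (\<lambda>x. (2 * c) powr r' * (1 + norm (u x) powr r))"
      using LpD(2)[OF u] by (intro integrable_mult_right Bochner_Integration.integrable_add) auto
    show "AE x in M. norm (norm (f x (u x)) powr r') \<le> norm ((2 * c) powr r' * (1 + norm (u x) powr r))"
      using growth_powr by (intro AE_I2) (simp add: abs_mult)
  qed simp
  then show ?thesis by (auto simp: Lp_def)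
qed

lemma F_integrable:
  assumes u: "u \<in> Lp r M"
  shows "integrable M (\<lambda>x. primitive (f x) (u x))"
proof -
  note [measurable] = LpD(1)[OF u]
  show ?thesis
  proof (rule Bochner_Integration.integrable_bound)
    show "integrable M (\<lambda>x. 2 * c * (1 + norm (u x) powr r))"
      using LpD(2)[OF u] by (intro integrable_mult_right Bochner_Integration.integrable_add) auto
    show "AE x in M. norm (primitive (f x) (u x)) \<le> norm (2 * c * (1 + norm (u x) powr r))"
      using F_growth c by (intro AE_I2) (simp add: abs_mult)
  qed simp
qed

text \<open>Convergence in L^r is pointwise only along a subsequence. The bound |un|^r \<le> 2^r
  (|un - u|^r + |u|^r) then gives a majorant that is a fixed integrable function plus one tending to
  0 in mean.\<close>

lemma nemytskii:
  assumes un: "\<And>n. un n \<in> Lp r M" and u: "u \<in> Lp r M"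
    and lim: "Lp_lim r M un u"
  obtains s :: "nat \<Rightarrow> nat" where "strict_mono s"
    "(\<lambda>n. Lp_norm r' M (\<lambda>x. f x (un (s n) x) - f x (u x))) \<longlonglongrightarrow> 0"
    "(\<lambda>n. LINT x|M. primitive (f x) (un (s n) x)) \<longlonglongrightarrow> (LINT x|M. primitive (f x) (u x))"
proof -
  have r0: "r > 0" using r by simp
  obtain s :: "nat \<Rightarrow> nat" where s: "strict_mono s" "AE x in M. (\<lambda>n. un (s n) x) \<longlonglongrightarrow> u x"
    using Lp_convergent_AE_subseq[OF un u r0 lim] by blast
  note [measurable] = LpD(1)[OF un] LpD(1)[OF u]
  let ?d = "\<lambda>n x. norm (un (s n) x - u x) powr r" and ?v = "\<lambda>x. norm (u x) powr r"
  have d0: "(\<lambda>n. LINT x|M. ?d n x) \<longlonglongrightarrow> 0"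
    using LIMSEQ_subseq_LIMSEQ[OF lim[unfolded Lp_norm_tendsto_zero_iff[OF r0]] s(1)] by (simp add: o_def)
  have dint: "integrable M (?d n)" for n using LpD(2)[OF Lp_diff[OF un u r0]] .
  have vint: "integrable M ?v" using LpD(2)[OF u] .
  have split: "norm (un (s n) x) powr r \<le> 2 powr r * (?d n x + ?v x)" for n x
  proof -
    have "norm (un (s n) x) powr r \<le> (norm (un (s n) x - u x) + norm (u x)) powr r"
      using norm_triangle_ineq[of "un (s n) x - u x" "u x"] r0 by (intro powr_mono2) auto
    also have "\<dots> \<le> 2 powr r * (?d n x + ?v x)" using r0 by (intro powr_add_le) auto
    finally show ?thesis .
  qed
  have contf: "isCont (f x) t" "isCont (primitive (f x)) t" if "x \<in> space M" for x t
    using f_cont[OF that] primitive_continuous[OF f_cont[OF that], of UNIV] by (auto simp: continuous_on_eq_continuous_at)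
  have dominated: "(\<lambda>n. LINT x|M. h n x) \<longlonglongrightarrow> 0"
    if h: "\<And>n. h n \<in> borel_measurable M" "\<And>n x. h n x \<ge> 0" and K: "K \<ge> 0"
      and lim: "\<And>x. x \<in> space M \<Longrightarrow> (\<lambda>n. un (s n) x) \<longlonglongrightarrow> u x \<Longrightarrow> (\<lambda>n. h n x) \<longlonglongrightarrow> 0"
      and le: "\<And>n x. x \<in> space M \<Longrightarrow> h n x \<le> K * (2 + norm (un (s n) x) powr r + ?v x)" for h :: "nat \<Rightarrow> 'a \<Rightarrow> real" and K
  proof (rule integral_tendsto_0_dominated[OF h])
    show "AE x in M. (\<lambda>n. h n x) \<longlonglongrightarrow> 0" using s(2) AE_space by eventually_elim (rule lim)
    show "integrable M (\<lambda>x. K * (2 + (2 powr r + 1) * ?v x))"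
      using vint by (intro integrable_mult_right Bochner_Integration.integrable_add) auto
    show "integrable M (\<lambda>x. K * 2 powr r * ?d n x)" for n using dint by (intro integrable_mult_right)
    show "(\<lambda>n. LINT x|M. K * 2 powr r * ?d n x) \<longlonglongrightarrow> 0" using tendsto_mult[OF tendsto_const[of "K * 2 powr r"] d0] by simp
    show "AE x in M. h n x \<le> K * (2 + (2 powr r + 1) * ?v x) + K * 2 powr r * ?d n x" for n
    proof (rule AE_I2)
      fix x assume "x \<in> space M"
      then have "h n x \<le> K * (2 + norm (un (s n) x) powr r + ?v x)" by (rule le)
      also have "\<dots> \<le> K * (2 + 2 powr r * (?d n x + ?v x) + ?v x)" using split K by (intro mult_left_mono add_mono) auto
      finally show "h n x \<le> K * (2 + (2 powr r + 1) * ?v x) + K * 2 powr r * ?d n x" by (simp add: algebra_simps)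
    qed
  qed (use K in auto)
  have "(\<lambda>n. Lp_int r' M (\<lambda>x. f x (un (s n) x) - f x (u x))) \<longlonglongrightarrow> 0"
  proof (rule dominated)
    fix n x assume x: "x \<in> space M"
    show "(\<lambda>n. norm (f x (un (s n) x) - f x (u x)) powr r') \<longlonglongrightarrow> 0" if lim: "(\<lambda>n. un (s n) x) \<longlonglongrightarrow> u x"
    proof -
      have "(\<lambda>n. f x (un (s n) x) - f x (u x)) \<longlonglongrightarrow> 0" by (rule LIM_zero[OF isCont_tendsto_compose[OF contf(1)[OF x] lim]])
      then have "(\<lambda>n. norm (f x (un (s n) x) - f x (u x)) powr r') \<longlonglongrightarrow> 0 powr r'"
        using r' by (intro tendsto_powr' tendsto_norm_zero tendsto_const) auto
      then show ?thesis by simp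
    qed
    have "norm (f x (un (s n) x) - f x (u x)) powr r' \<le> (\<bar>f x (un (s n) x)\<bar> + \<bar>f x (u x)\<bar>) powr r'"
      using r' by (intro powr_mono2) auto
    also have "\<dots> \<le> 2 powr r' * (\<bar>f x (un (s n) x)\<bar> powr r' + \<bar>f x (u x)\<bar> powr r')" using r' by (intro powr_add_le) auto
    also have "\<dots> \<le> 2 powr r' * ((2 * c) powr r' * (1 + \<bar>un (s n) x\<bar> powr r) + (2 * c) powr r' * (1 + \<bar>u x\<bar> powr r))"
      using growth_powr[OF x] by (intro mult_left_mono add_mono) auto
    also have "\<dots> = 2 powr r' * (2 * c) powr r' * (2 + norm (un (s n) x) powr r + ?v x)" by (simp add: algebra_simps)
    finally show "norm (f x (un (s n) x) - f x (u x)) powr r' \<le> 2 powr r' * (2 * c) powr r' * (2 + norm (un (s n) x) powr r + ?v x)" .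
  qed auto
  then have 1: "(\<lambda>n. Lp_norm r' M (\<lambda>x. f x (un (s n) x) - f x (u x))) \<longlonglongrightarrow> 0"
    using r' by (simp add: Lp_norm_tendsto_zero_iff)
  have "(\<lambda>n. LINT x|M. \<bar>primitive (f x) (un (s n) x) - primitive (f x) (u x)\<bar>) \<longlonglongrightarrow> 0"
  proof (rule dominated)
    fix n x assume x: "x \<in> space M"
    show "(\<lambda>n. \<bar>primitive (f x) (un (s n) x) - primitive (f x) (u x)\<bar>) \<longlonglongrightarrow> 0" if lim: "(\<lambda>n. un (s n) x) \<longlonglongrightarrow> u x"
      by (rule tendsto_rabs_zero[OF LIM_zero[OF isCont_tendsto_compose[OF contf(2)[OF x] lim]]])
    have "\<bar>primitive (f x) (un (s n) x) - primitive (f x) (u x)\<bar> \<le> 2 * c * (1 + norm (un (s n) x) powr r) + 2 * c * (1 + ?v x)"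
      using F_growth[OF x, of "un (s n) x"] F_growth[OF x, of "u x"] by simp
    also have "\<dots> = 2 * c * (2 + norm (un (s n) x) powr r + ?v x)" by (simp add: algebra_simps)
    finally show "\<bar>primitive (f x) (un (s n) x) - primitive (f x) (u x)\<bar> \<le> 2 * c * (2 + norm (un (s n) x) powr r + ?v x)" .
  qed (use c in auto)
  then have "(\<lambda>n. LINT x|M. primitive (f x) (un (s n) x) - primitive (f x) (u x)) \<longlonglongrightarrow> 0"
    by (rule Lim_null_comparison[rotated]) (simp add: integral_abs_bound)
  then have 2: "(\<lambda>n. LINT x|M. primitive (f x) (un (s n) x)) \<longlonglongrightarrow> (LINT x|M. primitive (f x) (u x))"
    using F_integrable[OF un] F_integrable[OF u] by (simp add: LIM_zero_iff)
  show ?thesis using s(1) 1 2 by (rule that)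
qed

end

section \<open>The energy functional\<close>

text \<open>On a finite measure space a constant majorant of the derivative near \<open>t0\<close>
  is integrable; bounded test functions with bounded gradients provide such constants.\<close>

lemma integral_has_derivative:
  fixes g g' :: "real \<Rightarrow> 'a \<Rightarrow> real"
  assumes M: "finite_measure M" and meas: "\<And>t. g t \<in> borel_measurable M" "\<And>t. g' t \<in> borel_measurable M"
    and int: "\<And>t. integrable M (g t)"
    and der: "\<And>x t. x \<in> space M \<Longrightarrow> ((\<lambda>t. g t x) has_real_derivative g' t x) (at t)"
    and bd: "\<And>x t. x \<in> space M \<Longrightarrow> \<bar>t - t0\<bar> \<le> 1 \<Longrightarrow> \<bar>g' t x\<bar> \<le> B"
  shows "((\<lambda>t. LINT x|M. g t x) has_real_derivative (LINT x|M. g' t0 x)) (at t0)"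
proof -
  interpret finite_measure M by (rule M)
  note [measurable] = meas
  have "((\<lambda>h. ((LINT x|M. g (t0 + h) x) - (LINT x|M. g t0 x)) / h) \<longlongrightarrow> (LINT x|M. g' t0 x)) (at 0)"
    unfolding tendsto_at_iff_sequentially comp_def
  proof (intro allI impI)
    fix h :: "nat \<Rightarrow> real" assume h: "\<forall>n. h n \<in> UNIV - {0}" and h0: "h \<longlonglongrightarrow> 0"
    have hn: "h n \<noteq> 0" for n using h by simp
    have "\<forall>\<^sub>F n in sequentially. \<bar>h n\<bar> < 1" using order_tendstoD(2)[OF tendsto_rabs[OF h0], of 1] by simp
    then obtain n0 where n0: "\<And>n. n \<ge> n0 \<Longrightarrow> \<bar>h n\<bar> < 1" by (auto simp: eventually_sequentially)
    let ?k = "\<lambda>n. h (n + n0)"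
    have "(\<lambda>n. LINT x|M. (g (t0 + ?k n) x - g t0 x) / ?k n) \<longlonglongrightarrow> (LINT x|M. g' t0 x)"
    proof (rule integral_dominated_convergence)
      show "integrable M (\<lambda>x. B)" by simp
      show "AE x in M. (\<lambda>n. (g (t0 + ?k n) x - g t0 x) / ?k n) \<longlonglongrightarrow> g' t0 x"
      proof (rule AE_I2)
        fix x assume "x \<in> space M"
        then have "((\<lambda>h. (g (t0 + h) x - g t0 x) / h) \<longlongrightarrow> g' t0 x) (at 0)" using der by (simp add: DERIV_def)
        moreover have "filterlim ?k (at 0) sequentially"
          using LIMSEQ_ignore_initial_segment[OF h0, of n0] hn by (simp add: filterlim_at)
        ultimately show "(\<lambda>n. (g (t0 + ?k n) x - g t0 x) / ?k n) \<longlonglongrightarrow> g' t0 x" by (rule filterlim_compose)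
      qed
      show "AE x in M. norm ((g (t0 + ?k n) x - g t0 x) / ?k n) \<le> B" for n
      proof (rule AE_I2)
        fix x assume x: "x \<in> space M"
        have k1: "\<bar>?k n\<bar> < 1" using n0[of "n + n0"] by simp
        have "norm (g (t0 + ?k n) x - g t0 x) \<le> B * norm ((t0 + ?k n) - t0)"
        proof (rule differentiable_bound[of "cball t0 1" "\<lambda>t. g t x" "\<lambda>t d. g' t x * d"])
          show "((\<lambda>t. g t x) has_derivative (\<lambda>d. g' t x * d)) (at t within cball t0 1)" for t
            using der[OF x, of t] by (auto simp: has_field_derivative_def intro: has_derivative_at_withinI)
          show "onorm (\<lambda>d. g' t x * d) \<le> B" if "t \<in> cball t0 1" for t
            using bd[OF x, of t] that by (intro onorm_le) (auto simp: abs_mult dist_real_def abs_minus_commute mult_right_mono)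
        qed (use k1 in \<open>auto simp: dist_real_def\<close>)
        then show "norm ((g (t0 + ?k n) x - g t0 x) / ?k n) \<le> B"
          using hn[of "n + n0"] by (simp add: abs_divide divide_le_eq)
      qed
    qed auto
    then have "(\<lambda>n. ((LINT x|M. g (t0 + ?k n) x) - (LINT x|M. g t0 x)) / ?k n) \<longlonglongrightarrow> (LINT x|M. g' t0 x)" using int by simp
    then show "(\<lambda>n. ((LINT x|M. g (t0 + h n) x) - (LINT x|M. g t0 x)) / h n) \<longlonglongrightarrow> (LINT x|M. g' t0 x)" by (rule LIMSEQ_offset)
  qed
  then show ?thesis by (simp add: DERIV_def)
qed

text \<open>At the origin s > 1 makes |h|^s / |h| tend to 0; elsewhere the chain rule
  applies.\<close>

lemma norm_powr_has_derivative:
  fixes v :: "'b::euclidean_space"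
  assumes s: "s > 1"
  shows "((\<lambda>v. norm v powr s) has_derivative (\<lambda>h. s * (pw s v \<bullet> h))) (at v)"
proof (cases "v = 0")
  case True
  have "((\<lambda>h::'b. norm h powr (s - 1)) \<longlongrightarrow> 0) (at 0)" by (rule tendsto_eq_intros refl | use s in force)+
  then have "((\<lambda>h::'b. norm (norm h powr s) / norm h) \<longlongrightarrow> 0) (at 0)"
  proof (rule Lim_transform_eventually)
    show "\<forall>\<^sub>F h::'b in at 0. norm h powr (s - 1) = norm (norm h powr s) / norm h"
      by (auto simp: eventually_at_filter powr_diff)
  qed
  then show ?thesis unfolding True by (simp add: has_derivative_at bounded_linear_zero)
next
  case False
  have n: "(norm has_derivative (\<lambda>h. h \<bullet> sgn v)) (at v)" by (rule has_derivative_norm[OF False])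
  have "((\<lambda>t. t powr s) has_real_derivative s * norm v powr (s - 1)) (at (norm v))"
    using False by (intro has_real_derivative_powr) simp
  from has_derivative_compose[OF n this[unfolded has_field_derivative_def]]
  have "((\<lambda>v. norm v powr s) has_derivative (\<lambda>h. s * norm v powr (s - 1) * (h \<bullet> sgn v))) (at v)" .
  moreover have "s * norm v powr (s - 1) * (h \<bullet> sgn v) = s * (pw s v \<bullet> h)" for h
    using False by (simp add: pw_def powr_diff power2_eq_square sgn_div_norm inner_commute[of h] field_simps)
  ultimately show ?thesis by simp
qed

lemma continuous_bounded_interval:
  fixes g :: "real \<Rightarrow> real"
  assumes "continuous_on {a..b} g"
  obtains K where "K \<ge> 0" "\<And>t. a \<le> t \<Longrightarrow> t \<le> b \<Longrightarrow> \<bar>g t\<bar> \<le> K"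
proof -
  have "bounded (g ` {a..b})" using assms by (intro compact_imp_bounded compact_continuous_image) auto
  then obtain K where K: "\<forall>y\<in>g ` {a..b}. norm y \<le> K" by (auto simp: bounded_iff)
  show ?thesis
  proof (rule that[of "max K 0"])
    fix t assume "a \<le> t" "t \<le> b"
    then have "norm (g t) \<le> K" using K by simp
    then show "\<bar>g t\<bar> \<le> max K 0" by simp
  qed simp
qed

lemma integral_norm_powr_has_derivative:
  fixes V W :: "'a \<Rightarrow> 'b::euclidean_space"
  assumes M: "finite_measure M" and s: "s > 1" and V[measurable]: "V \<in> borel_measurable M" and W[measurable]: "W \<in> borel_measurable M"
    and bd: "\<And>x. x \<in> space M \<Longrightarrow> norm (V x) \<le> B" "\<And>x. x \<in> space M \<Longrightarrow> norm (W x) \<le> B"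
  shows "((\<lambda>t. Lp_int s M (\<lambda>x. V x + t *\<^sub>R W x)) has_real_derivative s * (LINT x|M. pw s (V x + t0 *\<^sub>R W x) \<bullet> W x)) (at t0)"
proof -
  interpret finite_measure M by (rule M)
  define C where "C = \<bar>B\<bar> + (\<bar>t0\<bar> + 1) * \<bar>B\<bar>"
  have le: "norm (V x + t *\<^sub>R W x) \<le> \<bar>B\<bar> + \<bar>t\<bar> * \<bar>B\<bar>" if "x \<in> space M" for x t
  proof -
    have "norm (V x + t *\<^sub>R W x) \<le> norm (V x) + \<bar>t\<bar> * norm (W x)" using norm_triangle_ineq[of "V x" "t *\<^sub>R W x"] by simp
    also have "\<dots> \<le> \<bar>B\<bar> + \<bar>t\<bar> * \<bar>B\<bar>" using bd[OF that] by (intro add_mono mult_left_mono) auto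
    finally show ?thesis .
  qed
  have "((\<lambda>t. Lp_int s M (\<lambda>x. V x + t *\<^sub>R W x)) has_real_derivative (LINT x|M. s * (pw s (V x + t0 *\<^sub>R W x) \<bullet> W x))) (at t0)"
  proof (rule integral_has_derivative[OF M, where B = "s * (C powr (s - 1) * \<bar>B\<bar>)"])
    show "integrable M (\<lambda>x. norm (V x + t *\<^sub>R W x) powr s)" for t
    proof (rule integrable_const_bound)
      show "AE x in M. norm (norm (V x + t *\<^sub>R W x) powr s) \<le> (\<bar>B\<bar> + \<bar>t\<bar> * \<bar>B\<bar>) powr s"
        using le s by (intro AE_I2) (simp add: powr_mono2)
    qed simp
    show "((\<lambda>t. norm (V x + t *\<^sub>R W x) powr s) has_real_derivative s * (pw s (V x + t *\<^sub>R W x) \<bullet> W x)) (at t)" for x t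
    proof -
      have "((\<lambda>t. V x + t *\<^sub>R W x) has_derivative (\<lambda>h. h *\<^sub>R W x)) (at t)" by (auto intro!: derivative_eq_intros)
      from has_derivative_compose[OF this norm_powr_has_derivative[OF s]]
      show ?thesis by (simp add: has_field_derivative_def mult.left_commute mult_commute_abs)
    qed
    show "\<bar>s * (pw s (V x + t *\<^sub>R W x) \<bullet> W x)\<bar> \<le> s * (C powr (s - 1) * \<bar>B\<bar>)" if x: "x \<in> space M" and t: "\<bar>t - t0\<bar> \<le> 1" for x t
    proof -
      have "\<bar>t\<bar> \<le> \<bar>t0\<bar> + 1" using t by linarith
      then have "\<bar>t\<bar> * \<bar>B\<bar> \<le> (\<bar>t0\<bar> + 1) * \<bar>B\<bar>" by (intro mult_right_mono) auto
      then have C: "norm (V x + t *\<^sub>R W x) \<le> C" using le[OF x, of t] by (simp add: C_def)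
      have "\<bar>pw s (V x + t *\<^sub>R W x) \<bullet> W x\<bar> \<le> norm (pw s (V x + t *\<^sub>R W x)) * norm (W x)" by (rule Cauchy_Schwarz_ineq2)
      also have "\<dots> \<le> C powr (s - 1) * \<bar>B\<bar>"
        unfolding norm_pw using C bd(2)[OF x] s by (intro mult_mono powr_mono2) auto
      finally show ?thesis using s by (simp add: abs_mult)
    qed
  qed measurable
  then show ?thesis by simp
qed

text \<open>One phase of the operator in abstract form. It is used with p and the gradient, and with
  q and the weighted gradient, over the same measure.\<close>

locale kirchhoff_term =
  fixes \<mu> :: "'a measure" and M :: "real \<Rightarrow> real" and s :: real
  assumes s: "s > 1" and M_cont: "continuous_on UNIV M" and M_nonneg: "\<And>t. M t \<ge> 0"
begin

definition form :: "('a \<Rightarrow> 'b::euclidean_space) \<Rightarrow> ('a \<Rightarrow> 'b) \<Rightarrow> real" where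
  "form V W = M (Lp_int s \<mu> V) * (LINT x|\<mu>. pw s (V x) \<bullet> W x)"

lemma s': "s > 0" "s \<ge> 1" "s / (s - 1) > 0" using s by auto

lemma integrable_pw:
  assumes "V \<in> Lp s \<mu>" "W \<in> Lp s \<mu>"
  shows "integrable \<mu> (\<lambda>x. pw s (V x) \<bullet> W x)" by (rule Holder_inner(1)[OF assms(2) pw_Lp[OF assms(1) s] s])

lemma form_add:
  assumes "V \<in> Lp s \<mu>" "W \<in> Lp s \<mu>" "Z \<in> Lp s \<mu>"
  shows "form V (\<lambda>x. W x + Z x) = form V W + form V Z"
  using integrable_pw[OF assms(1,2)] integrable_pw[OF assms(1,3)]
  by (simp add: form_def inner_add_right distrib_left)

lemma form_scale: "form V (\<lambda>x. c *\<^sub>R W x) = c * form V W" by (simp add: form_def mult.left_commute)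

lemma form_bounded:
  obtains C where "C \<ge> 0"
    "\<And>V W :: 'a \<Rightarrow> 'b::euclidean_space. V \<in> Lp s \<mu> \<Longrightarrow> W \<in> Lp s \<mu> \<Longrightarrow> Lp_norm s \<mu> V \<le> R \<Longrightarrow> \<bar>form V W\<bar> \<le> C * Lp_norm s \<mu> W"
proof -
  obtain K where K0: "K \<ge> 0" and K: "\<And>t. 0 \<le> t \<Longrightarrow> t \<le> \<bar>R\<bar> powr s \<Longrightarrow> \<bar>M t\<bar> \<le> K"
    using continuous_bounded_interval[OF continuous_on_subset[OF M_cont subset_UNIV]] by blast
  show ?thesis
  proof (rule that[of "K * \<bar>R\<bar> powr (s - 1)"])
    fix V W :: "'a \<Rightarrow> 'b" assume V: "V \<in> Lp s \<mu>" and W: "W \<in> Lp s \<mu>" and R: "Lp_norm s \<mu> V \<le> R"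
    have "R \<ge> 0" using R Lp_norm_nonneg order_trans by blast
    then have "Lp_int s \<mu> V \<le> \<bar>R\<bar> powr s" using R s' by (simp add: Lp_norm_le_iff)
    then have MK: "M (Lp_int s \<mu> V) \<le> K" using K[of "Lp_int s \<mu> V"] by (simp add: integral_nonneg_AE)
    have "\<bar>form V W\<bar> = M (Lp_int s \<mu> V) * \<bar>LINT x|\<mu>. pw s (V x) \<bullet> W x\<bar>" by (simp add: form_def abs_mult M_nonneg)
    also have "\<dots> \<le> K * (Lp_norm s \<mu> V powr (s - 1) * Lp_norm s \<mu> W)"
      using MK K0 Holder_inner(2)[OF W pw_Lp[OF V s] s] by (intro mult_mono) (auto simp: Lp_norm_pw[OF s])
    also have "\<dots> \<le> K * (\<bar>R\<bar> powr (s - 1) * Lp_norm s \<mu> W)"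
      using R K0 s by (intro mult_left_mono mult_right_mono powr_mono2) auto
    finally show "\<bar>form V W\<bar> \<le> K * \<bar>R\<bar> powr (s - 1) * Lp_norm s \<mu> W" by (simp add: mult.assoc)
  qed (use K0 in simp)
qed

text \<open>k x - k' x' = k (x - x') + (k - k') x': the first term is small by uniform continuity of
  the flux, the second by uniform continuity of t \<mapsto> M(t^s) on a compact interval of
  norms.\<close>

lemma form_uniformly_continuous:
  assumes e: "e > 0"
  obtains \<eta> where "\<eta> > 0"
    "\<And>V V' W :: 'a \<Rightarrow> 'b::euclidean_space. V \<in> Lp s \<mu> \<Longrightarrow> V' \<in> Lp s \<mu> \<Longrightarrow> W \<in> Lp s \<mu> \<Longrightarrow> Lp_norm s \<mu> V \<le> R \<Longrightarrow> Lp_norm s \<mu> V' \<le> R \<Longrightarrow>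
       Lp_norm s \<mu> (\<lambda>x. V x - V' x) \<le> \<eta> \<Longrightarrow> \<bar>form V W - form V' W\<bar> \<le> e * Lp_norm s \<mu> W"
proof -
  define m where "m t = M (t powr s)" for t
  have mc: "continuous_on {0..\<bar>R\<bar>} m" unfolding m_def using s'
    by (intro continuous_on_compose2[OF M_cont] continuous_on_powr' continuous_intros) auto
  obtain K where K0: "K \<ge> 0" and K: "\<And>t. 0 \<le> t \<Longrightarrow> t \<le> \<bar>R\<bar> \<Longrightarrow> \<bar>m t\<bar> \<le> K"
    using continuous_bounded_interval[OF mc] by blast
  define \<epsilon>1 where "\<epsilon>1 = e / (2 * (K + 1))"
  define \<epsilon>2 where "\<epsilon>2 = e / (2 * (\<bar>R\<bar> powr (s - 1) + 1))"
  have e1: "\<epsilon>1 > 0" "K * \<epsilon>1 \<le> e / 2"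
  proof -
    show "\<epsilon>1 > 0" using e K0 by (simp add: \<epsilon>1_def)
    have "K * \<epsilon>1 = (K / (K + 1)) * (e / 2)" by (simp add: \<epsilon>1_def)
    also have "\<dots> \<le> 1 * (e / 2)" using K0 e by (intro mult_right_mono) auto
    finally show "K * \<epsilon>1 \<le> e / 2" by simp
  qed
  have e2: "\<epsilon>2 > 0" "\<epsilon>2 * \<bar>R\<bar> powr (s - 1) \<le> e / 2"
  proof -
    have R0: "\<bar>R\<bar> powr (s - 1) + 1 > 0" by (simp add: add_nonneg_pos)
    then show "\<epsilon>2 > 0" using e by (simp add: \<epsilon>2_def)
    have "\<epsilon>2 * \<bar>R\<bar> powr (s - 1) = (\<bar>R\<bar> powr (s - 1) / (\<bar>R\<bar> powr (s - 1) + 1)) * (e / 2)" by (simp add: \<epsilon>2_def mult.commute)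
    also have "\<dots> \<le> 1 * (e / 2)" using e R0 by (intro mult_right_mono) auto
    finally show "\<epsilon>2 * \<bar>R\<bar> powr (s - 1) \<le> e / 2" by simp
  qed
  obtain \<eta>1 where eta1: "\<eta>1 > 0"
    "\<And>V W :: 'a \<Rightarrow> 'b. V \<in> Lp s \<mu> \<Longrightarrow> W \<in> Lp s \<mu> \<Longrightarrow> Lp_norm s \<mu> V \<le> R \<Longrightarrow> Lp_norm s \<mu> W \<le> R \<Longrightarrow>
       Lp_norm s \<mu> (\<lambda>x. V x - W x) \<le> \<eta>1 \<Longrightarrow> Lp_norm (s / (s - 1)) \<mu> (\<lambda>x. pw s (V x) - pw s (W x)) \<le> \<epsilon>1"
  proof (rule pw_uniformly_continuous[OF s e1(1), where M = \<mu> and R = R and 'b = 'b])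
    fix \<eta> :: real assume "\<eta> > 0"
      "\<And>V W :: 'a \<Rightarrow> 'b. V \<in> Lp s \<mu> \<Longrightarrow> W \<in> Lp s \<mu> \<Longrightarrow> Lp_norm s \<mu> V \<le> R \<Longrightarrow> Lp_norm s \<mu> W \<le> R \<Longrightarrow>
         Lp_norm s \<mu> (\<lambda>x. V x - W x) \<le> \<eta> \<Longrightarrow> Lp_norm (s / (s - 1)) \<mu> (\<lambda>x. pw s (V x) - pw s (W x)) \<le> \<epsilon>1"
    then show thesis by (rule that)
  qed
  have "uniformly_continuous_on {0..\<bar>R\<bar>} m" using mc by (intro compact_uniformly_continuous) auto
  then obtain \<eta>2 where eta2: "\<eta>2 > 0" "\<And>t t'. t \<in> {0..\<bar>R\<bar>} \<Longrightarrow> t' \<in> {0..\<bar>R\<bar>} \<Longrightarrow> dist t' t < \<eta>2 \<Longrightarrow> dist (m t') (m t) < \<epsilon>2"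
    unfolding uniformly_continuous_on_def using e2(1) by meson
  show ?thesis
  proof (rule that[of "min \<eta>1 (\<eta>2 / 2)"])
    fix V V' W :: "'a \<Rightarrow> 'b"
    assume V: "V \<in> Lp s \<mu>" "V' \<in> Lp s \<mu>" and W: "W \<in> Lp s \<mu>" and R: "Lp_norm s \<mu> V \<le> R" "Lp_norm s \<mu> V' \<le> R"
      and d: "Lp_norm s \<mu> (\<lambda>x. V x - V' x) \<le> min \<eta>1 (\<eta>2 / 2)"
    let ?w = "Lp_norm s \<mu> W" and ?J = "\<lambda>V. LINT x|\<mu>. pw s (V x) \<bullet> W x"
    have mm: "M (Lp_int s \<mu> U) = m (Lp_norm s \<mu> U)" for U :: "'a \<Rightarrow> 'b" using s' by (simp add: m_def Lp_norm_powr)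
    have d1: "\<bar>Lp_norm s \<mu> V - Lp_norm s \<mu> V'\<bar> < \<eta>2" using Lp_norm_triangle_diff[OF V s'(2)] d eta2(1) by linarith
    have R0: "R \<ge> 0" using R(1) Lp_norm_nonneg order_trans by blast
    have dm: "\<bar>m (Lp_norm s \<mu> V) - m (Lp_norm s \<mu> V')\<bar> \<le> \<epsilon>2"
      using eta2(2)[of "Lp_norm s \<mu> V'" "Lp_norm s \<mu> V"] R R0 d1 by (simp add: dist_real_def)
    have dJ: "\<bar>?J V - ?J V'\<bar> \<le> \<epsilon>1 * ?w"
    proof -
      have "?J V - ?J V' = (LINT x|\<mu>. (pw s (V x) - pw s (V' x)) \<bullet> W x)" unfolding inner_diff_left
        by (rule Bochner_Integration.integral_diff[OF integrable_pw[OF V(1) W] integrable_pw[OF V(2) W], symmetric])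
      also have "\<bar>\<dots>\<bar> \<le> Lp_norm (s / (s - 1)) \<mu> (\<lambda>x. pw s (V x) - pw s (V' x)) * ?w"
        by (rule Holder_inner(2)[OF W Lp_diff[OF pw_Lp[OF V(1) s] pw_Lp[OF V(2) s] s'(3)] s])
      also have "\<dots> \<le> \<epsilon>1 * ?w" using eta1(2)[OF V R] d by (intro mult_right_mono) auto
      finally show ?thesis .
    qed
    have J': "\<bar>?J V'\<bar> \<le> \<bar>R\<bar> powr (s - 1) * ?w"
    proof -
      have "\<bar>?J V'\<bar> \<le> Lp_norm s \<mu> V' powr (s - 1) * ?w"
        using Holder_inner(2)[OF W pw_Lp[OF V(2) s] s] by (simp add: Lp_norm_pw[OF s])
      also have "\<dots> \<le> \<bar>R\<bar> powr (s - 1) * ?w" using R s by (intro mult_right_mono powr_mono2) auto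
      finally show ?thesis .
    qed
    have eq: "form V W - form V' W = m (Lp_norm s \<mu> V) * (?J V - ?J V') + (m (Lp_norm s \<mu> V) - m (Lp_norm s \<mu> V')) * ?J V'"
    proof -
      have *: "k * x - k' * x' = k * (x - x') + (k - k') * x'" for k k' x x' :: real by (simp add: algebra_simps)
      show ?thesis unfolding form_def mm by (rule *)
    qed
    have "\<bar>form V W - form V' W\<bar> \<le> \<bar>m (Lp_norm s \<mu> V) * (?J V - ?J V')\<bar> + \<bar>(m (Lp_norm s \<mu> V) - m (Lp_norm s \<mu> V')) * ?J V'\<bar>"
      unfolding eq by (rule abs_triangle_ineq)
    also have "\<dots> \<le> K * (\<epsilon>1 * ?w) + \<epsilon>2 * (\<bar>R\<bar> powr (s - 1) * ?w)"
    proof (rule add_mono)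
      have "\<bar>m (Lp_norm s \<mu> V)\<bar> \<le> K" using K[of "Lp_norm s \<mu> V"] R R0 by simp
      then show "\<bar>m (Lp_norm s \<mu> V) * (?J V - ?J V')\<bar> \<le> K * (\<epsilon>1 * ?w)"
        unfolding abs_mult using dJ K0 by (rule mult_mono) simp
      show "\<bar>(m (Lp_norm s \<mu> V) - m (Lp_norm s \<mu> V')) * ?J V'\<bar> \<le> \<epsilon>2 * (\<bar>R\<bar> powr (s - 1) * ?w)"
        unfolding abs_mult using dm J' less_imp_le[OF e2(1)] by (rule mult_mono) simp
    qed
    also have "\<dots> = (K * \<epsilon>1 + \<epsilon>2 * \<bar>R\<bar> powr (s - 1)) * ?w" by (simp add: algebra_simps)
    also have "\<dots> \<le> e * ?w" using e1(2) e2(2) by (intro mult_right_mono) auto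
    finally show "\<bar>form V W - form V' W\<bar> \<le> e * ?w" .
  qed (use eta1(1) eta2(1) in simp)
qed

end

section \<open>The variational problem on test functions\<close>

lemma not_uniform_sequences:
  fixes d :: "'v \<Rightarrow> 'v \<Rightarrow> real"
  assumes "\<not> (\<exists>\<eta>>0. \<forall>u\<in>T. \<forall>v\<in>T. P u \<longrightarrow> P v \<longrightarrow> d u v \<le> \<eta> \<longrightarrow> K u v)"
  obtains u v where "\<And>n. u n \<in> T" "\<And>n. v n \<in> T" "\<And>n. P (u n)" "\<And>n. P (v n)"
    "\<And>n. d (u n) (v n) \<le> 1 / real (Suc n)" "\<And>n. \<not> K (u n) (v n)"
proof -
  have "\<exists>u v. u \<in> T \<and> v \<in> T \<and> P u \<and> P v \<and> d u v \<le> 1 / real (Suc n) \<and> \<not> K u v" for n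
  proof -
    have "1 / real (Suc n) > 0" by simp
    with assms show ?thesis by blast
  qed
  then obtain u v where "\<And>n. u n \<in> T \<and> v n \<in> T \<and> P (u n) \<and> P (v n) \<and> d (u n) (v n) \<le> 1 / real (Suc n) \<and> \<not> K (u n) (v n)"
    by metis
  then show ?thesis by (intro that[of u v]) blast+
qed

text \<open>The problem after normalisation: \<open>M\<close> lives on the whole line, the
  conditions on \<open>f\<close> hold at every point of \<Omega>, the threshold \<open>t0\<close> is
  positive, and the weight enters through measurability and the bounds 0 and
  \<open>A\<close>.\<close>

locale kirchhoff_problem =
  fixes \<Omega> :: "'a::euclidean_space set" and p q \<theta> r \<sigma> c c0 t0 A :: real
    and a :: "'a \<Rightarrow> real" and M :: "real \<Rightarrow> real" and f :: "'a \<Rightarrow> real \<Rightarrow> real"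
  assumes \<Omega>: "open \<Omega>" "bounded \<Omega>" "\<Omega> \<noteq> {}"
    and pq: "1 < p" "p < q" "p < real DIM('a)" and \<theta>: "1 \<le> \<theta>"
    and a: "a \<in> borel_measurable (lebesgue_on \<Omega>)" "\<And>x. x \<in> \<Omega> \<Longrightarrow> 0 \<le> a x" "\<And>x. x \<in> \<Omega> \<Longrightarrow> a x \<le> A"
    and M: "continuous_on UNIV M" "\<And>t. M t \<ge> 0" "\<And>t. t \<ge> 0 \<Longrightarrow> t * M t \<le> \<theta> * primitive M t"
      "\<And>\<tau>. \<tau> > 0 \<Longrightarrow> \<exists>\<kappa>>0. \<forall>t\<ge>\<tau>. M t \<ge> \<kappa>"
    and f: "\<And>t. (\<lambda>x. f x t) \<in> borel_measurable (lebesgue_on \<Omega>)" "\<And>x. x \<in> \<Omega> \<Longrightarrow> continuous_on UNIV (f x)"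
    and r_range: "q * \<theta> < r" "r < sobolev_exponent (real DIM('a)) p"
    and c_nonneg: "c \<ge> 0" and f_le: "\<And>x t. x \<in> \<Omega> \<Longrightarrow> \<bar>f x t\<bar> \<le> c * (\<bar>t\<bar> powr (q * \<theta> - 1) + \<bar>t\<bar> powr (r - 1))"
    and AR: "q * \<theta> < \<sigma>" "c0 > 0" "t0 > 0"
      "\<And>x t. x \<in> \<Omega> \<Longrightarrow> t0 \<le> \<bar>t\<bar> \<Longrightarrow> c0 \<le> \<sigma> * primitive (f x) t"
      "\<And>x t. x \<in> \<Omega> \<Longrightarrow> t0 \<le> \<bar>t\<bar> \<Longrightarrow> \<sigma> * primitive (f x) t \<le> t * f x t"
begin

abbreviation "\<mu> \<equiv> lebesgue_on \<Omega>"

abbreviation "test \<equiv> test_functions \<Omega>"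

abbreviation "nrm s V \<equiv> Lp_norm s \<mu> V"

abbreviation "f_pair u v \<equiv> LINT x|\<mu>. f x (u x) * v x"

lemma \<Omega>_lebesgue: "\<Omega> \<in> sets lebesgue" using \<Omega>(1) by (simp add: lborelD)

lemma exponents: "q > 1" "q \<le> q * \<theta>" "p < q * \<theta>" "q < r" "p < r" "1 < r" "q * \<theta> > 1"
proof -
  show q: "q > 1" using pq by simp
  show qt: "q \<le> q * \<theta>" using mult_left_mono[OF \<theta>, of q] q by simp
  show "p < q * \<theta>" "q < r" "p < r" "1 < r" "q * \<theta> > 1" using q qt pq r_range by linarith+
qed

sublocale caratheodory_growth \<mu> f "2 * c" r
proof (intro caratheodory_growth.intro caratheodory_growth_axioms.intro)
  show "finite_measure \<mu>" by (rule finite_measure_lebesgue_on[OF \<Omega>(2) \<Omega>_lebesgue])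
  show "\<bar>f x t\<bar> \<le> 2 * c * (1 + \<bar>t\<bar> powr (r - 1))" if "x \<in> space \<mu>" for x t
  proof -
    have "\<bar>t\<bar> powr (q * \<theta> - 1) \<le> 1 + \<bar>t\<bar> powr (r - 1)"
    proof (cases "\<bar>t\<bar> \<le> 1")
      case True
      then have "\<bar>t\<bar> powr (q * \<theta> - 1) \<le> 1" using exponents by (intro powr_le1) auto
      then show ?thesis by (simp add: add_increasing2)
    next
      case False
      then have "\<bar>t\<bar> powr (q * \<theta> - 1) \<le> \<bar>t\<bar> powr (r - 1)" using r_range by (intro powr_mono) auto
      then show ?thesis by simp
    qed
    then have "c * (\<bar>t\<bar> powr (q * \<theta> - 1) + \<bar>t\<bar> powr (r - 1)) \<le> c * (1 + \<bar>t\<bar> powr (r - 1) + (1 + \<bar>t\<bar> powr (r - 1)))"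
      using c_nonneg by (intro mult_left_mono add_mono) auto
    then show ?thesis using f_le[of x t] that by (simp add: algebra_simps)
  qed
qed (use f exponents c_nonneg in auto)

sublocale P: kirchhoff_term \<mu> M p by unfold_locales (use pq M in auto)

sublocale Q: kirchhoff_term \<mu> M q by unfold_locales (use exponents M in auto)

text \<open>With the weight absorbed, |weighted V|^q = a |V|^q, so the second phase lives in an
  ordinary Lebesgue space over the same measure as the first.\<close>

definition weighted :: "('a \<Rightarrow> 'a) \<Rightarrow> 'a \<Rightarrow> 'a" where
  "weighted V x = a x powr (1 / q) *\<^sub>R V x"

text \<open>The field V is an argument of its own: for test functions it is \<open>grad u\<close>,
  for the limit it is an L^p limit of gradients that is recognised as a weak gradient only
  later.\<close>

definition energy_fun :: "('a \<Rightarrow> real) \<Rightarrow> ('a \<Rightarrow> 'a) \<Rightarrow> real" where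
  "energy_fun u V = primitive M (Lp_int p \<mu> V) / p
    + primitive M (Lp_int q \<mu> (weighted V)) / q - (LINT x|\<mu>. primitive (f x) (u x))"

definition energy_deriv :: "('a \<Rightarrow> real) \<Rightarrow> ('a \<Rightarrow> 'a) \<Rightarrow> ('a \<Rightarrow> real) \<Rightarrow> ('a \<Rightarrow> 'a) \<Rightarrow> real" where
  "energy_deriv u V v W = P.form V W + Q.form (weighted V) (weighted W) - f_pair u v"

abbreviation "energy_at u \<equiv> energy_fun u (grad u)"

abbreviation "energy_slope u v \<equiv> energy_deriv u (grad u) v (grad v)"

text \<open>A sum of two Lebesgue norms in the place of the Luxemburg norm of the gradient; it
  separates the two phases.\<close>

definition grad_norm :: "('a \<Rightarrow> 'a) \<Rightarrow> real" where
  "grad_norm V = nrm p V + nrm q (weighted V)"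

lemma weighted_add: "weighted (\<lambda>x. V x + W x) = (\<lambda>x. weighted V x + weighted W x)"
  by (simp add: weighted_def fun_eq_iff scaleR_add_right)

lemma weighted_diff: "weighted (\<lambda>x. V x - W x) = (\<lambda>x. weighted V x - weighted W x)"
  by (simp add: weighted_def fun_eq_iff scaleR_diff_right)

lemma weighted_scale: "weighted (\<lambda>x. k *\<^sub>R V x) = (\<lambda>x. k *\<^sub>R weighted V x)"
  by (simp add: weighted_def fun_eq_iff mult.commute)

lemma weighted_measurable [measurable]: "V \<in> borel_measurable \<mu> \<Longrightarrow> weighted V \<in> borel_measurable \<mu>"
  unfolding weighted_def[abs_def] using a(1) by measurable

lemma norm_weighted: "x \<in> \<Omega> \<Longrightarrow> norm (weighted V x) powr q = a x * norm (V x) powr q"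
  using exponents(1) a(2)[of x] by (simp add: weighted_def powr_mult powr_powr)

lemma weight_le: "x \<in> \<Omega> \<Longrightarrow> norm (weighted V x) \<le> \<bar>A\<bar> powr (1 / q) * norm (V x)"
  using exponents(1) a(2,3)[of x] unfolding weighted_def by (auto intro!: mult_right_mono powr_mono2)

lemma weighted_Lp:
  assumes V: "V \<in> Lp q \<mu>"
  shows "weighted V \<in> Lp q \<mu>"
proof (rule Lp_bound(1)[OF Lp_scale[OF V, of "\<bar>A\<bar> powr (1 / q)"]])
  show "AE x in \<mu>. norm (weighted V x) \<le> norm ((\<bar>A\<bar> powr (1 / q)) *\<^sub>R V x)" using weight_le by (intro AE_I2) simp
qed (use exponents LpD(1)[OF V] in auto)

lemma exponents_pos: "p > 0" "q > 0" "r > 0" "p \<ge> 1" "q \<ge> 1" "r \<ge> 1" using pq exponents by auto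

lemma test_mem:
  assumes "\<phi> \<in> test"
  shows "\<phi> \<in> Lp r \<mu>" "grad \<phi> \<in> Lp p \<mu>" "weighted (grad \<phi>) \<in> Lp q \<mu>"
  using test_Lp(3)[OF assms \<Omega>_lebesgue] test_Lp(4)[OF assms \<Omega>_lebesgue] weighted_Lp exponents_pos by auto

lemma sobolev:
  assumes "p \<le> s" "s < sobolev_exponent (real DIM('a)) p"
  obtains C where "C > 0" "\<And>u. u \<in> test \<Longrightarrow> nrm s u \<le> C * nrm p (grad u)"
  using sobolev_inequality[OF pq(1,3) \<Omega>(2) \<Omega>_lebesgue assms] by blast

lemma f_pairing:
  assumes u: "u \<in> Lp r \<mu>" and v: "v \<in> Lp r \<mu>"
  shows "integrable \<mu> (\<lambda>x. f x (u x) * v x)"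
    and "\<bar>LINT x|\<mu>. f x (u x) * v x\<bar> \<le> nrm r' (\<lambda>x. f x (u x)) * nrm r v" using Holder_inner[OF v f_Lp[OF u] r] by auto

lemma f_pairing_diff:
  assumes u: "u \<in> Lp r \<mu>" "w \<in> Lp r \<mu>" and v: "v \<in> Lp r \<mu>"
  shows "\<bar>f_pair u v - f_pair w v\<bar> \<le> nrm r' (\<lambda>x. f x (u x) - f x (w x)) * nrm r v"
proof -
  have "f_pair u v - f_pair w v = (LINT x|\<mu>. (f x (u x) - f x (w x)) * v x)" unfolding left_diff_distrib
    by (rule Bochner_Integration.integral_diff[OF f_pairing(1)[OF u(1) v] f_pairing(1)[OF u(2) v], symmetric])
  then show ?thesis using Holder_inner(2)[OF v Lp_diff[OF f_Lp[OF u(1)] f_Lp[OF u(2)] r'(2)] r] by simp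
qed

lemma test_space_measurable:
  assumes "\<phi> \<in> test"
  shows "\<phi> \<in> borel_measurable \<mu>" "grad \<phi> \<in> borel_measurable \<mu>"
  using LpD(1)[OF test_mem(1)[OF assms]] LpD(1)[OF test_mem(2)[OF assms]] by auto

lemma energy_has_derivative:
  assumes \<phi>: "\<phi> \<in> test" and \<psi>: "\<psi> \<in> test"
  shows "((\<lambda>t. energy_fun (\<lambda>x. \<phi> x + t * \<psi> x) (\<lambda>x. grad \<phi> x + t *\<^sub>R grad \<psi> x)) has_real_derivative
    energy_deriv (\<lambda>x. \<phi> x + t * \<psi> x) (\<lambda>x. grad \<phi> x + t *\<^sub>R grad \<psi> x) \<psi> (grad \<psi>)) (at t)"
proof -
  note [measurable] = test_space_measurable[OF \<phi>] test_space_measurable[OF \<psi>]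
  obtain B1 where B1: "B1 > 0" "\<And>x. \<bar>\<phi> x\<bar> \<le> B1" "\<And>x. norm (grad \<phi> x) \<le> B1" using test_bounded[OF \<phi>] by blast
  obtain B2 where B2: "B2 > 0" "\<And>x. \<bar>\<psi> x\<bar> \<le> B2" "\<And>x. norm (grad \<psi> x) \<le> B2" using test_bounded[OF \<psi>] by blast
  define B where "B = max B1 B2"
  have B: "B > 0" "\<bar>\<phi> x\<bar> \<le> B" "norm (grad \<phi> x) \<le> B" "\<bar>\<psi> x\<bar> \<le> B" "norm (grad \<psi> x) \<le> B" for x
    unfolding B_def using B1(1) B1(2,3)[of x] B2(2,3)[of x] by auto
  have wB: "norm (weighted V x) \<le> \<bar>A\<bar> powr (1 / q) * B" if "x \<in> \<Omega>" "norm (V x) \<le> B" for V x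
    using weight_le[OF that(1), of V] that(2) by (meson mult_left_mono order_trans powr_ge_zero)
  have dP: "((\<lambda>t. Lp_int p \<mu> (\<lambda>x. grad \<phi> x + t *\<^sub>R grad \<psi> x)) has_real_derivative
      p * (LINT x|\<mu>. pw p (grad \<phi> x + t *\<^sub>R grad \<psi> x) \<bullet> grad \<psi> x)) (at t)"
    by (rule integral_norm_powr_has_derivative[OF finite_measure_axioms pq(1), where B = B]) (use B in auto)
  have dQ: "((\<lambda>t. Lp_int q \<mu> (\<lambda>x. weighted (grad \<phi>) x + t *\<^sub>R weighted (grad \<psi>) x)) has_real_derivative
      q * (LINT x|\<mu>. pw q (weighted (grad \<phi>) x + t *\<^sub>R weighted (grad \<psi>) x) \<bullet> weighted (grad \<psi>) x)) (at t)"
    by (rule integral_norm_powr_has_derivative[OF finite_measure_axioms exponents(1), where B = "\<bar>A\<bar> powr (1 / q) * B"])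
      (use B wB in auto)
  \<comment> \<open>Majorant near t: |s| \<le> |t| + 1 bounds \<phi> + s \<psi> by B + (|t| + 1)
    B.\<close>
  define K where "K = 2 * c * (1 + (B + (\<bar>t\<bar> + 1) * B) powr (r - 1)) * B"
  have Lr: "(\<lambda>x. \<phi> x + t * \<psi> x) \<in> Lp r \<mu>" for t
    using Lp_add[OF test_mem(1)[OF \<phi>] Lp_scale[OF test_mem(1)[OF \<psi>], of t] exponents_pos(3)] by simp
  have dF: "((\<lambda>t. LINT x|\<mu>. primitive (f x) (\<phi> x + t * \<psi> x)) has_real_derivative
      f_pair (\<lambda>x. \<phi> x + t * \<psi> x) \<psi>) (at t)"
  proof (rule integral_has_derivative[OF finite_measure_axioms, where B = K])
    show "(\<lambda>x. primitive (f x) (\<phi> x + s * \<psi> x)) \<in> borel_measurable \<mu>" for s by (rule F_comp) measurable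
    show "(\<lambda>x. f x (\<phi> x + s * \<psi> x) * \<psi> x) \<in> borel_measurable \<mu>" for s
      by (intro borel_measurable_times f_comp) measurable
    show "integrable \<mu> (\<lambda>x. primitive (f x) (\<phi> x + s * \<psi> x))" for s by (rule F_integrable[OF Lr])
    show "((\<lambda>s. primitive (f x) (\<phi> x + s * \<psi> x)) has_real_derivative f x (\<phi> x + s * \<psi> x) * \<psi> x) (at s)"
      if "x \<in> space \<mu>" for x s
    proof -
      have "((\<lambda>s. \<phi> x + s * \<psi> x) has_real_derivative \<psi> x) (at s)" by (auto intro!: derivative_eq_intros)
      from DERIV_chain2[OF primitive_has_derivative[OF f_cont[OF that]] this] show ?thesis .
    qed
    show "\<bar>f x (\<phi> x + s * \<psi> x) * \<psi> x\<bar> \<le> K" if x: "x \<in> space \<mu>" and s: "\<bar>s - t\<bar> \<le> 1" for x s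
    proof -
      have "\<bar>s\<bar> \<le> \<bar>t\<bar> + 1" using s by linarith
      then have "\<bar>s\<bar> * \<bar>\<psi> x\<bar> \<le> (\<bar>t\<bar> + 1) * B" using B(4)[of x] by (intro mult_mono) auto
      then have "\<bar>\<phi> x + s * \<psi> x\<bar> \<le> B + (\<bar>t\<bar> + 1) * B"
        using B(2)[of x] abs_triangle_ineq[of "\<phi> x" "s * \<psi> x"] by (simp only: abs_mult)
      then have "\<bar>\<phi> x + s * \<psi> x\<bar> powr (r - 1) \<le> (B + (\<bar>t\<bar> + 1) * B) powr (r - 1)" using r by (intro powr_mono2) auto
      then have "\<bar>f x (\<phi> x + s * \<psi> x)\<bar> \<le> 2 * c * (1 + (B + (\<bar>t\<bar> + 1) * B) powr (r - 1))"
        using growth[OF x, of "\<phi> x + s * \<psi> x"] c by (meson add_left_mono mult_left_mono mult_nonneg_nonneg order_trans zero_le_numeral)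
      then show ?thesis unfolding K_def abs_mult using B(4)[of x] c by (intro mult_mono) auto
    qed
  qed
  have w: "weighted (\<lambda>x. grad \<phi> x + t *\<^sub>R grad \<psi> x) = (\<lambda>x. weighted (grad \<phi>) x + t *\<^sub>R weighted (grad \<psi>) x)" for t
    unfolding weighted_add weighted_scale ..
  have "((\<lambda>t. primitive M (Lp_int p \<mu> (\<lambda>x. grad \<phi> x + t *\<^sub>R grad \<psi> x)) / p
     + primitive M (Lp_int q \<mu> (\<lambda>x. weighted (grad \<phi>) x + t *\<^sub>R weighted (grad \<psi>) x)) / q
     - (LINT x|\<mu>. primitive (f x) (\<phi> x + t * \<psi> x))) has_real_derivative
     M (Lp_int p \<mu> (\<lambda>x. grad \<phi> x + t *\<^sub>R grad \<psi> x)) * (p * (LINT x|\<mu>. pw p (grad \<phi> x + t *\<^sub>R grad \<psi> x) \<bullet> grad \<psi> x)) / p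
     + M (Lp_int q \<mu> (\<lambda>x. weighted (grad \<phi>) x + t *\<^sub>R weighted (grad \<psi>) x))
       * (q * (LINT x|\<mu>. pw q (weighted (grad \<phi>) x + t *\<^sub>R weighted (grad \<psi>) x) \<bullet> weighted (grad \<psi>) x)) / q
     - f_pair (\<lambda>x. \<phi> x + t * \<psi> x) \<psi>) (at t)"
    by (intro DERIV_diff DERIV_add DERIV_cdivide dF DERIV_chain2[OF primitive_has_derivative[OF M(1)] dP]
        DERIV_chain2[OF primitive_has_derivative[OF M(1)] dQ])
  then show ?thesis unfolding energy_fun_def energy_deriv_def P.form_def Q.form_def w using exponents_pos by simp
qed

lemma compact_embedding:
  assumes u: "\<And>n. u n \<in> test" "\<And>n. nrm p (grad (u n)) \<le> R"
  shows "\<exists>s w. strict_mono (s :: nat \<Rightarrow> nat) \<and> w \<in> Lp r \<mu> \<and> Lp_lim r \<mu> (\<lambda>n. u (s n)) w"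
proof (rule rellich[OF pq(1,3) \<Omega>(2) \<Omega>_lebesgue u])
  fix s :: "nat \<Rightarrow> nat" assume s: "strict_mono s"
    and sc: "\<And>\<rho> e. p \<le> \<rho> \<Longrightarrow> \<rho> < sobolev_exponent (real DIM('a)) p \<Longrightarrow> e > 0 \<Longrightarrow>
      \<exists>n0. \<forall>m\<ge>n0. \<forall>n\<ge>n0. Lp_norm \<rho> \<mu> (\<lambda>x. u (s m) x - u (s n) x) \<le> e"
  have pr: "p \<le> r" using exponents by simp
  show ?thesis
  proof (rule Lp_complete[of "\<lambda>n. u (s n)"])
    show "u (s n) \<in> Lp r \<mu>" for n by (rule test_mem(1)[OF u(1)])
    show "1 \<le> r" by (rule exponents_pos)
    show "\<exists>n0. \<forall>m\<ge>n0. \<forall>n\<ge>n0. nrm r (\<lambda>x. u (s m) x - u (s n) x) \<le> e" if "e > 0" for e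
      by (rule sc[OF pr r_range(2) that])
    fix w assume "w \<in> Lp r \<mu>" "Lp_lim r \<mu> (\<lambda>n. u (s n)) w"
    with s show ?thesis by (intro exI[of _ s] exI[of _ w] conjI)
  qed
qed

lemma sobolev_constant:
  assumes "p \<le> s" "s < sobolev_exponent (real DIM('a)) p"
  shows "\<exists>C>0. \<forall>u\<in>test. nrm s u \<le> C * nrm p (grad u)"
proof (rule sobolev[OF assms])
  fix C :: real assume "C > 0" "\<And>u. u \<in> test \<Longrightarrow> nrm s u \<le> C * nrm p (grad u)"
  then show ?thesis by (intro exI[of _ C] conjI ballI)
qed

text \<open>A continuous superposition operator can fail to be uniformly continuous on bounded sets;
  the compact embedding supplies uniformity. Otherwise two bounded sequences whose gradients
  approach each other would have a common L^r limit w along a subsequence, and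
  \<open>f x (u n x)\<close> and \<open>f x (v n x)\<close> would both tend to
  \<open>f x (w x)\<close> in the dual norm.\<close>

lemma f_uniformly_continuous:
  assumes e: "e > 0"
  shows "\<exists>\<eta>>0. \<forall>u\<in>test. \<forall>v\<in>test. nrm p (grad u) \<le> R \<longrightarrow> nrm p (grad v) \<le> R \<longrightarrow>
    nrm p (grad (\<lambda>x. u x - v x)) \<le> \<eta> \<longrightarrow> nrm r' (\<lambda>x. f x (u x) - f x (v x)) \<le> e"
proof (rule ccontr)
  assume neg: "\<not> ?thesis"
  show False
  proof (rule not_uniform_sequences[where T = test and P = "\<lambda>u. nrm p (grad u) \<le> R" and
        d = "\<lambda>u v. nrm p (grad (\<lambda>x. u x - v x))" and K = "\<lambda>u v. nrm r' (\<lambda>x. f x (u x) - f x (v x)) \<le> e", OF neg])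
  fix u v :: "nat \<Rightarrow> 'a \<Rightarrow> real"
  assume uv: "\<And>n. u n \<in> test" "\<And>n. v n \<in> test" "\<And>n. nrm p (grad (u n)) \<le> R" "\<And>n. nrm p (grad (v n)) \<le> R"
    "\<And>n. nrm p (grad (\<lambda>x. u n x - v n x)) \<le> 1 / real (Suc n)" "\<And>n. \<not> nrm r' (\<lambda>x. f x (u n x) - f x (v n x)) \<le> e"
  obtain s :: "nat \<Rightarrow> nat" and w where s: "strict_mono s" and w: "w \<in> Lp r \<mu>" "Lp_lim r \<mu> (\<lambda>n. u (s n)) w"
    using compact_embedding[of u R, OF uv(1,3)] by (elim exE conjE)
  have pr: "p \<le> r" using exponents by simp
  obtain C where C: "C > 0" "\<forall>u\<in>test. nrm r u \<le> C * nrm p (grad u)"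
    using sobolev_constant[OF pr r_range(2)] by (elim exE conjE)
  have vw: "Lp_lim r \<mu> (\<lambda>n. v (s n)) w"
  proof (rule tendsto_sandwich[OF _ _ tendsto_const])
    show "\<forall>\<^sub>F n in sequentially. 0 \<le> nrm r (\<lambda>x. v (s n) x - w x)" by simp
    show "\<forall>\<^sub>F n in sequentially. nrm r (\<lambda>x. v (s n) x - w x) \<le> C * (1 / real (Suc (s n))) + nrm r (\<lambda>x. u (s n) x - w x)"
    proof (intro always_eventually allI)
      fix n
      have d: "(\<lambda>x. u (s n) x - v (s n) x) \<in> test" by (rule test_functions_diff[OF uv(1,2)])
      have eq: "(\<lambda>x. v (s n) x - w x) = (\<lambda>x. (v (s n) x - u (s n) x) + (u (s n) x - w x))" by auto
      have "nrm r (\<lambda>x. v (s n) x - w x) \<le> nrm r (\<lambda>x. v (s n) x - u (s n) x) + nrm r (\<lambda>x. u (s n) x - w x)"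
        unfolding eq by (intro Lp_norm_triangle Lp_diff test_mem(1) uv(1,2) w(1) exponents_pos)
      also have "nrm r (\<lambda>x. v (s n) x - u (s n) x) \<le> C * nrm p (grad (\<lambda>x. u (s n) x - v (s n) x))"
        using bspec[OF C(2) d] unfolding Lp_norm_diff_commute[of r \<mu> "v (s n)" "u (s n)"] .
      also have "\<dots> \<le> C * (1 / real (Suc (s n)))" using uv(5) C(1) by (intro mult_left_mono) auto
      finally show "nrm r (\<lambda>x. v (s n) x - w x) \<le> C * (1 / real (Suc (s n))) + nrm r (\<lambda>x. u (s n) x - w x)" by simp
    qed
    have "(\<lambda>n. 1 / real (Suc (s n))) \<longlonglongrightarrow> 0"
      using LIMSEQ_subseq_LIMSEQ[OF LIMSEQ_inverse_real_of_nat s] by (simp add: o_def inverse_eq_divide)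
    then have "(\<lambda>n. C * (1 / real (Suc (s n))) + nrm r (\<lambda>x. u (s n) x - w x)) \<longlonglongrightarrow> C * 0 + 0"
      using w(2) by (intro tendsto_add tendsto_mult tendsto_const)
    then show "(\<lambda>n. C * (1 / real (Suc (s n))) + nrm r (\<lambda>x. u (s n) x - w x)) \<longlonglongrightarrow> 0" by simp
  qed
  obtain s1 :: "nat \<Rightarrow> nat" where s1: "strict_mono s1"
    "(\<lambda>n. nrm r' (\<lambda>x. f x (u (s (s1 n)) x) - f x (w x))) \<longlonglongrightarrow> 0" by (rule nemytskii[OF test_mem(1)[OF uv(1)] w])
  have vw1: "Lp_lim r \<mu> (\<lambda>n. v (s (s1 n))) w" using LIMSEQ_subseq_LIMSEQ[OF vw s1(1)] by (simp add: o_def)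
  obtain s2 :: "nat \<Rightarrow> nat" where s2: "strict_mono s2"
    "(\<lambda>n. nrm r' (\<lambda>x. f x (v (s (s1 (s2 n))) x) - f x (w x))) \<longlonglongrightarrow> 0"
    by (rule nemytskii[OF test_mem(1)[OF uv(2)] w(1) vw1])
  let ?k = "\<lambda>n. s (s1 (s2 n))"
  have "(\<lambda>n. nrm r' (\<lambda>x. f x (u (?k n) x) - f x (w x)) + nrm r' (\<lambda>x. f x (v (?k n) x) - f x (w x))) \<longlonglongrightarrow> 0 + 0"
    using LIMSEQ_subseq_LIMSEQ[OF s1(2) s2(1)] s2(2) by (intro tendsto_add) (simp_all add: o_def)
  then have "\<forall>\<^sub>F n in sequentially. nrm r' (\<lambda>x. f x (u (?k n) x) - f x (w x)) + nrm r' (\<lambda>x. f x (v (?k n) x) - f x (w x)) < e"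
    using e by (intro order_tendstoD(2)[where y = 0]) auto
  then obtain n where n: "nrm r' (\<lambda>x. f x (u (?k n) x) - f x (w x)) + nrm r' (\<lambda>x. f x (v (?k n) x) - f x (w x)) < e"
    by (auto simp: eventually_sequentially)
  have eq: "(\<lambda>x. f x (u (?k n) x) - f x (v (?k n) x)) = (\<lambda>x. (f x (u (?k n) x) - f x (w x)) + (f x (w x) - f x (v (?k n) x)))" by auto
  have "nrm r' (\<lambda>x. f x (u (?k n) x) - f x (v (?k n) x))
      \<le> nrm r' (\<lambda>x. f x (u (?k n) x) - f x (w x)) + nrm r' (\<lambda>x. f x (w x) - f x (v (?k n) x))"
    unfolding eq using r' by (intro Lp_norm_triangle Lp_diff f_Lp test_mem(1) uv(1,2) w(1)) auto
  then show False using n uv(6)[of "?k n"] by (simp add: Lp_norm_diff_commute[of r' \<mu> "\<lambda>x. f x (w x)"])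
  qed
qed


lemma f_bounded:
  "\<exists>K\<ge>0. \<forall>u\<in>Lp r \<mu>. nrm r u \<le> R \<longrightarrow> nrm r' (\<lambda>x. f x (u x)) \<le> K"
proof (intro exI conjI ballI impI)
  let ?K = "((2 * (2 * c)) powr r' * (measure \<mu> (space \<mu>) + \<bar>R\<bar> powr r)) powr (1 / r')"
  show "?K \<ge> 0" by simp
  fix u :: "'a \<Rightarrow> real" assume u: "u \<in> Lp r \<mu>" and R: "nrm r u \<le> R"
  have "R \<ge> 0" using R Lp_norm_nonneg order_trans by blast
  then have le: "Lp_int r \<mu> u \<le> \<bar>R\<bar> powr r" using R exponents_pos(3) by (simp add: Lp_norm_le_iff)
  have "Lp_int r' \<mu> (\<lambda>x. f x (u x)) \<le> (LINT x|\<mu>. (2 * (2 * c)) powr r' * (1 + norm (u x) powr r))"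
    using LpD(2)[OF f_Lp[OF u]] LpD(2)[OF u] growth_powr by (intro integral_mono) auto
  also have "\<dots> = (2 * (2 * c)) powr r' * (measure \<mu> (space \<mu>) + Lp_int r \<mu> u)" using LpD(2)[OF u] by simp
  also have "\<dots> \<le> (2 * (2 * c)) powr r' * (measure \<mu> (space \<mu>) + \<bar>R\<bar> powr r)"
    using le by (intro mult_left_mono add_mono) auto
  finally have "Lp_int r' \<mu> (\<lambda>x. f x (u x)) \<le> (2 * (2 * c)) powr r' * (measure \<mu> (space \<mu>) + \<bar>R\<bar> powr r)" .
  then show "nrm r' (\<lambda>x. f x (u x)) \<le> ?K"
    unfolding Lp_norm_def using r by (intro powr_mono2) (auto intro: integral_nonneg_AE)
qed

lemma grad_fun_add: "u \<in> test \<Longrightarrow> v \<in> test \<Longrightarrow> grad (\<lambda>x. u x + v x) = (\<lambda>x. grad u x + grad v x)"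
  by (rule ext) (rule grad_add)

lemma grad_fun_diff: "u \<in> test \<Longrightarrow> v \<in> test \<Longrightarrow> grad (\<lambda>x. u x - v x) = (\<lambda>x. grad u x - grad v x)"
  by (rule ext) (rule grad_diff)

lemma grad_fun_scale: "u \<in> test \<Longrightarrow> grad (\<lambda>x. k * u x) = (\<lambda>x. k *\<^sub>R grad u x)" by (rule ext) (rule grad_cmult)

lemma grad_norm_parts: "nrm p V \<le> grad_norm V" "nrm q (weighted V) \<le> grad_norm V" by (simp_all add: grad_norm_def)

lemma grad_norm_scale: "grad_norm (\<lambda>x. k *\<^sub>R V x) = \<bar>k\<bar> * grad_norm V"
  using exponents_pos by (simp add: grad_norm_def weighted_scale Lp_norm_scale distrib_left)

lemma grad_norm_triangle:
  assumes "V \<in> Lp p \<mu>" "weighted V \<in> Lp q \<mu>" "W \<in> Lp p \<mu>" "weighted W \<in> Lp q \<mu>"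
  shows "grad_norm (\<lambda>x. V x + W x) \<le> grad_norm V + grad_norm W"
  using Lp_norm_triangle[OF assms(1,3) exponents_pos(4)] Lp_norm_triangle[OF assms(2,4) exponents_pos(5)]
  unfolding grad_norm_def weighted_add by linarith

lemma energy_deriv_add:
  assumes u: "u \<in> test" and v: "v \<in> test" and w: "w \<in> test"
  shows "energy_deriv u (grad u) (\<lambda>x. v x + w x) (\<lambda>x. grad v x + grad w x)
    = energy_slope u v + energy_slope u w"
proof -
  have "f_pair u (\<lambda>x. v x + w x) = f_pair u v + f_pair u w" unfolding distrib_left
    by (rule Bochner_Integration.integral_add[OF f_pairing(1)[OF test_mem(1)[OF u] test_mem(1)[OF v]]
          f_pairing(1)[OF test_mem(1)[OF u] test_mem(1)[OF w]]])
  then show ?thesis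
    unfolding energy_deriv_def weighted_add P.form_add[OF test_mem(2)[OF u] test_mem(2)[OF v] test_mem(2)[OF w]]
      Q.form_add[OF test_mem(3)[OF u] test_mem(3)[OF v] test_mem(3)[OF w]] by linarith
qed

lemma energy_deriv_scale:
  "energy_deriv u V (\<lambda>x. k * v x) (\<lambda>x. k *\<^sub>R W x) = k * energy_deriv u V v W"
  unfolding energy_deriv_def weighted_scale P.form_scale Q.form_scale mult.left_commute[of _ k]
  by (simp add: right_diff_distrib distrib_left)

lemma energy_deriv_bounded:
  "\<exists>C. \<forall>u\<in>test. \<forall>v\<in>test. grad_norm (grad u) \<le> R \<longrightarrow> \<bar>energy_slope u v\<bar> \<le> C * grad_norm (grad v)"
proof -
  obtain S where S: "S > 0" "\<forall>u\<in>test. nrm r u \<le> S * nrm p (grad u)"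
    using sobolev_constant[OF less_imp_le[OF exponents(5)] r_range(2)] by (elim exE conjE)
  obtain K where K: "K \<ge> 0" "\<forall>u\<in>Lp r \<mu>. nrm r u \<le> S * R \<longrightarrow> nrm r' (\<lambda>x. f x (u x)) \<le> K"
    using f_bounded[of "S * R"] by (elim exE conjE)
  show ?thesis
  proof (rule P.form_bounded[of R, where 'b = 'a])
    fix C1 :: real
    assume C1: "C1 \<ge> 0" "\<And>V W :: 'a \<Rightarrow> 'a. V \<in> Lp p \<mu> \<Longrightarrow> W \<in> Lp p \<mu> \<Longrightarrow> nrm p V \<le> R \<Longrightarrow> \<bar>P.form V W\<bar> \<le> C1 * nrm p W"
    show ?thesis
    proof (rule Q.form_bounded[of R, where 'b = 'a])
      fix C2 :: real
      assume C2: "C2 \<ge> 0" "\<And>V W :: 'a \<Rightarrow> 'a. V \<in> Lp q \<mu> \<Longrightarrow> W \<in> Lp q \<mu> \<Longrightarrow> nrm q V \<le> R \<Longrightarrow> \<bar>Q.form V W\<bar> \<le> C2 * nrm q W"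
      show ?thesis
      proof (intro exI ballI impI)
        fix u v assume u: "u \<in> test" and v: "v \<in> test" and R: "grad_norm (grad u) \<le> R"
        have uR: "nrm p (grad u) \<le> R" "nrm q (weighted (grad u)) \<le> R"
          using R grad_norm_parts[of "grad u"] by linarith+
        have "nrm r u \<le> S * R" using bspec[OF S(2) u] mult_left_mono[OF uR(1), of S] S(1) by linarith
        then have "nrm r' (\<lambda>x. f x (u x)) \<le> K" using K(2) test_mem(1)[OF u] by blast
        then have "nrm r' (\<lambda>x. f x (u x)) * nrm r v \<le> K * (S * nrm p (grad v))"
          using bspec[OF S(2) v] K(1) by (intro mult_mono) auto
        also have "\<dots> \<le> K * (S * grad_norm (grad v))"
          using K(1) S(1) grad_norm_parts(1) by (intro mult_left_mono) auto
        finally have 3: "\<bar>LINT x|\<mu>. f x (u x) * v x\<bar> \<le> K * S * grad_norm (grad v)"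
          using f_pairing(2)[OF test_mem(1)[OF u] test_mem(1)[OF v]] by (simp add: mult.assoc)
        have 1: "\<bar>P.form (grad u) (grad v)\<bar> \<le> C1 * grad_norm (grad v)"
          using C1(2)[OF test_mem(2)[OF u] test_mem(2)[OF v] uR(1)] mult_left_mono[OF grad_norm_parts(1) C1(1), of "grad v"]
          by linarith
        have 2: "\<bar>Q.form (weighted (grad u)) (weighted (grad v))\<bar> \<le> C2 * grad_norm (grad v)"
          using C2(2)[OF test_mem(3)[OF u] test_mem(3)[OF v] uR(2)] mult_left_mono[OF grad_norm_parts(2) C2(1), of "grad v"]
          by linarith
        show "\<bar>energy_slope u v\<bar> \<le> (C1 + C2 + K * S) * grad_norm (grad v)"
          unfolding energy_deriv_def distrib_right using 1 2 3 by linarith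
      qed
    qed
  qed
qed

lemma energy_deriv_uniformly_continuous:
  assumes \<epsilon>: "\<epsilon> > 0"
  shows "\<exists>\<eta>>0. \<forall>u\<in>test. \<forall>w\<in>test. grad_norm (grad u) \<le> R \<longrightarrow> grad_norm (grad w) \<le> R \<longrightarrow>
    grad_norm (grad (\<lambda>x. u x - w x)) \<le> \<eta> \<longrightarrow>
    (\<forall>v\<in>test. \<bar>energy_slope u v - energy_slope w v\<bar> \<le> \<epsilon> * grad_norm (grad v))"
proof -
  obtain S where S: "S > 0" "\<forall>u\<in>test. nrm r u \<le> S * nrm p (grad u)"
    using sobolev_constant[OF less_imp_le[OF exponents(5)] r_range(2)] by (elim exE conjE)
  \<comment> \<open>One third of \<epsilon> for each phase and one for the term with
    \<open>f\<close>; S compensates the Sobolev inequality applied to the direction.\<close>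
  have e: "\<epsilon> / 3 > 0" "\<epsilon> / (3 * S) > 0" using \<epsilon> S(1) by auto
  obtain \<eta>3 where \<eta>3: "\<eta>3 > 0" "\<forall>u\<in>test. \<forall>v\<in>test. nrm p (grad u) \<le> R \<longrightarrow> nrm p (grad v) \<le> R \<longrightarrow>
      nrm p (grad (\<lambda>x. u x - v x)) \<le> \<eta>3 \<longrightarrow> nrm r' (\<lambda>x. f x (u x) - f x (v x)) \<le> \<epsilon> / (3 * S)"
    using f_uniformly_continuous[OF e(2), of R] by (elim exE conjE)
  show ?thesis
  proof (rule P.form_uniformly_continuous[OF e(1), where R = R and 'b = 'a])
    fix \<eta>1 :: real
    assume \<eta>1: "\<eta>1 > 0" "\<And>V V' W :: 'a \<Rightarrow> 'a. V \<in> Lp p \<mu> \<Longrightarrow> V' \<in> Lp p \<mu> \<Longrightarrow> W \<in> Lp p \<mu> \<Longrightarrow> nrm p V \<le> R \<Longrightarrow> nrm p V' \<le> R \<Longrightarrow>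
       nrm p (\<lambda>x. V x - V' x) \<le> \<eta>1 \<Longrightarrow> \<bar>P.form V W - P.form V' W\<bar> \<le> \<epsilon> / 3 * nrm p W"
    show ?thesis
    proof (rule Q.form_uniformly_continuous[OF e(1), where R = R and 'b = 'a])
      fix \<eta>2 :: real
      assume \<eta>2: "\<eta>2 > 0" "\<And>V V' W :: 'a \<Rightarrow> 'a. V \<in> Lp q \<mu> \<Longrightarrow> V' \<in> Lp q \<mu> \<Longrightarrow> W \<in> Lp q \<mu> \<Longrightarrow> nrm q V \<le> R \<Longrightarrow> nrm q V' \<le> R \<Longrightarrow>
         nrm q (\<lambda>x. V x - V' x) \<le> \<eta>2 \<Longrightarrow> \<bar>Q.form V W - Q.form V' W\<bar> \<le> \<epsilon> / 3 * nrm q W"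
      show ?thesis
      proof (intro exI[of _ "min \<eta>1 (min \<eta>2 \<eta>3)"] conjI ballI impI)
        show "min \<eta>1 (min \<eta>2 \<eta>3) > 0" using \<eta>1(1) \<eta>2(1) \<eta>3(1) by simp
        fix u w v assume u: "u \<in> test" and w: "w \<in> test" and v: "v \<in> test"
          and R: "grad_norm (grad u) \<le> R" "grad_norm (grad w) \<le> R"
          and le: "grad_norm (grad (\<lambda>x. u x - w x)) \<le> min \<eta>1 (min \<eta>2 \<eta>3)"
        have uR: "nrm p (grad u) \<le> R" "nrm q (weighted (grad u)) \<le> R"
          "nrm p (grad w) \<le> R" "nrm q (weighted (grad w)) \<le> R"
          using R grad_norm_parts[of "grad u"] grad_norm_parts[of "grad w"] by linarith+
        have d: "nrm p (\<lambda>x. grad u x - grad w x) \<le> \<eta>1" "nrm q (\<lambda>x. weighted (grad u) x - weighted (grad w) x) \<le> \<eta>2"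
          "nrm p (grad (\<lambda>x. u x - w x)) \<le> \<eta>3"
          using le grad_norm_parts[of "grad (\<lambda>x. u x - w x)"] unfolding grad_fun_diff[OF u w] weighted_diff by linarith+
        have "nrm r' (\<lambda>x. f x (u x) - f x (w x)) \<le> \<epsilon> / (3 * S)" using \<eta>3(2) u w uR(1,3) d(3) by blast
        then have "nrm r' (\<lambda>x. f x (u x) - f x (w x)) * nrm r v \<le> \<epsilon> / (3 * S) * (S * nrm p (grad v))"
          using bspec[OF S(2) v] \<epsilon> S(1) by (intro mult_mono) auto
        also have "\<dots> = \<epsilon> / 3 * nrm p (grad v)" using S(1) by simp
        also have "\<dots> \<le> \<epsilon> / 3 * grad_norm (grad v)" using \<epsilon> grad_norm_parts(1) by (intro mult_left_mono) auto
        finally have 3: "\<bar>f_pair u v - f_pair w v\<bar> \<le> \<epsilon> / 3 * grad_norm (grad v)"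
          using f_pairing_diff[OF test_mem(1)[OF u] test_mem(1)[OF w] test_mem(1)[OF v]] by linarith
        have e0: "0 \<le> \<epsilon> / 3" using e by simp
        have 1: "\<bar>P.form (grad u) (grad v) - P.form (grad w) (grad v)\<bar> \<le> \<epsilon> / 3 * grad_norm (grad v)"
          using \<eta>1(2)[OF test_mem(2)[OF u] test_mem(2)[OF w] test_mem(2)[OF v] uR(1,3) d(1)]
            mult_left_mono[OF grad_norm_parts(1) e0, of "grad v"] by linarith
        have 2: "\<bar>Q.form (weighted (grad u)) (weighted (grad v)) - Q.form (weighted (grad w)) (weighted (grad v))\<bar> \<le> \<epsilon> / 3 * grad_norm (grad v)"
          using \<eta>2(2)[OF test_mem(3)[OF u] test_mem(3)[OF w] test_mem(3)[OF v] uR(2,4) d(2)]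
            mult_left_mono[OF grad_norm_parts(2) e0, of "grad v"] by linarith
        have sum: "\<bar>a1 + b1 - c1 - (a2 + b2 - c2)\<bar> \<le> \<epsilon> * n" if "\<bar>a1 - a2\<bar> \<le> \<epsilon> / 3 * n" "\<bar>b1 - b2\<bar> \<le> \<epsilon> / 3 * n" "\<bar>c1 - c2\<bar> \<le> \<epsilon> / 3 * n"
          for a1 b1 c1 a2 b2 c2 n :: real using that by linarith
        show "\<bar>energy_slope u v - energy_slope w v\<bar> \<le> \<epsilon> * grad_norm (grad v)"
          unfolding energy_deriv_def by (rule sum[OF 1 2 3])
      qed
    qed
  qed
qed


text \<open>Test functions are bounded and continuous, so they form a subspace of the type of
  bounded continuous functions, from which only the linear structure is taken. The barrier is
  located by \<open>nrm p (grad u)\<close>, which is 1-Lipschitz for the seminorm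
  \<open>grad_norm (grad u)\<close>.\<close>

lemma mountain_pass_test:
  assumes e: "e \<in> test" "\<rho>\<^sub>2 < nrm p (grad e)" "energy_at e \<le> 0"
    and \<rho>: "0 < \<rho>\<^sub>1" "\<rho>\<^sub>1 < \<rho>\<^sub>2" and \<alpha>: "0 < \<alpha>"
    and barrier: "\<And>u. u \<in> test \<Longrightarrow> \<rho>\<^sub>1 \<le> nrm p (grad u) \<Longrightarrow> nrm p (grad u) \<le> \<rho>\<^sub>2 \<Longrightarrow> \<alpha> \<le> energy_at u"
  shows "\<exists>B. \<forall>\<delta>>0. \<exists>u\<in>test. \<alpha> / 2 \<le> energy_at u \<and> energy_at u \<le> B \<and>
    (\<forall>v\<in>test. \<bar>energy_slope u v\<bar> \<le> \<delta> * grad_norm (grad v))"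
proof -
  define V where "V = {b :: 'a \<Rightarrow>\<^sub>C real. apply_bcontfun b \<in> test}"
  let ?g = "\<lambda>b :: 'a \<Rightarrow>\<^sub>C real. grad (apply_bcontfun b)"
  have VD: "apply_bcontfun b \<in> test" if "b \<in> V" for b using that by (simp add: V_def)
  have app: "apply_bcontfun (b + k *\<^sub>R b') = (\<lambda>x. b x + k * b' x)" "apply_bcontfun (b + b') = (\<lambda>x. b x + b' x)"
    "apply_bcontfun (b - b') = (\<lambda>x. b x - b' x)" "apply_bcontfun (k *\<^sub>R b') = (\<lambda>x. k * b' x)"
    "apply_bcontfun (0 :: 'a \<Rightarrow>\<^sub>C real) = (\<lambda>x. 0)" for b b' :: "'a \<Rightarrow>\<^sub>C real" and k
    by (auto simp: plus_bcontfun.rep_eq minus_bcontfun.rep_eq scaleR_bcontfun.rep_eq zero_bcontfun.rep_eq)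
  have g_add: "?g (b + b') = (\<lambda>x. ?g b x + ?g b' x)" if "b \<in> V" "b' \<in> V" for b b'
    unfolding app by (rule grad_fun_add[OF VD[OF that(1)] VD[OF that(2)]])
  have g_scale: "?g (k *\<^sub>R b') = (\<lambda>x. k *\<^sub>R ?g b' x)" if "b' \<in> V" for k b'
    unfolding app by (rule grad_fun_scale[OF VD[OF that]])
  have V: "subspace V"
  proof (rule subspaceI)
    show "0 \<in> V" unfolding V_def mem_Collect_eq app by (rule test_functions_zero)
    show "b + b' \<in> V" if "b \<in> V" "b' \<in> V" for b b'
      using test_functions_add[OF VD[OF that(1)] VD[OF that(2)]] unfolding V_def mem_Collect_eq app .
    show "k *\<^sub>R b \<in> V" if "b \<in> V" for b k
      using test_functions_cmult[OF VD[OF that]] unfolding V_def mem_Collect_eq app .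
  qed
  have lift: "\<exists>b\<in>V. apply_bcontfun b = u" if u: "u \<in> test" for u
  proof (rule test_bounded[OF u])
    fix B :: real assume "\<And>x. \<bar>u x\<bar> \<le> B"
    then have "u \<in> bcontfun" using test_continuous[OF u, of UNIV] by (intro bcontfun_normI[where b = B]) auto
    then have "apply_bcontfun (Bcontfun u) = u" by (rule Bcontfun_inverse)
    then show ?thesis using u by (intro bexI[of _ "Bcontfun u"]) (auto simp: V_def)
  qed
  obtain be where be: "be \<in> V" "apply_bcontfun be = e" using lift[OF e(1)] by blast
  have g0: "?g 0 = (\<lambda>x. 0)" unfolding app by (rule ext) (rule grad_eqI, simp)
  have I0: "energy_fun (\<lambda>x. 0) (\<lambda>x. 0) = 0" using exponents_pos by (simp add: energy_fun_def weighted_def)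
  have "\<exists>B. \<forall>\<delta>>0. \<exists>b\<in>V. \<alpha> / 2 \<le> energy_fun (apply_bcontfun b) (?g b) \<and> energy_fun (apply_bcontfun b) (?g b) \<le> B \<and>
    (\<forall>v\<in>V. \<bar>energy_deriv (apply_bcontfun b) (?g b) (apply_bcontfun v) (?g v)\<bar> \<le> \<delta> * grad_norm (?g v))"
  proof (rule mountain_pass_almost_critical[OF V, where N = "\<lambda>b. grad_norm (?g b)" and I = "\<lambda>b. energy_fun (apply_bcontfun b) (?g b)" and
        D = "\<lambda>b v. energy_deriv (apply_bcontfun b) (?g b) (apply_bcontfun v) (?g v)" and G = "\<lambda>b. nrm p (?g b)" and e = be and \<rho>\<^sub>1 = \<rho>\<^sub>1 and \<rho>\<^sub>2 = \<rho>\<^sub>2])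
    show "grad_norm (?g (k *\<^sub>R b)) = \<bar>k\<bar> * grad_norm (?g b)" if "b \<in> V" for k b
      unfolding g_scale[OF that] by (rule grad_norm_scale)
    show "grad_norm (?g (b + b')) \<le> grad_norm (?g b) + grad_norm (?g b')" if "b \<in> V" "b' \<in> V" for b b'
      unfolding g_add[OF that] by (intro grad_norm_triangle test_mem VD that)
    show "energy_deriv (apply_bcontfun b) (?g b) (apply_bcontfun (v + w)) (?g (v + w)) = energy_deriv (apply_bcontfun b) (?g b) (apply_bcontfun v) (?g v) + energy_deriv (apply_bcontfun b) (?g b) (apply_bcontfun w) (?g w)"
      if "b \<in> V" "v \<in> V" "w \<in> V" for b v w
      unfolding g_add[OF that(2,3)] unfolding app by (intro energy_deriv_add VD that)
    show "energy_deriv (apply_bcontfun b) (?g b) (apply_bcontfun (k *\<^sub>R v)) (?g (k *\<^sub>R v)) = k * energy_deriv (apply_bcontfun b) (?g b) (apply_bcontfun v) (?g v)"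
      if "b \<in> V" "v \<in> V" for b v k unfolding g_scale[OF that(2)] unfolding app by (rule energy_deriv_scale)
    show "((\<lambda>t. energy_fun (apply_bcontfun (b + t *\<^sub>R v)) (?g (b + t *\<^sub>R v))) has_real_derivative
        energy_deriv (apply_bcontfun (b + t *\<^sub>R v)) (?g (b + t *\<^sub>R v)) (apply_bcontfun v) (?g v)) (at t)" if "b \<in> V" "v \<in> V" for b v t
    proof -
      have g: "?g (b + t *\<^sub>R v) = (\<lambda>x. ?g b x + t *\<^sub>R ?g v x)" for t
        unfolding g_add[OF that(1) subspace_scale[OF V that(2)]] g_scale[OF that(2)] ..
      show ?thesis unfolding g unfolding app by (rule energy_has_derivative[OF VD[OF that(1)] VD[OF that(2)]])
    qed
    show "\<exists>C. \<forall>b\<in>V. \<forall>v\<in>V. grad_norm (?g b) \<le> R \<longrightarrow> \<bar>energy_deriv (apply_bcontfun b) (?g b) (apply_bcontfun v) (?g v)\<bar> \<le> C * grad_norm (?g v)" for R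
      using energy_deriv_bounded[of R] VD by blast
    show "\<exists>\<eta>>0. \<forall>b\<in>V. \<forall>w\<in>V. grad_norm (?g b) \<le> R \<longrightarrow> grad_norm (?g w) \<le> R \<longrightarrow> grad_norm (?g (b - w)) \<le> \<eta> \<longrightarrow>
        (\<forall>v\<in>V. \<bar>energy_deriv (apply_bcontfun b) (?g b) (apply_bcontfun v) (?g v) - energy_deriv (apply_bcontfun w) (?g w) (apply_bcontfun v) (?g v)\<bar> \<le> \<epsilon> * grad_norm (?g v))"
      if "\<epsilon> > 0" for R \<epsilon> using energy_deriv_uniformly_continuous[OF that, of R] VD unfolding app by blast
    show "\<bar>nrm p (?g b) - nrm p (?g b')\<bar> \<le> grad_norm (?g (b - b'))" if "b \<in> V" "b' \<in> V" for b b'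
      unfolding app grad_fun_diff[OF VD[OF that(1)] VD[OF that(2)]]
      by (rule order_trans[OF Lp_norm_triangle_diff grad_norm_parts(1)]) (intro test_mem VD that exponents_pos)+
    show "be \<in> V" by (rule be)
    show "nrm p (?g 0) < \<rho>\<^sub>1" unfolding g0 using \<rho>(1) exponents_pos by (simp add: Lp_norm_def)
    show "\<rho>\<^sub>2 < nrm p (?g be)" "energy_fun (apply_bcontfun be) (?g be) \<le> 0" unfolding be(2) by (rule e)+
    show "\<alpha> \<le> energy_fun (apply_bcontfun b) (?g b)" if "b \<in> V" "\<rho>\<^sub>1 \<le> nrm p (?g b)" "nrm p (?g b) \<le> \<rho>\<^sub>2" for b
      by (rule barrier[OF VD[OF that(1)] that(2,3)])
    show "energy_fun (apply_bcontfun 0) (?g 0) \<le> 0" unfolding g0 unfolding app I0 by simp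
  qed (fact \<rho> \<alpha>)+
  then obtain B where B: "\<forall>\<delta>>0. \<exists>b\<in>V. \<alpha> / 2 \<le> energy_fun (apply_bcontfun b) (?g b) \<and> energy_fun (apply_bcontfun b) (?g b) \<le> B \<and>
    (\<forall>v\<in>V. \<bar>energy_deriv (apply_bcontfun b) (?g b) (apply_bcontfun v) (?g v)\<bar> \<le> \<delta> * grad_norm (?g v))" by (elim exE)
  show ?thesis
  proof (intro exI[of _ B] allI impI)
    fix \<delta> :: real assume "\<delta> > 0"
    with B obtain b where b: "b \<in> V" "\<alpha> / 2 \<le> energy_fun (apply_bcontfun b) (?g b)" "energy_fun (apply_bcontfun b) (?g b) \<le> B"
      "\<forall>v\<in>V. \<bar>energy_deriv (apply_bcontfun b) (?g b) (apply_bcontfun v) (?g v)\<bar> \<le> \<delta> * grad_norm (?g v)" by blast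
    have "\<bar>energy_deriv (apply_bcontfun b) (?g b) v (grad v)\<bar> \<le> \<delta> * grad_norm (grad v)" if v: "v \<in> test" for v
    proof -
      obtain b' where "b' \<in> V" "apply_bcontfun b' = v" using lift[OF v] by blast
      then show ?thesis using bspec[OF b(4), of b'] by simp
    qed
    then show "\<exists>u\<in>test. \<alpha> / 2 \<le> energy_at u \<and> energy_at u \<le> B \<and>
        (\<forall>v\<in>test. \<bar>energy_slope u v\<bar> \<le> \<delta> * grad_norm (grad v))"
      using b(2,3) by (intro bexI[OF _ VD[OF b(1)]] conjI ballI)
  qed
qed

end

section \<open>Mountain-pass geometry\<close>

text \<open>The differential inequality says that h(t) t^(-k) has a nonnegative derivative. It
  serves twice: for \<open>- primitive M\<close> with k = \<theta>, and for the primitive of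
  \<open>f x\<close> with k = \<sigma>.\<close>

lemma powr_ratio_mono:
  fixes h h' :: "real \<Rightarrow> real"
  assumes st: "0 < s" "s \<le> t" and d: "\<And>\<xi>. s \<le> \<xi> \<Longrightarrow> \<xi> \<le> t \<Longrightarrow> (h has_real_derivative h' \<xi>) (at \<xi>)"
    and le: "\<And>\<xi>. s \<le> \<xi> \<Longrightarrow> \<xi> \<le> t \<Longrightarrow> k * h \<xi> \<le> \<xi> * h' \<xi>"
  shows "h s * t powr k \<le> h t * s powr k"
proof -
  have "h s * s powr (- k) \<le> h t * t powr (- k)"
  proof (rule DERIV_nonneg_imp_nondecreasing[OF st(2)])
    fix \<xi> assume x: "s \<le> \<xi>" "\<xi> \<le> t"
    then have pos: "\<xi> > 0" using st by simp
    have "((\<lambda>t. h t * t powr (- k)) has_real_derivative h' \<xi> * \<xi> powr (- k) + (- k * \<xi> powr (- k - 1)) * h \<xi>) (at \<xi>)"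
      by (rule DERIV_mult'[OF d[OF x] has_real_derivative_powr[OF pos], THEN DERIV_cong]) simp
    moreover have "h' \<xi> * \<xi> powr (- k) + (- k * \<xi> powr (- k - 1)) * h \<xi> = \<xi> powr (- k - 1) * (\<xi> * h' \<xi> - k * h \<xi>)"
      using pos by (simp add: powr_diff field_simps)
    moreover have "\<xi> powr (- k - 1) * (\<xi> * h' \<xi> - k * h \<xi>) \<ge> 0" using le[OF x] by simp
    ultimately show "\<exists>y. ((\<lambda>t. h t * t powr (- k)) has_real_derivative y) (at \<xi>) \<and> 0 \<le> y" by metis
  qed
  then show ?thesis using st by (simp add: powr_minus field_simps)
qed

lemma powr_dominates:
  fixes k l C e :: real
  assumes "k < l" "0 \<le> k" "e > 0"
  obtains t where "t \<ge> T" "t \<ge> 1" "A + C * t powr k \<le> e * t powr l"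
proof -
  \<comment> \<open>t^(l - k) \<ge> z makes e t^l dominate (|A| + |C|) t^k, and t \<ge> 1 makes that
    at least A + C t^k.\<close>
  define z where "z = (\<bar>A\<bar> + \<bar>C\<bar>) / e"
  define t where "t = max T (max 1 (z powr (1 / (l - k))))"
  have t: "t \<ge> T" "t \<ge> 1" "z powr (1 / (l - k)) \<le> t" by (auto simp: t_def)
  have z: "z \<ge> 0" using assms by (simp add: z_def)
  have "z = (z powr (1 / (l - k))) powr (l - k)" using assms z by (simp add: powr_powr)
  also have "\<dots> \<le> t powr (l - k)" using assms t by (intro powr_mono2) auto
  finally have "\<bar>A\<bar> + \<bar>C\<bar> \<le> e * t powr (l - k)" using assms by (simp add: z_def field_simps)
  then have "(\<bar>A\<bar> + \<bar>C\<bar>) * t powr k \<le> (e * t powr (l - k)) * t powr k" by (intro mult_right_mono) auto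
  also have "\<dots> = e * t powr l" using t by (simp add: mult.assoc powr_add[symmetric])
  finally have 1: "\<bar>A\<bar> * t powr k + \<bar>C\<bar> * t powr k \<le> e * t powr l" by (simp add: distrib_right)
  have "1 \<le> t powr k" using t assms by (simp add: ge_one_powr_ge_zero)
  then have "\<bar>A\<bar> * 1 \<le> \<bar>A\<bar> * t powr k" by (intro mult_left_mono) auto
  moreover have "C * t powr k \<le> \<bar>C\<bar> * t powr k" by (intro mult_right_mono) auto
  ultimately have "A + C * t powr k \<le> e * t powr l" using 1 by linarith
  then show ?thesis using t by (intro that[of t])
qed

lemma powr_absorbs_linear:
  fixes C s :: real
  assumes "s > 1" "C \<ge> 0"
  obtains K where "K \<ge> 0" "\<And>x. x \<ge> 0 \<Longrightarrow> C * x \<le> K + x powr s / 2"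
proof -
  \<comment> \<open>Up to L the linear term is at most C L; beyond L it holds that 2 C = L^(s - 1)
    \<le> x^(s - 1).\<close>
  define L where "L = (2 * C) powr (1 / (s - 1))"
  have L: "L \<ge> 0" by (simp add: L_def)
  show ?thesis
  proof (rule that[of "C * L"])
    show "C * L \<ge> 0" using assms L by simp
    fix x :: real assume x: "x \<ge> 0"
    show "C * x \<le> C * L + x powr s / 2"
    proof (cases "x \<le> L")
      case True
      then have "C * x \<le> C * L" using assms by (intro mult_left_mono)
      then show ?thesis by (simp add: add_increasing2)
    next
      case False
      then have x0: "x > 0" using L by simp
      have "2 * C = L powr (s - 1)" using assms by (simp add: L_def powr_powr)
      also have "\<dots> \<le> x powr (s - 1)" using False L assms by (intro powr_mono2) auto
      finally have "2 * C * x \<le> x powr (s - 1) * x" using x by (intro mult_right_mono)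
      also have "\<dots> = x powr s" using x0 by (simp add: powr_diff)
      finally show ?thesis using assms L by (simp add: add_increasing)
    qed
  qed
qed

lemma Lp_norm_zero_AE:
  assumes "V \<in> Lp s M" "s > 0" "Lp_norm s M V = 0"
  shows "AE x in M. V x = 0"
proof -
  have "Lp_int s M V = 0" using Lp_norm_powr[OF assms(2), of M V] assms(3) by simp
  then have "AE x in M. norm (V x) powr s = 0" using integral_nonneg_eq_0_iff_AE[OF LpD(2)[OF assms(1)]] by simp
  then show ?thesis by simp
qed

lemma flat_pos: "t > 0 \<Longrightarrow> flat 1 t > 0" by (simp add: flat_def)

lemma exists_nonzero_test:
  fixes \<Omega> :: "'a::euclidean_space set"
  assumes "open \<Omega>" "\<Omega> \<noteq> {}"
  shows "\<exists>\<psi>\<in>test_functions \<Omega>. \<not> (AE x in lebesgue_on \<Omega>. \<psi> x = 0)"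
proof -
  obtain z where z: "z \<in> \<Omega>" using assms(2) by blast
  obtain a b where ab: "cbox a b \<subseteq> \<Omega>" "z \<in> box a b" "\<forall>i\<in>Basis. a \<bullet> i < b \<bullet> i"
    by (rule open_contains_cbox[OF assms(1) z])
  have pos: "bump 1 a b x > 0" if "x \<in> box a b" for x
    using that unfolding bump_def by (intro prod_pos mult_pos_pos flat_pos) (auto simp: mem_box)
  have sub: "box a b \<subseteq> \<Omega>" by (rule order_trans[OF box_subset_cbox ab(1)])
  have "\<not> (AE x in lebesgue_on \<Omega>. bump 1 a b x = 0)"
  proof
    assume "AE x in lebesgue_on \<Omega>. bump 1 a b x = 0"
    then have "AE x in lebesgue. x \<in> \<Omega> \<longrightarrow> bump 1 a b x = 0"
      using assms(1) by (simp add: AE_restrict_space_iff lborelD)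
    then have "AE x in lebesgue. x \<notin> box a b"
    proof eventually_elim
      fix x assume "x \<in> \<Omega> \<longrightarrow> bump 1 a b x = 0"
      then show "x \<notin> box a b" using pos[of x] sub by force
    qed
    then have "emeasure lebesgue (box a b) = 0" by (subst (asm) AE_iff_null) (auto simp: null_sets_def)
    then have "negligible (box a b)" by (simp add: negligible_iff_null_sets null_sets_def)
    then show False using ab(2) open_not_negligible[of "box a b"] by auto
  qed
  then show ?thesis using bump_test_function[OF ab(1)] by blast
qed

context kirchhoff_problem
begin

lemma M_primitive_mono:
  assumes "s \<le> t" "\<And>\<xi>. s \<le> \<xi> \<Longrightarrow> \<xi> \<le> t \<Longrightarrow> \<kappa> \<le> M \<xi>"
  shows "primitive M s + \<kappa> * (t - s) \<le> primitive M t"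
proof -
  have "primitive M s - \<kappa> * s \<le> primitive M t - \<kappa> * t"
  proof (rule DERIV_nonneg_imp_nondecreasing[OF assms(1)])
    fix \<xi> assume x: "s \<le> \<xi>" "\<xi> \<le> t"
    have "((\<lambda>t. primitive M t - \<kappa> * t) has_real_derivative M \<xi> - \<kappa>) (at \<xi>)"
      by (auto intro!: derivative_eq_intros primitive_has_derivative M(1))
    then show "\<exists>y. ((\<lambda>t. primitive M t - \<kappa> * t) has_real_derivative y) (at \<xi>) \<and> 0 \<le> y" using assms(2)[OF x] by force
  qed
  then show ?thesis by (simp add: algebra_simps)
qed

lemma M_primitive_nonneg: "t \<ge> 0 \<Longrightarrow> primitive M t \<ge> 0" using M_primitive_mono[of 0 t 0] M(2) by simp

lemma M_primitive_pos: "primitive M 1 > 0"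
proof -
  obtain \<kappa> where k: "\<kappa> > 0" "\<forall>t\<ge>1/2. M t \<ge> \<kappa>" using M(4)[of "1/2"] by auto
  have "primitive M (1/2) + \<kappa> * (1 - 1/2) \<le> primitive M 1" using k by (intro M_primitive_mono) auto
  moreover have "\<kappa> * (1 - 1/2) > 0" using k(1) by simp
  ultimately show ?thesis using M_primitive_nonneg[of "1/2"] by linarith
qed

text \<open>The condition on \<open>M\<close> is the hypothesis of \<open>powr_ratio_mono\<close>
  for \<open>- primitive M\<close>. Comparison with the value at 1 bounds the primitive from below
  on [0, 1] and from above beyond 1.\<close>

lemma M_primitive_ratio:
  assumes "0 < s" "s \<le> t"
  shows "primitive M t * s powr \<theta> \<le> primitive M s * t powr \<theta>"
proof -
  have "- primitive M s * t powr \<theta> \<le> - primitive M t * s powr \<theta>"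
  proof (rule powr_ratio_mono[OF assms, where h' = "\<lambda>\<xi>. - M \<xi>"])
    show "((\<lambda>t. - primitive M t) has_real_derivative - M \<xi>) (at \<xi>)" for \<xi>
      by (intro DERIV_minus primitive_has_derivative M(1))
    show "\<theta> * - primitive M \<xi> \<le> \<xi> * - M \<xi>" if "s \<le> \<xi>" for \<xi> using M(3)[of \<xi>] that assms by simp
  qed
  then show ?thesis by simp
qed

lemma M_primitive_ge: "0 \<le> t \<Longrightarrow> t \<le> 1 \<Longrightarrow> primitive M 1 * t powr \<theta> \<le> primitive M t"
  using M_primitive_ratio[of t 1] by (cases "t = 0") auto

lemma M_primitive_le: "0 \<le> t \<Longrightarrow> primitive M t \<le> primitive M 1 * (1 + t powr \<theta>)"
proof (cases "t \<le> 1")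
  case True
  then have "primitive M t \<le> primitive M 1" using M_primitive_mono[of t 1 0] M(2) by simp
  also have "\<dots> \<le> primitive M 1 * (1 + t powr \<theta>)" using M_primitive_pos by simp
  finally show ?thesis .
next
  case False
  then have "primitive M t \<le> primitive M 1 * t powr \<theta>" using M_primitive_ratio[of 1 t] by simp
  then show ?thesis using M_primitive_pos by (simp add: distrib_left)
qed

lemma F_le:
  assumes x: "x \<in> \<Omega>"
  shows "\<bar>primitive (f x) t\<bar> \<le> c * (\<bar>t\<bar> powr (q * \<theta>) + \<bar>t\<bar> powr r)"
proof -
  have "\<bar>primitive (f x) t\<bar> \<le> c * (\<bar>t\<bar> powr (q * \<theta> - 1) + \<bar>t\<bar> powr (r - 1)) * \<bar>t\<bar>"
  proof (rule primitive_bound[OF f(2)[OF x]])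
    fix \<tau> :: real assume "\<bar>\<tau>\<bar> \<le> \<bar>t\<bar>"
    then have "c * (\<bar>\<tau>\<bar> powr (q * \<theta> - 1) + \<bar>\<tau>\<bar> powr (r - 1)) \<le> c * (\<bar>t\<bar> powr (q * \<theta> - 1) + \<bar>t\<bar> powr (r - 1))"
      using exponents c_nonneg by (intro mult_left_mono add_mono powr_mono2) auto
    then show "\<bar>f x \<tau>\<bar> \<le> c * (\<bar>t\<bar> powr (q * \<theta> - 1) + \<bar>t\<bar> powr (r - 1))" using f_le[OF x, of \<tau>] by linarith
  qed
  also have "\<dots> = c * (\<bar>t\<bar> powr (q * \<theta>) + \<bar>t\<bar> powr r)" by (cases "t = 0") (simp_all add: powr_diff field_simps)
  finally show ?thesis .
qed

text \<open>Integrating the superlinearity condition outwards from |t| = t0 gives the power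
  \<sigma>; the constant K extends the bound to |t| \<le> t0, where the growth condition bounds the
  primitive.\<close>

lemma F_ge:
  "\<exists>k K. k > 0 \<and> (\<forall>x\<in>\<Omega>. \<forall>t. k * \<bar>t\<bar> powr \<sigma> - K \<le> primitive (f x) t)"
proof -
  have \<sigma>: "\<sigma> > 0" using AR(1) exponents by simp
  \<comment> \<open>Chosen so that k t0^\<sigma> = c0 / \<sigma>, the lower bound of the primitive
    at |t| = t0.\<close>
  define k where "k = c0 / \<sigma> / t0 powr \<sigma>"
  define K where "K = c0 / \<sigma> + c * (t0 powr (q * \<theta>) + t0 powr r)"
  have k: "k > 0" using AR \<sigma> by (simp add: k_def)
  have "k * \<bar>t\<bar> powr \<sigma> - K \<le> primitive (f x) t" if x: "x \<in> \<Omega>" for x t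
  proof (cases "\<bar>t\<bar> \<le> t0")
    case True
    have "k * \<bar>t\<bar> powr \<sigma> \<le> k * t0 powr \<sigma>" using True k \<sigma> AR by (intro mult_left_mono powr_mono2) auto
    moreover have "k * t0 powr \<sigma> = c0 / \<sigma>" using AR by (simp add: k_def)
    moreover have "c * (\<bar>t\<bar> powr (q * \<theta>) + \<bar>t\<bar> powr r) \<le> c * (t0 powr (q * \<theta>) + t0 powr r)"
      using True c_nonneg exponents AR by (intro mult_left_mono add_mono powr_mono2) auto
    ultimately show ?thesis using F_le[OF x, of t] unfolding K_def by linarith
  next
    case False
    have K: "K \<ge> 0" using AR \<sigma> c_nonneg by (simp add: K_def)
    \<comment> \<open>The sign reduces negative t to a function of |t|.\<close>
    define e where "e = sgn t"
    have e: "e * \<bar>t\<bar> = t" "e * e = 1" "\<bar>e\<bar> = 1" using False AR by (auto simp: e_def sgn_if)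
    have "primitive (f x) (e * t0) * \<bar>t\<bar> powr \<sigma> \<le> primitive (f x) (e * \<bar>t\<bar>) * t0 powr \<sigma>"
    proof (rule powr_ratio_mono[where h' = "\<lambda>\<xi>. f x (e * \<xi>) * e"])
      show "((\<lambda>\<xi>. primitive (f x) (e * \<xi>)) has_real_derivative f x (e * \<xi>) * e) (at \<xi>)" for \<xi>
      proof (rule DERIV_chain2[OF primitive_has_derivative[OF f(2)[OF x]]])
        show "((\<lambda>\<xi>. e * \<xi>) has_real_derivative e) (at \<xi>)" by (auto intro!: derivative_eq_intros)
      qed
      show "\<sigma> * primitive (f x) (e * \<xi>) \<le> \<xi> * (f x (e * \<xi>) * e)" if "t0 \<le> \<xi>" for \<xi>
      proof -
        have "t0 \<le> \<bar>e * \<xi>\<bar>" using that e by (simp add: abs_mult)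
        from AR(5)[OF x this] show ?thesis by (simp add: mult_ac)
      qed
    qed (use False AR in auto)
    moreover have "c0 \<le> \<sigma> * primitive (f x) (e * t0)" using AR e by (intro AR(4)[OF x]) (simp add: abs_mult)
    then have "c0 / \<sigma> \<le> primitive (f x) (e * t0)" using \<sigma> by (simp add: field_simps)
    then have "c0 / \<sigma> * \<bar>t\<bar> powr \<sigma> \<le> primitive (f x) (e * t0) * \<bar>t\<bar> powr \<sigma>" by (intro mult_right_mono) auto
    ultimately have "c0 / \<sigma> * \<bar>t\<bar> powr \<sigma> \<le> primitive (f x) t * t0 powr \<sigma>" using e(1) by simp
    then have "c0 / \<sigma> * \<bar>t\<bar> powr \<sigma> / t0 powr \<sigma> \<le> primitive (f x) t" using AR(3) by (subst pos_divide_le_eq) auto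
    then have "k * \<bar>t\<bar> powr \<sigma> \<le> primitive (f x) t" unfolding k_def by simp
    then show ?thesis using K by linarith
  qed
  then show ?thesis using k by blast
qed

text \<open>Beyond t0 the difference is at most 0 by superlinearity; for |t| \<le> t0 the growth
  bounds control it. It is the error that appears when 1 / \<sigma> times the derivative in
  direction u is subtracted from the functional.\<close>

lemma AR_defect:
  "\<exists>K\<ge>0. \<forall>x\<in>\<Omega>. \<forall>t. primitive (f x) t - f x t * t / \<sigma> \<le> K"
proof -
  have \<sigma>: "\<sigma> > 0" using AR(1) exponents by simp
  define K where "K = c * (t0 powr (q * \<theta>) + t0 powr r) + c * (t0 powr (q * \<theta> - 1) + t0 powr (r - 1)) * t0 / \<sigma>"
  have K: "K \<ge> 0" using c_nonneg \<sigma> AR by (simp add: K_def)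
  have "primitive (f x) t - f x t * t / \<sigma> \<le> K" if x: "x \<in> \<Omega>" for x t
  proof (cases "\<bar>t\<bar> \<le> t0")
    case True
    have "c * (\<bar>t\<bar> powr (q * \<theta>) + \<bar>t\<bar> powr r) \<le> c * (t0 powr (q * \<theta>) + t0 powr r)"
      using True c_nonneg exponents AR by (intro mult_left_mono add_mono powr_mono2) auto
    moreover have "c * (\<bar>t\<bar> powr (q * \<theta> - 1) + \<bar>t\<bar> powr (r - 1)) \<le> c * (t0 powr (q * \<theta> - 1) + t0 powr (r - 1))"
      using True c_nonneg exponents AR by (intro mult_left_mono add_mono powr_mono2) auto
    then have "\<bar>f x t\<bar> \<le> c * (t0 powr (q * \<theta> - 1) + t0 powr (r - 1))" using f_le[OF x, of t] by linarith
    then have "\<bar>f x t\<bar> * \<bar>t\<bar> / \<sigma> \<le> c * (t0 powr (q * \<theta> - 1) + t0 powr (r - 1)) * t0 / \<sigma>"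
      using True \<sigma> c_nonneg by (intro divide_right_mono mult_mono) auto
    moreover have "- (f x t * t / \<sigma>) \<le> \<bar>f x t\<bar> * \<bar>t\<bar> / \<sigma>"
      using \<sigma> abs_ge_minus_self[of "f x t * t / \<sigma>"] by (simp add: abs_mult)
    ultimately show ?thesis using F_le[OF x, of t] unfolding K_def by linarith
  next
    case False
    then have "\<sigma> * primitive (f x) t \<le> t * f x t" using AR(5)[OF x] by simp
    then have "primitive (f x) t - f x t * t / \<sigma> \<le> 0" using \<sigma> by (simp add: field_simps)
    then show ?thesis using K by linarith
  qed
  then show ?thesis using K by blast
qed


text \<open>For y = nrm p (grad u) \<le> 1 the first phase is at least 2 m y^(p \<theta>), and the
  integral of the primitive of f is at most K y^(q \<theta>) = K y^k y^(p \<theta>). Since k > 0, a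
  small radius makes K y^k at most m; the second phase only adds something nonnegative.\<close>

lemma energy_barrier:
  "\<exists>\<rho> \<alpha>. 0 < \<rho> \<and> 0 < \<alpha> \<and> (\<forall>u\<in>test. \<rho> / 2 \<le> nrm p (grad u) \<longrightarrow> nrm p (grad u) \<le> \<rho> \<longrightarrow> \<alpha> \<le> energy_at u)"
proof -
  have qt: "p \<le> q * \<theta>" "q * \<theta> < sobolev_exponent (real DIM('a)) p" "p \<le> r" "q * \<theta> > 0" using exponents r_range by auto
  obtain S1 where S1: "S1 > 0" "\<forall>u\<in>test. nrm (q * \<theta>) u \<le> S1 * nrm p (grad u)"
    using sobolev_constant[OF qt(1,2)] by (elim exE conjE)
  obtain S2 where S2: "S2 > 0" "\<forall>u\<in>test. nrm r u \<le> S2 * nrm p (grad u)"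
    using sobolev_constant[OF qt(3) r_range(2)] by (elim exE conjE)
  define K where "K = c * (S1 powr (q * \<theta>) + S2 powr r)"
  have K: "K \<ge> 0" using c_nonneg by (simp add: K_def)
  define k where "k = (q - p) * \<theta>"
  have k: "k > 0" using pq \<theta> by (simp add: k_def)
  define m where "m = primitive M 1 / (2 * p)"
  have m: "m > 0" using M_primitive_pos pq by (simp add: m_def)
  \<comment> \<open>The radius satisfies K \<rho>^k \<le> m, and \<rho> \<le> 1 gives access to y^r
    \<le> y^(q \<theta>) and to the lower bound of \<open>primitive M\<close> on [0, 1].\<close>
  define \<rho> where "\<rho> = min 1 ((m / (K + 1)) powr (1 / k))"
  have \<rho>: "0 < \<rho>" "\<rho> \<le> 1" using m K by (auto simp: \<rho>_def)
  have K\<rho>: "K * \<rho> powr k \<le> m"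
  proof -
    have "\<rho> powr k \<le> ((m / (K + 1)) powr (1 / k)) powr k" using \<rho> k by (intro powr_mono2) (auto simp: \<rho>_def)
    also have "\<dots> = m / (K + 1)" using k m K by (simp add: powr_powr)
    finally have "K * \<rho> powr k \<le> K * (m / (K + 1))" using K by (intro mult_left_mono)
    also have "\<dots> = m * (K / (K + 1))" by simp
    also have "\<dots> \<le> m * 1" using K m by (intro mult_left_mono) auto
    finally show ?thesis by simp
  qed
  \<comment> \<open>The lower bound m y^(p \<theta>) at the inner radius \<rho> / 2 of the
    shell.\<close>
  define \<alpha> where "\<alpha> = m * (\<rho> / 2) powr (p * \<theta>)"
  have \<alpha>: "\<alpha> > 0" using m \<rho> by (simp add: \<alpha>_def)
  have "\<alpha> \<le> energy_at u" if u: "u \<in> test" and y: "\<rho> / 2 \<le> nrm p (grad u)" "nrm p (grad u) \<le> \<rho>" for u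
  proof -
    define y where "y = nrm p (grad u)"
    have y: "\<rho> / 2 \<le> y" "y \<le> \<rho>" "0 < y" "y \<le> 1" using y \<rho> by (auto simp: y_def)
    have uL: "u \<in> Lp (q * \<theta>) \<mu>" "u \<in> Lp r \<mu>" using test_Lp(3)[OF u \<Omega>_lebesgue] qt(4) exponents_pos by auto
    have "(LINT x|\<mu>. primitive (f x) (u x)) \<le> (LINT x|\<mu>. c * (norm (u x) powr (q * \<theta>) + norm (u x) powr r))"
    proof (rule integral_mono[OF F_integrable[OF uL(2)]])
      show "integrable \<mu> (\<lambda>x. c * (norm (u x) powr (q * \<theta>) + norm (u x) powr r))"
        using LpD(2)[OF uL(1)] LpD(2)[OF uL(2)] by (intro integrable_mult_right Bochner_Integration.integrable_add)
      show "primitive (f x) (u x) \<le> c * (norm (u x) powr (q * \<theta>) + norm (u x) powr r)" if "x \<in> space \<mu>" for x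
        using F_le[of x "u x"] that by simp
    qed
    also have "\<dots> = c * (nrm (q * \<theta>) u powr (q * \<theta>) + nrm r u powr r)"
      using LpD(2)[OF uL(1)] LpD(2)[OF uL(2)] by (simp add: Lp_norm_powr[OF qt(4)] Lp_norm_powr[OF exponents_pos(3)])
    also have "\<dots> \<le> c * ((S1 * y) powr (q * \<theta>) + (S2 * y) powr r)"
      using bspec[OF S1(2) u] bspec[OF S2(2) u] c_nonneg exponents_pos qt(4) unfolding y_def
      by (intro mult_left_mono add_mono powr_mono2) auto
    also have "\<dots> \<le> c * (S1 powr (q * \<theta>) * y powr (q * \<theta>) + S2 powr r * y powr (q * \<theta>))"
    proof (intro mult_left_mono add_mono c_nonneg)
      show "(S1 * y) powr (q * \<theta>) \<le> S1 powr (q * \<theta>) * y powr (q * \<theta>)" using S1(1) y by (simp add: powr_mult)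
      have "y powr r \<le> y powr (q * \<theta>)" using y r_range by (intro powr_mono') auto
      then show "(S2 * y) powr r \<le> S2 powr r * y powr (q * \<theta>)" using S2(1) y by (simp add: powr_mult mult_left_mono)
    qed
    also have "\<dots> = K * y powr (q * \<theta>)" by (simp add: K_def distrib_left distrib_right)
    also have "\<dots> = (K * y powr k) * y powr (p * \<theta>)"
      by (simp add: k_def mult.assoc powr_add[symmetric] left_diff_distrib)
    also have "\<dots> \<le> m * y powr (p * \<theta>)"
    proof (rule mult_right_mono)
      have "K * y powr k \<le> K * \<rho> powr k" using K y k by (intro mult_left_mono powr_mono2) auto
      then show "K * y powr k \<le> m" using K\<rho> by linarith
    qed simp
    finally have F: "(LINT x|\<mu>. primitive (f x) (u x)) \<le> m * y powr (p * \<theta>)" .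
    have yp: "Lp_int p \<mu> (grad u) = y powr p"
      unfolding y_def by (rule Lp_norm_powr[OF exponents_pos(1), symmetric])
    have "primitive M 1 * (y powr p) powr \<theta> \<le> primitive M (y powr p)"
      using y exponents_pos by (intro M_primitive_ge) (auto simp: powr_le1)
    then have "2 * m * y powr (p * \<theta>) \<le> primitive M (y powr p) / p"
      using pq by (simp add: m_def powr_powr field_simps)
    moreover have "0 \<le> primitive M (Lp_int q \<mu> (weighted (grad u))) / q"
      using exponents_pos by (intro divide_nonneg_pos M_primitive_nonneg integral_nonneg_AE) auto
    moreover have "\<alpha> \<le> m * y powr (p * \<theta>)"
      unfolding \<alpha>_def using m y \<rho> exponents_pos \<theta> by (intro mult_left_mono powr_mono2) auto
    ultimately show ?thesis using F unfolding energy_fun_def yp by linarith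
  qed
  then show ?thesis using \<rho> \<alpha> by blast
qed

text \<open>On the ray t \<psi> the two phases grow at most like t^(q \<theta>), while the integral
  of the primitive of f grows at least like t^\<sigma> up to a constant, and \<sigma> > q
  \<theta>.\<close>

lemma energy_negative:
  "\<exists>e\<in>test. T < nrm p (grad e) \<and> energy_at e \<le> 0"
proof -
  obtain \<psi> where \<psi>: "\<psi> \<in> test" "\<not> (AE x in \<mu>. \<psi> x = 0)" using exists_nonzero_test[OF \<Omega>(1,3)] by blast
  have \<sigma>: "\<sigma> > 0" using AR(1) exponents by simp
  have L\<sigma>: "\<psi> \<in> Lp \<sigma> \<mu>" by (rule test_Lp(3)[OF \<psi>(1) \<Omega>_lebesgue \<sigma>])
  obtain S where S: "S > 0" "\<forall>u\<in>test. nrm r u \<le> S * nrm p (grad u)"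
    using sobolev_constant[OF less_imp_le[OF exponents(5)] r_range(2)] by (elim exE conjE)
  obtain k K where k: "k > 0" "\<forall>x\<in>\<Omega>. \<forall>t. k * \<bar>t\<bar> powr \<sigma> - K \<le> primitive (f x) t" using F_ge by blast
  define G where "G = nrm p (grad \<psi>)"
  define H where "H = nrm q (weighted (grad \<psi>))"
  define J where "J = nrm \<sigma> \<psi>"
  \<comment> \<open>By the Sobolev inequality a nonzero \<psi> has a positive gradient norm, so the
    ray leaves every ball of gradients.\<close>
  have "nrm r \<psi> \<noteq> 0" using Lp_norm_zero_AE[OF test_mem(1)[OF \<psi>(1)] exponents_pos(3)] \<psi>(2) by blast
  then have "nrm r \<psi> > 0" using Lp_norm_nonneg[of r \<mu> \<psi>] by linarith
  then have "S * G > 0" using bspec[OF S(2) \<psi>(1)] unfolding G_def by linarith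
  then have G: "G > 0" using S(1) by (simp add: zero_less_mult_iff)
  have "J \<noteq> 0" using Lp_norm_zero_AE[OF L\<sigma> \<sigma>] \<psi>(2) unfolding J_def by blast
  then have J: "J > 0" using Lp_norm_nonneg[of \<sigma> \<mu> \<psi>] unfolding J_def by linarith
  have H: "H \<ge> 0" by (simp add: H_def)
  define A where "A = primitive M 1 / p + primitive M 1 / q + K * measure \<mu> (space \<mu>)"
  define C where "C = primitive M 1 * G powr (p * \<theta>) / p + primitive M 1 * H powr (q * \<theta>) / q"
  have kJ: "k * J powr \<sigma> > 0" "0 \<le> q * \<theta>" using k J exponents by auto
  \<comment> \<open>t \<ge> T / G + 1 takes the endpoint beyond radius T; the last bound makes the
    functional nonpositive there.\<close>
  obtain t where t: "t \<ge> T / G + 1" "t \<ge> 1" "A + C * t powr (q * \<theta>) \<le> k * J powr \<sigma> * t powr \<sigma>"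
    by (rule powr_dominates[OF AR(1) kJ(2,1)])
  let ?e = "\<lambda>x. t * \<psi> x"
  have e: "?e \<in> test" by (rule test_functions_cmult[OF \<psi>(1)])
  have ge: "grad ?e = (\<lambda>x. t *\<^sub>R grad \<psi> x)" by (rule grad_fun_scale[OF \<psi>(1)])
  have nG: "nrm p (grad ?e) = t * G" unfolding ge G_def using t exponents_pos by (simp add: Lp_norm_scale)
  have nH: "nrm q (weighted (grad ?e)) = t * H" unfolding ge weighted_scale H_def using t exponents_pos by (simp add: Lp_norm_scale)
  have nJ: "nrm \<sigma> ?e = t * J" using Lp_norm_scale[OF \<sigma>, of \<mu> t \<psi>] t by (simp add: J_def)
  have eL: "?e \<in> Lp \<sigma> \<mu>" by (rule test_Lp(3)[OF e \<Omega>_lebesgue \<sigma>])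
  have "T < t * G"
  proof -
    have "T = T / G * G" using G by simp
    also have "\<dots> < t * G" using t(1) G by (intro mult_strict_right_mono) auto
    finally show ?thesis .
  qed
  moreover have "energy_fun ?e (grad ?e) \<le> 0"
  proof -
    have "(LINT x|\<mu>. k * norm (?e x) powr \<sigma> - K) \<le> (LINT x|\<mu>. primitive (f x) (?e x))"
    proof (rule integral_mono[OF _ F_integrable[OF test_mem(1)[OF e]]])
      show "integrable \<mu> (\<lambda>x. k * norm (?e x) powr \<sigma> - K)"
        using LpD(2)[OF eL] by (intro Bochner_Integration.integrable_diff integrable_mult_right) auto
      show "k * norm (?e x) powr \<sigma> - K \<le> primitive (f x) (?e x)" if "x \<in> space \<mu>" for x using k(2) that by simp
    qed
    moreover have "(LINT x|\<mu>. k * norm (?e x) powr \<sigma> - K) = k * Lp_int \<sigma> \<mu> (\<lambda>x. ?e x) - K * measure \<mu> (space \<mu>)"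
      using LpD(2)[OF eL] by (subst Bochner_Integration.integral_diff) auto
    moreover have "Lp_int \<sigma> \<mu> (\<lambda>x. ?e x) = J powr \<sigma> * t powr \<sigma>"
      unfolding Lp_norm_powr[OF \<sigma>, symmetric] nJ using t J by (simp add: powr_mult mult.commute)
    ultimately have F: "k * J powr \<sigma> * t powr \<sigma> - K * measure \<mu> (space \<mu>) \<le> (LINT x|\<mu>. primitive (f x) (?e x))"
      by (simp add: mult.assoc)
    have P: "primitive M ((t * X) powr s) / s \<le> primitive M 1 / s + primitive M 1 * X powr (s * \<theta>) / s * t powr (q * \<theta>)"
      if s: "0 < s" "s \<le> q" and X: "X \<ge> 0" for s X
    proof -
      have "((t * X) powr s) powr \<theta> = t powr (s * \<theta>) * X powr (s * \<theta>)" using t X by (simp add: powr_powr powr_mult)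
      also have "\<dots> \<le> t powr (q * \<theta>) * X powr (s * \<theta>)" using t s \<theta> by (intro mult_right_mono powr_mono) auto
      finally have "primitive M 1 * (1 + ((t * X) powr s) powr \<theta>) \<le> primitive M 1 * (1 + t powr (q * \<theta>) * X powr (s * \<theta>))"
        using M_primitive_pos by (intro mult_left_mono add_left_mono) auto
      then have "primitive M ((t * X) powr s) \<le> primitive M 1 * (1 + t powr (q * \<theta>) * X powr (s * \<theta>))"
        using M_primitive_le[of "(t * X) powr s"] by simp
      then have "primitive M ((t * X) powr s) / s \<le> primitive M 1 * (1 + t powr (q * \<theta>) * X powr (s * \<theta>)) / s"
        using s by (intro divide_right_mono) auto
      also have "\<dots> = primitive M 1 / s + primitive M 1 * X powr (s * \<theta>) / s * t powr (q * \<theta>)"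
        by (simp add: distrib_left add_divide_distrib mult_ac)
      finally show ?thesis .
    qed
    have "C * t powr (q * \<theta>) = primitive M 1 * G powr (p * \<theta>) / p * t powr (q * \<theta>) + primitive M 1 * H powr (q * \<theta>) / q * t powr (q * \<theta>)"
      unfolding C_def distrib_right ..
    then show ?thesis
      unfolding energy_fun_def Lp_norm_powr[OF exponents_pos(1), symmetric] Lp_norm_powr[OF exponents_pos(2), symmetric] nG nH
      using P[of p G] P[of q H] F t(3) G H exponents_pos pq unfolding A_def by linarith
  qed
  ultimately show ?thesis using e nG by (intro bexI[of _ ?e]) auto
qed

text \<open>The lower bound \<alpha> of the levels will exclude the zero solution; the upper bound B
  makes the sequence bounded.\<close>

lemma palais_smale_sequence:
  "\<exists>\<alpha> B u. \<alpha> > 0 \<and> (\<forall>n. u n \<in> test \<and> \<alpha> \<le> energy_at (u n) \<and> energy_at (u n) \<le> B \<and>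
    (\<forall>v\<in>test. \<bar>energy_slope (u n) v\<bar> \<le> 1 / real (Suc n) * grad_norm (grad v)))"
proof -
  obtain \<rho> \<alpha> where \<rho>: "0 < \<rho>" "0 < \<alpha>" "\<forall>u\<in>test. \<rho> / 2 \<le> nrm p (grad u) \<longrightarrow> nrm p (grad u) \<le> \<rho> \<longrightarrow> \<alpha> \<le> energy_at u"
    using energy_barrier by (elim exE conjE)
  obtain e where e: "e \<in> test" "\<rho> < nrm p (grad e)" "energy_at e \<le> 0" using energy_negative[of \<rho>] by blast
  have \<rho>2: "0 < \<rho> / 2" "\<rho> / 2 < \<rho>" using \<rho>(1) by auto
  have "\<exists>B. \<forall>\<delta>>0. \<exists>u\<in>test. \<alpha> / 2 \<le> energy_at u \<and> energy_at u \<le> B \<and>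
    (\<forall>v\<in>test. \<bar>energy_slope u v\<bar> \<le> \<delta> * grad_norm (grad v))"
    by (rule mountain_pass_test[OF e \<rho>2 \<rho>(2)]) (use \<rho>(3) in blast)
  then obtain B where B: "\<forall>\<delta>>0. \<exists>u\<in>test. \<alpha> / 2 \<le> energy_at u \<and> energy_at u \<le> B \<and>
    (\<forall>v\<in>test. \<bar>energy_slope u v\<bar> \<le> \<delta> * grad_norm (grad v))" by (elim exE)
  have "\<exists>u\<in>test. \<alpha> / 2 \<le> energy_at u \<and> energy_at u \<le> B \<and>
    (\<forall>v\<in>test. \<bar>energy_slope u v\<bar> \<le> 1 / real (Suc n) * grad_norm (grad v))" for n
    using spec[OF B, of "1 / real (Suc n)"] by simp
  then have "\<exists>u. \<forall>n. u n \<in> test \<and> \<alpha> / 2 \<le> energy_at (u n) \<and> energy_at (u n) \<le> B \<and>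
    (\<forall>v\<in>test. \<bar>energy_slope (u n) v\<bar> \<le> 1 / real (Suc n) * grad_norm (grad v))"
    by (intro choice allI) (simp only: Bex_def)
  then obtain u where "\<forall>n. u n \<in> test \<and> \<alpha> / 2 \<le> energy_at (u n) \<and> energy_at (u n) \<le> B \<and>
    (\<forall>v\<in>test. \<bar>energy_slope (u n) v\<bar> \<le> 1 / real (Suc n) * grad_norm (grad v))" by (elim exE)
  then show ?thesis using \<rho>(2) by (intro exI[of _ "\<alpha> / 2"] exI[of _ B] exI[of _ u] conjI) simp_all
qed

end

section \<open>Palais--Smale sequences\<close>

context kirchhoff_term
begin

text \<open>Freezing the coefficient at V splits the difference into a monotone part and a part that
  carries only the difference of the two coefficients.\<close>

lemma form_diff_eq:
  assumes V: "V \<in> Lp s \<mu>" and W: "W \<in> Lp s \<mu>"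
  shows "form V (\<lambda>x. V x - W x) - form W (\<lambda>x. V x - W x)
    = M (Lp_int s \<mu> V) * (LINT x|\<mu>. (pw s (V x) - pw s (W x)) \<bullet> (V x - W x))
      + (M (Lp_int s \<mu> V) - M (Lp_int s \<mu> W)) * (LINT x|\<mu>. pw s (W x) \<bullet> (V x - W x))"
proof -
  have D: "(\<lambda>x. V x - W x) \<in> Lp s \<mu>" by (rule Lp_diff[OF V W s'(1)])
  have "(LINT x|\<mu>. (pw s (V x) - pw s (W x)) \<bullet> (V x - W x))
      = (LINT x|\<mu>. pw s (V x) \<bullet> (V x - W x)) - (LINT x|\<mu>. pw s (W x) \<bullet> (V x - W x))"
    unfolding inner_diff_left[of "pw s _"]
    by (rule Bochner_Integration.integral_diff[OF integrable_pw[OF V D] integrable_pw[OF W D]])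
  then show ?thesis unfolding form_def by (simp add: right_diff_distrib left_diff_distrib)
qed

lemma cross_bound:
  assumes V: "V \<in> Lp s \<mu>" "Lp_norm s \<mu> V \<le> R" and W: "W \<in> Lp s \<mu>" "Lp_norm s \<mu> W \<le> R"
  shows "\<bar>LINT x|\<mu>. pw s (W x) \<bullet> (V x - W x)\<bar> \<le> R powr (s - 1) * (2 * R)"
proof -
  have D: "(\<lambda>x. V x - W x) \<in> Lp s \<mu>" by (rule Lp_diff[OF V(1) W(1) s'(1)])
  have "Lp_norm s \<mu> (\<lambda>x. V x + (- 1) *\<^sub>R W x) \<le> Lp_norm s \<mu> V + Lp_norm s \<mu> (\<lambda>x. (- 1) *\<^sub>R W x)"
    by (rule Lp_norm_triangle[OF V(1) Lp_scale[OF W(1)] s'(2)])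
  then have "Lp_norm s \<mu> (\<lambda>x. V x - W x) \<le> 2 * R" using V(2) W(2) by (simp add: Lp_norm_minus)
  moreover have "Lp_norm s \<mu> W powr (s - 1) \<le> R powr (s - 1)" using W(2) s by (intro powr_mono2) auto
  ultimately have "Lp_norm s \<mu> W powr (s - 1) * Lp_norm s \<mu> (\<lambda>x. V x - W x) \<le> R powr (s - 1) * (2 * R)"
    by (intro mult_mono) auto
  then show ?thesis using Holder_inner(2)[OF D pw_Lp[OF W(1) s] s] by (simp add: Lp_norm_pw[OF s])
qed

context
  fixes V :: "nat \<Rightarrow> 'a \<Rightarrow> 'b::euclidean_space" and R d :: real
  assumes V: "\<And>n. V n \<in> Lp s \<mu>" and R: "\<And>n. Lp_norm s \<mu> (V n) \<le> R"
    and d: "(\<lambda>n. Lp_int s \<mu> (V n)) \<longlonglongrightarrow> d"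
begin

lemma M_norm_tendsto: "(\<lambda>n. M (Lp_int s \<mu> (V n))) \<longlonglongrightarrow> M d"
  using M_cont d by (auto simp: continuous_on_eq_continuous_at intro: isCont_tendsto_compose)

lemma cross_small:
  assumes e: "e > 0"
  shows "\<exists>n0. \<forall>m\<ge>n0. \<forall>n\<ge>n0. \<bar>(M (Lp_int s \<mu> (V n)) - M (Lp_int s \<mu> (V m))) *
    (LINT x|\<mu>. pw s (V m x) \<bullet> (V n x - V m x))\<bar> \<le> e"
proof -
  define C where "C = R powr (s - 1) * (2 * R) + 1"
  have "R \<ge> 0" using R[of 0] Lp_norm_nonneg order_trans by blast
  then have C: "C > 0" by (simp add: C_def add_nonneg_pos)
  have "Cauchy (\<lambda>n. M (Lp_int s \<mu> (V n)))" by (rule LIMSEQ_imp_Cauchy[OF M_norm_tendsto])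
  from metric_CauchyD[OF this, of "e / C"] obtain n0 where
    n0: "\<forall>m\<ge>n0. \<forall>n\<ge>n0. dist (M (Lp_int s \<mu> (V m))) (M (Lp_int s \<mu> (V n))) < e / C" using e C by auto
  show ?thesis
  proof (intro exI[of _ n0] allI impI)
    fix m n assume mn: "m \<ge> n0" "n \<ge> n0"
    have "\<bar>M (Lp_int s \<mu> (V n)) - M (Lp_int s \<mu> (V m))\<bar> \<le> e / C"
      using n0[rule_format, OF mn(2,1)] by (simp add: dist_real_def)
    moreover have "\<bar>LINT x|\<mu>. pw s (V m x) \<bullet> (V n x - V m x)\<bar> \<le> C"
      using cross_bound[OF V R V R, of m n] by (simp add: C_def)
    ultimately have "\<bar>M (Lp_int s \<mu> (V n)) - M (Lp_int s \<mu> (V m))\<bar> *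
      \<bar>LINT x|\<mu>. pw s (V m x) \<bullet> (V n x - V m x)\<bar> \<le> e / C * C" using e C by (intro mult_mono) auto
    then show "\<bar>(M (Lp_int s \<mu> (V n)) - M (Lp_int s \<mu> (V m))) *
      (LINT x|\<mu>. pw s (V m x) \<bullet> (V n x - V m x))\<bar> \<le> e" using C by (simp add: abs_mult)
  qed
qed

text \<open>The coefficients converge and the cross integrals are bounded, so up to a small error
  only the nonnegative monotone part remains.\<close>

lemma form_almost_monotone:
  assumes e: "e > 0"
  shows "\<exists>n0. \<forall>m\<ge>n0. \<forall>n\<ge>n0. - e \<le> form (V n) (\<lambda>x. V n x - V m x) - form (V m) (\<lambda>x. V n x - V m x)"
proof -
  obtain n0 where n0: "\<forall>m\<ge>n0. \<forall>n\<ge>n0. \<bar>(M (Lp_int s \<mu> (V n)) - M (Lp_int s \<mu> (V m))) *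
    (LINT x|\<mu>. pw s (V m x) \<bullet> (V n x - V m x))\<bar> \<le> e" using cross_small[OF e] by (elim exE)
  show ?thesis
  proof (intro exI[of _ n0] allI impI)
    fix m n assume mn: "m \<ge> n0" "n \<ge> n0"
    have "0 \<le> M (Lp_int s \<mu> (V n)) * (LINT x|\<mu>. (pw s (V n x) - pw s (V m x)) \<bullet> (V n x - V m x))"
      by (intro mult_nonneg_nonneg M_nonneg pw_monotone_Lp[OF s V V])
    then show "- e \<le> form (V n) (\<lambda>x. V n x - V m x) - form (V m) (\<lambda>x. V n x - V m x)"
      unfolding form_diff_eq[OF V V] using n0[rule_format, OF mn] by linarith
  qed
qed

text \<open>\<open>M 0\<close> may be 0. If the integrals tend to d = 0, the fields tend to 0 in
  norm and are Cauchy for that reason. If d > 0, the coefficients eventually exceed M d / 2 > 0, and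
  smallness of the forms passes to the monotone pairing.\<close>

lemma form_cauchy:
  assumes M_pos: "\<And>t. t > 0 \<Longrightarrow> M t > 0"
    and small: "\<And>\<epsilon>. \<epsilon> > 0 \<Longrightarrow> \<exists>n0. \<forall>m\<ge>n0. \<forall>n\<ge>n0. form (V n) (\<lambda>x. V n x - V m x) - form (V m) (\<lambda>x. V n x - V m x) \<le> \<epsilon>"
    and \<epsilon>: "\<epsilon> > 0"
  shows "\<exists>n0. \<forall>m\<ge>n0. \<forall>n\<ge>n0. Lp_norm s \<mu> (\<lambda>x. V n x - V m x) \<le> \<epsilon>"
proof (cases "d = 0")
  case True
  have "(\<lambda>n. Lp_norm s \<mu> (V n)) \<longlonglongrightarrow> 0" using d unfolding Lp_norm_tendsto_zero_iff[OF s'(1)] True .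
  then have "\<forall>\<^sub>F n in sequentially. Lp_norm s \<mu> (V n) < \<epsilon> / 2" using \<epsilon> by (intro order_tendstoD(2)) auto
  then obtain n0 where n0: "\<And>n. n \<ge> n0 \<Longrightarrow> Lp_norm s \<mu> (V n) < \<epsilon> / 2" by (auto simp: eventually_sequentially)
  show ?thesis
  proof (intro exI[of _ n0] allI impI)
    fix m n assume mn: "m \<ge> n0" "n \<ge> n0"
    have "Lp_norm s \<mu> (\<lambda>x. V n x + (- 1) *\<^sub>R V m x) \<le> Lp_norm s \<mu> (V n) + Lp_norm s \<mu> (\<lambda>x. (- 1) *\<^sub>R V m x)"
      by (rule Lp_norm_triangle[OF V Lp_scale[OF V] s'(2)])
    then show "Lp_norm s \<mu> (\<lambda>x. V n x - V m x) \<le> \<epsilon>" using n0[OF mn(1)] n0[OF mn(2)] by (simp add: Lp_norm_minus)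
  qed
next
  case False
  have "d \<ge> 0" by (rule LIMSEQ_le_const[OF d]) (auto intro!: integral_nonneg_AE)
  then have Md: "M d > 0" using False M_pos by simp
  show ?thesis
  proof (rule pw_strongly_monotone[OF s \<epsilon>, where M = \<mu> and R = R and 'b = 'b])
    fix \<eta> :: real assume \<eta>: "\<eta> > 0"
      "\<And>V W :: 'a \<Rightarrow> 'b. V \<in> Lp s \<mu> \<Longrightarrow> W \<in> Lp s \<mu> \<Longrightarrow> Lp_norm s \<mu> V \<le> R \<Longrightarrow> Lp_norm s \<mu> W \<le> R \<Longrightarrow>
       (LINT x|\<mu>. (pw s (V x) - pw s (W x)) \<bullet> (V x - W x)) \<le> \<eta> \<Longrightarrow> Lp_norm s \<mu> (\<lambda>x. V x - W x) \<le> \<epsilon>"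
    \<comment> \<open>Twice e equals (M d / 2) \<eta>: one e for the forms, one for the cross
      term.\<close>
    define e where "e = \<eta> * (M d / 2) / 2"
    have e: "e > 0" using \<eta>(1) Md by (simp add: e_def)
    obtain n1 where n1: "\<forall>m\<ge>n1. \<forall>n\<ge>n1. \<bar>(M (Lp_int s \<mu> (V n)) - M (Lp_int s \<mu> (V m))) *
      (LINT x|\<mu>. pw s (V m x) \<bullet> (V n x - V m x))\<bar> \<le> e" using cross_small[OF e] by (elim exE)
    obtain n2 where n2: "\<forall>m\<ge>n2. \<forall>n\<ge>n2. form (V n) (\<lambda>x. V n x - V m x) - form (V m) (\<lambda>x. V n x - V m x) \<le> e"
      using small[OF e] by (elim exE)
    have "\<forall>\<^sub>F n in sequentially. M d / 2 < M (Lp_int s \<mu> (V n))"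
      using Md by (intro order_tendstoD(1)[OF M_norm_tendsto]) simp
    then obtain n3 where n3: "\<And>n. n \<ge> n3 \<Longrightarrow> M d / 2 < M (Lp_int s \<mu> (V n))" by (auto simp: eventually_sequentially)
    show ?thesis
    proof (intro exI[of _ "max n1 (max n2 n3)"] allI impI)
      fix m n assume mn: "m \<ge> max n1 (max n2 n3)" "n \<ge> max n1 (max n2 n3)"
      define X where "X = (LINT x|\<mu>. (pw s (V n x) - pw s (V m x)) \<bullet> (V n x - V m x))"
      have X0: "X \<ge> 0" unfolding X_def by (rule pw_monotone_Lp[OF s V V])
      have 1: "\<bar>(M (Lp_int s \<mu> (V n)) - M (Lp_int s \<mu> (V m))) *
        (LINT x|\<mu>. pw s (V m x) \<bullet> (V n x - V m x))\<bar> \<le> e" using n1 mn by simp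
      have "form (V n) (\<lambda>x. V n x - V m x) - form (V m) (\<lambda>x. V n x - V m x) \<le> e" using n2 mn by simp
      then have "M (Lp_int s \<mu> (V n)) * X \<le> e + e"
        unfolding form_diff_eq[OF V V] X_def[symmetric] using 1 by linarith
      moreover have "M d / 2 * X \<le> M (Lp_int s \<mu> (V n)) * X" using n3[of n] mn X0 by (intro mult_right_mono) auto
      ultimately have "M d / 2 * X \<le> M d / 2 * \<eta>" unfolding e_def by (simp add: mult.commute)
      then have "X \<le> \<eta>" using Md by simp
      then show "Lp_norm s \<mu> (\<lambda>x. V n x - V m x) \<le> \<epsilon>" unfolding X_def by (intro \<eta>(2) V R)
    qed
  qed
qed

end

end

context kirchhoff_problem
begin

lemma M_pos: "t > 0 \<Longrightarrow> M t > 0" using M(4)[of t] by force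

text \<open>Subtract 1 / \<sigma> times the slope in direction u. As M(t) t / (q \<theta>) \<le>
  primitive M t / s for s = p and s = q, the phases keep the factor k = 1 / (q \<theta>) - 1 /
  \<sigma> > 0, and the terms with f leave a constant. A lower bound of \<open>M\<close> away from 0
  then bounds x^p + y^q by a linear function of x + y, for the norms x and y of the two
  phases.\<close>

lemma palais_smale_bounded:
  "\<exists>R. \<forall>u\<in>test. energy_at u \<le> B \<longrightarrow> \<bar>energy_slope u u\<bar> \<le> grad_norm (grad u) \<longrightarrow>
    grad_norm (grad u) \<le> R"
proof -
  have \<sigma>: "\<sigma> > 0" and qt: "q * \<theta> > 0" using AR(1) exponents by auto
  obtain K where K: "K \<ge> 0" "\<forall>x\<in>\<Omega>. \<forall>t. primitive (f x) t - f x t * t / \<sigma> \<le> K" using AR_defect by (elim exE conjE)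
  \<comment> \<open>\<open>M\<close> may vanish at 0, so the lower bound starts at a threshold; its
    price is the -1 in \<open>low\<close>, which costs 2 in all.\<close>
  obtain \<kappa> where \<kappa>: "\<kappa> > 0" "\<forall>t\<ge>1. M t \<ge> \<kappa>" using M(4)[OF zero_less_one] by (elim exE conjE)
  define k where "k = 1 / (q * \<theta>) - 1 / \<sigma>"
  have k: "k > 0" using AR(1) qt \<sigma> by (simp add: k_def frac_less2)
  \<comment> \<open>The slope of the term (x + y) / \<sigma> after division by k \<kappa>; K1 and K2
    absorb it into half of each power.\<close>
  define L where "L = 1 / (\<sigma> * (k * \<kappa>))"
  have L: "L \<ge> 0" using k \<kappa>(1) \<sigma> by (simp add: L_def)
  obtain K1 where K1: "K1 \<ge> 0" "\<And>x. x \<ge> 0 \<Longrightarrow> L * x \<le> K1 + x powr p / 2" using powr_absorbs_linear[OF pq(1) L] by blast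
  obtain K2 where K2: "K2 \<ge> 0" "\<And>x. x \<ge> 0 \<Longrightarrow> L * x \<le> K2 + x powr q / 2" using powr_absorbs_linear[OF exponents(1) L] by blast
  define m where "m = measure \<mu> (space \<mu>)"
  define E where "E = 2 + (B + K * m) / (k * \<kappa>) + K1 + K2"
  have "grad_norm (grad u) \<le> 2 + 2 * E"
    if u: "u \<in> test" and eB: "energy_at u \<le> B" and dB: "\<bar>energy_slope u u\<bar> \<le> grad_norm (grad u)" for u
  proof -
    define x where "x = nrm p (grad u)"
    define y where "y = nrm q (weighted (grad u))"
    have xy: "x \<ge> 0" "y \<ge> 0" by (simp_all add: x_def y_def)
    have X: "Lp_int p \<mu> (grad u) = x powr p" unfolding x_def by (rule Lp_norm_powr[OF exponents_pos(1), symmetric])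
    have Y: "Lp_int q \<mu> (weighted (grad u)) = y powr q" unfolding y_def by (rule Lp_norm_powr[OF exponents_pos(2), symmetric])
    define I1 where "I1 = (LINT x|\<mu>. primitive (f x) (u x))"
    define I2 where "I2 = f_pair u u"
    have uL: "u \<in> Lp r \<mu>" by (rule test_mem(1)[OF u])
    have "(LINT x|\<mu>. primitive (f x) (u x) - f x (u x) * u x / \<sigma>) \<le> (LINT x|\<mu>. K)"
    proof (rule integral_mono)
      show "integrable \<mu> (\<lambda>x. primitive (f x) (u x) - f x (u x) * u x / \<sigma>)"
        by (rule Bochner_Integration.integrable_diff[OF F_integrable[OF uL] integrable_divide[OF f_pairing(1)[OF uL uL]]])
    qed (use K(2) in auto)
    moreover have "(LINT x|\<mu>. primitive (f x) (u x) - f x (u x) * u x / \<sigma>) = I1 - I2 / \<sigma>" unfolding I1_def I2_def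
      by (subst Bochner_Integration.integral_diff[OF F_integrable[OF uL] integrable_divide[OF f_pairing(1)[OF uL uL]]]) simp
    ultimately have I: "I1 - I2 / \<sigma> \<le> K * m" by (simp add: m_def mult.commute)
    have en: "energy_at u = primitive M (x powr p) / p + primitive M (y powr q) / q - I1"
      unfolding energy_fun_def X Y I1_def ..
    have de: "energy_slope u u = M (x powr p) * x powr p + M (y powr q) * y powr q - I2"
      unfolding energy_deriv_def P.form_def Q.form_def pw_inner_self X Y I2_def ..
    have prim: "M t * t / (q * \<theta>) \<le> primitive M t / s" if "0 < s" "s \<le> q" "t \<ge> 0" for s t
    proof -
      have "M t * t \<le> \<theta> * primitive M t" using M(3)[OF that(3)] by (simp add: mult.commute)
      then have "M t * t / (q * \<theta>) \<le> \<theta> * primitive M t / (q * \<theta>)" using qt by (intro divide_right_mono) auto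
      also have "\<dots> = primitive M t / q" using \<theta> by simp
      also have "\<dots> \<le> primitive M t / s" using that M_primitive_nonneg[OF that(3)] by (intro divide_left_mono) auto
      finally show ?thesis .
    qed
    have low: "\<kappa> * (t - 1) \<le> M t * t" if "t \<ge> 0" for t
    proof (cases "t \<ge> 1")
      case True
      then have "\<kappa> * t \<le> M t * t" using \<kappa>(2) by (intro mult_right_mono) auto
      then show ?thesis using \<kappa>(1) by (simp add: right_diff_distrib)
    next
      case False
      then have "\<kappa> * (t - 1) \<le> 0" using \<kappa>(1) by (simp add: mult_nonneg_nonpos)
      moreover have "0 \<le> M t * t" using that M(2) by simp
      ultimately show ?thesis by linarith
    qed
    define P Q where "P = M (x powr p) * x powr p" and "Q = M (y powr q) * y powr q"
    have "P / (q * \<theta>) \<le> primitive M (x powr p) / p" "Q / (q * \<theta>) \<le> primitive M (y powr q) / q"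
      unfolding P_def Q_def using pq exponents_pos by (intro prim; simp)+
    moreover have "- ((P + Q - I2) / \<sigma>) \<le> (x + y) / \<sigma>"
    proof -
      have "- (P + Q - I2) \<le> x + y" using dB unfolding de grad_norm_def x_def[symmetric] y_def[symmetric] P_def Q_def by linarith
      then have "- (P + Q - I2) / \<sigma> \<le> (x + y) / \<sigma>" using \<sigma> by (intro divide_right_mono) auto
      then show ?thesis unfolding minus_divide_left .
    qed
    moreover have "P / (q * \<theta>) + Q / (q * \<theta>) - (P + Q) / \<sigma> = k * (P + Q)"
      by (simp add: k_def left_diff_distrib add_divide_distrib distrib_left)
    moreover have "(P + Q - I2) / \<sigma> = (P + Q) / \<sigma> - I2 / \<sigma>" by (simp add: diff_divide_distrib)
    ultimately have "k * (P + Q) \<le> B + K * m + (x + y) / \<sigma>" using eB I unfolding en by linarith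
    moreover have "k * (\<kappa> * (x powr p - 1) + \<kappa> * (y powr q - 1)) \<le> k * (P + Q)"
      unfolding P_def Q_def using k by (intro mult_left_mono add_mono low) auto
    moreover have "k * (\<kappa> * (x powr p - 1) + \<kappa> * (y powr q - 1)) = k * \<kappa> * (x powr p + y powr q - 2)"
      by (simp add: algebra_simps)
    ultimately have "k * \<kappa> * (x powr p + y powr q - 2) \<le> B + K * m + (x + y) / \<sigma>" by linarith
    then have "x powr p + y powr q - 2 \<le> (B + K * m + (x + y) / \<sigma>) / (k * \<kappa>)"
      using k \<kappa>(1) by (subst pos_le_divide_eq) (auto simp: mult.commute)
    also have "\<dots> = (B + K * m) / (k * \<kappa>) + (L * x + L * y)" by (simp add: L_def add_divide_distrib)
    finally have "x powr p / 2 + y powr q / 2 \<le> E"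
      using K1(2)[OF xy(1)] K2(2)[OF xy(2)] unfolding E_def by linarith
    moreover have "z \<le> 1 + z powr s" if "z \<ge> 0" "s > 1" for z s :: real
    proof (cases "z \<le> 1")
      case True then show ?thesis by (simp add: add_increasing2)
    next
      case False
      then have "z powr 1 \<le> z powr s" using that by (intro powr_mono) auto
      then show ?thesis using False by simp
    qed
    then have "x \<le> 1 + x powr p" "y \<le> 1 + y powr q" using xy pq exponents by auto
    ultimately show ?thesis unfolding grad_norm_def x_def[symmetric] y_def[symmetric] by linarith
  qed
  then show ?thesis by (intro exI[of _ "2 + 2 * E"] ballI impI)
qed

end

section \<open>Convergence of the sequence and of its equations\<close>

lemma Lp_norm_tendsto:
  assumes V: "\<And>n. V n \<in> Lp s M" "W \<in> Lp s M" and s: "s \<ge> 1"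
    and lim: "Lp_lim s M V W"
  shows "(\<lambda>n. Lp_norm s M (V n)) \<longlonglongrightarrow> Lp_norm s M W"
    and "(\<lambda>n. Lp_int s M (V n)) \<longlonglongrightarrow> (Lp_int s M W)"
proof -
  have s0: "s > 0" using s by simp
  have "(\<lambda>n. Lp_norm s M (V n) - Lp_norm s M W) \<longlonglongrightarrow> 0"
  proof (rule Lim_null_comparison[OF _ lim])
    show "\<forall>\<^sub>F n in sequentially. norm (Lp_norm s M (V n) - Lp_norm s M W) \<le> Lp_norm s M (\<lambda>x. V n x - W x)"
      unfolding real_norm_def by (intro always_eventually allI Lp_norm_triangle_diff V s)
  qed
  then show 1: "(\<lambda>n. Lp_norm s M (V n)) \<longlonglongrightarrow> Lp_norm s M W" by (simp only: LIM_zero_iff)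
  show "(\<lambda>n. Lp_int s M (V n)) \<longlonglongrightarrow> (Lp_int s M W)" unfolding Lp_norm_powr[OF s0, symmetric] using s0
    by (intro tendsto_powr'[OF 1 tendsto_const]) auto
qed

lemma Lp_norm_cong_AE:
  assumes "V \<in> borel_measurable M" "W \<in> borel_measurable M" "AE x in M. V x = W x"
  shows "Lp_norm s M V = Lp_norm s M W"
proof -
  have "Lp_int s M V = Lp_int s M W" using assms by (intro integral_cong_AE) auto
  then show ?thesis by (simp add: Lp_norm_def)
qed

lemma Lp_cong_AE:
  assumes "V \<in> Lp s M" "W \<in> borel_measurable M" "s > 0" "AE x in M. W x = V x"
  shows "W \<in> Lp s M" by (rule Lp_bound(1)[OF assms(1-3)]) (use assms(4) in auto)

context kirchhoff_term
begin

lemma form_tendsto_right: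
  fixes V :: "'a \<Rightarrow> 'b::euclidean_space"
  assumes V: "V \<in> Lp s \<mu>" and W: "\<And>n. W n \<in> Lp s \<mu>" "Z \<in> Lp s \<mu>"
    and lim: "Lp_lim s \<mu> W Z"
  shows "(\<lambda>n. form V (W n)) \<longlonglongrightarrow> form V Z"
proof (rule form_bounded[of "Lp_norm s \<mu> V", where 'b = 'b])
  fix C assume C: "C \<ge> 0"
    "\<And>V' W' :: 'a \<Rightarrow> 'b. V' \<in> Lp s \<mu> \<Longrightarrow> W' \<in> Lp s \<mu> \<Longrightarrow> Lp_norm s \<mu> V' \<le> Lp_norm s \<mu> V \<Longrightarrow> \<bar>form V' W'\<bar> \<le> C * Lp_norm s \<mu> W'"
  have "(\<lambda>n. form V (W n) - form V Z) \<longlonglongrightarrow> 0"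
  proof (rule Lim_null_comparison[where g = "\<lambda>n. C * Lp_norm s \<mu> (\<lambda>x. W n x - Z x)"])
    show "(\<lambda>n. C * Lp_norm s \<mu> (\<lambda>x. W n x - Z x)) \<longlonglongrightarrow> 0" using tendsto_mult[OF tendsto_const lim, of C] by simp
    show "\<forall>\<^sub>F n in sequentially. norm (form V (W n) - form V Z) \<le> C * Lp_norm s \<mu> (\<lambda>x. W n x - Z x)"
    proof (intro always_eventually allI)
      fix n
      have D: "(\<lambda>x. W n x - Z x) \<in> Lp s \<mu>" by (rule Lp_diff[OF W s'(1)])
      have eq: "W n = (\<lambda>x. (W n x - Z x) + Z x)" by simp
      have "form V (W n) = form V (\<lambda>x. (W n x - Z x) + Z x)" by simp
      also have "\<dots> = form V (\<lambda>x. W n x - Z x) + form V Z" by (rule form_add[OF V D W(2)])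
      finally have "form V (W n) - form V Z = form V (\<lambda>x. W n x - Z x)" by linarith
      then show "norm (form V (W n) - form V Z) \<le> C * Lp_norm s \<mu> (\<lambda>x. W n x - Z x)"
        using C(2)[OF V D order_refl] by simp
    qed
  qed
  then show ?thesis by (simp only: LIM_zero_iff)
qed

lemma form_tendsto_left:
  fixes V :: "'a \<Rightarrow> 'b::euclidean_space"
  assumes Vn: "\<And>n. Vn n \<in> Lp s \<mu>" "V \<in> Lp s \<mu>" and W: "W \<in> Lp s \<mu>"
    and lim: "Lp_lim s \<mu> Vn V"
  shows "(\<lambda>n. form (Vn n) W) \<longlonglongrightarrow> form V W"
proof (rule LIMSEQ_I)
  fix e :: real assume e: "e > 0"
  define \<epsilon> where "\<epsilon> = e / 2 / (Lp_norm s \<mu> W + 1)"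
  have W1: "Lp_norm s \<mu> W + 1 > 0" by (simp add: add_nonneg_pos)
  have \<epsilon>: "\<epsilon> > 0" using e W1 by (simp add: \<epsilon>_def)
  have "\<epsilon> * Lp_norm s \<mu> W \<le> \<epsilon> * (Lp_norm s \<mu> W + 1)" using \<epsilon> by (intro mult_left_mono) auto
  also have "\<dots> = e / 2" by (rule iffD1[OF nonzero_eq_divide_eq]) (use W1 in simp, rule \<epsilon>_def)
  finally have \<epsilon>W: "\<epsilon> * Lp_norm s \<mu> W < e" using e by linarith
  define R where "R = Lp_norm s \<mu> V + 1"
  show "\<exists>n0. \<forall>n\<ge>n0. norm (form (Vn n) W - form V W) < e"
  proof (rule form_uniformly_continuous[OF \<epsilon>, where R = R and 'b = 'b])
    fix \<eta> assume \<eta>: "\<eta> > 0"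
      "\<And>V V' W :: 'a \<Rightarrow> 'b. V \<in> Lp s \<mu> \<Longrightarrow> V' \<in> Lp s \<mu> \<Longrightarrow> W \<in> Lp s \<mu> \<Longrightarrow> Lp_norm s \<mu> V \<le> R \<Longrightarrow> Lp_norm s \<mu> V' \<le> R \<Longrightarrow>
       Lp_norm s \<mu> (\<lambda>x. V x - V' x) \<le> \<eta> \<Longrightarrow> \<bar>form V W - form V' W\<bar> \<le> \<epsilon> * Lp_norm s \<mu> W"
    have "\<forall>\<^sub>F n in sequentially. Lp_norm s \<mu> (\<lambda>x. Vn n x - V x) < min \<eta> 1"
      using \<eta>(1) by (intro order_tendstoD(2)[OF lim]) auto
    then obtain n0 where n0: "\<And>n. n \<ge> n0 \<Longrightarrow> Lp_norm s \<mu> (\<lambda>x. Vn n x - V x) < min \<eta> 1"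
      by (auto simp: eventually_sequentially)
    show ?thesis
    proof (intro exI[of _ n0] allI impI)
      fix n assume n: "n \<ge> n0"
      have R: "Lp_norm s \<mu> (Vn n) \<le> R" "Lp_norm s \<mu> V \<le> R"
        using Lp_norm_triangle_diff[OF Vn(1)[of n] Vn(2) s'(2)] n0[OF n] unfolding R_def by linarith+
      have "Lp_norm s \<mu> (\<lambda>x. Vn n x - V x) \<le> \<eta>" using n0[OF n] by linarith
      from \<eta>(2)[OF Vn W R this] \<epsilon>W show "norm (form (Vn n) W - form V W) < e" by simp
    qed
  qed
qed

end

context kirchhoff_problem
begin

text \<open>The integrals inside \<open>M\<close> converge by assumption, so
  \<open>form_almost_monotone\<close> bounds both phases below; since their sum is at most b n + b
  m, each of them is then bounded above as well, which is what \<open>form_cauchy\<close> asks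
  for.\<close>

lemma palais_smale_cauchy:
  assumes z: "\<And>n. z n \<in> test" and R: "\<And>n. grad_norm (grad (z n)) \<le> R"
    and crit: "\<And>n v. v \<in> test \<Longrightarrow> \<bar>energy_slope (z n) v\<bar> \<le> 1 / real (Suc n) * grad_norm (grad v)"
    and w: "w \<in> Lp r \<mu>" "Lp_lim r \<mu> z w"
    and d1: "(\<lambda>n. Lp_int p \<mu> (grad (z n))) \<longlonglongrightarrow> d1"
    and d2: "(\<lambda>n. Lp_int q \<mu> (weighted (grad (z n)))) \<longlonglongrightarrow> d2"
    and \<epsilon>: "\<epsilon> > 0"
  shows "\<exists>n0. \<forall>n\<ge>n0. \<forall>m\<ge>n0. nrm p (\<lambda>x. grad (z n) x - grad (z m) x) \<le> \<epsilon>"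
    and "\<exists>n0. \<forall>n\<ge>n0. \<forall>m\<ge>n0. nrm q (\<lambda>x. weighted (grad (z n)) x - weighted (grad (z m)) x) \<le> \<epsilon>"
proof -
  note zp = test_mem(2)[OF z] and zq = test_mem(3)[OF z] and zr = test_mem(1)[OF z]
  have Rp: "nrm p (grad (z n)) \<le> R" and Rq: "nrm q (weighted (grad (z n))) \<le> R" for n
    using R[of n] grad_norm_parts[of "grad (z n)"] by linarith+
  obtain S where S: "S > 0" "\<forall>u\<in>test. nrm r u \<le> S * nrm p (grad u)"
    using sobolev_constant[OF less_imp_le[OF exponents(5)] r_range(2)] by (elim exE conjE)
  obtain K where K: "K \<ge> 0" "\<forall>u\<in>Lp r \<mu>. nrm r u \<le> S * R \<longrightarrow> nrm r' (\<lambda>x. f x (u x)) \<le> K"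
    using f_bounded[of "S * R"] by (elim exE conjE)
  have Kz: "nrm r' (\<lambda>x. f x (z n x)) \<le> K" for n
  proof -
    have "nrm r (z n) \<le> S * R" using bspec[OF S(2) z[of n]] mult_left_mono[OF Rp[of n], of S] S(1) by linarith
    then show ?thesis using K(2) zr[of n] by (simp del: One_nat_def)
  qed
  define A where "A n m = P.form (grad (z n)) (\<lambda>x. grad (z n) x - grad (z m) x) - P.form (grad (z m)) (\<lambda>x. grad (z n) x - grad (z m) x)" for n m
  define B where "B n m = Q.form (weighted (grad (z n))) (\<lambda>x. weighted (grad (z n)) x - weighted (grad (z m)) x)
    - Q.form (weighted (grad (z m))) (\<lambda>x. weighted (grad (z n)) x - weighted (grad (z m)) x)" for n m
  \<comment> \<open>The error of one tested equation: its slope against a direction of norm at most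
    2 R, and the terms with f, bounded in the dual norm by K, against the L^r distance to w.\<close>
  define b where "b n = 2 * R * (1 / real (Suc n)) + 2 * K * nrm r (\<lambda>x. z n x - w x)" for n
  have "(\<lambda>n. 1 / real (Suc n)) \<longlonglongrightarrow> 0" using LIMSEQ_inverse_real_of_nat by (simp add: inverse_eq_divide)
  then have "b \<longlonglongrightarrow> 2 * R * 0 + 2 * K * 0"
    unfolding b_def using w(2) by (intro tendsto_add tendsto_mult tendsto_const)
  then have b0: "b \<longlonglongrightarrow> 0" by simp
  have AB: "A n m + B n m \<le> b n + b m" for n m
  proof -
    let ?v = "\<lambda>x. z n x - z m x"
    have v: "?v \<in> test" by (rule test_functions_diff[OF z z])
    have gv: "grad ?v = (\<lambda>x. grad (z n) x - grad (z m) x)" by (rule grad_fun_diff[OF z z])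
    have wv: "weighted (grad ?v) = (\<lambda>x. weighted (grad (z n)) x - weighted (grad (z m)) x)" unfolding gv weighted_diff ..
    have "nrm p (grad ?v) \<le> nrm p (grad (z n)) + nrm p (grad (z m))"
      by (rule test_grad_diff_norm[OF z z \<Omega>_lebesgue exponents_pos(4)])
    moreover have "nrm q (\<lambda>x. weighted (grad (z n)) x + (- 1) *\<^sub>R weighted (grad (z m)) x)
        \<le> nrm q (weighted (grad (z n))) + nrm q (\<lambda>x. (- 1) *\<^sub>R weighted (grad (z m)) x)"
      by (rule Lp_norm_triangle[OF zq Lp_scale[OF zq] exponents_pos(5)])
    then have "nrm q (weighted (grad ?v)) \<le> nrm q (weighted (grad (z n))) + nrm q (weighted (grad (z m)))"
      unfolding wv by (simp add: Lp_norm_minus)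
    ultimately have N: "grad_norm (grad ?v) \<le> 2 * R" using R[of n] R[of m] unfolding grad_norm_def by linarith
    have cr: "\<bar>energy_deriv (z k) (grad (z k)) ?v (grad ?v)\<bar> \<le> 2 * R * (1 / real (Suc k))" for k
    proof -
      have "1 / real (Suc k) * grad_norm (grad ?v) \<le> 1 / real (Suc k) * (2 * R)" using N by (intro mult_left_mono) auto
      then show ?thesis using crit[OF v, of k] by (simp only: mult.commute)
    qed
    have "nrm r (\<lambda>x. (z n x - w x) + (w x - z m x)) \<le> nrm r (\<lambda>x. z n x - w x) + nrm r (\<lambda>x. w x - z m x)"
      by (intro Lp_norm_triangle Lp_diff zr w exponents_pos)
    then have vr: "nrm r ?v \<le> nrm r (\<lambda>x. z n x - w x) + nrm r (\<lambda>x. z m x - w x)"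
      by (simp add: Lp_norm_diff_commute[of r \<mu> w])
    have fb: "\<bar>LINT x|\<mu>. f x (z k x) * ?v x\<bar> \<le> K * (nrm r (\<lambda>x. z n x - w x) + nrm r (\<lambda>x. z m x - w x))" for k
      using f_pairing(2)[OF zr[of k] test_mem(1)[OF v]] mult_mono[OF Kz[of k] vr K(1) Lp_norm_nonneg] by linarith
    have eq: "(a1 - a2) + (b1 - b2) = (a1 + b1 - c1) - (a2 + b2 - c2) + c1 - c2" for a1 a2 b1 b2 c1 c2 :: real by simp
    have lin: "e1 - e2 + c1 - c2 \<le> (2 * R * i1 + 2 * K * n1) + (2 * R * i2 + 2 * K * n2)"
      if "\<bar>e1\<bar> \<le> 2 * R * i1" "\<bar>e2\<bar> \<le> 2 * R * i2" "\<bar>c1\<bar> \<le> K * (n1 + n2)" "\<bar>c2\<bar> \<le> K * (n1 + n2)"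
      for e1 e2 c1 c2 i1 i2 n1 n2 using that unfolding distrib_left by linarith
    have "A n m + B n m = energy_deriv (z n) (grad (z n)) ?v (grad ?v) - energy_deriv (z m) (grad (z m)) ?v (grad ?v)
        + (LINT x|\<mu>. f x (z n x) * ?v x) - (LINT x|\<mu>. f x (z m x) * ?v x)"
      unfolding A_def B_def energy_deriv_def wv unfolding gv by (rule eq)
    also note lin[OF cr[of n] cr[of m] fb[of n] fb[of m], folded b_def]
    finally show ?thesis .
  qed
  have A_low: "\<exists>n0. \<forall>m\<ge>n0. \<forall>n\<ge>n0. - e \<le> A n m" if "e > 0" for e
    unfolding A_def by (rule P.form_almost_monotone[OF zp Rp d1 that])
  have B_low: "\<exists>n0. \<forall>m\<ge>n0. \<forall>n\<ge>n0. - e \<le> B n m" if "e > 0" for e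
    unfolding B_def by (rule Q.form_almost_monotone[OF zq Rq d2 that])
  have b_small: "\<exists>n0. \<forall>n\<ge>n0. b n \<le> e" if e: "e > 0" for e
  proof -
    have "\<forall>\<^sub>F n in sequentially. b n < e" by (rule order_tendstoD(2)[OF b0 e])
    then obtain n0 where "\<forall>n\<ge>n0. b n < e" unfolding eventually_sequentially by (elim exE)
    then show ?thesis by (intro exI[of _ n0]) (auto intro: less_imp_le)
  qed
  \<comment> \<open>If X + Y is asymptotically at most 0 and X is asymptotically nonnegative, then Y
    is asymptotically at most 0; one e / 3 for X and one for each of b n and b m. It is used in both
    directions.\<close>
  have small: "\<exists>n0. \<forall>m\<ge>n0. \<forall>n\<ge>n0. Y n m \<le> e"
    if low: "\<And>e. e > 0 \<Longrightarrow> \<exists>n0. \<forall>m\<ge>n0. \<forall>n\<ge>n0. - e \<le> X n m" and XY: "\<And>n m. X n m + Y n m \<le> b n + b m" and e: "e > 0"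
    for X Y :: "nat \<Rightarrow> nat \<Rightarrow> real" and e
  proof -
    have e3: "e / 3 > 0" using e by simp
    obtain n1 where n1: "\<forall>m\<ge>n1. \<forall>n\<ge>n1. - (e / 3) \<le> X n m" using low[OF e3] by (elim exE)
    obtain n2 where n2: "\<forall>n\<ge>n2. b n \<le> e / 3" using b_small[OF e3] by (elim exE)
    show ?thesis
    proof (intro exI[of _ "max n1 n2"] allI impI)
      fix m n assume mn: "m \<ge> max n1 n2" "n \<ge> max n1 n2"
      have "- (e / 3) \<le> X n m" "b n \<le> e / 3" "b m \<le> e / 3" using n1 n2 mn by auto
      then show "Y n m \<le> e" using XY[of n m] by linarith
    qed
  qed
  have A_small: "\<exists>n0. \<forall>m\<ge>n0. \<forall>n\<ge>n0. A n m \<le> e" if "e > 0" for e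
    by (rule small[OF B_low _ that]) (use AB in \<open>simp_all add: add.commute\<close>)
  have B_small: "\<exists>n0. \<forall>m\<ge>n0. \<forall>n\<ge>n0. B n m \<le> e" if "e > 0" for e
    by (rule small[OF A_low AB that])
  have swap: "\<exists>n0. \<forall>n\<ge>n0. \<forall>m\<ge>n0. Y n m" if "\<exists>n0. \<forall>m\<ge>n0. \<forall>n\<ge>n0. Y n m" for Y :: "nat \<Rightarrow> nat \<Rightarrow> bool"
    using that by blast
  show "\<exists>n0. \<forall>n\<ge>n0. \<forall>m\<ge>n0. nrm p (\<lambda>x. grad (z n) x - grad (z m) x) \<le> \<epsilon>"
    by (rule swap[OF P.form_cauchy[OF zp Rp d1 M_pos A_small[unfolded A_def] \<epsilon>]])
  show "\<exists>n0. \<forall>n\<ge>n0. \<forall>m\<ge>n0. nrm q (\<lambda>x. weighted (grad (z n)) x - weighted (grad (z m)) x) \<le> \<epsilon>"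
    by (rule swap[OF Q.form_cauchy[OF zq Rq d2 M_pos B_small[unfolded B_def] \<epsilon>]])
qed

text \<open>The two limits come from different norms. Along a common subsequence both hold almost
  everywhere, and multiplication by the weight is pointwise continuous, so the second limit is the
  first one weighted.\<close>

lemma gradient_complete:
  assumes V: "\<And>n. V n \<in> Lp p \<mu>" "\<And>n. weighted (V n) \<in> Lp q \<mu>"
    and cauchy: "\<And>e. e > 0 \<Longrightarrow> \<exists>n0. \<forall>m\<ge>n0. \<forall>n\<ge>n0. nrm p (\<lambda>x. V m x - V n x) \<le> e"
      "\<And>e. e > 0 \<Longrightarrow> \<exists>n0. \<forall>m\<ge>n0. \<forall>n\<ge>n0. nrm q (\<lambda>x. weighted (V m) x - weighted (V n) x) \<le> e"
  shows "\<exists>W. W \<in> Lp p \<mu> \<and> weighted W \<in> Lp q \<mu> \<and> Lp_lim p \<mu> V W \<and>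
    Lp_lim q \<mu> (\<lambda>n. weighted (V n)) (weighted W)"
proof (rule Lp_complete[OF V(1) exponents_pos(4) cauchy(1)])
  fix W assume W: "W \<in> Lp p \<mu>" "Lp_lim p \<mu> V W"
  show ?thesis
  proof (rule Lp_complete[OF V(2) exponents_pos(5) cauchy(2)])
    fix X assume X: "X \<in> Lp q \<mu>" "Lp_lim q \<mu> (\<lambda>n. weighted (V n)) X"
    have wW: "weighted W \<in> borel_measurable \<mu>" by (rule weighted_measurable[OF LpD(1)[OF W(1)]])
    have AE: "AE x in \<mu>. weighted W x = X x"
    proof (rule Lp_convergent_AE_subseq[OF V(1) W(1) exponents_pos(1) W(2)])
      fix k :: "nat \<Rightarrow> nat" assume k: "strict_mono k" "AE x in \<mu>. (\<lambda>n. V (k n) x) \<longlonglongrightarrow> W x"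
      have X': "Lp_lim q \<mu> (\<lambda>n. weighted (V (k n))) X"
        using LIMSEQ_subseq_LIMSEQ[OF X(2) k(1)] by (simp add: o_def)
      show ?thesis
      proof (rule Lp_convergent_AE_subseq[OF V(2) X(1) exponents_pos(2) X'])
        fix l :: "nat \<Rightarrow> nat" assume l: "strict_mono l" "AE x in \<mu>. (\<lambda>n. weighted (V (k (l n))) x) \<longlonglongrightarrow> X x"
        show ?thesis using k(2) l(2)
        proof eventually_elim
          fix x assume lim: "(\<lambda>n. V (k n) x) \<longlonglongrightarrow> W x" "(\<lambda>n. weighted (V (k (l n))) x) \<longlonglongrightarrow> X x"
          have "(\<lambda>n. V (k (l n)) x) \<longlonglongrightarrow> W x" using LIMSEQ_subseq_LIMSEQ[OF lim(1) l(1)] by (simp add: o_def)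
          then have "(\<lambda>n. weighted (V (k (l n))) x) \<longlonglongrightarrow> weighted W x"
            unfolding weighted_def by (intro tendsto_scaleR tendsto_const)
          then show "weighted W x = X x" using lim(2) by (rule LIMSEQ_unique)
        qed
      qed
    qed
    have wL: "weighted W \<in> Lp q \<mu>" by (rule Lp_cong_AE[OF X(1) wW exponents_pos(2) AE])
    have "nrm q (\<lambda>x. weighted (V n) x - weighted W x) = nrm q (\<lambda>x. weighted (V n) x - X x)" for n
    proof (rule Lp_norm_cong_AE)
      show "(\<lambda>x. weighted (V n) x - weighted W x) \<in> borel_measurable \<mu>" "(\<lambda>x. weighted (V n) x - X x) \<in> borel_measurable \<mu>"
        by (intro borel_measurable_diff LpD(1)[OF V(2)] LpD(1)[OF wL] LpD(1)[OF X(1)])+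
      show "AE x in \<mu>. weighted (V n) x - weighted W x = weighted (V n) x - X x" using AE by eventually_elim simp
    qed
    then have "Lp_lim q \<mu> (\<lambda>n. weighted (V n)) (weighted W)" using X(2) by simp
    with W wL show ?thesis by (intro exI[of _ W] conjI)
  qed
qed

end

lemma bounded_real_subseq:
  fixes X :: "nat \<Rightarrow> real"
  assumes "\<And>n. 0 \<le> X n" "\<And>n. X n \<le> B"
  shows "\<exists>l s. strict_mono (s :: nat \<Rightarrow> nat) \<and> (\<lambda>n. X (s n)) \<longlonglongrightarrow> l"
proof -
  have "\<bar>X n\<bar> \<le> B" for n using assms(1)[of n] assms(2)[of n] by simp
  then have "bounded (range X)" by (intro boundedI[where B = B]) auto
  from bounded_imp_convergent_subsequence[OF this] show ?thesis by (simp add: o_def)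
qed

context kirchhoff_problem
begin

text \<open>Four nested subsequences: for L^r convergence, for the terms with f, and for the
  integral inside \<open>M\<close> in each phase. V is so far only a limit of gradients.\<close>

lemma critical_limit:
  "\<exists>\<alpha> w V z. \<alpha> > 0 \<and> (\<forall>n. z n \<in> test) \<and> w \<in> Lp r \<mu> \<and> V \<in> Lp p \<mu> \<and> weighted V \<in> Lp q \<mu> \<and>
    Lp_lim r \<mu> z w \<and>
    Lp_lim p \<mu> (\<lambda>n. grad (z n)) V \<and>
    Lp_lim q \<mu> (\<lambda>n. weighted (grad (z n))) (weighted V) \<and>
    \<alpha> \<le> energy_fun w V \<and> (\<forall>v\<in>test. energy_deriv w V v (grad v) = 0)"
proof -
  obtain \<alpha> B u where \<alpha>: "\<alpha> > 0" and ps: "\<forall>n. u n \<in> test \<and> \<alpha> \<le> energy_at (u n) \<and> energy_at (u n) \<le> B \<and>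
    (\<forall>v\<in>test. \<bar>energy_slope (u n) v\<bar> \<le> 1 / real (Suc n) * grad_norm (grad v))"
    using palais_smale_sequence by (elim exE conjE)
  note ps1 = spec[OF ps] and ps2 = conjunct2[OF spec[OF ps]] and ps3 = conjunct2[OF conjunct2[OF spec[OF ps]]]
  have u: "u n \<in> test" for n by (rule conjunct1[OF ps1])
  have u\<alpha>: "\<alpha> \<le> energy_at (u n)" for n by (rule conjunct1[OF ps2])
  have uB: "energy_at (u n) \<le> B" for n by (rule conjunct1[OF ps3])
  have ucrit: "\<bar>energy_slope (u n) v\<bar> \<le> 1 / real (Suc n) * grad_norm (grad v)" if "v \<in> test" for n v
    by (rule bspec[OF conjunct2[OF ps3] that])
  have gn0: "grad_norm W \<ge> 0" for W by (simp add: grad_norm_def)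
  obtain R where R: "\<forall>u\<in>test. energy_at u \<le> B \<longrightarrow> \<bar>energy_slope u u\<bar> \<le> grad_norm (grad u) \<longrightarrow>
    grad_norm (grad u) \<le> R" using palais_smale_bounded[of B] by (elim exE)
  have uR: "grad_norm (grad (u n)) \<le> R" for n
  proof -
    have "1 / real (Suc n) * grad_norm (grad (u n)) \<le> 1 * grad_norm (grad (u n))"
      using gn0[of "grad (u n)"] by (intro mult_right_mono) auto
    then have "\<bar>energy_slope (u n) (u n)\<bar> \<le> grad_norm (grad (u n))" using ucrit[OF u, of n n] by linarith
    with R u uB show ?thesis by (auto simp del: One_nat_def)
  qed
  have uRp: "nrm p (grad (u n)) \<le> R" and uRq: "nrm q (weighted (grad (u n))) \<le> R" for n
    using uR[of n] grad_norm_parts[of "grad (u n)"] by linarith+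
  have R0: "R \<ge> 0" using uRp[of 0] Lp_norm_nonneg order_trans by blast
  obtain s1 w where s1: "strict_mono (s1 :: nat \<Rightarrow> nat)" and w: "w \<in> Lp r \<mu>" and w1: "Lp_lim r \<mu> (\<lambda>n. u (s1 n)) w"
    using compact_embedding[of u R, OF u uRp] by (elim exE conjE)
  obtain s2 :: "nat \<Rightarrow> nat" where s2: "strict_mono s2"
    "(\<lambda>n. nrm r' (\<lambda>x. f x (u (s1 (s2 n)) x) - f x (w x))) \<longlonglongrightarrow> 0"
    "(\<lambda>n. LINT x|\<mu>. primitive (f x) (u (s1 (s2 n)) x)) \<longlonglongrightarrow> (LINT x|\<mu>. primitive (f x) (w x))"
    by (rule nemytskii[OF test_mem(1)[OF u] w w1])
  have bP: "Lp_int p \<mu> (grad (u n)) \<le> R powr p" for n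
    using uRp[of n] unfolding Lp_norm_le_iff[OF exponents_pos(1) R0] .
  have bQ: "Lp_int q \<mu> (weighted (grad (u n))) \<le> R powr q" for n
    using uRq[of n] unfolding Lp_norm_le_iff[OF exponents_pos(2) R0] .
  have nn: "0 \<le> Lp_int s \<mu> Z" for Z :: "'a \<Rightarrow> 'a" and s by (intro integral_nonneg_AE) simp
  obtain d1 s3 where s3: "strict_mono (s3 :: nat \<Rightarrow> nat)" and d1: "(\<lambda>n. Lp_int p \<mu> (grad (u (s1 (s2 (s3 n)))))) \<longlonglongrightarrow> d1"
    using bounded_real_subseq[where X = "\<lambda>n. Lp_int p \<mu> (grad (u (s1 (s2 n))))", OF nn bP] by (elim exE conjE)
  obtain d2 s4 where s4: "strict_mono (s4 :: nat \<Rightarrow> nat)" and d2: "(\<lambda>n. Lp_int q \<mu> (weighted (grad (u (s1 (s2 (s3 (s4 n)))))))) \<longlonglongrightarrow> d2"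
    using bounded_real_subseq[where X = "\<lambda>n. Lp_int q \<mu> (weighted (grad (u (s1 (s2 (s3 n))))))", OF nn bQ] by (elim exE conjE)
  define k where "k n = s1 (s2 (s3 (s4 n)))" for n
  have km: "strict_mono k" unfolding k_def using s1 s2(1) s3 s4 by (simp add: strict_mono_def)
  define z where "z n = u (k n)" for n
  have s34: "strict_mono (\<lambda>n. s3 (s4 n))" "strict_mono (\<lambda>n. s2 (s3 (s4 n)))" using s2(1) s3 s4 by (simp_all add: strict_mono_def)
  have zt: "z n \<in> test" for n unfolding z_def by (rule u)
  have zR: "grad_norm (grad (z n)) \<le> R" for n unfolding z_def by (rule uR)
  have zcrit: "\<bar>energy_slope (z n) v\<bar> \<le> 1 / real (Suc n) * grad_norm (grad v)" if v: "v \<in> test" for n v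
  proof -
    \<comment> \<open>The slope bound survives the renumbering because k n \<ge> n.\<close>
    have "1 / real (Suc (k n)) \<le> 1 / real (Suc n)" using seq_suble[OF km, of n] by (intro divide_left_mono) auto
    then have "1 / real (Suc (k n)) * grad_norm (grad v) \<le> 1 / real (Suc n) * grad_norm (grad v)" using gn0 by (intro mult_right_mono)
    then show ?thesis using ucrit[OF v, of "k n"] unfolding z_def by linarith
  qed
  have zw: "Lp_lim r \<mu> z w" using LIMSEQ_subseq_LIMSEQ[OF w1 s34(2)] by (simp add: o_def z_def k_def)
  have zf: "(\<lambda>n. nrm r' (\<lambda>x. f x (z n x) - f x (w x))) \<longlonglongrightarrow> 0"
    using LIMSEQ_subseq_LIMSEQ[OF s2(2) s34(1)] by (simp add: o_def z_def k_def)
  have zF: "(\<lambda>n. LINT x|\<mu>. primitive (f x) (z n x)) \<longlonglongrightarrow> (LINT x|\<mu>. primitive (f x) (w x))"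
    using LIMSEQ_subseq_LIMSEQ[OF s2(3) s34(1)] by (simp add: o_def z_def k_def)
  have zd1: "(\<lambda>n. Lp_int p \<mu> (grad (z n))) \<longlonglongrightarrow> d1"
    using LIMSEQ_subseq_LIMSEQ[OF d1 s4] by (simp add: o_def z_def k_def)
  have zd2: "(\<lambda>n. Lp_int q \<mu> (weighted (grad (z n)))) \<longlonglongrightarrow> d2" using d2 by (simp add: z_def k_def)
  have cauchy: "\<exists>n0. \<forall>n\<ge>n0. \<forall>m\<ge>n0. nrm p (\<lambda>x. grad (z n) x - grad (z m) x) \<le> e"
    "\<exists>n0. \<forall>n\<ge>n0. \<forall>m\<ge>n0. nrm q (\<lambda>x. weighted (grad (z n)) x - weighted (grad (z m)) x) \<le> e" if "e > 0" for e
    by (rule palais_smale_cauchy[OF zt zR _ w zw zd1 zd2 that], rule zcrit, assumption)+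
  note zp = test_mem(2)[OF zt] and zq = test_mem(3)[OF zt] and zr = test_mem(1)[OF zt]
  have "\<exists>V. V \<in> Lp p \<mu> \<and> weighted V \<in> Lp q \<mu> \<and> Lp_lim p \<mu> (\<lambda>n. grad (z n)) V \<and>
    Lp_lim q \<mu> (\<lambda>n. weighted (grad (z n))) (weighted V)"
    by (rule gradient_complete[OF zp zq]; rule cauchy; assumption)
  then obtain V where V: "V \<in> Lp p \<mu>" "weighted V \<in> Lp q \<mu>" and zV: "Lp_lim p \<mu> (\<lambda>n. grad (z n)) V"
    "Lp_lim q \<mu> (\<lambda>n. weighted (grad (z n))) (weighted V)" by (elim exE conjE)
  have contM: "isCont (primitive M) t" for t
    using primitive_continuous[OF M(1), of UNIV] by (simp add: continuous_on_eq_continuous_at)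
  have "(\<lambda>n. energy_at (z n)) \<longlonglongrightarrow> energy_fun w V" unfolding energy_fun_def using exponents_pos
    by (intro tendsto_diff tendsto_add tendsto_divide tendsto_const zF
        isCont_tendsto_compose[OF contM Lp_norm_tendsto(2)[OF zp V(1) exponents_pos(4) zV(1)]]
        isCont_tendsto_compose[OF contM Lp_norm_tendsto(2)[OF zq V(2) exponents_pos(5) zV(2)]]) auto
  then have en: "\<alpha> \<le> energy_fun w V" by (rule LIMSEQ_le_const) (use u\<alpha> in \<open>auto simp: z_def\<close>)
  have "energy_deriv w V v (grad v) = 0" if v: "v \<in> test" for v
  proof -
    have "(\<lambda>n. f_pair (z n) v - f_pair w v) \<longlonglongrightarrow> 0"
    proof (rule Lim_null_comparison)
      show "(\<lambda>n. nrm r' (\<lambda>x. f x (z n x) - f x (w x)) * nrm r v) \<longlonglongrightarrow> 0"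
        using tendsto_mult[OF zf tendsto_const, of "nrm r v"] by simp
      show "\<forall>\<^sub>F n in sequentially. norm (f_pair (z n) v - f_pair w v)
          \<le> nrm r' (\<lambda>x. f x (z n x) - f x (w x)) * nrm r v"
        unfolding real_norm_def by (intro always_eventually allI f_pairing_diff zr w test_mem(1)[OF v])
    qed
    then have l3: "(\<lambda>n. LINT x|\<mu>. f x (z n x) * v x) \<longlonglongrightarrow> f_pair w v" by (simp only: LIM_zero_iff)
    have lim: "(\<lambda>n. energy_slope (z n) v) \<longlonglongrightarrow> energy_deriv w V v (grad v)" unfolding energy_deriv_def
      by (intro tendsto_diff tendsto_add l3 P.form_tendsto_left[OF zp V(1) test_mem(2)[OF v] zV(1)]
          Q.form_tendsto_left[OF zq V(2) test_mem(3)[OF v] zV(2)])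
    have "(\<lambda>n. energy_slope (z n) v) \<longlonglongrightarrow> 0"
    proof (rule Lim_null_comparison)
      have "(\<lambda>n. 1 / real (Suc n)) \<longlonglongrightarrow> 0" using LIMSEQ_inverse_real_of_nat by (simp add: inverse_eq_divide)
      from tendsto_mult[OF this tendsto_const, of "grad_norm (grad v)"]
      show "(\<lambda>n. 1 / real (Suc n) * grad_norm (grad v)) \<longlonglongrightarrow> 0" by simp
      show "\<forall>\<^sub>F n in sequentially. norm (energy_slope (z n) v) \<le> 1 / real (Suc n) * grad_norm (grad v)"
        unfolding real_norm_def by (intro always_eventually allI zcrit v)
    qed
    with lim show ?thesis by (rule LIMSEQ_unique)
  qed
  then show ?thesis
    using \<alpha> zt w V zw zV en by (intro exI[of _ \<alpha>] exI[of _ w] exI[of _ V] exI[of _ z] conjI allI ballI)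
qed

text \<open>With the base point fixed, the derivative is continuous in the direction; this extends
  the equation from test functions to all of \<open>W10_H\<close>.\<close>

lemma energy_deriv_tendsto:
  assumes w: "w \<in> Lp r \<mu>" and V: "V \<in> Lp p \<mu>" "weighted V \<in> Lp q \<mu>"
    and z: "\<And>n. z n \<in> Lp r \<mu>" "v \<in> Lp r \<mu>" "Lp_lim r \<mu> z v"
    and Z: "\<And>n. Z n \<in> Lp p \<mu>" "\<And>n. weighted (Z n) \<in> Lp q \<mu>" and W: "W \<in> Lp p \<mu>" "weighted W \<in> Lp q \<mu>"
    and ZW: "Lp_lim p \<mu> Z W" "Lp_lim q \<mu> (\<lambda>n. weighted (Z n)) (weighted W)"
  shows "(\<lambda>n. energy_deriv w V (z n) (Z n)) \<longlonglongrightarrow> energy_deriv w V v W"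
proof -
  have "(\<lambda>n. f_pair w (z n) - f_pair w v) \<longlonglongrightarrow> 0"
  proof (rule Lim_null_comparison)
    show "(\<lambda>n. nrm r' (\<lambda>x. f x (w x)) * nrm r (\<lambda>x. z n x - v x)) \<longlonglongrightarrow> 0"
      using tendsto_mult[OF tendsto_const z(3), of "nrm r' (\<lambda>x. f x (w x))"] by simp
    have "\<bar>f_pair w (z n) - f_pair w v\<bar> \<le> nrm r' (\<lambda>x. f x (w x)) * nrm r (\<lambda>x. z n x - v x)" for n
    proof -
      have "f_pair w (z n) - f_pair w v = f_pair w (\<lambda>x. z n x - v x)" unfolding right_diff_distrib
        by (rule Bochner_Integration.integral_diff[OF f_pairing(1)[OF w z(1)] f_pairing(1)[OF w z(2)], symmetric])
      then show ?thesis using f_pairing(2)[OF w Lp_diff[OF z(1,2) exponents_pos(3)]] by simp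
    qed
    then show "\<forall>\<^sub>F n in sequentially. norm (f_pair w (z n) - f_pair w v)
        \<le> nrm r' (\<lambda>x. f x (w x)) * nrm r (\<lambda>x. z n x - v x)"
      unfolding real_norm_def by (intro always_eventually allI)
  qed
  then have l3: "(\<lambda>n. LINT x|\<mu>. f x (w x) * z n x) \<longlonglongrightarrow> f_pair w v" by (simp only: LIM_zero_iff)
  show ?thesis unfolding energy_deriv_def
    by (intro tendsto_diff tendsto_add l3 P.form_tendsto_right[OF V(1) Z(1) W(1) ZW(1)]
        Q.form_tendsto_right[OF V(2) Z(2) W(2) ZW(2)])
qed

section \<open>The Musielak--Orlicz--Sobolev space\<close>

abbreviation "L_space \<equiv> L_H p q a \<Omega>"

abbreviation "lux \<equiv> luxemburg_norm p q a \<Omega>"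

lemma L_H_iff:
  "u \<in> L_space \<longleftrightarrow> u \<in> borel_measurable \<mu> \<and> integrable \<mu> (\<lambda>x. \<bar>u x\<bar> powr p) \<and> integrable \<mu> (\<lambda>x. a x * \<bar>u x\<bar> powr q)"
proof (cases "u \<in> borel_measurable \<mu>")
  case u[measurable]: True
  note [measurable] = a(1)
  have fin: "integrable \<mu> g \<longleftrightarrow> (\<integral>\<^sup>+x. ennreal (g x) \<partial>\<mu>) < \<infinity>"
    if [measurable]: "g \<in> borel_measurable \<mu>" and g: "\<And>x. x \<in> \<Omega> \<Longrightarrow> 0 \<le> g x" for g
  proof -
    have "(\<integral>\<^sup>+x. ennreal (norm (g x)) \<partial>\<mu>) = (\<integral>\<^sup>+x. ennreal (g x) \<partial>\<mu>)" using g by (intro nn_integral_cong) simp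
    then show ?thesis by (simp add: integrable_iff_bounded)
  qed
  have "modular p q a \<Omega> u = (\<integral>\<^sup>+x. ennreal (\<bar>u x\<bar> powr p) + ennreal (a x * \<bar>u x\<bar> powr q) \<partial>\<mu>)"
    unfolding modular_def double_phase_def using a(2) by (intro nn_integral_cong) (simp add: ennreal_plus)
  also have "\<dots> = (\<integral>\<^sup>+x. ennreal (\<bar>u x\<bar> powr p) \<partial>\<mu>) + (\<integral>\<^sup>+x. ennreal (a x * \<bar>u x\<bar> powr q) \<partial>\<mu>)"
    by (intro nn_integral_add) measurable
  finally have "modular p q a \<Omega> u < \<infinity> \<longleftrightarrow> integrable \<mu> (\<lambda>x. \<bar>u x\<bar> powr p) \<and> integrable \<mu> (\<lambda>x. a x * \<bar>u x\<bar> powr q)"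
    using a(2) by (subst (1 2) fin) auto
  then show ?thesis using u by (simp add: L_H_def)
qed (simp add: L_H_def)

text \<open>Division by l scales the two phases by different powers. For members of the space both
  phase integrals are finite, so the Luxemburg condition becomes an inequality between
  reals.\<close>

lemma modular_scaled:
  assumes u: "u \<in> L_space" and l: "l > 0"
  shows "modular p q a \<Omega> (\<lambda>x. u x / l) = ennreal ((LINT x|\<mu>. \<bar>u x\<bar> powr p) / l powr p + (LINT x|\<mu>. a x * \<bar>u x\<bar> powr q) / l powr q)"
proof -
  note I = conjunct1[OF conjunct2[OF iffD1[OF L_H_iff u]]] conjunct2[OF conjunct2[OF iffD1[OF L_H_iff u]]]
  have "modular p q a \<Omega> (\<lambda>x. u x / l) = (\<integral>\<^sup>+x. ennreal (\<bar>u x\<bar> powr p / l powr p + a x * \<bar>u x\<bar> powr q / l powr q) \<partial>\<mu>)"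
    unfolding modular_def double_phase_def using l by (intro nn_integral_cong) (simp add: powr_divide)
  also have "\<dots> = ennreal (LINT x|\<mu>. \<bar>u x\<bar> powr p / l powr p + a x * \<bar>u x\<bar> powr q / l powr q)"
    using I a(2) by (intro nn_integral_eq_integral Bochner_Integration.integrable_add integrable_divide AE_I2) auto
  also have "(LINT x|\<mu>. \<bar>u x\<bar> powr p / l powr p + a x * \<bar>u x\<bar> powr q / l powr q)
      = (LINT x|\<mu>. \<bar>u x\<bar> powr p) / l powr p + (LINT x|\<mu>. a x * \<bar>u x\<bar> powr q) / l powr q"
    using I by (subst Bochner_Integration.integral_add) auto
  finally show ?thesis .
qed

lemma phase_integral_nonneg: "0 \<le> (LINT x|\<mu>. \<bar>u x\<bar> powr p)" "0 \<le> (LINT x|\<mu>. a x * \<bar>u x\<bar> powr q)"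
  using a(2) by (auto intro!: integral_nonneg_AE AE_I2)

lemma luxemburg_set:
  assumes u: "u \<in> L_space"
  shows "{l. l > 0 \<and> modular p q a \<Omega> (\<lambda>x. u x / l) \<le> 1} =
    {l. l > 0 \<and> (LINT x|\<mu>. \<bar>u x\<bar> powr p) / l powr p + (LINT x|\<mu>. a x * \<bar>u x\<bar> powr q) / l powr q \<le> 1}"
  using modular_scaled[OF u] by (auto simp: ennreal_le_1)

text \<open>l = X + Y + 1 is at least 1, so the powers p and q only decrease the quotients.
  Nonemptiness makes the \<open>Inf\<close> in the Luxemburg norm a genuine infimum.\<close>

lemma luxemburg_set_nonempty:
  "\<exists>l>0. (LINT x|\<mu>. \<bar>u x\<bar> powr p) / l powr p + (LINT x|\<mu>. a x * \<bar>u x\<bar> powr q) / l powr q \<le> 1"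
proof -
  define X where "X = (LINT x|\<mu>. \<bar>u x\<bar> powr p)"
  define Y where "Y = (LINT x|\<mu>. a x * \<bar>u x\<bar> powr q)"
  have XY: "X \<ge> 0" "Y \<ge> 0" unfolding X_def Y_def by (rule phase_integral_nonneg)+
  define l where "l = X + Y + 1"
  have l: "l \<ge> 1" "l > 0" using XY by (auto simp: l_def)
  have le: "Z / l powr s \<le> Z / l" if "s \<ge> 1" "Z \<ge> 0" for s Z
  proof (rule divide_left_mono)
    show "l \<le> l powr s" using powr_mono[of 1 s l] that l by simp
  qed (use that l in auto)
  have "X / l powr p + Y / l powr q \<le> X / l + Y / l" using XY exponents_pos by (intro add_mono le)
  also have "\<dots> \<le> 1" using l unfolding add_divide_distrib[symmetric] by (simp add: l_def)
  finally show ?thesis using l unfolding X_def Y_def by blast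
qed

lemma luxemburg_le:
  assumes u: "u \<in> L_space" and l: "l > 0"
    and le: "(LINT x|\<mu>. \<bar>u x\<bar> powr p) / l powr p + (LINT x|\<mu>. a x * \<bar>u x\<bar> powr q) / l powr q \<le> 1"
  shows "lux u \<le> l" unfolding luxemburg_norm_def luxemburg_set[OF u]
  by (rule cInf_lower) (use l le in \<open>auto intro!: bdd_belowI[of _ 0]\<close>)

lemma luxemburg_nonneg:
  assumes u: "u \<in> L_space"
  shows "0 \<le> lux u" unfolding luxemburg_norm_def luxemburg_set[OF u]
  by (rule cInf_greatest) (use luxemburg_set_nonempty[of u] in auto)

text \<open>Some admissible k lies below l, and as both quotients are nonnegative, each is at most 1
  by itself.\<close>

lemma luxemburg_less_D:
  assumes u: "u \<in> L_space" and l: "lux u < l"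
  shows "(LINT x|\<mu>. \<bar>u x\<bar> powr p) \<le> l powr p" "(LINT x|\<mu>. a x * \<bar>u x\<bar> powr q) \<le> l powr q"
proof -
  have "\<exists>k\<in>{l. l > 0 \<and> (LINT x|\<mu>. \<bar>u x\<bar> powr p) / l powr p + (LINT x|\<mu>. a x * \<bar>u x\<bar> powr q) / l powr q \<le> 1}. k < l"
    using l unfolding luxemburg_norm_def luxemburg_set[OF u]
    by (intro cInf_lessD) (use luxemburg_set_nonempty[of u] in auto)
  then obtain k where k: "0 < k" "k < l" "(LINT x|\<mu>. \<bar>u x\<bar> powr p) / k powr p + (LINT x|\<mu>. a x * \<bar>u x\<bar> powr q) / k powr q \<le> 1"
    by auto
  have nn: "0 \<le> (LINT x|\<mu>. \<bar>u x\<bar> powr p) / k powr p" "0 \<le> (LINT x|\<mu>. a x * \<bar>u x\<bar> powr q) / k powr q"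
    by (intro divide_nonneg_nonneg phase_integral_nonneg powr_ge_zero)+
  have *: "X \<le> l powr s" if "X / k powr s \<le> 1" "s > 0" for X s
  proof -
    have "X \<le> k powr s" using that k(1) by (simp add: divide_le_eq)
    also have "\<dots> \<le> l powr s" using k that by (intro powr_mono2) auto
    finally show ?thesis .
  qed
  show "(LINT x|\<mu>. \<bar>u x\<bar> powr p) \<le> l powr p" using k(3) nn exponents_pos by (intro *) linarith+
  show "(LINT x|\<mu>. a x * \<bar>u x\<bar> powr q) \<le> l powr q" using k(3) nn exponents_pos by (intro *) linarith+
qed

lemma luxemburg_tendsto_zero:
  assumes u: "\<And>n. u n \<in> L_space" and lim: "(\<lambda>n. LINT x|\<mu>. \<bar>u n x\<bar> powr p) \<longlonglongrightarrow> 0" "(\<lambda>n. LINT x|\<mu>. a x * \<bar>u n x\<bar> powr q) \<longlonglongrightarrow> 0"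
    and e: "e > 0"
  shows "\<forall>\<^sub>F n in sequentially. lux (u n) < e"
proof -
  define l where "l = e / 2"
  have l: "l > 0" "l < e" using e by (auto simp: l_def)
  have "(\<lambda>n. (LINT x|\<mu>. \<bar>u n x\<bar> powr p) / l powr p + (LINT x|\<mu>. a x * \<bar>u n x\<bar> powr q) / l powr q) \<longlonglongrightarrow> 0 / l powr p + 0 / l powr q"
    using l by (intro tendsto_add tendsto_divide lim tendsto_const) auto
  then have "\<forall>\<^sub>F n in sequentially. (LINT x|\<mu>. \<bar>u n x\<bar> powr p) / l powr p + (LINT x|\<mu>. a x * \<bar>u n x\<bar> powr q) / l powr q < 1"
    by (intro order_tendstoD(2)) auto
  then show ?thesis
  proof eventually_elim
    fix n assume "(LINT x|\<mu>. \<bar>u n x\<bar> powr p) / l powr p + (LINT x|\<mu>. a x * \<bar>u n x\<bar> powr q) / l powr q < 1"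
    then show "lux (u n) < e" using luxemburg_le[OF u l(1), of n] l(2) by linarith
  qed
qed

text \<open>The bridge from the double phase space to one Lebesgue condition per phase.\<close>

lemma L_H_norm_iff:
  assumes "V \<in> borel_measurable \<mu>"
  shows "(\<lambda>x. norm (V x)) \<in> L_space \<longleftrightarrow> V \<in> Lp p \<mu> \<and> weighted V \<in> Lp q \<mu>"
proof -
  have "integrable \<mu> (\<lambda>x. norm (weighted V x) powr q) \<longleftrightarrow> integrable \<mu> (\<lambda>x. a x * norm (V x) powr q)"
    by (intro Bochner_Integration.integrable_cong) (auto simp: norm_weighted)
  then show ?thesis using assms weighted_measurable[OF assms] by (auto simp: L_H_iff Lp_def)
qed

lemma integral_weighted: "Lp_int q \<mu> (weighted V) = (LINT x|\<mu>. a x * norm (V x) powr q)"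
  by (intro Bochner_Integration.integral_cong) (auto simp: norm_weighted)

lemma L_H_cong_AE:
  assumes "u \<in> L_space" "v \<in> borel_measurable \<mu>" "AE x in \<mu>. u x = v x"
  shows "v \<in> L_space" "lux v = lux u"
proof -
  have m: "modular p q a \<Omega> (\<lambda>x. v x / l) = modular p q a \<Omega> (\<lambda>x. u x / l)" for l
    unfolding modular_def by (rule nn_integral_cong_AE) (use assms(3) in \<open>auto elim!: eventually_mono\<close>)
  show "lux v = lux u" unfolding luxemburg_norm_def m ..
  show "v \<in> L_space" using assms(1,2) m[of 1] by (simp add: L_H_def)
qed

end

section \<open>Weak gradients under limits, and membership in the Sobolev space\<close>

lemma Lp_embedding:
  fixes V :: "'a \<Rightarrow> 'b::euclidean_space"
  assumes M: "finite_measure M" and s: "0 < s" "s < r" and V: "V \<in> Lp r M"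
  shows "V \<in> Lp s M" "Lp_int s M V \<le> Lp_norm r M V powr s * Lp_norm (r / s / (r / s - 1)) M (\<lambda>x. 1 :: real)"
proof -
  interpret finite_measure M by (rule M)
  note [measurable] = LpD(1)[OF V]
  have rs: "r / s > 1" using s by simp
  have U: "(\<lambda>x. norm (V x) powr s) \<in> Lp (r / s) M" using LpD(2)[OF V] s by (simp add: Lp_def powr_powr)
  have one: "(\<lambda>x. 1 :: real) \<in> Lp k M" for k by (simp add: Lp_def)
  note H = Holder[OF U one rs]
  show "V \<in> Lp s M" using H(1) by (simp add: Lp_def)
  have "Lp_norm (r / s) M (\<lambda>x. norm (V x) powr s) = Lp_norm r M V powr s"
    using s by (simp add: Lp_norm_def powr_powr)
  then show "Lp_int s M V \<le> Lp_norm r M V powr s * Lp_norm (r / s / (r / s - 1)) M (\<lambda>x. 1 :: real)"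
    using H(2) by simp
qed

lemma Lp_embedding_tendsto:
  fixes V :: "nat \<Rightarrow> 'a \<Rightarrow> 'b::euclidean_space"
  assumes M: "finite_measure M" and s: "0 < s" "s < r" and V: "\<And>n. V n \<in> Lp r M"
    and lim: "(\<lambda>n. Lp_norm r M (V n)) \<longlonglongrightarrow> 0"
  shows "(\<lambda>n. Lp_int s M (V n)) \<longlonglongrightarrow> 0"
proof (rule Lim_null_comparison)
  let ?C = "Lp_norm (r / s / (r / s - 1)) M (\<lambda>x. 1 :: real)"
  have "(\<lambda>n. Lp_norm r M (V n) powr s) \<longlonglongrightarrow> 0 powr s" using s by (intro tendsto_powr'[OF lim tendsto_const]) auto
  from tendsto_mult[OF this tendsto_const, of ?C] show "(\<lambda>n. Lp_norm r M (V n) powr s * ?C) \<longlonglongrightarrow> 0" by simp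
  show "\<forall>\<^sub>F n in sequentially. norm (Lp_int s M (V n)) \<le> Lp_norm r M (V n) powr s * ?C"
    using Lp_embedding(2)[OF M s V] by (intro always_eventually allI) (simp add: integral_nonneg_AE)
qed

context kirchhoff_problem
begin

lemma Lp_L1:
  assumes "p \<le> s" "V \<in> Lp s \<mu>"
  shows "V \<in> Lp 1 \<mu>"
  by (rule Lp_embedding(1)[OF finite_measure_axioms zero_less_one _ assms(2)]) (use assms(1) pq(1) in linarith)

lemma Lp_1_integrable: "V \<in> Lp 1 \<mu> \<longleftrightarrow> integrable \<mu> V" using integrable_norm_iff[of V \<mu>] by (auto simp: Lp_def)

lemma integrable_pairing:
  fixes Z G :: "'a \<Rightarrow> 'b::euclidean_space"
  assumes Z: "Z \<in> Lp 1 \<mu>" and G[measurable]: "G \<in> borel_measurable \<mu>" and B: "\<And>x. norm (G x) \<le> B"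
  shows "integrable \<mu> (\<lambda>x. Z x \<bullet> G x)"
    and "\<bar>LINT x|\<mu>. Z x \<bullet> G x\<bar> \<le> Lp_int 1 \<mu> Z * B"
proof -
  note [measurable] = LpD(1)[OF Z]
  have le: "\<bar>Z x \<bullet> G x\<bar> \<le> norm (Z x) powr 1 * B" for x
    using Cauchy_Schwarz_ineq2[of "Z x" "G x"] mult_left_mono[OF B norm_ge_zero, of "Z x" x] by simp
  have I: "integrable \<mu> (\<lambda>x. norm (Z x) powr 1 * B)" using LpD(2)[OF Z] by simp
  show int: "integrable \<mu> (\<lambda>x. Z x \<bullet> G x)"
    by (rule Bochner_Integration.integrable_bound[OF I]) (use le in \<open>auto intro: order_trans[OF _ abs_ge_self]\<close>)
  have "\<bar>LINT x|\<mu>. Z x \<bullet> G x\<bar> \<le> (LINT x|\<mu>. \<bar>Z x \<bullet> G x\<bar>)" by (rule integral_abs_bound)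
  also have "\<dots> \<le> (LINT x|\<mu>. norm (Z x) powr 1 * B)" using int I le by (intro integral_mono) auto
  finally show "\<bar>LINT x|\<mu>. Z x \<bullet> G x\<bar> \<le> Lp_int 1 \<mu> Z * B" by simp
qed

lemma pairing_tendsto:
  fixes Z :: "nat \<Rightarrow> 'a \<Rightarrow> 'b::euclidean_space"
  assumes s: "p \<le> s" and Z: "\<And>n. Z n \<in> Lp s \<mu>" "W \<in> Lp s \<mu>" and lim: "Lp_lim s \<mu> Z W"
    and G: "G \<in> borel_measurable \<mu>" "\<And>x. norm (G x) \<le> B"
  shows "(\<lambda>n. LINT x|\<mu>. Z n x \<bullet> G x) \<longlonglongrightarrow> (LINT x|\<mu>. W x \<bullet> G x)"
proof -
  have s0: "s > 0" "1 < s" using s pq by auto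
  have D: "(\<lambda>x. Z n x - W x) \<in> Lp s \<mu>" for n by (rule Lp_diff[OF Z s0(1)])
  have lim1: "(\<lambda>n. Lp_int 1 \<mu> (\<lambda>x. Z n x - W x)) \<longlonglongrightarrow> 0"
    by (rule Lp_embedding_tendsto[OF finite_measure_axioms zero_less_one s0(2) D lim])
  have "(\<lambda>n. (LINT x|\<mu>. Z n x \<bullet> G x) - (LINT x|\<mu>. W x \<bullet> G x)) \<longlonglongrightarrow> 0"
  proof (rule Lim_null_comparison)
    from tendsto_mult[OF lim1 tendsto_const, of B] show "(\<lambda>n. (Lp_int 1 \<mu> (\<lambda>x. Z n x - W x)) * B) \<longlonglongrightarrow> 0" by simp
    have "\<bar>(LINT x|\<mu>. Z n x \<bullet> G x) - (LINT x|\<mu>. W x \<bullet> G x)\<bar> \<le> Lp_int 1 \<mu> (\<lambda>x. Z n x - W x) * B" for n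
    proof -
      have "(LINT x|\<mu>. Z n x \<bullet> G x) - (LINT x|\<mu>. W x \<bullet> G x) = (LINT x|\<mu>. (Z n x - W x) \<bullet> G x)" unfolding inner_diff_left
        by (rule Bochner_Integration.integral_diff[symmetric])
          (rule integrable_pairing(1)[OF Lp_L1[OF s] G], rule Z)+
      then show ?thesis using integrable_pairing(2)[OF Lp_L1[OF s D] G] by simp
    qed
    then show "\<forall>\<^sub>F n in sequentially. norm ((LINT x|\<mu>. Z n x \<bullet> G x) - (LINT x|\<mu>. W x \<bullet> G x)) \<le> Lp_int 1 \<mu> (\<lambda>x. Z n x - W x) * B"
      unfolding real_norm_def by (intro always_eventually allI)
  qed
  then show ?thesis by (simp only: LIM_zero_iff)
qed

lemma L1_locally_integrable:
  fixes V :: "'a \<Rightarrow> 'b::euclidean_space"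
  assumes "V \<in> Lp 1 \<mu>"
  shows "locally_integrable_on \<Omega> V"
proof -
  have "set_integrable lebesgue \<Omega> V"
    using assms \<Omega>_lebesgue unfolding Lp_1_integrable by (simp add: integrable_restrict_space set_integrable_def)
  then show ?thesis
    unfolding locally_integrable_on_def by (auto intro!: set_integrable_subset[of lebesgue \<Omega>] lmeasurable_compact fmeasurableD)
qed

lemma grad_component_bounded:
  assumes "\<phi> \<in> test"
  shows "\<exists>B. \<forall>x. norm (grad \<phi> x \<bullet> i) \<le> B \<and> norm (\<phi> x *\<^sub>R i) \<le> B"
proof (rule test_bounded[OF assms])
  fix B assume B: "\<And>x. \<bar>\<phi> x\<bar> \<le> B" "\<And>x. norm (grad \<phi> x) \<le> B"
  have "norm (grad \<phi> x \<bullet> i) \<le> B * norm i" for x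
    using Cauchy_Schwarz_ineq2[of "grad \<phi> x" i] mult_right_mono[OF B(2) norm_ge_zero, of x i] by simp
  moreover have "norm (\<phi> x *\<^sub>R i) \<le> B * norm i" for x using mult_right_mono[OF B(1) norm_ge_zero, of x i] by simp
  ultimately show ?thesis by blast
qed

text \<open>Both sides of the defining identity become pairings with a bounded field, one scalar and
  one vector valued, so that \<open>pairing_tendsto\<close> covers both.\<close>

lemma weak_gradient_pairing:
  "has_weak_gradient \<Omega> u g \<longleftrightarrow> locally_integrable_on \<Omega> u \<and> locally_integrable_on \<Omega> g \<and>
    (\<forall>\<phi>\<in>test. \<forall>i\<in>Basis. (LINT x|\<mu>. u x \<bullet> (grad \<phi> x \<bullet> i)) = - (LINT x|\<mu>. g x \<bullet> (\<phi> x *\<^sub>R i)))"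
proof -
  have eq: "(LINT x|\<mu>. u x * frechet_derivative \<phi> (at x) i) = (LINT x|\<mu>. u x \<bullet> (grad \<phi> x \<bullet> i))"
    "(LINT x|\<mu>. (g x \<bullet> i) * \<phi> x) = (LINT x|\<mu>. g x \<bullet> (\<phi> x *\<^sub>R i))" if "\<phi> \<in> test" for \<phi> i
    using test_frechet[OF that] by (simp_all add: mult.commute)
  show ?thesis unfolding has_weak_gradient_def by (simp add: eq cong: ball_cong)
qed

lemma pairing_measurable:
  assumes "\<phi> \<in> test"
  shows "(\<lambda>x. grad \<phi> x \<bullet> i) \<in> borel_measurable \<mu>" "(\<lambda>x. \<phi> x *\<^sub>R i) \<in> borel_measurable \<mu>"
  using test_space_measurable[OF assms] by measurable

text \<open>The weak gradient is a closed operator: against a fixed test function, both sides of the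
  integration by parts are continuous under L^1 convergence.\<close>

lemma weak_gradient_limit:
  assumes z: "\<And>n. z n \<in> test" and w: "w \<in> Lp r \<mu>" "Lp_lim r \<mu> z w"
    and V: "V \<in> Lp p \<mu>" "Lp_lim p \<mu> (\<lambda>n. grad (z n)) V"
  shows "has_weak_gradient \<Omega> w V" unfolding weak_gradient_pairing
proof (intro conjI ballI)
  have pr: "p \<le> r" using exponents by simp
  show "locally_integrable_on \<Omega> w" "locally_integrable_on \<Omega> V"
    by (intro L1_locally_integrable Lp_L1[OF pr w(1)] Lp_L1[OF order_refl V(1)])+
  fix \<phi> and i :: 'a assume \<phi>: "\<phi> \<in> test" and i: "i \<in> Basis"
  obtain B where B: "\<forall>x. norm (grad \<phi> x \<bullet> i) \<le> B \<and> norm (\<phi> x *\<^sub>R i) \<le> B" using grad_component_bounded[OF \<phi>, of i] by (elim exE)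
  have B1: "norm (grad \<phi> x \<bullet> i) \<le> B" for x by (rule conjunct1[OF spec[OF B]])
  have B2: "norm (\<phi> x *\<^sub>R i) \<le> B" for x by (rule conjunct2[OF spec[OF B]])
  have l1: "(\<lambda>n. LINT x|\<mu>. z n x \<bullet> (grad \<phi> x \<bullet> i)) \<longlonglongrightarrow> (LINT x|\<mu>. w x \<bullet> (grad \<phi> x \<bullet> i))"
    by (rule pairing_tendsto[OF pr test_mem(1)[OF z] w pairing_measurable(1)[OF \<phi>] B1])
  have l2: "(\<lambda>n. LINT x|\<mu>. grad (z n) x \<bullet> (\<phi> x *\<^sub>R i)) \<longlonglongrightarrow> (LINT x|\<mu>. V x \<bullet> (\<phi> x *\<^sub>R i))"
    by (rule pairing_tendsto[OF order_refl test_mem(2)[OF z] V pairing_measurable(2)[OF \<phi>] B2])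
  have "(LINT x|\<mu>. z n x \<bullet> (grad \<phi> x \<bullet> i)) = - (LINT x|\<mu>. grad (z n) x \<bullet> (\<phi> x *\<^sub>R i))" for n
    using has_weak_gradient_test[OF z \<Omega>_lebesgue] \<phi> i unfolding weak_gradient_pairing by blast
  then have "(\<lambda>n. - (LINT x|\<mu>. grad (z n) x \<bullet> (\<phi> x *\<^sub>R i))) \<longlonglongrightarrow> (LINT x|\<mu>. w x \<bullet> (grad \<phi> x \<bullet> i))" using l1 by simp
  then show "(LINT x|\<mu>. w x \<bullet> (grad \<phi> x \<bullet> i)) = - (LINT x|\<mu>. V x \<bullet> (\<phi> x *\<^sub>R i))"
    using tendsto_minus[OF l2] by (rule LIMSEQ_unique)
qed

lemma weak_gradient_diff:
  assumes u: "has_weak_gradient \<Omega> u g" "u \<in> Lp 1 \<mu>" "g \<in> Lp 1 \<mu>" and v: "has_weak_gradient \<Omega> v h" "v \<in> Lp 1 \<mu>" "h \<in> Lp 1 \<mu>"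
  shows "has_weak_gradient \<Omega> (\<lambda>x. u x - v x) (\<lambda>x. g x - h x)" unfolding weak_gradient_pairing
proof (intro conjI ballI)
  show "locally_integrable_on \<Omega> (\<lambda>x. u x - v x)" "locally_integrable_on \<Omega> (\<lambda>x. g x - h x)"
    by (intro L1_locally_integrable Lp_diff u v zero_less_one)+
  fix \<phi> and i :: 'a assume \<phi>: "\<phi> \<in> test" and i: "i \<in> Basis"
  obtain B where B: "\<forall>x. norm (grad \<phi> x \<bullet> i) \<le> B \<and> norm (\<phi> x *\<^sub>R i) \<le> B" using grad_component_bounded[OF \<phi>, of i] by (elim exE)
  have B1: "norm (grad \<phi> x \<bullet> i) \<le> B" for x by (rule conjunct1[OF spec[OF B]])
  have B2: "norm (\<phi> x *\<^sub>R i) \<le> B" for x by (rule conjunct2[OF spec[OF B]])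
  note int = integrable_pairing(1)[OF u(2) pairing_measurable(1)[OF \<phi>] B1] integrable_pairing(1)[OF v(2) pairing_measurable(1)[OF \<phi>] B1]
    integrable_pairing(1)[OF u(3) pairing_measurable(2)[OF \<phi>] B2] integrable_pairing(1)[OF v(3) pairing_measurable(2)[OF \<phi>] B2]
  have "(LINT x|\<mu>. u x \<bullet> (grad \<phi> x \<bullet> i)) = - (LINT x|\<mu>. g x \<bullet> (\<phi> x *\<^sub>R i))" "(LINT x|\<mu>. v x \<bullet> (grad \<phi> x \<bullet> i)) = - (LINT x|\<mu>. h x \<bullet> (\<phi> x *\<^sub>R i))"
    using u(1) v(1) \<phi> i unfolding weak_gradient_pairing by blast+
  then show "(LINT x|\<mu>. (u x - v x) \<bullet> (grad \<phi> x \<bullet> i)) = - (LINT x|\<mu>. (g x - h x) \<bullet> (\<phi> x *\<^sub>R i))"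
    unfolding inner_diff_left Bochner_Integration.integral_diff[OF int(1,2)] Bochner_Integration.integral_diff[OF int(3,4)] by linarith
qed

lemma Lr_L_space:
  assumes u: "u \<in> Lp r \<mu>"
  shows "u \<in> L_space" "\<And>v. v \<in> Lp q \<mu> \<Longrightarrow> (LINT x|\<mu>. a x * \<bar>v x\<bar> powr q) \<le> \<bar>A\<bar> * Lp_int q \<mu> v"
proof -
  have int: "integrable \<mu> (\<lambda>x. a x * \<bar>v x\<bar> powr q)" and le: "a x * \<bar>v x\<bar> powr q \<le> \<bar>A\<bar> * norm (v x) powr q"
    if v: "v \<in> Lp q \<mu>" and x: "x \<in> \<Omega>" for v x
  proof -
    note [measurable] = LpD(1)[OF v] a(1)
    have le: "a x * \<bar>v x\<bar> powr q \<le> \<bar>A\<bar> * norm (v x) powr q" if "x \<in> \<Omega>" for x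
      using a(3)[OF that] by (auto intro!: mult_right_mono)
    then show "a x * \<bar>v x\<bar> powr q \<le> \<bar>A\<bar> * norm (v x) powr q" using x .
    show "integrable \<mu> (\<lambda>x. a x * \<bar>v x\<bar> powr q)"
      using a(2) le by (intro Bochner_Integration.integrable_bound[OF integrable_mult_right[OF LpD(2)[OF v], of "\<bar>A\<bar>"]] AE_I2) (auto simp: abs_mult)
  qed
  obtain x0 where x0: "x0 \<in> \<Omega>" using \<Omega>(3) by blast
  have uq: "u \<in> Lp q \<mu>" and up: "u \<in> Lp p \<mu>"
    by (rule Lp_embedding(1)[OF finite_measure_axioms _ _ u]; use exponents exponents_pos in simp)+
  show "u \<in> L_space" unfolding L_H_iff using LpD[OF up] int[OF uq x0] by simp
  show "(LINT x|\<mu>. a x * \<bar>v x\<bar> powr q) \<le> \<bar>A\<bar> * Lp_int q \<mu> v" if v: "v \<in> Lp q \<mu>" for v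
  proof -
    have "(LINT x|\<mu>. a x * \<bar>v x\<bar> powr q) \<le> (LINT x|\<mu>. \<bar>A\<bar> * norm (v x) powr q)"
      using int[OF v x0] LpD(2)[OF v] le[OF v] by (intro integral_mono) auto
    then show ?thesis by simp
  qed
qed

lemma weak_grad_measurable: "has_weak_gradient \<Omega> u g \<Longrightarrow> weak_grad \<Omega> u \<in> borel_measurable \<mu>"
  using locally_integrable_measurable[OF \<Omega>(1)] has_weak_gradient_weak_grad has_weak_gradient_def by blast

text \<open>Vanishing of the two phase integrals, for the differences and for their gradients,
  drives the Luxemburg norms to 0. For the functions this follows from L^r convergence, since p < q
  < r and the weight is bounded; \<open>norm_lux\<close> replaces the chosen weak gradient by an
  explicit one.\<close>

lemma W10_H_intro:
  assumes z: "\<And>n. z n \<in> test" and w: "w \<in> Lp r \<mu>" "Lp_lim r \<mu> z w"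
    and V: "V \<in> Lp p \<mu>" "weighted V \<in> Lp q \<mu>" "Lp_lim p \<mu> (\<lambda>n. grad (z n)) V"
      "Lp_lim q \<mu> (\<lambda>n. weighted (grad (z n))) (weighted V)"
  shows "w \<in> W10_H p q a \<Omega>"
proof -
  have pr: "p \<le> r" using exponents by simp
  note zp = test_mem(2)[OF z] and zq = test_mem(3)[OF z] and zr = test_mem(1)[OF z]
  have hw: "has_weak_gradient \<Omega> w V" by (rule weak_gradient_limit[OF z w V(1,3)])
  have norm_mem: "(\<lambda>x. norm (weak_grad \<Omega> u x)) \<in> L_space" and norm_lux: "lux (\<lambda>x. norm (weak_grad \<Omega> u x)) = lux (\<lambda>x. norm (g x))"
    if u: "has_weak_gradient \<Omega> u g" "(\<lambda>x. norm (g x)) \<in> L_space" for u g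
  proof -
    have AE: "AE x in \<mu>. norm (g x) = norm (weak_grad \<Omega> u x)"
      using weak_grad_AE[OF \<Omega>(1) u(1)] by eventually_elim simp
    have m: "(\<lambda>x. norm (weak_grad \<Omega> u x)) \<in> borel_measurable \<mu>" using weak_grad_measurable[OF u(1)] by measurable
    show "(\<lambda>x. norm (weak_grad \<Omega> u x)) \<in> L_space" "lux (\<lambda>x. norm (weak_grad \<Omega> u x)) = lux (\<lambda>x. norm (g x))"
      using L_H_cong_AE[OF u(2) m AE] by simp_all
  qed
  have nV: "(\<lambda>x. norm (V x)) \<in> L_space" using L_H_norm_iff[OF LpD(1)[OF V(1)]] V(1,2) by simp
  have W1: "w \<in> W1_H p q a \<Omega>" unfolding W1_H_def using Lr_L_space(1)[OF w(1)] hw norm_mem[OF hw nV] by blast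
  have dr: "(\<lambda>x. w x - z n x) \<in> Lp r \<mu>" for n by (rule Lp_diff[OF w(1) zr exponents_pos(3)])
  have dL: "(\<lambda>x. w x - z n x) \<in> L_space" for n by (rule Lr_L_space(1)[OF dr])
  have wz: "(\<lambda>n. nrm r (\<lambda>x. w x - z n x)) \<longlonglongrightarrow> 0" using w(2) by (simp add: Lp_norm_diff_commute[of r \<mu> w])
  have conv: "(\<lambda>n. Lp_int s \<mu> (\<lambda>x. w x - z n x)) \<longlonglongrightarrow> 0" if "0 < s" "s < r" for s
    by (rule Lp_embedding_tendsto[OF finite_measure_axioms that dr wz])
  have c1: "(\<lambda>n. LINT x|\<mu>. \<bar>w x - z n x\<bar> powr p) \<longlonglongrightarrow> 0" using conv[of p] exponents exponents_pos by simp
  have c2: "(\<lambda>n. LINT x|\<mu>. a x * \<bar>w x - z n x\<bar> powr q) \<longlonglongrightarrow> 0"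
  proof (rule tendsto_sandwich[OF _ _ tendsto_const])
    show "\<forall>\<^sub>F n in sequentially. 0 \<le> (LINT x|\<mu>. a x * \<bar>w x - z n x\<bar> powr q)" using phase_integral_nonneg(2) by (intro always_eventually allI)
    have dq: "(\<lambda>x. w x - z n x) \<in> Lp q \<mu>" for n
      by (rule Lp_embedding(1)[OF finite_measure_axioms exponents_pos(2) exponents(4) dr])
    show "\<forall>\<^sub>F n in sequentially. (LINT x|\<mu>. a x * \<bar>w x - z n x\<bar> powr q) \<le> \<bar>A\<bar> * Lp_int q \<mu> (\<lambda>x. w x - z n x)"
      by (intro always_eventually allI Lr_L_space(2)[OF w(1)] dq)
    have "(\<lambda>n. Lp_int q \<mu> (\<lambda>x. w x - z n x)) \<longlonglongrightarrow> 0" by (rule conv[OF exponents_pos(2) exponents(4)])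
    from tendsto_mult[OF tendsto_const this, of "\<bar>A\<bar>"]
    show "(\<lambda>n. \<bar>A\<bar> * Lp_int q \<mu> (\<lambda>x. w x - z n x)) \<longlonglongrightarrow> 0" by simp
  qed
  have gd: "has_weak_gradient \<Omega> (\<lambda>x. w x - z n x) (\<lambda>x. V x - grad (z n) x)" for n
    by (rule weak_gradient_diff[OF hw Lp_L1[OF pr w(1)] Lp_L1[OF order_refl V(1)] has_weak_gradient_test[OF z \<Omega>_lebesgue]
          Lp_L1[OF pr zr] Lp_L1[OF order_refl zp]])
  have gL: "(\<lambda>x. norm (V x - grad (z n) x)) \<in> L_space" for n
  proof -
    have 1: "(\<lambda>x. V x - grad (z n) x) \<in> Lp p \<mu>" by (rule Lp_diff[OF V(1) zp exponents_pos(1)])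
    have 2: "weighted (\<lambda>x. V x - grad (z n) x) \<in> Lp q \<mu>"
      unfolding weighted_diff by (rule Lp_diff[OF V(2) zq exponents_pos(2)])
    show ?thesis by (rule iffD2[OF L_H_norm_iff[OF LpD(1)[OF 1]] conjI[OF 1 2]])
  qed
  have c3: "(\<lambda>n. LINT x|\<mu>. \<bar>norm (V x - grad (z n) x)\<bar> powr p) \<longlonglongrightarrow> 0"
    using V(3) unfolding Lp_norm_diff_commute[of p \<mu> _ V] Lp_norm_tendsto_zero_iff[OF exponents_pos(1)] by simp
  have c4: "(\<lambda>n. LINT x|\<mu>. a x * \<bar>norm (V x - grad (z n) x)\<bar> powr q) \<longlonglongrightarrow> 0"
  proof -
    have "(\<lambda>n. Lp_int q \<mu> (\<lambda>x. weighted V x - weighted (grad (z n)) x)) \<longlonglongrightarrow> 0"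
      using V(4) unfolding Lp_norm_diff_commute[of q \<mu> _ "weighted V"] Lp_norm_tendsto_zero_iff[OF exponents_pos(2)] .
    then have "(\<lambda>n. Lp_int q \<mu> (\<lambda>x. weighted (\<lambda>x. V x - grad (z n) x) x)) \<longlonglongrightarrow> 0" unfolding weighted_diff .
    then show ?thesis unfolding integral_weighted by simp
  qed
  have "\<exists>\<phi>\<in>test. W1_H_norm p q a \<Omega> (\<lambda>x. w x - \<phi> x) < e" if e: "e > 0" for e
  proof -
    have e2: "e / 2 > 0" using e by simp
    from eventually_conj[OF luxemburg_tendsto_zero[OF dL c1 c2 e2] luxemburg_tendsto_zero[OF gL c3 c4 e2]]
    obtain n where n: "lux (\<lambda>x. w x - z n x) < e / 2" "lux (\<lambda>x. norm (V x - grad (z n) x)) < e / 2"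
      unfolding eventually_sequentially by auto
    have "W1_H_norm p q a \<Omega> (\<lambda>x. w x - z n x) < e" unfolding W1_H_norm_def norm_lux[OF gd gL] using n by linarith
    then show ?thesis by (rule bexI[OF _ z])
  qed
  then show ?thesis unfolding W10_H_def using W1 by blast
qed


lemma L_H_diff:
  assumes u: "u \<in> L_space" and v: "v \<in> L_space"
  shows "(\<lambda>x. u x - v x) \<in> L_space"
proof -
  note U = iffD1[OF L_H_iff u] and V = iffD1[OF L_H_iff v]
  note um[measurable] = conjunct1[OF U] and vm[measurable] = conjunct1[OF V] and [measurable] = a(1)
  have le: "\<bar>u x - v x\<bar> powr s \<le> 2 powr s * (\<bar>u x\<bar> powr s + \<bar>v x\<bar> powr s)" if "s > 0" for x s
  proof -
    have "\<bar>u x - v x\<bar> powr s \<le> (\<bar>u x\<bar> + \<bar>v x\<bar>) powr s" using that by (intro powr_mono2) auto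
    also have "\<dots> \<le> 2 powr s * (\<bar>u x\<bar> powr s + \<bar>v x\<bar> powr s)" using that by (intro powr_add_le) auto
    finally show ?thesis .
  qed
  have 1: "integrable \<mu> (\<lambda>x. 2 powr p * (\<bar>u x\<bar> powr p + \<bar>v x\<bar> powr p))"
    using U V by (intro integrable_mult_right Bochner_Integration.integrable_add) auto
  have 2: "integrable \<mu> (\<lambda>x. 2 powr q * (a x * \<bar>u x\<bar> powr q + a x * \<bar>v x\<bar> powr q))"
    using U V by (intro integrable_mult_right Bochner_Integration.integrable_add) auto
  have "integrable \<mu> (\<lambda>x. \<bar>u x - v x\<bar> powr p)"
    by (rule Bochner_Integration.integrable_bound[OF 1]) (use le[OF exponents_pos(1)] in \<open>auto intro!: AE_I2\<close>)
  moreover have "integrable \<mu> (\<lambda>x. a x * \<bar>u x - v x\<bar> powr q)"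
  proof (rule Bochner_Integration.integrable_bound[OF 2])
    show "AE x in \<mu>. norm (a x * \<bar>u x - v x\<bar> powr q) \<le> norm (2 powr q * (a x * \<bar>u x\<bar> powr q + a x * \<bar>v x\<bar> powr q))"
    proof (rule AE_I2)
      fix x assume "x \<in> space \<mu>"
      then have a0: "0 \<le> a x" using a(2) by simp
      have "a x * \<bar>u x - v x\<bar> powr q \<le> a x * (2 powr q * (\<bar>u x\<bar> powr q + \<bar>v x\<bar> powr q))"
        by (rule mult_left_mono[OF le[OF exponents_pos(2)] a0])
      then show "norm (a x * \<bar>u x - v x\<bar> powr q) \<le> norm (2 powr q * (a x * \<bar>u x\<bar> powr q + a x * \<bar>v x\<bar> powr q))"
        using a0 by (simp add: distrib_left mult.left_commute)
    qed
  qed measurable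
  ultimately show ?thesis using um vm by (simp add: L_H_iff)
qed

text \<open>The Luxemburg norm controls both phases of the gradient, and the function itself in L^p.
  The Sobolev inequality makes the approximating test functions Cauchy in L^r, and their L^r limit
  agrees with v almost everywhere along a common subsequence.\<close>

lemma W10_H_elim:
  assumes v: "v \<in> W10_H p q a \<Omega>"
  shows "has_weak_gradient \<Omega> v (weak_grad \<Omega> v) \<and> v \<in> Lp r \<mu> \<and> weak_grad \<Omega> v \<in> Lp p \<mu> \<and> weighted (weak_grad \<Omega> v) \<in> Lp q \<mu> \<and>
    (\<exists>z. (\<forall>n. z n \<in> test) \<and> Lp_lim r \<mu> z v \<and>
      Lp_lim p \<mu> (\<lambda>n. grad (z n)) (weak_grad \<Omega> v) \<and>
      Lp_lim q \<mu> (\<lambda>n. weighted (grad (z n))) (weighted (weak_grad \<Omega> v)))"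
proof -
  have pr: "p \<le> r" using exponents by simp
  define W where "W = weak_grad \<Omega> v"
  have v1: "v \<in> W1_H p q a \<Omega>" using v by (simp add: W10_H_def)
  have vL: "v \<in> L_space" using v1 by (simp add: W1_H_def)
  have "\<exists>g. has_weak_gradient \<Omega> v g" using v1 by (simp add: W1_H_def)
  then have hW: "has_weak_gradient \<Omega> v W" unfolding W_def by (elim exE) (rule has_weak_gradient_weak_grad)
  have Wm: "W \<in> borel_measurable \<mu>" unfolding W_def by (rule weak_grad_measurable[OF hW])
  have "(\<lambda>x. norm (W x)) \<in> L_space" using v1 by (simp add: W1_H_def W_def)
  then have W: "W \<in> Lp p \<mu>" "weighted W \<in> Lp q \<mu>" using L_H_norm_iff[OF Wm] by blast+
  have vp: "v \<in> Lp p \<mu>" using vL by (simp add: L_H_iff Lp_def)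
  have "\<exists>\<phi>. \<phi> \<in> test \<and> W1_H_norm p q a \<Omega> (\<lambda>x. v x - \<phi> x) < 1 / real (Suc n)" for n
    using v unfolding W10_H_def by (simp add: Bex_def del: of_nat_Suc)
  then have "\<exists>z. \<forall>n. z n \<in> test \<and> W1_H_norm p q a \<Omega> (\<lambda>x. v x - z n x) < 1 / real (Suc n)" by (intro choice allI)
  then obtain z where zz: "\<forall>n. z n \<in> test \<and> W1_H_norm p q a \<Omega> (\<lambda>x. v x - z n x) < 1 / real (Suc n)" by (elim exE)
  have z: "z n \<in> test" for n by (rule conjunct1[OF spec[OF zz]])
  have zn: "W1_H_norm p q a \<Omega> (\<lambda>x. v x - z n x) < 1 / real (Suc n)" for n by (rule conjunct2[OF spec[OF zz]])
  note zp = test_mem(2)[OF z] and zq = test_mem(3)[OF z] and zr = test_mem(1)[OF z]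
  have zpp: "z n \<in> Lp p \<mu>" for n by (rule test_Lp(3)[OF z \<Omega>_lebesgue exponents_pos(1)])
  have dL: "(\<lambda>x. v x - z n x) \<in> L_space" for n by (rule L_H_diff[OF vL Lr_L_space(1)[OF zr]])
  have gd: "has_weak_gradient \<Omega> (\<lambda>x. v x - z n x) (\<lambda>x. W x - grad (z n) x)" for n
    by (rule weak_gradient_diff[OF hW Lp_L1[OF order_refl vp] Lp_L1[OF order_refl W(1)] has_weak_gradient_test[OF z \<Omega>_lebesgue]
          Lp_L1[OF pr zr] Lp_L1[OF order_refl zp]])
  have D: "(\<lambda>x. W x - grad (z n) x) \<in> Lp p \<mu>" "weighted (\<lambda>x. W x - grad (z n) x) \<in> Lp q \<mu>" for n
    unfolding weighted_diff by (rule Lp_diff[OF W(1) zp exponents_pos(1)] Lp_diff[OF W(2) zq exponents_pos(2)])+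
  have gL: "(\<lambda>x. norm (W x - grad (z n) x)) \<in> L_space" for n
    by (rule iffD2[OF L_H_norm_iff[OF LpD(1)[OF D(1)]] conjI[OF D]])
  have AE: "AE x in \<mu>. norm (W x - grad (z n) x) = norm (weak_grad \<Omega> (\<lambda>x. v x - z n x) x)" for n
    using weak_grad_AE[OF \<Omega>(1) gd[of n]] by eventually_elim simp
  have lux_eq: "lux (\<lambda>x. norm (weak_grad \<Omega> (\<lambda>x. v x - z n x) x)) = lux (\<lambda>x. norm (W x - grad (z n) x))" for n
  proof (rule L_H_cong_AE(2)[OF gL _ AE])
    show "(\<lambda>x. norm (weak_grad \<Omega> (\<lambda>x. v x - z n x) x)) \<in> borel_measurable \<mu>"
      using weak_grad_measurable[OF gd] by measurable
  qed
  have l1: "lux (\<lambda>x. v x - z n x) < 1 / real (Suc n)" "lux (\<lambda>x. norm (W x - grad (z n) x)) < 1 / real (Suc n)" for n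
    using zn[of n] luxemburg_nonneg[OF dL[of n]] luxemburg_nonneg[OF gL[of n]]
    unfolding W1_H_norm_def lux_eq by linarith+
  have inv: "0 \<le> 1 / real (Suc n)" for n by simp
  have b1: "nrm p (\<lambda>x. z n x - v x) \<le> 1 / real (Suc n)" for n using luxemburg_less_D(1)[OF dL l1(1), of n]
    unfolding Lp_norm_diff_commute[of p \<mu> _ v] Lp_norm_le_iff[OF exponents_pos(1) inv] by simp
  have b2: "nrm p (\<lambda>x. grad (z n) x - W x) \<le> 1 / real (Suc n)" for n using luxemburg_less_D(1)[OF gL l1(2), of n]
    unfolding Lp_norm_diff_commute[of p \<mu> _ W] Lp_norm_le_iff[OF exponents_pos(1) inv] by simp
  have b3: "nrm q (\<lambda>x. weighted (grad (z n)) x - weighted W x) \<le> 1 / real (Suc n)" for n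
    using luxemburg_less_D(2)[OF gL l1(2), of n]
    unfolding Lp_norm_diff_commute[of q \<mu> _ "weighted W"] unfolding weighted_diff[symmetric] Lp_norm_le_iff[OF exponents_pos(2) inv] integral_weighted
    by simp
  have inv0: "(\<lambda>n. 1 / real (Suc n)) \<longlonglongrightarrow> 0" using LIMSEQ_inverse_real_of_nat by (simp add: inverse_eq_divide)
  have to0: "X \<longlonglongrightarrow> 0" if "\<And>n. 0 \<le> X n" "\<And>n. X n \<le> 1 / real (Suc n)" for X :: "nat \<Rightarrow> real"
    by (rule tendsto_sandwich[OF _ _ tendsto_const inv0]) (use that in auto)
  have c1: "Lp_lim p \<mu> z v" by (rule to0[OF Lp_norm_nonneg b1])
  have c2: "Lp_lim p \<mu> (\<lambda>n. grad (z n)) W" by (rule to0[OF Lp_norm_nonneg b2])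
  have c3: "Lp_lim q \<mu> (\<lambda>n. weighted (grad (z n))) (weighted W)" by (rule to0[OF Lp_norm_nonneg b3])
  obtain S where S: "S > 0" "\<forall>u\<in>test. nrm r u \<le> S * nrm p (grad u)"
    using sobolev_constant[OF pr r_range(2)] by (elim exE conjE)
  have cauchy: "\<exists>n0. \<forall>m\<ge>n0. \<forall>n\<ge>n0. nrm r (\<lambda>x. z m x - z n x) \<le> e" if e: "e > 0" for e
  proof -
    have "\<forall>\<^sub>F n in sequentially. 1 / real (Suc n) < e / (2 * S)" using e S(1) by (intro order_tendstoD(2)[OF inv0]) simp
    \<comment> \<open>With e / (2 S) for each approximant, two of them have gradient distance at
      most e / S, and the Sobolev constant S restores e.\<close>
    then obtain n0 where n0: "\<forall>n\<ge>n0. 1 / real (Suc n) < e / (2 * S)" unfolding eventually_sequentially by (elim exE)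
    show ?thesis
    proof (intro exI[of _ n0] allI impI)
      fix m n assume mn: "m \<ge> n0" "n \<ge> n0"
      have "nrm p (\<lambda>x. (grad (z m) x - W x) + (W x - grad (z n) x)) \<le> nrm p (\<lambda>x. grad (z m) x - W x) + nrm p (\<lambda>x. W x - grad (z n) x)"
        by (rule Lp_norm_triangle[OF Lp_diff[OF zp W(1) exponents_pos(1)] D(1) exponents_pos(4)])
      then have "nrm p (\<lambda>x. grad (z m) x - grad (z n) x) \<le> 1 / real (Suc m) + 1 / real (Suc n)"
        using b2[of m] b2[of n] unfolding Lp_norm_diff_commute[of p \<mu> W] by simp
      also have "\<dots> \<le> e / (2 * S) + e / (2 * S)" using n0 mn by (intro add_mono less_imp_le) auto
      finally have "S * nrm p (\<lambda>x. grad (z m) x - grad (z n) x) \<le> S * (e / (2 * S) + e / (2 * S))"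
        using S(1) by (intro mult_left_mono) auto
      also have "\<dots> = e" using S(1) by simp
      finally show "nrm r (\<lambda>x. z m x - z n x) \<le> e"
        using bspec[OF S(2) test_functions_diff[OF z[of m] z[of n]]] unfolding grad_fun_diff[OF z z] by linarith
    qed
  qed
  have "v \<in> Lp r \<mu> \<and> Lp_lim r \<mu> z v"
  proof (rule Lp_complete[OF zr exponents_pos(6) cauchy])
    fix y assume y: "y \<in> Lp r \<mu>" "Lp_lim r \<mu> z y"
    have AE: "AE x in \<mu>. v x = y x"
    proof (rule Lp_convergent_AE_subseq[OF zr y(1) exponents_pos(3) y(2)])
      fix k :: "nat \<Rightarrow> nat" assume k: "strict_mono k" "AE x in \<mu>. (\<lambda>n. z (k n) x) \<longlonglongrightarrow> y x"
      have c1': "Lp_lim p \<mu> (\<lambda>n. z (k n)) v" using LIMSEQ_subseq_LIMSEQ[OF c1 k(1)] by (simp add: o_def)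
      show ?thesis
      proof (rule Lp_convergent_AE_subseq[OF zpp vp exponents_pos(1) c1'])
        fix l :: "nat \<Rightarrow> nat" assume l: "strict_mono l" "AE x in \<mu>. (\<lambda>n. z (k (l n)) x) \<longlonglongrightarrow> v x"
        show ?thesis using k(2) l(2)
        proof eventually_elim
          fix x assume lim: "(\<lambda>n. z (k n) x) \<longlonglongrightarrow> y x" "(\<lambda>n. z (k (l n)) x) \<longlonglongrightarrow> v x"
          have "(\<lambda>n. z (k (l n)) x) \<longlonglongrightarrow> y x" using LIMSEQ_subseq_LIMSEQ[OF lim(1) l(1)] by (simp add: o_def)
          with lim(2) show "v x = y x" by (rule LIMSEQ_unique)
        qed
      qed
    qed
    have vr: "v \<in> Lp r \<mu>" by (rule Lp_cong_AE[OF y(1) LpD(1)[OF vp] exponents_pos(3) AE])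
    have "nrm r (\<lambda>x. z n x - v x) = nrm r (\<lambda>x. z n x - y x)" for n
    proof (rule Lp_norm_cong_AE)
      show "(\<lambda>x. z n x - v x) \<in> borel_measurable \<mu>" "(\<lambda>x. z n x - y x) \<in> borel_measurable \<mu>"
        by (intro borel_measurable_diff LpD(1)[OF zr] LpD(1)[OF vr] LpD(1)[OF y(1)])+
      show "AE x in \<mu>. z n x - v x = z n x - y x" using AE by eventually_elim simp
    qed
    then show ?thesis using vr y(2) by simp
  qed
  then show ?thesis using hW W z c2 c3 unfolding W_def[symmetric] by (elim conjE, intro conjI exI[of _ z] allI)
qed

lemma energy_deriv_cong_AE:
  assumes m: "V \<in> borel_measurable \<mu>" "V' \<in> borel_measurable \<mu>" "W \<in> borel_measurable \<mu>"
    and AE: "AE x in \<mu>. V x = V' x"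
  shows "energy_deriv u V v W = energy_deriv u V' v W"
proof -
  have AEw: "AE x in \<mu>. weighted V x = weighted V' x" using AE by eventually_elim (simp add: weighted_def)
  note [measurable] = m
  have 1: "Lp_int p \<mu> V = Lp_int p \<mu> V'" using AE by (intro integral_cong_AE) auto
  have 2: "Lp_int q \<mu> (weighted V) = Lp_int q \<mu> (weighted V')" using AEw by (intro integral_cong_AE) auto
  have 3: "(LINT x|\<mu>. pw p (V x) \<bullet> W x) = (LINT x|\<mu>. pw p (V' x) \<bullet> W x)"
    by (intro integral_cong_AE) (measurable, use AE in auto)
  have 4: "(LINT x|\<mu>. pw q (weighted V x) \<bullet> weighted W x) = (LINT x|\<mu>. pw q (weighted V' x) \<bullet> weighted W x)"
    by (intro integral_cong_AE) (measurable, use AEw in auto)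
  show ?thesis unfolding energy_deriv_def P.form_def Q.form_def 1 2 3 4 ..
qed

text \<open>The exponents (q - 2) / q, 1 / q and 1 / q add up to 1, so exactly one factor
  \<open>a x\<close> remains.\<close>

lemma pw_weighted:
  assumes "x \<in> \<Omega>"
  shows "pw q (weighted V x) \<bullet> weighted W x = a x * norm (V x) powr (q - 2) * (V x \<bullet> W x)"
proof (cases "a x = 0")
  case True
  then show ?thesis by (simp add: weighted_def)
next
  case False
  then have a0: "a x > 0" using a(2)[OF assms] by simp
  have "(a x powr (1 / q)) powr (q - 2) * (a x powr (1 / q) * a x powr (1 / q)) = a x powr ((q - 2) / q + (1 / q + 1 / q))"
    by (simp only: powr_powr powr_add times_divide_eq_left mult_1)
  also have "(q - 2) / q + (1 / q + 1 / q) = 1" using exponents_pos(2) by (simp add: field_simps)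
  finally have *: "(a x powr (1 / q)) powr (q - 2) * (a x powr (1 / q) * a x powr (1 / q)) = a x" using a0 by simp
  have "pw q (weighted V x) \<bullet> weighted W x
      = ((a x powr (1 / q)) powr (q - 2) * (a x powr (1 / q) * a x powr (1 / q))) * (norm (V x) powr (q - 2) * (V x \<bullet> W x))"
    by (simp add: pw_def weighted_def powr_mult)
  then show ?thesis unfolding * by (simp add: mult.assoc)
qed

theorem exists_solution: "\<exists>u. weak_solution p q a \<Omega> M f u \<and> \<not> (AE x in \<mu>. u x = 0)"
proof -
  obtain \<alpha> w V z where \<alpha>: "\<alpha> > 0" and z: "\<forall>n. z n \<in> test" and w: "w \<in> Lp r \<mu>" and V: "V \<in> Lp p \<mu>" "weighted V \<in> Lp q \<mu>"
    and lim: "Lp_lim r \<mu> z w" "Lp_lim p \<mu> (\<lambda>n. grad (z n)) V"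
      "Lp_lim q \<mu> (\<lambda>n. weighted (grad (z n))) (weighted V)"
    and en: "\<alpha> \<le> energy_fun w V" and crit: "\<forall>v\<in>test. energy_deriv w V v (grad v) = 0"
    using critical_limit by (elim exE conjE)
  have zt: "z n \<in> test" for n by (rule spec[OF z])
  have w10: "w \<in> W10_H p q a \<Omega>" by (rule W10_H_intro[OF zt w lim(1) V lim(2,3)])
  have hV: "has_weak_gradient \<Omega> w V" by (rule weak_gradient_limit[OF zt w lim(1) V(1) lim(2)])
  define D where "D = weak_grad \<Omega> w"
  \<comment> \<open>V is the limit of gradients, D the representative that
    \<open>weak_solution\<close> refers to.\<close>
  have DV: "AE x in \<mu>. V x = D x" using weak_grad_AE[OF \<Omega>(1) hV] unfolding D_def by eventually_elim simp
  note wE = W10_H_elim[OF w10, folded D_def]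
  note D = conjunct1[OF conjunct2[OF conjunct2[OF wE]]] conjunct1[OF conjunct2[OF conjunct2[OF conjunct2[OF wE]]]]
  have sol: "integrable \<mu> (\<lambda>x. norm (D x) powr (p - 2) * (D x \<bullet> E x)) \<and>
      integrable \<mu> (\<lambda>x. a x * norm (D x) powr (q - 2) * (D x \<bullet> E x)) \<and> integrable \<mu> (\<lambda>x. f x (w x) * v x) \<and>
      M (Lp_int p \<mu> D) * (LINT x|\<mu>. norm (D x) powr (p - 2) * (D x \<bullet> E x)) +
      M (LINT x|\<mu>. a x * norm (D x) powr q) * (LINT x|\<mu>. a x * norm (D x) powr (q - 2) * (D x \<bullet> E x)) = f_pair w v"
    if v: "v \<in> W10_H p q a \<Omega>" and E: "E = weak_grad \<Omega> v" for v E
  proof -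
    obtain y where "has_weak_gradient \<Omega> v E" and vr: "v \<in> Lp r \<mu>" and EL: "E \<in> Lp p \<mu>" "weighted E \<in> Lp q \<mu>" and y: "\<forall>n. y n \<in> test"
      and ylim: "Lp_lim r \<mu> y v" "Lp_lim p \<mu> (\<lambda>n. grad (y n)) E"
        "Lp_lim q \<mu> (\<lambda>n. weighted (grad (y n))) (weighted E)" using W10_H_elim[OF v, folded E] by (elim exE conjE)
    have yt: "y n \<in> test" for n by (rule spec[OF y])
    have "energy_deriv w D (y n) (grad (y n)) = 0" for n
      using bspec[OF crit yt] energy_deriv_cong_AE[OF LpD(1)[OF V(1)] LpD(1)[OF D(1)] LpD(1)[OF test_mem(2)[OF yt]] DV] by simp
    then have "(\<lambda>n. 0) \<longlonglongrightarrow> energy_deriv w D v E"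
      using energy_deriv_tendsto[OF w D test_mem(1)[OF yt] vr ylim(1) test_mem(2)[OF yt] test_mem(3)[OF yt] EL ylim(2,3)] by simp
    then have zero: "energy_deriv w D v E = 0" by (simp add: LIMSEQ_const_iff)
    have ip: "pw p (D x) \<bullet> E x = norm (D x) powr (p - 2) * (D x \<bullet> E x)" for x by (simp add: pw_def)
    have Iq: "integrable \<mu> (\<lambda>x. a x * norm (D x) powr (q - 2) * (D x \<bullet> E x)) \<longleftrightarrow> integrable \<mu> (\<lambda>x. pw q (weighted D x) \<bullet> weighted E x)"
      by (intro Bochner_Integration.integrable_cong) (auto simp: pw_weighted)
    have iq: "(LINT x|\<mu>. pw q (weighted D x) \<bullet> weighted E x) = (LINT x|\<mu>. a x * norm (D x) powr (q - 2) * (D x \<bullet> E x))"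
      by (intro Bochner_Integration.integral_cong) (auto simp: pw_weighted)
    show ?thesis using P.integrable_pw[OF D(1) EL(1)] Q.integrable_pw[OF D(2) EL(2)] f_pairing(1)[OF w vr] zero
      unfolding energy_deriv_def P.form_def Q.form_def integral_weighted ip iq Iq by simp
  qed
  \<comment> \<open>If w vanished, uniqueness of weak gradients would make V vanish too, and every
    term of the functional with it.\<close>
  have "\<not> (AE x in \<mu>. w x = 0)"
  proof
    assume w0: "AE x in \<mu>. w x = 0"
    have 0: "has_weak_gradient \<Omega> (\<lambda>x. 0) (\<lambda>x. 0)"
    proof -
      have "grad (\<lambda>x. 0) = (\<lambda>x :: 'a. 0)" by (rule ext) (rule grad_eqI, simp)
      then show ?thesis using has_weak_gradient_test[OF test_functions_zero[of \<Omega>] \<Omega>_lebesgue] by simp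
    qed
    have V0: "AE x in \<mu>. V x = 0" by (rule weak_gradient_unique[OF \<Omega>(1) hV 0 w0])
    note [measurable] = LpD(1)[OF V(1)] LpD(1)[OF w]
    have "Lp_int p \<mu> V = (LINT x|\<mu>. 0)" using V0 by (intro integral_cong_AE) auto
    moreover have "Lp_int q \<mu> (weighted V) = (LINT x|\<mu>. 0)"
    proof -
      have "AE x in \<mu>. weighted V x = 0" using V0 by eventually_elim (simp add: weighted_def)
      then show ?thesis by (intro integral_cong_AE) auto
    qed
    moreover have "(LINT x|\<mu>. primitive (f x) (w x)) = (LINT x|\<mu>. 0)" using w0 by (intro integral_cong_AE F_comp) auto
    ultimately have "energy_fun w V = 0" by (simp add: energy_fun_def)
    then show False using en \<alpha> by simp
  qed
  moreover have "weak_solution p q a \<Omega> M f w"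
    unfolding weak_solution_def Let_def D_def[symmetric] by (rule conjI[OF w10 ballI], rule sol[OF _ refl])
  ultimately show ?thesis by (intro exI[of _ w] conjI)
qed

end

section \<open>Reduction of the stated problem to the normalised one\<close>

lemma lebesgue_on_measurable_AE:
  fixes g h :: "'a::euclidean_space \<Rightarrow> real"
  assumes "\<Omega> \<in> sets lebesgue" "g \<in> borel_measurable (lebesgue_on \<Omega>)" "AE x in lebesgue_on \<Omega>. g x = h x"
  shows "h \<in> borel_measurable (lebesgue_on \<Omega>)"
proof -
  have "AE x in lebesgue. x \<in> \<Omega> \<longrightarrow> g x = h x" using assms(1,3) by (simp add: AE_restrict_space_iff)
  then have AE: "AE x in lebesgue. (if x \<in> \<Omega> then g x else 0) = (if x \<in> \<Omega> then h x else 0)" by eventually_elim simp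
  have "(\<lambda>x. if x \<in> \<Omega> then g x else 0) \<in> borel_measurable lebesgue"
    using assms(1,2) by (simp add: borel_measurable_if)
  then have "(\<lambda>x. if x \<in> \<Omega> then h x else 0) \<in> borel_measurable lebesgue" using AE by (rule borel_measurable_AE)
  then show ?thesis using assms(1) by (simp add: borel_measurable_if)
qed

text \<open>A nonempty open set is not null: otherwise every function, in particular a nonzero test
  function, would vanish almost everywhere on it.\<close>

lemma exists_AE_point:
  fixes \<Omega> :: "'a::euclidean_space set"
  assumes "open \<Omega>" "\<Omega> \<noteq> {}" "AE x in lebesgue_on \<Omega>. P x"
  shows "\<exists>x\<in>\<Omega>. P x"
proof (rule ccontr)
  assume "\<not> (\<exists>x\<in>\<Omega>. P x)"
  then have "\<And>\<psi> :: 'a \<Rightarrow> real. AE x in lebesgue_on \<Omega>. \<psi> x = 0"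
    using assms(3) AE_space[of "lebesgue_on \<Omega>"] by (auto elim!: eventually_rev_mp)
  then show False using exists_nonzero_test[OF assms(1,2)] by blast
qed

text \<open>\<open>M\<close> is evaluated at integrals of nonnegative functions, so agreement on the
  half line suffices; measurability of the changed product comes from completeness of Lebesgue
  measure.\<close>

lemma weak_solution_cong:
  assumes sol: "weak_solution p q a \<Omega> M f u" and \<Omega>: "\<Omega> \<in> sets lebesgue"
    and a: "\<And>x. x \<in> \<Omega> \<Longrightarrow> 0 \<le> a x" and M: "\<And>t. t \<ge> 0 \<Longrightarrow> M t = M' t"
    and f: "AE x in lebesgue_on \<Omega>. f x (u x) = g x (u x)"
  shows "weak_solution p q a \<Omega> M' g u"
proof -
  have M1: "M' (Lp_int p (lebesgue_on \<Omega>) D) = M (Lp_int p (lebesgue_on \<Omega>) D)" for D :: "'a \<Rightarrow> 'a"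
    by (rule M[symmetric]) (auto intro: integral_nonneg_AE)
  have M2: "M' (LINT x|lebesgue_on \<Omega>. a x * norm (D x) powr q) = M (LINT x|lebesgue_on \<Omega>. a x * norm (D x) powr q)" for D :: "'a \<Rightarrow> 'a"
    by (rule M[symmetric]) (auto intro!: integral_nonneg_AE AE_I2 simp: a)
  have fg: "integrable (lebesgue_on \<Omega>) (\<lambda>x. g x (u x) * \<phi> x)" "(LINT x|lebesgue_on \<Omega>. g x (u x) * \<phi> x) = (LINT x|lebesgue_on \<Omega>. f x (u x) * \<phi> x)"
    if int: "integrable (lebesgue_on \<Omega>) (\<lambda>x. f x (u x) * \<phi> x)" for \<phi>
  proof -
    have AE: "AE x in lebesgue_on \<Omega>. f x (u x) * \<phi> x = g x (u x) * \<phi> x" using f by eventually_elim simp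
    have m: "(\<lambda>x. g x (u x) * \<phi> x) \<in> borel_measurable (lebesgue_on \<Omega>)"
      by (rule lebesgue_on_measurable_AE[OF \<Omega> borel_measurable_integrable[OF int] AE])
    show "integrable (lebesgue_on \<Omega>) (\<lambda>x. g x (u x) * \<phi> x)"
      using int integrable_cong_AE[OF borel_measurable_integrable[OF int] m AE] by simp
    show "(LINT x|lebesgue_on \<Omega>. g x (u x) * \<phi> x) = (LINT x|lebesgue_on \<Omega>. f x (u x) * \<phi> x)"
      by (rule integral_cong_AE[OF borel_measurable_integrable[OF int] m AE, symmetric])
  qed
  show ?thesis using sol fg unfolding weak_solution_def Let_def M1 M2 by simp
qed

theorem theorem1p3:
  fixes \<Omega> :: "(real ^ 'n) set"
    and p q \<theta> :: real
    and a :: "real ^ 'n \<Rightarrow> real"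
    and M :: "real \<Rightarrow> real"
    and f :: "real ^ 'n \<Rightarrow> real \<Rightarrow> real"
  defines "N \<equiv> real CARD('n)"
  defines "p_star \<equiv> sobolev_exponent N p"
  assumes dim: "CARD('n) \<ge> 2"
    and Omega: "open \<Omega>" "bounded \<Omega>" "\<Omega> \<noteq> {}" "lipschitz_boundary \<Omega>"
    and exponents: "1 < p" "p < q" "q < N" "q / p < 1 + 1 / N"
    and a: "\<forall>x\<in>closure \<Omega>. a x \<ge> 0" "\<exists>L. L-lipschitz_on (closure \<Omega>) a"
    and M: "continuous_on {0..} M" "\<forall>t\<ge>0. M t \<ge> 0"
    and i: "1 \<le> \<theta>" "\<theta> < p_star / q" "\<forall>t\<ge>0. t * M t \<le> \<theta> * primitive M t"
    and ii: "\<forall>\<tau>>0. \<exists>\<kappa>>0. \<forall>t\<ge>\<tau>. M t \<ge> \<kappa>"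
    and f: "caratheodory_on \<Omega> f"
    and iii: "\<exists>r. q * \<theta> < r \<and> r < p_star \<and>
      (\<forall>\<epsilon>>0. \<exists>\<delta>>0. AE x in lebesgue_on \<Omega>. \<forall>t.
         \<bar>f x t\<bar> \<le> q * \<theta> * \<epsilon> * \<bar>t\<bar> powr (q * \<theta> - 1) + r * \<delta> * \<bar>t\<bar> powr (r - 1))"
    and iv: "\<exists>\<sigma> c t\<^sub>0. q * \<theta> < \<sigma> \<and> \<sigma> < p_star \<and> c > 0 \<and> t\<^sub>0 \<ge> 0 \<and>
      (AE x in lebesgue_on \<Omega>. \<forall>t. \<bar>t\<bar> \<ge> t\<^sub>0 \<longrightarrow>
         c \<le> \<sigma> * primitive (f x) t \<and> \<sigma> * primitive (f x) t \<le> t * f x t)"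
  shows "\<exists>u. weak_solution p q a \<Omega> M f u \<and> \<not> (AE x in lebesgue_on \<Omega>. u x = 0)"
proof -
  have \<Omega>L: "\<Omega> \<in> sets lebesgue" using Omega(1) by (simp add: lborelD)
  obtain r where r: "q * \<theta> < r" "r < p_star" and iii': "\<forall>\<epsilon>>0. \<exists>\<delta>>0. AE x in lebesgue_on \<Omega>. \<forall>t.
      \<bar>f x t\<bar> \<le> q * \<theta> * \<epsilon> * \<bar>t\<bar> powr (q * \<theta> - 1) + r * \<delta> * \<bar>t\<bar> powr (r - 1)" using iii by (elim exE conjE)
  \<comment> \<open>The instance \<epsilon> = 1: the radius in \<open>energy_barrier\<close> adapts
    to the coefficient of the power q \<theta> - 1.\<close>
  obtain \<delta> where \<delta>: "\<delta> > 0" and bound: "AE x in lebesgue_on \<Omega>. \<forall>t.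
      \<bar>f x t\<bar> \<le> q * \<theta> * 1 * \<bar>t\<bar> powr (q * \<theta> - 1) + r * \<delta> * \<bar>t\<bar> powr (r - 1)"
    using iii'[rule_format, OF zero_less_one] by (elim exE conjE)
  obtain \<sigma> c t0 where \<sigma>: "q * \<theta> < \<sigma>" and c: "c > 0" and AR: "AE x in lebesgue_on \<Omega>. \<forall>t. \<bar>t\<bar> \<ge> t0 \<longrightarrow>
      c \<le> \<sigma> * primitive (f x) t \<and> \<sigma> * primitive (f x) t \<le> t * f x t" using iv by (elim exE conjE)
  define C where "C = max (q * \<theta>) (r * \<delta>)"
  \<comment> \<open>The threshold is raised to at least 1 because \<open>F_ge\<close> divides by a
    power of it.\<close>
  define good where "good x \<longleftrightarrow> continuous_on UNIV (f x) \<and> (\<forall>t. \<bar>f x t\<bar> \<le> C * (\<bar>t\<bar> powr (q * \<theta> - 1) + \<bar>t\<bar> powr (r - 1))) \<and>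
    (\<forall>t. max t0 1 \<le> \<bar>t\<bar> \<longrightarrow> c \<le> \<sigma> * primitive (f x) t \<and> \<sigma> * primitive (f x) t \<le> t * f x t)" for x
  have f_meas: "(\<lambda>x. f x t) \<in> borel_measurable (lebesgue_on \<Omega>)" for t using f by (simp add: caratheodory_on_def)
  have f_cont: "AE x in lebesgue_on \<Omega>. continuous_on UNIV (f x)" using f by (simp add: caratheodory_on_def)
  have AE_good: "AE x in lebesgue_on \<Omega>. good x" using f_cont bound AR
  proof eventually_elim
    fix x assume 1: "continuous_on UNIV (f x)"
      and 2: "\<forall>t. \<bar>f x t\<bar> \<le> q * \<theta> * 1 * \<bar>t\<bar> powr (q * \<theta> - 1) + r * \<delta> * \<bar>t\<bar> powr (r - 1)"
      and 3: "\<forall>t. \<bar>t\<bar> \<ge> t0 \<longrightarrow> c \<le> \<sigma> * primitive (f x) t \<and> \<sigma> * primitive (f x) t \<le> t * f x t"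
    have "\<bar>f x t\<bar> \<le> C * (\<bar>t\<bar> powr (q * \<theta> - 1) + \<bar>t\<bar> powr (r - 1))" for t
    proof -
      have "q * \<theta> * \<bar>t\<bar> powr (q * \<theta> - 1) \<le> C * \<bar>t\<bar> powr (q * \<theta> - 1)" "r * \<delta> * \<bar>t\<bar> powr (r - 1) \<le> C * \<bar>t\<bar> powr (r - 1)"
        by (intro mult_right_mono; simp add: C_def)+
      then show ?thesis using spec[OF 2, of t] by (simp add: distrib_left)
    qed
    with 1 3 show "good x" by (simp add: good_def)
  qed
  obtain x0 where x0: "x0 \<in> \<Omega>" "good x0" using exists_AE_point[OF Omega(1,3) AE_good] by blast
  \<comment> \<open>modifying \<open>f\<close> on a null set makes the hypotheses hold at every point\<close>
  define f' where "f' x = (if good x then f x else f x0)" for x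
  have f'_good: "continuous_on UNIV (f' x)" "\<bar>f' x t\<bar> \<le> C * (\<bar>t\<bar> powr (q * \<theta> - 1) + \<bar>t\<bar> powr (r - 1))"
    "max t0 1 \<le> \<bar>t\<bar> \<Longrightarrow> c \<le> \<sigma> * primitive (f' x) t" "max t0 1 \<le> \<bar>t\<bar> \<Longrightarrow> \<sigma> * primitive (f' x) t \<le> t * f' x t" for x t
    using x0(2) unfolding f'_def good_def by (cases "good x"; simp add: good_def)+
  have f'_eq: "AE x in lebesgue_on \<Omega>. \<forall>t. f' x t = f x t" using AE_good by eventually_elim (simp add: f'_def)
  \<comment> \<open>Constant continuation to negative arguments makes the function continuous on the
    whole line and leaves the primitive on the half line unchanged.\<close>
  define M' where "M' t = M (max 0 t)" for t
  have M': "M' t = M t" if "t \<ge> 0" for t using that by (simp add: M'_def)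
  have prim: "primitive M' t = primitive M t" if "t \<ge> 0" for t by (rule primitive_cong_nonneg[OF that M'])
  obtain L where L: "L-lipschitz_on (closure \<Omega>) a" using a(2) by blast
  have ac: "continuous_on (closure \<Omega>) a" by (rule lipschitz_on_continuous_on[OF L])
  have "compact (a ` closure \<Omega>)" using ac Omega(2) by (intro compact_continuous_image) (simp_all add: compact_closure)
  then obtain A where A: "\<forall>y\<in>a ` closure \<Omega>. norm y \<le> A" using compact_imp_bounded bounded_iff by blast
  have cl: "x \<in> closure \<Omega>" if "x \<in> \<Omega>" for x using that closure_subset by blast
  have a_nonneg: "0 \<le> a x" if "x \<in> \<Omega>" for x using a(1) cl[OF that] by blast
  interpret kirchhoff_problem \<Omega> p q \<theta> r \<sigma> C c "max t0 1" A a M' f'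
  proof
    show "p < real DIM(real ^ 'n)" using exponents by (simp add: N_def)
    show "a \<in> borel_measurable (lebesgue_on \<Omega>)"
      using continuous_on_subset[OF ac closure_subset] \<Omega>L by (rule continuous_imp_measurable_on_sets_lebesgue)
    show "a x \<le> A" if "x \<in> \<Omega>" for x using A cl[OF that] by force
    show "0 \<le> a x" if "x \<in> \<Omega>" for x by (rule a_nonneg[OF that])
    show "continuous_on UNIV M'"
      unfolding M'_def by (rule continuous_on_compose2[OF M(1)]) (auto intro!: continuous_intros)
    show "0 \<le> M' t" for t using M(2) by (simp add: M'_def)
    show "t * M' t \<le> \<theta> * primitive M' t" if "t \<ge> 0" for t using i(3) that by (simp add: M' prim)
    show "\<exists>\<kappa>>0. \<forall>t\<ge>\<tau>. \<kappa> \<le> M' t" if \<tau>: "\<tau> > 0" for \<tau>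
    proof -
      obtain \<kappa> where "\<kappa> > 0" "\<forall>t\<ge>\<tau>. M t \<ge> \<kappa>" using ii \<tau> by blast
      then show ?thesis using \<tau> by (intro exI[of _ \<kappa>]) (auto simp: M')
    qed
    show "(\<lambda>x. f' x t) \<in> borel_measurable (lebesgue_on \<Omega>)" for t
    proof (rule lebesgue_on_measurable_AE[OF \<Omega>L f_meas])
      show "AE x in lebesgue_on \<Omega>. f x t = f' x t" using f'_eq by eventually_elim simp
    qed
    show "continuous_on UNIV (f' x)" for x by (rule f'_good)
    show "r < sobolev_exponent (real DIM(real ^ 'n)) p" using r(2) by (simp add: p_star_def N_def)
    show "0 \<le> C" using exponents i(1) by (simp add: C_def le_max_iff_disj)
    show "\<bar>f' x t\<bar> \<le> C * (\<bar>t\<bar> powr (q * \<theta> - 1) + \<bar>t\<bar> powr (r - 1))" for x t by (rule f'_good)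
    show "c \<le> \<sigma> * primitive (f' x) t" "\<sigma> * primitive (f' x) t \<le> t * f' x t" if "max t0 1 \<le> \<bar>t\<bar>" for x t
      by (rule f'_good(3,4)[OF that])+
  qed (use Omega exponents i r \<sigma> c in auto)
  obtain u where u: "weak_solution p q a \<Omega> M' f' u" "\<not> (AE x in lebesgue_on \<Omega>. u x = 0)"
    using exists_solution by (elim exE conjE)
  have "weak_solution p q a \<Omega> M f u"
  proof (rule weak_solution_cong[OF u(1) \<Omega>L])
    show "0 \<le> a x" if "x \<in> \<Omega>" for x by (rule a_nonneg[OF that])
    show "AE x in lebesgue_on \<Omega>. f' x (u x) = f x (u x)" using f'_eq by eventually_elim simp
  qed (rule M')
  with u(2) show ?thesis by blast
qed

end
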